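(* Let $G$ be a group, let $k$ be a commutative $G$-ring and let $\varepsilon\in k$ be invertible. For $G$-rook algebras over $k$, the morphism $$\mathrm{Tor}_{q}^{G\mathcal{R}_{n-1}(\varepsilon)}(\mathbf{1},\mathbf{1})\rightarrow \mathrm{Tor}_{q}^{G\mathcal{R}_{n}(\varepsilon)}(\mathbf{1},\mathbf{1})$$ induced by the inclusion map $G\mathcal{R}_{n-1}(\varepsilon)\rightarrow G\mathcal{R}_{n}(\varepsilon)$ is an isomorphism for $n\geqslant 2q+2$.
   Context: A commutative $G$-ring is a unital commutative ring $k$ together with a group homomorphism $G\to\mathrm{Aut}(k)$ to the group of ring automorphisms of $k$. A $G$-rook $n$-diagram is a graph on two columns (left and right) of $n$ nodes in which each node is connected to at most one other node by an edge, every edge joins a left node to a right node, and each edge is labelled by an element of $G$. The $G$-rook algebra $G\mathcal{R}_n(\varepsilon)$ consists of formal $k$-linear combinations of $G$-rook $n$-diagrams. The product $x\cdot y$ of two diagrams is the $k$-bilinear extension of: identify the right-hand nodes of $x$ with the left-hand nodes of $y$, forget the middle nodes, label each edge formed by concatenation with the product of the group elements read from left to right, and multiply by a factor $\varepsilon$ for each contractible component lying entirely in the middle, i.e. for each middle node attached to no edge of $x$ and no edge of $y$. An edge which reaches the middle column and is not continued is discarded without a factor, leaving its outer node unconnected. The inclusion $G\mathcal{R}_{n-1}(\varepsilon)\to G\mathcal{R}_n(\varepsilon)$ sends an $(n-1)$-diagram to the $n$-diagram obtained by adding an extra node at the end of each column and joining these two nodes by a horizontal edge labelled $1\in G$. The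 trivial module $\mathbf{1}$ is a copy of $k$ (as a left and as a right module) on which diagrams with no missing edges act as $1$ and all other diagrams act as $0$. *)

theory Defs
  imports "HOL-Algebra.Module" "HOL-Algebra.QuotRing" "HOL-Algebra.Bij"
    "HOL-Algebra.Free_Abelian_Groups"
begin

section \<open>Modules over a noncommutative ring and projective resolutions\<close>

locale left_module = R?: ring R + M?: abelian_group M
  for R :: "('a, 'r) ring_scheme" (structure) and M :: "('a, 'b, 'm) module_scheme" (structure) +
  assumes smult_closed:
      "\<lbrakk>a \<in> carrier R; x \<in> carrier M\<rbrakk> \<Longrightarrow> a \<odot>\<^bsub>M\<^esub> x \<in> carrier M"
    and smult_l_distr:
      "\<lbrakk>a \<in> carrier R; b \<in> carrier R; x \<in> carrier M\<rbrakk> \<Longrightarrow>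
      (a \<oplus> b) \<odot>\<^bsub>M\<^esub> x = a \<odot>\<^bsub>M\<^esub> x \<oplus>\<^bsub>M\<^esub> b \<odot>\<^bsub>M\<^esub> x"
    and smult_r_distr:
      "\<lbrakk>a \<in> carrier R; x \<in> carrier M; y \<in> carrier M\<rbrakk> \<Longrightarrow>
      a \<odot>\<^bsub>M\<^esub> (x \<oplus>\<^bsub>M\<^esub> y) = a \<odot>\<^bsub>M\<^esub> x \<oplus>\<^bsub>M\<^esub> a \<odot>\<^bsub>M\<^esub> y"
    and smult_assoc:
      "\<lbrakk>a \<in> carrier R; b \<in> carrier R; x \<in> carrier M\<rbrakk> \<Longrightarrow>
      (a \<otimes> b) \<odot>\<^bsub>M\<^esub> x = a \<odot>\<^bsub>M\<^esub> (b \<odot>\<^bsub>M\<^esub> x)"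
    and smult_one:
      "x \<in> carrier M \<Longrightarrow> \<one> \<odot>\<^bsub>M\<^esub> x = x"

definition semilinear_maps ::
  "('a \<Rightarrow> 'b) \<Rightarrow> 'a ring \<Rightarrow> ('a, 'm) module \<Rightarrow> ('b, 'n) module \<Rightarrow> ('m \<Rightarrow> 'n) set" where
  "semilinear_maps \<phi> R M N = {f \<in> carrier M \<rightarrow> carrier N.
     (\<forall>x\<in>carrier M. \<forall>y\<in>carrier M. f (x \<oplus>\<^bsub>M\<^esub> y) = f x \<oplus>\<^bsub>N\<^esub> f y) \<and>
     (\<forall>a\<in>carrier R. \<forall>x\<in>carrier M. f (a \<odot>\<^bsub>M\<^esub> x) = \<phi> a \<odot>\<^bsub>N\<^esub> f x)}"

abbreviation linear_maps ::
  "'a ring \<Rightarrow> ('a, 'm) module \<Rightarrow> ('a, 'n) module \<Rightarrow> ('m \<Rightarrow> 'n) set" where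
  "linear_maps \<equiv> semilinear_maps (\<lambda>a. a)"

definition formal_combinations :: "'a ring \<Rightarrow> 'x set \<Rightarrow> ('x \<Rightarrow> 'a) set" where
  "formal_combinations R X = {f. (\<forall>x\<in>X. f x \<in> carrier R) \<and> (\<forall>x. x \<notin> X \<longrightarrow> f x = \<zero>\<^bsub>R\<^esub>) \<and>
     finite {x. f x \<noteq> \<zero>\<^bsub>R\<^esub>}}"

text \<open>The record type of modules extends that of rings; the fields \<open>mult\<close> and \<open>one\<close> play no role
  for a module.\<close>

definition free_left_module :: "'a ring \<Rightarrow> 'x set \<Rightarrow> ('a, 'x \<Rightarrow> 'a) module" where
  "free_left_module R X = \<lparr>carrier = formal_combinations R X, mult = undefined, one = undefined,
     ring.zero = (\<lambda>x. \<zero>\<^bsub>R\<^esub>), add = (\<lambda>f g x. f x \<oplus>\<^bsub>R\<^esub> g x), smult = (\<lambda>a f x. a \<otimes>\<^bsub>R\<^esub> f x)\<rparr>"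

text \<open>Projective means direct summand of a free module. Bases \<open>X\<close> in the element type of the
  module suffice: a projective module is a retract of the free module on its own carrier.\<close>

definition projective_module :: "'a ring \<Rightarrow> ('a, 'p) module \<Rightarrow> bool" where
  "projective_module R P \<longleftrightarrow> left_module R P \<and>
     (\<exists>(X :: 'p set) s r. s \<in> linear_maps R P (free_left_module R X) \<and>
        r \<in> linear_maps R (free_left_module R X) P \<and> (\<forall>x\<in>carrier P. r (s x) = x))"

text \<open>\<open>\<dots> \<rightarrow> P 1 \<rightarrow> P 0 \<rightarrow> N \<rightarrow> 0\<close> with differentials \<open>d i : P (i + 1) \<rightarrow> P i\<close> and augmentation
  \<open>e : P 0 \<rightarrow> N\<close>.\<close>

definition projective_resolution ::
  "'a ring \<Rightarrow> ('a, 'm) module \<Rightarrow> (nat \<Rightarrow> ('a, 'p) module) \<Rightarrow> (nat \<Rightarrow> 'p \<Rightarrow> 'p) \<Rightarrow> ('p \<Rightarrow> 'm) \<Rightarrow> bool"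
where
  "projective_resolution R N P d e \<longleftrightarrow>
     (\<forall>i. projective_module R (P i)) \<and>
     (\<forall>i. d i \<in> linear_maps R (P (Suc i)) (P i)) \<and>
     e \<in> linear_maps R (P 0) N \<and>
     e ` carrier (P 0) = carrier N \<and>
     {x \<in> carrier (P 0). e x = \<zero>\<^bsub>N\<^esub>} = d 0 ` carrier (P (Suc 0)) \<and>
     (\<forall>i. {x \<in> carrier (P (Suc i)). d i x = \<zero>\<^bsub>P i\<^esub>} = d (Suc i) ` carrier (P (Suc (Suc i))))"

text \<open>A chain map \<open>f\<close> over the ring homomorphism \<open>\<phi> : R \<rightarrow> S\<close> covering the map \<open>\<eta>\<close> of resolved
  modules.\<close>

definition resolution_map ::
  "('a \<Rightarrow> 'b) \<Rightarrow> 'a ring \<Rightarrow> ('m \<Rightarrow> 'n) \<Rightarrow>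
   (nat \<Rightarrow> ('a, 'p) module) \<Rightarrow> (nat \<Rightarrow> 'p \<Rightarrow> 'p) \<Rightarrow> ('p \<Rightarrow> 'm) \<Rightarrow>
   (nat \<Rightarrow> ('b, 'q) module) \<Rightarrow> (nat \<Rightarrow> 'q \<Rightarrow> 'q) \<Rightarrow> ('q \<Rightarrow> 'n) \<Rightarrow> (nat \<Rightarrow> 'p \<Rightarrow> 'q) \<Rightarrow> bool" where
  "resolution_map \<phi> R \<eta> P d e P' d' e' f \<longleftrightarrow>
     (\<forall>i. f i \<in> semilinear_maps \<phi> R (P i) (P' i)) \<and>
     (\<forall>i. \<forall>x\<in>carrier (P (Suc i)). f i (d i x) = d' i (f (Suc i) x)) \<and>
     (\<forall>x\<in>carrier (P 0). e' (f 0 x) = \<eta> (e x))"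


section \<open>Tensor products, homology and Tor\<close>

text \<open>A right module uses the same record type, with \<open>a \<odot>\<^bsub>M\<^esub> x\<close> standing for \<open>x \<cdot> a\<close>.\<close>

definition tensor_relators ::
  "'a ring \<Rightarrow> ('a, 'm) module \<Rightarrow> ('a, 'n) module \<Rightarrow> ('m \<times> 'n \<Rightarrow>\<^sub>0 int) set" where
  "tensor_relators R M N =
     {frag_of (x \<oplus>\<^bsub>M\<^esub> x', y) - frag_of (x, y) - frag_of (x', y) | x x' y.
        x \<in> carrier M \<and> x' \<in> carrier M \<and> y \<in> carrier N} \<union>
     {frag_of (x, y \<oplus>\<^bsub>N\<^esub> y') - frag_of (x, y) - frag_of (x, y') | x y y'.
        x \<in> carrier M \<and> y \<in> carrier N \<and> y' \<in> carrier N} \<union>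
     {frag_of (a \<odot>\<^bsub>M\<^esub> x, y) - frag_of (x, a \<odot>\<^bsub>N\<^esub> y) | a x y.
        a \<in> carrier R \<and> x \<in> carrier M \<and> y \<in> carrier N}"

definition tensor_kernel ::
  "'a ring \<Rightarrow> ('a, 'm) module \<Rightarrow> ('a, 'n) module \<Rightarrow> ('m \<times> 'n \<Rightarrow>\<^sub>0 int) set" where
  "tensor_kernel R M N =
     generate (free_Abelian_group (carrier M \<times> carrier N)) (tensor_relators R M N)"

definition tensor_product ::
  "'a ring \<Rightarrow> ('a, 'm) module \<Rightarrow> ('a, 'n) module \<Rightarrow> ('m \<times> 'n \<Rightarrow>\<^sub>0 int) set monoid" where
  "tensor_product R M N =
     free_Abelian_group (carrier M \<times> carrier N) Mod tensor_kernel R M N"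

text \<open>The map \<open>G / N \<rightarrow> H / N'\<close> induced by a homomorphism \<open>h : G \<rightarrow> H\<close> with \<open>h(N) \<subseteq> N'\<close>: all the
  cosets in the union coincide.\<close>

definition quotient_map :: "('b, 'c) monoid_scheme \<Rightarrow> 'b set \<Rightarrow> ('a \<Rightarrow> 'b) \<Rightarrow> 'a set \<Rightarrow> 'b set" where
  "quotient_map H N' h C = (\<Union>c\<in>C. N' #>\<^bsub>H\<^esub> h c)"

definition tensor_map ::
  "'b ring \<Rightarrow> ('b, 'm') module \<Rightarrow> ('b, 'n') module \<Rightarrow> ('m \<Rightarrow> 'm') \<Rightarrow> ('n \<Rightarrow> 'n') \<Rightarrow>
   ('m \<times> 'n \<Rightarrow>\<^sub>0 int) set \<Rightarrow> ('m' \<times> 'n' \<Rightarrow>\<^sub>0 int) set" where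
  "tensor_map S M' N' f g =
     quotient_map (free_Abelian_group (carrier M' \<times> carrier N')) (tensor_kernel S M' N')
       (frag_extend (\<lambda>(x, y). frag_of (f x, g y)))"

text \<open>Homology of \<open>\<dots> \<rightarrow> C 1 \<rightarrow> C 0 \<rightarrow> 0\<close> with differentials \<open>\<delta> i : C (i + 1) \<rightarrow> C i\<close>.\<close>

definition cycles :: "(nat \<Rightarrow> 'c monoid) \<Rightarrow> (nat \<Rightarrow> 'c \<Rightarrow> 'c) \<Rightarrow> nat \<Rightarrow> 'c set" where
  "cycles C \<delta> q =
     (case q of 0 \<Rightarrow> carrier (C 0) | Suc p \<Rightarrow> kernel (C (Suc p)) (C p) (\<delta> p))"

definition boundaries :: "(nat \<Rightarrow> 'c monoid) \<Rightarrow> (nat \<Rightarrow> 'c \<Rightarrow> 'c) \<Rightarrow> nat \<Rightarrow> 'c set" where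
  "boundaries C \<delta> q = \<delta> q ` carrier (C (Suc q))"

definition complex_homology ::
  "(nat \<Rightarrow> 'c monoid) \<Rightarrow> (nat \<Rightarrow> 'c \<Rightarrow> 'c) \<Rightarrow> nat \<Rightarrow> 'c set monoid" where
  "complex_homology C \<delta> q = (C q)\<lparr>carrier := cycles C \<delta> q\<rparr> Mod boundaries C \<delta> q"

text \<open>\<open>Tor\<^sub>q(M, N)\<close> over \<open>R\<close>, for a right module \<open>M\<close> and a left module \<open>N\<close> with projective
  resolution \<open>P\<close>, is the homology of \<open>M \<otimes> P\<close>. The resolution is an explicit argument.\<close>

definition Tor_complex ::
  "'a ring \<Rightarrow> ('a, 'm) module \<Rightarrow> (nat \<Rightarrow> ('a, 'p) module) \<Rightarrow> nat \<Rightarrow> ('m \<times> 'p \<Rightarrow>\<^sub>0 int) set monoid"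
where
  "Tor_complex R M P i = tensor_product R M (P i)"

definition Tor_diff ::
  "'a ring \<Rightarrow> ('a, 'm) module \<Rightarrow> (nat \<Rightarrow> ('a, 'p) module) \<Rightarrow> (nat \<Rightarrow> 'p \<Rightarrow> 'p) \<Rightarrow>
   nat \<Rightarrow> ('m \<times> 'p \<Rightarrow>\<^sub>0 int) set \<Rightarrow> ('m \<times> 'p \<Rightarrow>\<^sub>0 int) set" where
  "Tor_diff R M P d i = tensor_map R M (P i) (\<lambda>x. x) (d i)"

definition Tor ::
  "'a ring \<Rightarrow> ('a, 'm) module \<Rightarrow> (nat \<Rightarrow> ('a, 'p) module) \<Rightarrow> (nat \<Rightarrow> 'p \<Rightarrow> 'p) \<Rightarrow>
   nat \<Rightarrow> ('m \<times> 'p \<Rightarrow>\<^sub>0 int) set set monoid" where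
  "Tor R M P d q = complex_homology (Tor_complex R M P) (Tor_diff R M P d) q"

text \<open>The map from Tor over \<open>R\<close> to Tor over \<open>S\<close> induced by a ring homomorphism \<open>R \<rightarrow> S\<close>, a
  semilinear map \<open>\<eta>\<close> of right modules \<open>M \<rightarrow> M'\<close> and a chain map \<open>f\<close> of resolutions \<open>P \<rightarrow> P'\<close>; the
  source data enter only through the domains of \<open>\<eta>\<close> and \<open>f\<close>.\<close>

definition Tor_map ::
  "'b ring \<Rightarrow> ('b, 'm') module \<Rightarrow> (nat \<Rightarrow> ('b, 'p') module) \<Rightarrow> (nat \<Rightarrow> 'p' \<Rightarrow> 'p') \<Rightarrow>
   ('m \<Rightarrow> 'm') \<Rightarrow> (nat \<Rightarrow> 'p \<Rightarrow> 'p') \<Rightarrow> nat \<Rightarrow>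
   ('m \<times> 'p \<Rightarrow>\<^sub>0 int) set set \<Rightarrow> ('m' \<times> 'p' \<Rightarrow>\<^sub>0 int) set set" where
  "Tor_map S M' P' d' \<eta> f q =
     quotient_map (Tor_complex S M' P' q) (boundaries (Tor_complex S M' P') (Tor_diff S M' P' d') q)
       (tensor_map S M' (P' q) \<eta> (f q))"


section \<open>Rook algebras\<close>

definition RingAutoGroup :: "'k ring \<Rightarrow> ('k \<Rightarrow> 'k) monoid" where
  "RingAutoGroup K = BijGroup (carrier K) \<lparr>carrier := ring_iso K K \<inter> Bij (carrier K)\<rparr>"

definition commutative_G_ring :: "'g monoid \<Rightarrow> 'k ring \<Rightarrow> ('g \<Rightarrow> 'k \<Rightarrow> 'k) \<Rightarrow> bool" where
  "commutative_G_ring G K \<alpha> \<longleftrightarrow> cring K \<and> \<alpha> \<in> hom G (RingAutoGroup K)"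

text \<open>The nodes of each column are numbered \<open>0, \<dots>, n - 1\<close>; a diagram is its set of edges, where
  \<open>(i, g, j)\<close> joins the left node \<open>i\<close> to the right node \<open>j\<close> with label \<open>g\<close>.\<close>

type_synonym 'g diagram = "(nat \<times> 'g \<times> nat) set"

definition rook_diagrams :: "'g monoid \<Rightarrow> nat \<Rightarrow> 'g diagram set" where
  "rook_diagrams G n = {D. D \<subseteq> {..<n} \<times> carrier G \<times> {..<n} \<and>
     (\<forall>(i, g, j)\<in>D. \<forall>(i', g', j')\<in>D. i = i' \<or> j = j' \<longrightarrow> (i, g, j) = (i', g', j'))}"

definition left_nodes :: "'g diagram \<Rightarrow> nat set" where
  "left_nodes D = {i. \<exists>g j. (i, g, j) \<in> D}"

definition right_nodes :: "'g diagram \<Rightarrow> nat set" where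
  "right_nodes D = {j. \<exists>i g. (i, g, j) \<in> D}"

definition no_missing_edges :: "nat \<Rightarrow> 'g diagram \<Rightarrow> bool" where
  "no_missing_edges n D \<longleftrightarrow> left_nodes D = {..<n} \<and> right_nodes D = {..<n}"

definition diagram_comp :: "'g monoid \<Rightarrow> 'g diagram \<Rightarrow> 'g diagram \<Rightarrow> 'g diagram" where
  "diagram_comp G x y =
     {(i, g \<otimes>\<^bsub>G\<^esub> h, j) | i g m h j. (i, g, m) \<in> x \<and> (m, h, j) \<in> y}"

text \<open>The number of middle nodes attached to no edge when \<open>x\<close> and \<open>y\<close> are concatenated.\<close>

definition isolated_nodes :: "nat \<Rightarrow> 'g diagram \<Rightarrow> 'g diagram \<Rightarrow> nat" where
  "isolated_nodes n x y = card {m \<in> {..<n}. m \<notin> right_nodes x \<and> m \<notin> left_nodes y}"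

definition identity_diagram :: "'g monoid \<Rightarrow> nat \<Rightarrow> 'g diagram" where
  "identity_diagram G n = {(i, \<one>\<^bsub>G\<^esub>, i) | i. i < n}"

definition rook_algebra :: "'g monoid \<Rightarrow> 'k ring \<Rightarrow> 'k \<Rightarrow> nat \<Rightarrow> ('g diagram \<Rightarrow> 'k) ring" where
  "rook_algebra G K \<epsilon> n =
     \<lparr>carrier = formal_combinations K (rook_diagrams G n),
      mult = (\<lambda>f g D. finsum K (\<lambda>(x, y). f x \<otimes>\<^bsub>K\<^esub> g y \<otimes>\<^bsub>K\<^esub> (\<epsilon> [^]\<^bsub>K\<^esub> isolated_nodes n x y))
                {(x, y). f x \<noteq> \<zero>\<^bsub>K\<^esub> \<and> g y \<noteq> \<zero>\<^bsub>K\<^esub> \<and> diagram_comp G x y = D}),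
      one = (\<lambda>D. if D = identity_diagram G n then \<one>\<^bsub>K\<^esub> else \<zero>\<^bsub>K\<^esub>),
      ring.zero = (\<lambda>D. \<zero>\<^bsub>K\<^esub>),
      add = (\<lambda>f g D. f D \<oplus>\<^bsub>K\<^esub> g D)\<rparr>"

text \<open>The linear extension of the map adding the edge \<open>(m, \<one>, m)\<close> to an \<open>m\<close>-diagram.\<close>

definition rook_inclusion ::
  "'g monoid \<Rightarrow> 'k ring \<Rightarrow> nat \<Rightarrow> ('g diagram \<Rightarrow> 'k) \<Rightarrow> ('g diagram \<Rightarrow> 'k)" where
  "rook_inclusion G K m f =
     (\<lambda>D. \<Oplus>\<^bsub>K\<^esub>x \<in> {x. f x \<noteq> \<zero>\<^bsub>K\<^esub> \<and> insert (m, \<one>\<^bsub>G\<^esub>, m) x = D}. f x)"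

text \<open>Both the left and the right trivial module: the two actions are given by the same formula
  because \<open>K\<close> is commutative. The fields \<open>mult\<close> and \<open>one\<close> are irrelevant.\<close>

definition trivial_module ::
  "'g monoid \<Rightarrow> 'k ring \<Rightarrow> nat \<Rightarrow> ('g diagram \<Rightarrow> 'k, 'k) module" where
  "trivial_module G K n =
     \<lparr>carrier = carrier K, mult = (\<otimes>\<^bsub>K\<^esub>), one = \<one>\<^bsub>K\<^esub>, ring.zero = \<zero>\<^bsub>K\<^esub>, add = (\<oplus>\<^bsub>K\<^esub>),
      smult = (\<lambda>f c. (\<Oplus>\<^bsub>K\<^esub>D \<in> {D. f D \<noteq> \<zero>\<^bsub>K\<^esub> \<and> no_missing_edges n D}. f D) \<otimes>\<^bsub>K\<^esub> c)\<rparr>"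

end

theory Submission
  imports Defs
begin

text \<open>Let \<open>\<Gamma>\<^sub>n\<close> be the group of \<open>n\<close>-diagrams without missing edges and \<open>N\<close> the ideal spanned by the
  other diagrams, so that the quotient by \<open>N\<close> is the group ring of \<open>\<Gamma>\<^sub>n\<close>. Since \<open>\<epsilon>\<close> is invertible, the
  diagrams obtained from the identity by removing one edge give idempotents \<open>e\<^sub>i\<close> after division by
  \<open>\<epsilon>\<close>, and \<open>z = \<Prod>(1 - e\<^sub>i)\<close> satisfies \<open>z N = 0\<close> and \<open>1 - z \<in> N\<close>. This makes the group ring a
  projective right module over the rook algebra, and Tor of the trivial modules becomes the homology
  of \<open>\<Gamma>\<^sub>n\<close>: the double complex of chains on tuples in \<open>\<Gamma>\<^sub>n\<close> with coefficients in the resolution has exact rows and columns.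

  The groups \<open>\<Gamma>\<^sub>n\<close> act on the complex of injective words with letters in \<open>{0, \<dots>, n - 1} \<times> G\<close>, which is
  exact below the top degree; the action on words of length \<open>l\<close> is transitive with stabilizer
  \<open>\<Gamma>\<^bsub>n-l\<^esub>\<close>. The maps between the homology groups of consecutive stabilizers are alternating sums of
  conjugates of the inclusion, hence alternately zero and the inclusion, and stability follows by
  induction on \<open>n\<close>.\<close>

section \<open>Subgroups of abelian groups and formal integer combinations\<close>

text \<open>Until the final translation no quotient is formed: a chain group is a free abelian group
  together with a subgroup of relations, and homological statements are memberships in such
  subgroups. All groups \<open>U m\<close> act on tuples in one fixed large group, so the chains are
  the same for every \<open>m\<close> and only the relations grow; stabilization is the identity on
  chains. Coefficients enter as bare labels whose addition is imposed by relations, so exactness of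
  rows is obtained from contractions given on generators, which carry over to labelled chains. The
  passage between Tor and group homology is a zigzag through a double complex; it is kept as a
  relation between cycles, so that naturality needs no compatible choice of lifts. The empty tuple
  is a chain too, hence tuples of length \<open>k\<close> have degree \<open>k - 1\<close>. The
  induction gives injectivity from \<open>U (m - 1)\<close> to \<open>U m\<close> for
  \<open>2 * k <= m\<close> and surjectivity for \<open>2 * k <= m + 1\<close>; with
  \<open>k = q + 1\<close> and \<open>m = n\<close> the former bound is exactly
  \<open>2 * q + 2 <= n\<close>.\<close>

definition subgrp :: "'v::ab_group_add set \<Rightarrow> bool" where
  "subgrp M \<longleftrightarrow> 0 \<in> M \<and> (\<forall>x\<in>M. \<forall>y\<in>M. x - y \<in> M)"

lemma subgrp_zero: "subgrp M \<Longrightarrow> 0 \<in> M"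
  and subgrp_diff: "subgrp M \<Longrightarrow> x \<in> M \<Longrightarrow> y \<in> M \<Longrightarrow> x - y \<in> M"
  by (auto simp: subgrp_def)

lemma subgrp_uminus: "subgrp M \<Longrightarrow> x \<in> M \<Longrightarrow> - x \<in> M"
  by (metis diff_0 subgrp_def)

lemma subgrp_add: "subgrp M \<Longrightarrow> x \<in> M \<Longrightarrow> y \<in> M \<Longrightarrow> x + y \<in> M"
  by (metis diff_minus_eq_add subgrp_diff subgrp_uminus)

lemma subgrp_sum: "subgrp M \<Longrightarrow> (\<And>i. i \<in> I \<Longrightarrow> f i \<in> M) \<Longrightarrow> sum f I \<in> M"
  by (induction I rule: infinite_finite_induct) (auto intro: subgrp_zero subgrp_add)

text \<open>The subgroup generated by \<open>R\<close>, built one signed generator at a time, so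
  that inductions have a single generator in each step.\<close>

inductive_set spn :: "'v::ab_group_add set \<Rightarrow> 'v set" for R where
  zero: "0 \<in> spn R"
| add: "x \<in> spn R \<Longrightarrow> r \<in> R \<Longrightarrow> x + r \<in> spn R"
| diff: "x \<in> spn R \<Longrightarrow> r \<in> R \<Longrightarrow> x - r \<in> spn R"

lemma spn_base: "r \<in> R \<Longrightarrow> r \<in> spn R"
  using spn.add[OF spn.zero] by fastforce

lemma subgrp_spn: "subgrp (spn R)"
proof -
  have "x - y \<in> spn R" if "y \<in> spn R" "x \<in> spn R" for x y
    using that
  proof (induction arbitrary: x)
    case (add y r)
    have "x - y - r \<in> spn R" by (intro spn.diff add)
    then show ?case by (simp add: algebra_simps)
  next
    case (diff y r)
    have "x - y + r \<in> spn R" by (intro spn.add diff)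
    then show ?case by (simp add: algebra_simps)
  qed auto
  then show ?thesis by (auto simp: subgrp_def spn.zero)
qed

lemma spn_least: "subgrp M \<Longrightarrow> R \<subseteq> M \<Longrightarrow> spn R \<subseteq> M"
proof
  fix x assume "subgrp M" "R \<subseteq> M" "x \<in> spn R"
  from this(3) show "x \<in> M"
    by induction (use \<open>subgrp M\<close> \<open>R \<subseteq> M\<close> in \<open>auto intro: subgrp_zero subgrp_add subgrp_diff\<close>)
qed

lemma spn_mono: "R \<subseteq> R' \<Longrightarrow> spn R \<subseteq> spn R'"
  by (intro spn_least subgrp_spn) (auto intro: spn_base)

definition additive :: "('v::ab_group_add \<Rightarrow> 'w::ab_group_add) \<Rightarrow> bool" where
  "additive F \<longleftrightarrow> (\<forall>x y. F (x + y) = F x + F y)"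

lemma additive_zero: "additive F \<Longrightarrow> F 0 = 0"
  unfolding additive_def by (metis add.right_neutral add_left_cancel)

lemma additive_uminus: "additive F \<Longrightarrow> F (- x) = - F x"
  using additive_zero[of F] unfolding additive_def by (metis add.right_inverse add_eq_0_iff)

lemma additive_diff: "additive F \<Longrightarrow> F (x - y) = F x - F y"
  and additive_add: "additive F \<Longrightarrow> F (x + y) = F x + F y"
  using additive_uminus[of F y] unfolding additive_def by (metis add_uminus_conv_diff, simp)

lemma additive_sum: "additive F \<Longrightarrow> F (sum g I) = (\<Sum>i\<in>I. F (g i))"
  by (induction I rule: infinite_finite_induct) (auto simp: additive_add additive_zero)

lemma subgrp_vimage: "additive F \<Longrightarrow> subgrp M \<Longrightarrow> subgrp (F -` M)"
  by (auto simp: subgrp_def additive_diff additive_zero)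

lemma spn_image:
  assumes "additive F" "subgrp M" "\<And>r. r \<in> R \<Longrightarrow> F r \<in> M" "x \<in> spn R"
  shows "F x \<in> M"
  using spn_least[OF subgrp_vimage[OF assms(1,2)], of R] assms(3,4) by auto

text \<open>The carrier of the free abelian group on \<open>S\<close>, seen inside a type of class
  \<open>ab_group_add\<close>: plain addition and subtraction apply, and chain groups on different
  generators share one ambient group.\<close>

definition frags :: "'s set \<Rightarrow> ('s \<Rightarrow>\<^sub>0 int) set" where
  "frags S = {c. Poly_Mapping.keys c \<subseteq> S}"

lemma subgrp_frags: "subgrp (frags S)"
  unfolding subgrp_def frags_def by (auto dest!: subsetD[OF keys_diff])

lemma frag_of_in_frags [simp]: "frag_of s \<in> frags S \<longleftrightarrow> s \<in> S"
  by (simp add: frags_def)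

lemma frags_mono: "S \<subseteq> T \<Longrightarrow> frags S \<subseteq> frags T"
  by (auto simp: frags_def)

lemma frags_UNIV [simp]: "x \<in> frags UNIV"
  by (simp add: frags_def)

lemma frags_induct [consumes 1, case_names zero one diff]:
  assumes "c \<in> frags S" "P 0" "\<And>s. s \<in> S \<Longrightarrow> P (frag_of s)"
    "\<And>x y. P x \<Longrightarrow> P y \<Longrightarrow> P (x - y)"
  shows "P c"
  using assms by (intro frag_induction[of c S P]) (simp_all add: frags_def)

lemma additive_frag_extend: "additive (frag_extend f)"
  by (simp add: additive_def frag_extend_add)

lemma additive_image_frags:
  assumes "additive F" "subgrp M" "\<And>s. s \<in> S \<Longrightarrow> F (frag_of s) \<in> M" "c \<in> frags S"
  shows "F c \<in> M"
  using assms(4)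
  by (induction rule: frags_induct) (simp_all add: assms additive_diff additive_zero subgrp_zero subgrp_diff)

lemma additive_compose: "additive F \<Longrightarrow> additive G \<Longrightarrow> additive (\<lambda>x. F (G x))"
  by (simp add: additive_def)

lemma additive_minus_fun: "additive F \<Longrightarrow> additive G \<Longrightarrow> additive (\<lambda>x. F x - G x :: 'v::ab_group_add)"
  by (auto simp: additive_def)

lemma additive_plus_fun: "additive F \<Longrightarrow> additive G \<Longrightarrow> additive (\<lambda>x. F x + G x :: 'v::ab_group_add)"
  by (auto simp: additive_def)

lemma additive_id: "additive (\<lambda>x. x)"
  by (auto simp: additive_def)

lemma additive_sum_fun: "(\<And>i. i \<in> I \<Longrightarrow> additive (F i)) \<Longrightarrow> additive (\<lambda>x. \<Sum>i\<in>I. F i x :: 'v::ab_group_add)"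
  by (induction I rule: infinite_finite_induct) (auto simp: additive_def)

lemma additive_frag_cmul: "additive (frag_cmul n)"
  by (simp add: additive_def frag_cmul_distrib2)

text \<open>The difference of two additive maps is additive, so a congruence modulo \<open>M\<close>
  need only be tested on generators. Most chain identities below hold only modulo relations and are
  proved in this way.\<close>

lemma additive_cong_frags:
  assumes "additive F" "additive G" "subgrp M" "c \<in> frags S"
    "\<And>s. s \<in> S \<Longrightarrow> F (frag_of s) - G (frag_of s) \<in> M"
  shows "F c - G c \<in> M"
  using additive_image_frags[OF additive_minus_fun[OF assms(1,2)] assms(3) assms(5) assms(4)] by simp

lemma additive_eq_frags:
  assumes "additive F" "additive G" "c \<in> frags S" "\<And>s. s \<in> S \<Longrightarrow> F (frag_of s) = G (frag_of s)"
  shows "F c = G c"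
  using additive_cong_frags[of F G "{0}" c S] assms by (simp add: subgrp_def)

lemma subgrp_cmul:
  assumes "subgrp M" "x \<in> M"
  shows "frag_cmul n x \<in> M"
  using assms by (intro frag_closure_minus_cmul[of "\<lambda>x. x \<in> M"]) (auto intro: subgrp_zero subgrp_diff)

section \<open>Labelled chains\<close>

text \<open>Here \<open>x\<close> is a chain and \<open>c\<close> a single label. Additivity in
  \<open>c\<close> is absent at this point and comes in through the relations \<open>Q\<close> of
  \<open>rels\<close>.\<close>

definition tens :: "('s \<Rightarrow>\<^sub>0 int) \<Rightarrow> 'c \<Rightarrow> ('s \<times> 'c) \<Rightarrow>\<^sub>0 int" where
  "tens x c = frag_extend (\<lambda>u. frag_of (u, c)) x"

text \<open>The operator \<open>F\<close> tensored with the identity on labels. Only the values of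
  \<open>F\<close> on generators are read off, which is why \<open>lift_tens\<close> asks for
  additivity of \<open>F\<close>.\<close>

definition lift :: "(('s \<Rightarrow>\<^sub>0 int) \<Rightarrow> ('t \<Rightarrow>\<^sub>0 int)) \<Rightarrow> (('s \<times> 'c) \<Rightarrow>\<^sub>0 int) \<Rightarrow> ('t \<times> 'c) \<Rightarrow>\<^sub>0 int" where
  "lift F = frag_extend (\<lambda>(t, c). tens (F (frag_of t)) c)"

lemma additive_tens: "additive (\<lambda>x. tens x c)"
  unfolding tens_def by (rule additive_frag_extend)

lemma tens_of [simp]: "tens (frag_of t) c = frag_of (t, c)"
  by (simp add: tens_def)

lemma additive_lift: "additive (lift F)"
  unfolding lift_def by (rule additive_frag_extend)

lemma lift_of [simp]: "lift F (frag_of (t, c)) = tens (F (frag_of t)) c"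
  by (simp add: lift_def)

lemma lift_tens: "additive F \<Longrightarrow> lift F (tens x c) = tens (F x) c"
  by (rule additive_eq_frags[OF additive_compose[OF additive_lift additive_tens]
        additive_compose[OF additive_tens], where S = UNIV]) auto

lemma tens_frags: "x \<in> frags T \<Longrightarrow> c \<in> C \<Longrightarrow> tens x c \<in> frags (T \<times> C)"
  by (rule additive_image_frags[OF additive_tens subgrp_frags]) auto

lemma lift_frags:
  assumes "\<And>t. t \<in> T \<Longrightarrow> F (frag_of t) \<in> frags T'" "x \<in> frags (T \<times> C)"
  shows "lift F x \<in> frags (T' \<times> C)"
  by (rule additive_image_frags[OF additive_lift subgrp_frags _ assms(2)]) (auto intro!: tens_frags assms(1))

lemma lift_compose: "additive F \<Longrightarrow> lift F (lift G x) = lift (\<lambda>y. F (G y)) x"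
  by (rule additive_eq_frags[OF additive_compose[OF additive_lift additive_lift] additive_lift, where S = UNIV])
     (auto simp: lift_tens)

lemma lift_cong:
  assumes "\<And>t. t \<in> T \<Longrightarrow> F (frag_of t) = G (frag_of t)" "x \<in> frags (T \<times> C)"
  shows "lift F x = lift G x"
  by (rule additive_eq_frags[OF additive_lift additive_lift assms(2)]) (auto simp: assms)

lemma lift_id: "lift (\<lambda>x. x) x = x"
  by (rule additive_eq_frags[OF additive_lift additive_id, where S = UNIV]) auto

lemma lift_plus: "lift (\<lambda>x. F x + G x) x = lift F x + lift G x"
  by (rule additive_eq_frags[OF additive_lift additive_plus_fun[OF additive_lift additive_lift], where S = UNIV])
     (auto simp: additive_add[OF additive_tens])

lemma lift_minus: "lift (\<lambda>x. F x - G x) x = lift F x - lift G x"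
  by (rule additive_eq_frags[OF additive_lift additive_minus_fun[OF additive_lift additive_lift], where S = UNIV])
     (auto simp: additive_diff[OF additive_tens])

lemma lift_zero: "lift (\<lambda>x. 0) x = 0"
  by (rule additive_eq_frags[OF additive_lift, where S = UNIV])
     (auto simp: additive_def additive_zero[OF additive_tens])

definition ten2 :: "'s \<Rightarrow> ('c \<Rightarrow>\<^sub>0 int) \<Rightarrow> ('s \<times> 'c) \<Rightarrow>\<^sub>0 int" where
  "ten2 t q = frag_extend (\<lambda>c. frag_of (t, c)) q"

text \<open>The kernel of the map from the free group on \<open>T \<times> C\<close> to \<open>\<int>T / R \<otimes> \<int>C / Q\<close>.\<close>

definition rels :: "('s \<Rightarrow>\<^sub>0 int) set \<Rightarrow> 's set \<Rightarrow> 'c set \<Rightarrow> ('c \<Rightarrow>\<^sub>0 int) set \<Rightarrow> (('s \<times> 'c) \<Rightarrow>\<^sub>0 int) set" where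
  "rels R T C Q = spn ({tens r c | r c. r \<in> R \<and> c \<in> C} \<union> {ten2 t q | t q. t \<in> T \<and> q \<in> Q})"

lemma additive_ten2: "additive (ten2 t)"
  unfolding ten2_def by (rule additive_frag_extend)

lemma ten2_of [simp]: "ten2 t (frag_of c) = frag_of (t, c)"
  by (simp add: ten2_def)

lemma subgrp_rels: "subgrp (rels R T C Q)"
  unfolding rels_def by (rule subgrp_spn)

lemma tens_rels: "r \<in> spn R \<Longrightarrow> c \<in> C \<Longrightarrow> tens r c \<in> rels R T C Q"
  by (rule spn_image[OF additive_tens subgrp_rels]) (auto simp: rels_def intro!: spn_base)

lemma ten2_rels: "t \<in> T \<Longrightarrow> q \<in> Q \<Longrightarrow> ten2 t q \<in> rels R T C Q"
  unfolding rels_def by (rule spn_base) auto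

text \<open>Expanding \<open>F (frag_of t)\<close> in generators \<open>u\<close> and exchanging the
  two summations turns the image of a label relation at \<open>t\<close> into an integer combination
  of the same label relation at the various \<open>u\<close>.\<close>

lemma lift_ten2_rels:
  assumes "additive F" "F (frag_of t) \<in> frags T'" "q \<in> Q"
  shows "lift F (ten2 t q) \<in> rels R T' C Q"
proof -
  define G where "G y = frag_extend (\<lambda>u. ten2 u q) y" for y :: "'b \<Rightarrow>\<^sub>0 int"
  have G: "additive G" unfolding G_def by (rule additive_frag_extend)
  have "frag_extend (\<lambda>c. tens y c) q = G y" for y :: "'b \<Rightarrow>\<^sub>0 int"
  proof (rule additive_eq_frags[OF _ G, where S = UNIV])
    show "additive (\<lambda>y. frag_extend (\<lambda>c. tens y c) q)"
      by (simp add: additive_def frag_extend_def additive_add[OF additive_tens] frag_cmul_distrib2 sum.distrib)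
  qed (auto simp: G_def ten2_def)
  moreover have "lift F (ten2 t q) = frag_extend (\<lambda>c. tens (F (frag_of t)) c) q"
    by (rule additive_eq_frags[OF additive_compose[OF additive_lift additive_ten2] additive_frag_extend, where S = UNIV])
       auto
  moreover have "G (F (frag_of t)) \<in> rels R T' C Q"
    by (rule additive_image_frags[OF G subgrp_rels _ assms(2)]) (auto simp: G_def intro: ten2_rels assms)
  ultimately show ?thesis by simp
qed

lemma lift_rels:
  assumes "additive F" "\<And>t. t \<in> T \<Longrightarrow> F (frag_of t) \<in> frags T'" "\<And>r. r \<in> R \<Longrightarrow> F r \<in> spn R'"
    "x \<in> rels R T C Q"
  shows "lift F x \<in> rels R' T' C Q"
  by (rule spn_image[OF additive_lift subgrp_rels _ assms(4)[unfolded rels_def]])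
     (auto simp: lift_tens assms intro!: tens_rels lift_ten2_rels)

lemma rels_mono: "spn R \<subseteq> spn R' \<Longrightarrow> rels R T C Q \<subseteq> rels R' T C Q"
  using lift_rels[OF additive_id, of T T R R' _ C Q] by (auto simp: lift_id spn_base subset_iff)

lemma lift_into_rels:
  assumes "\<And>t. t \<in> T \<Longrightarrow> F (frag_of t) \<in> spn R" "x \<in> frags (T \<times> C)"
  shows "lift F x \<in> rels R T' C Q"
  by (rule additive_image_frags[OF additive_lift subgrp_rels _ assms(2)]) (auto intro!: tens_rels assms(1))

section \<open>The boundary operator on lists\<close>

definition cns :: "'a \<Rightarrow> ('a list \<Rightarrow>\<^sub>0 int) \<Rightarrow> ('a list \<Rightarrow>\<^sub>0 int)" where
  "cns a = frag_extend (\<lambda>t. frag_of (a # t))"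

text \<open>The simplicial boundary, written so that prepending a vertex is a cone: the boundary of
  a cone is its base minus the cone over the boundary. A one-letter list has the empty list as
  boundary, so the complex is augmented.\<close>

primrec bd_list :: "'a list \<Rightarrow> ('a list \<Rightarrow>\<^sub>0 int)" where
  "bd_list [] = 0"
| "bd_list (a # t) = frag_of t - cns a (bd_list t)"

definition bd :: "('a list \<Rightarrow>\<^sub>0 int) \<Rightarrow> ('a list \<Rightarrow>\<^sub>0 int)" where
  "bd = frag_extend bd_list"

definition lact :: "('a \<Rightarrow> 'b) \<Rightarrow> ('a list \<Rightarrow>\<^sub>0 int) \<Rightarrow> ('b list \<Rightarrow>\<^sub>0 int)" where
  "lact g = frag_extend (\<lambda>t. frag_of (map g t))"

text \<open>The classical triangulation of a prism: unfolded, an alternating sum of lists that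
  follow \<open>t\<close> up to and including some position and \<open>map g t\<close> from that
  same position on.\<close>

primrec prism_list :: "('a \<Rightarrow> 'a) \<Rightarrow> 'a list \<Rightarrow> ('a list \<Rightarrow>\<^sub>0 int)" where
  "prism_list g [] = 0"
| "prism_list g (a # t) = cns a (frag_of (map g (a # t)) - prism_list g t)"

definition prism :: "('a \<Rightarrow> 'a) \<Rightarrow> ('a list \<Rightarrow>\<^sub>0 int) \<Rightarrow> ('a list \<Rightarrow>\<^sub>0 int)" where
  "prism g = frag_extend (prism_list g)"

definition tup :: "'a set \<Rightarrow> nat \<Rightarrow> 'a list set" where
  "tup A k = {t. length t = k \<and> set t \<subseteq> A}"

definition del :: "nat \<Rightarrow> 'a list \<Rightarrow> 'a list" where
  "del i t = take i t @ drop (Suc i) t"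

lemma additive_cns: "additive (cns a)"
  and additive_bd: "additive bd"
  and additive_lact: "additive (lact g)"
  and additive_prism: "additive (prism h)"
  by (simp_all add: cns_def bd_def lact_def prism_def additive_frag_extend)

lemma cns_of [simp]: "cns a (frag_of t) = frag_of (a # t)"
  and bd_of [simp]: "bd (frag_of t) = bd_list t"
  and lact_of [simp]: "lact g (frag_of u) = frag_of (map g u)"
  and prism_of [simp]: "prism h (frag_of t) = prism_list h t"
  by (simp_all add: cns_def bd_def lact_def prism_def)

lemmas op_diff = additive_diff[OF additive_cns] additive_diff[OF additive_bd] additive_diff[OF additive_lact]
  additive_diff[OF additive_prism] additive_zero[OF additive_cns] additive_zero[OF additive_bd]
  additive_zero[OF additive_lact] additive_zero[OF additive_prism]

lemma bd_cns: "bd (cns a x) = x - cns a (bd x)"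
  by (rule additive_eq_frags[OF additive_compose[OF additive_bd additive_cns]
        additive_minus_fun[OF additive_id additive_compose[OF additive_cns additive_bd]] frags_UNIV]) simp

lemma bd_bd_list: "bd (bd_list t) = 0"
  by (induction t) (auto simp: additive_zero[OF additive_bd] additive_zero[OF additive_cns] op_diff bd_cns)

lemma bd_bd: "bd (bd x) = 0"
  by (rule additive_eq_frags[OF additive_compose[OF additive_bd additive_bd] _ frags_UNIV, of "\<lambda>x. 0"])
     (auto simp: bd_bd_list additive_def)

lemma lact_cns: "lact g (cns a x) = cns (g a) (lact g x)"
  by (rule additive_eq_frags[OF additive_compose[OF additive_lact additive_cns]
        additive_compose[OF additive_cns additive_lact] frags_UNIV]) simp

lemma bd_map: "bd_list (map g t) = lact g (bd_list t)"
  by (induction t) (auto simp: additive_zero[OF additive_lact] op_diff lact_cns)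

lemma bd_lact: "bd (lact g x) = lact g (bd x)"
  by (rule additive_eq_frags[OF additive_compose[OF additive_bd additive_lact]
        additive_compose[OF additive_lact additive_bd] frags_UNIV]) (simp add: bd_map)

lemma prism_cns: "prism g (cns a x) = cns a (lact g (cns a x) - prism g x)"
  by (rule additive_eq_frags[OF additive_compose[OF additive_prism additive_cns]
        additive_compose[OF additive_cns additive_minus_fun[OF additive_compose[OF additive_lact additive_cns] additive_prism]]
        frags_UNIV]) simp

text \<open>This homotopy between \<open>map g\<close> and the identity is the source of all trivial
  conjugations below. The recursion of the prism matches the cone formula \<open>bd_cns\<close>, so
  induction on the list suffices.\<close>

lemma bd_prism_list: "bd (prism_list g t) + prism g (bd_list t) = frag_of (map g t) - frag_of t"
proof (induction t)
  case (Cons a t)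
  define b where "b = bd_list t"
  define y where "y = frag_of (map g (a # t)) - prism_list g t"
  have p: "bd (prism_list g t) = frag_of (map g t) - frag_of t - prism g b"
    using Cons by (simp add: b_def algebra_simps)
  have "bd y = frag_of t + prism g b - cns (g a) (lact g b)"
    unfolding y_def op_diff p by (simp add: bd_map b_def)
  then have "bd (prism_list g (a # t)) = y - (cns a (frag_of t) + cns a (prism g b) - cns a (cns (g a) (lact g b)))"
    by (simp add: bd_cns op_diff additive_add[OF additive_cns] flip: y_def del: cns_of list.map)
  moreover have "prism g (bd_list (a # t)) = prism_list g t - (cns a (cns (g a) (lact g b)) - cns a (prism g b))"
    by (simp add: op_diff prism_cns lact_cns b_def)
  ultimately show ?case by (simp add: y_def)
qed (auto simp: op_diff)

lemma bd_prism: "bd (prism g x) + prism g (bd x) = lact g x - x"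
  by (rule additive_eq_frags[OF additive_plus_fun[OF additive_compose[OF additive_bd additive_prism]
          additive_compose[OF additive_prism additive_bd]] additive_minus_fun[OF additive_lact additive_id] frags_UNIV])
     (simp add: bd_prism_list)

text \<open>This lets the homotopy pass to coinvariants: translations by elements that commute with
  \<open>g\<close> preserve the prism.\<close>

lemma lact_prism_list:
  "(\<And>a. a \<in> set t \<Longrightarrow> f (g a) = g (f a)) \<Longrightarrow> lact f (prism_list g t) = prism_list g (map f t)"
proof (induction t)
  case (Cons a t)
  then have "map (f \<circ> g) t = map (g \<circ> f) t" "f (g a) = g (f a)" by simp_all
  with Cons show ?case by (simp add: lact_cns op_diff del: map_eq_conv)
qed (simp add: op_diff)

lemma cns_frags: "a \<in> A \<Longrightarrow> x \<in> frags (tup A k) \<Longrightarrow> cns a x \<in> frags (tup A (Suc k))"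
  by (rule additive_image_frags[OF additive_cns subgrp_frags]) (auto simp: tup_def)

lemma bd_list_frags: "t \<in> tup A (Suc k) \<Longrightarrow> bd_list t \<in> frags (tup A k)"
proof (induction t arbitrary: k)
  case (Cons a t)
  then have t: "t \<in> tup A k" "a \<in> A" by (auto simp: tup_def)
  show ?case
  proof (cases k)
    case 0
    then show ?thesis using t by (auto simp: tup_def additive_zero[OF additive_cns])
  next
    case (Suc j)
    with Cons.IH[of j] t have "cns a (bd_list t) \<in> frags (tup A k)" by (auto intro: cns_frags)
    then show ?thesis using t by (auto intro!: subgrp_diff[OF subgrp_frags])
  qed
qed (auto simp: tup_def)

lemma bd_list_Nil: "t \<in> tup A 0 \<Longrightarrow> bd_list t = 0"
  by (simp add: tup_def)

lemma prism_list_frags: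
  "t \<in> tup A k \<Longrightarrow> (\<And>a. a \<in> A \<Longrightarrow> g a \<in> A) \<Longrightarrow> prism_list g t \<in> frags (tup A (Suc k))"
proof (induction t arbitrary: k)
  case (Cons a t)
  then obtain j where j: "k = Suc j" "t \<in> tup A j" "a \<in> A" by (cases k) (auto simp: tup_def)
  then have "map g (a # t) \<in> tup A k" using Cons.prems(2) by (auto simp: tup_def)
  with j Cons.IH[OF j(2) Cons.prems(2)] show ?case
    by (auto intro!: cns_frags subgrp_diff[OF subgrp_frags] simp del: list.map)
qed (auto simp: subgrp_zero[OF subgrp_frags])

lemma del_0 [simp]: "del 0 (a # t) = t" and del_Suc [simp]: "del (Suc i) (a # t) = a # del i t"
  by (simp_all add: del_def)

lemma bd_list_sum: "bd_list t = (\<Sum>i<length t. frag_cmul ((- 1) ^ i) (frag_of (del i t)))"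
proof (induction t)
  case (Cons a t)
  have *: "cns a (frag_cmul n x) = frag_cmul n (cns a x)" for n x
    by (simp add: cns_def frag_extend_cmul)
  show ?case
    by (simp add: Cons sum.lessThan_Suc_shift additive_sum[OF additive_cns] * frag_cmul_distrib
        flip: sum_negf del: sum.lessThan_Suc)
qed simp

text \<open>The Leibniz rule for concatenation; the sign counts the letters of \<open>p\<close> that
  a deletion in \<open>w\<close> passes over.\<close>

lemma bd_list_append:
  "bd_list (p @ w) = frag_extend (\<lambda>u. frag_of (u @ w)) (bd_list p)
     + frag_cmul ((- 1) ^ length p) (frag_extend (\<lambda>u. frag_of (p @ u)) (bd_list w))"
proof (induction p)
  case Nil
  show ?case by (simp flip: frag_expansion)
next
  case (Cons a p)
  have 1: "cns a (frag_cmul n x) = frag_cmul n (cns a x)" for n x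
    by (simp add: cns_def frag_extend_cmul)
  have 2: "cns a (frag_extend (\<lambda>u. frag_of (u @ w)) x) = frag_extend (\<lambda>u. frag_of (u @ w)) (cns a x)" for x
    by (rule additive_eq_frags[OF additive_compose[OF additive_cns additive_frag_extend]
          additive_compose[OF additive_frag_extend additive_cns] frags_UNIV]) simp
  have 3: "cns a (frag_extend (\<lambda>u. frag_of (p @ u)) x) = frag_extend (\<lambda>u. frag_of ((a # p) @ u)) x" for x
    by (rule additive_eq_frags[OF additive_compose[OF additive_cns additive_frag_extend]
          additive_frag_extend frags_UNIV]) simp
  show ?case
    by (simp add: Cons additive_add[OF additive_cns] 1 2 3 frag_extend_diff)
qed

section \<open>The complex of injective words\<close>

text \<open>A letter is a pair of a colour and a label.\<close>

definition words :: "'i set \<Rightarrow> 'g set \<Rightarrow> nat \<Rightarrow> ('i \<times> 'g) list set" where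
  "words C A l = {w. length w = l \<and> distinct (map fst w) \<and> set w \<subseteq> C \<times> A}"

text \<open>Filtering by the position of the colour \<open>a\<close> reduces exactness to the words avoiding \<open>a\<close>.\<close>

definition words_below :: "'i set \<Rightarrow> 'g set \<Rightarrow> 'i \<Rightarrow> nat \<Rightarrow> nat \<Rightarrow> ('i \<times> 'g) list set" where
  "words_below C A a i l = {w \<in> words C A l. \<forall>j<length w. fst (w ! j) = a \<longrightarrow> j < i}"

text \<open>Reads off the part of a chain with prefix \<open>p\<close>, the prefix being removed; a
  left inverse of \<open>prep p\<close>.\<close>

definition strip :: "'a list \<Rightarrow> ('a list \<Rightarrow>\<^sub>0 int) \<Rightarrow> ('a list \<Rightarrow>\<^sub>0 int)" where
  "strip p = frag_extend (\<lambda>w. if take (length p) w = p then frag_of (drop (length p) w) else 0)"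

definition prep :: "'a list \<Rightarrow> ('a list \<Rightarrow>\<^sub>0 int) \<Rightarrow> ('a list \<Rightarrow>\<^sub>0 int)" where
  "prep p = frag_extend (\<lambda>w. frag_of (p @ w))"

lemma additive_strip: "additive (strip p)" and additive_prep: "additive (prep p)"
  by (simp_all add: strip_def prep_def additive_frag_extend)

lemma strip_of: "strip p (frag_of w) = (if take (length p) w = p then frag_of (drop (length p) w) else 0)"
  and prep_of [simp]: "prep p (frag_of w) = frag_of (p @ w)"
  by (simp_all add: strip_def prep_def)

lemma length_del: "i < length t \<Longrightarrow> length (del i t) = length t - 1"
  by (simp add: del_def)

lemma nth_del: "i < length t \<Longrightarrow> j < length t - 1 \<Longrightarrow> del i t ! j = (if j < i then t ! j else t ! Suc j)"
  by (auto simp: del_def nth_append min_def)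

lemma take_del: "j \<ge> k \<Longrightarrow> take k (del j t) = take k t"
  by (simp add: del_def take_append min_def)

lemma drop_del: "j \<ge> k \<Longrightarrow> k \<le> length t \<Longrightarrow> drop k (del j t) = del (j - k) (drop k t)"
  by (auto simp: del_def drop_take Suc_diff_le algebra_simps)

text \<open>Deleting one of the first \<open>i + 1\<close> letters moves the letter at position
  \<open>i + 1\<close>, if any, into position \<open>i\<close>, and by the filtration that letter
  does not have colour \<open>a\<close>. Hence only deletions in the suffix contribute to prefix
  \<open>p\<close>, with the Leibniz sign.\<close>

lemma strip_bd_below:
  assumes w: "w \<in> words_below C A a (Suc i) l" and p: "length p = Suc i" "fst (p ! i) = a"
  shows "strip p (bd_list w) = frag_cmul ((- 1) ^ Suc i) (bd (strip p (frag_of w)))"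
proof -
  have len: "length w = l" using w by (auto simp: words_below_def words_def)
  have low: "strip p (frag_of (del j w)) = 0" if "j < l" "j \<le> i" for j
  proof -
    have "take (Suc i) (del j w) \<noteq> p"
    proof
      assume eq: "take (Suc i) (del j w) = p"
      then have "Suc i \<le> length (del j w)" using p by (metis length_take min.cobounded1 min_def)
      then have "Suc i < l" using that len by (simp add: length_del)
      moreover have "p ! i = del j w ! i" using eq by (metis lessI nth_take)
      ultimately have "fst (w ! Suc i) = a" using that len p by (simp add: nth_del)
      then show False using w len \<open>Suc i < l\<close> by (auto simp: words_below_def)
    qed
    then show ?thesis using p by (simp add: strip_of)
  qed
  have sc: "strip p (frag_cmul n x) = frag_cmul n (strip p x)" for n x
    by (simp add: strip_def frag_extend_cmul)
  have "strip p (bd_list w) = (\<Sum>j<l. frag_cmul ((- 1) ^ j) (strip p (frag_of (del j w))))"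
    by (simp add: bd_list_sum len additive_sum[OF additive_strip] sc)
  also have "\<dots> = (\<Sum>j\<in>{Suc i..<l}. frag_cmul ((- 1) ^ j) (strip p (frag_of (del j w))))"
    by (rule sum.mono_neutral_right) (auto simp: low)
  also have "\<dots> = (\<Sum>j<l - Suc i. frag_cmul ((- 1) ^ (j + Suc i)) (strip p (frag_of (del (j + Suc i) w))))"
    by (rule sum.reindex_bij_witness[of _ "\<lambda>j. j + Suc i" "\<lambda>j. j - Suc i"]) auto
  also have "\<dots> = frag_cmul ((- 1) ^ Suc i) (bd (strip p (frag_of w)))"
  proof (cases "take (Suc i) w = p")
    case True
    then have "Suc i \<le> l" using p len by (metis length_take min.cobounded1 min_def)
    then show ?thesis
      using True p by (simp add: strip_of take_del drop_del bd_list_sum len frag_cmul_sum power_add mult.commute)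
  next
    case False
    then show ?thesis using p by (simp add: strip_of take_del additive_zero[OF additive_bd])
  qed
  finally show ?thesis .
qed

lemma strip_bd:
  assumes z: "z \<in> frags (words_below C A a (Suc i) l)" and p: "length p = Suc i" "fst (p ! i) = a"
  shows "strip p (bd z) = frag_cmul ((- 1) ^ Suc i) (bd (strip p z))"
  by (rule additive_eq_frags[OF additive_compose[OF additive_strip additive_bd]
        additive_compose[OF additive_frag_cmul additive_compose[OF additive_bd additive_strip]] z])
     (use strip_bd_below[OF _ p] in auto)

lemma words_append:
  assumes "u \<in> words C A k" "v \<in> words (C - fst ` set u) A l"
  shows "u @ v \<in> words C A (k + l)"
  using assms unfolding words_def by (fastforce simp: image_iff)

lemma words_append_D:
  assumes "u @ v \<in> words C A n"
  shows "u \<in> words C A (length u)" "v \<in> words (C - fst ` set u) A (n - length u)" "length u \<le> n"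
  using assms by (auto simp: words_def) (metis IntI empty_iff fst_conv image_eqI)

lemma del_in_words: "w \<in> words C A l \<Longrightarrow> i < l \<Longrightarrow> del i w \<in> words C A (l - 1) \<and> set (del i w) \<subseteq> set w"
proof -
  assume w: "w \<in> words C A l" and i: "i < l"
  have s: "set (del i w) \<subseteq> set w" by (auto simp: del_def dest: in_set_takeD in_set_dropD)
  have "distinct (map fst (take i w @ w ! i # drop (Suc i) w))"
    using w i by (simp add: words_def id_take_nth_drop[symmetric])
  then have "distinct (map fst (del i w))" by (simp add: del_def) blast?
  then show ?thesis using w i s by (auto simp: words_def length_del)
qed

text \<open>The words of \<open>z\<close> with colour \<open>a\<close> in position \<open>i\<close>
  are grouped by their prefix \<open>p\<close> of length \<open>i + 1\<close>. By
  \<open>strip_bd\<close> each suffix coefficient is a cycle of words avoiding the colours of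
  \<open>p\<close>, which can be filled over the smaller colour set. Prepending \<open>p\<close> to
  the filling removes these words from \<open>z\<close>, and in every new word \<open>a\<close>
  stands further to the left or not at all.\<close>

lemma words_exact_step:
  assumes IH: "\<And>D l z. D \<subset> C \<Longrightarrow> l < card D \<Longrightarrow> z \<in> frags (words D A l) \<Longrightarrow> bd z = 0 \<Longrightarrow>
      \<exists>y \<in> frags (words D A (Suc l)). bd y = z"
    and fin: "finite C" and l: "l < card C"
    and z: "z \<in> frags (words_below C A a (Suc i) l)" "bd z = 0"
  shows "\<exists>y \<in> frags (words C A (Suc l)). z - bd y \<in> frags (words_below C A a i l)"
proof -
  define Ps where "Ps = {take (Suc i) w | w. w \<in> Poly_Mapping.keys z \<and> i < l \<and> fst (w ! i) = a}"
  have finP: "finite Ps" unfolding Ps_def by simp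
  have zw: "w \<in> words_below C A a (Suc i) l" if "w \<in> Poly_Mapping.keys z" for w
    using z that by (auto simp: frags_def)
  have P: "length p = Suc i" "fst (p ! i) = a" "p \<in> words C A (Suc i)" "Suc i \<le> l" if "p \<in> Ps" for p
  proof -
    obtain w where w: "w \<in> Poly_Mapping.keys z" "p = take (Suc i) w" "i < l" "fst (w ! i) = a"
      using \<open>p \<in> Ps\<close> unfolding Ps_def by blast
    have "w \<in> words C A l" using zw[OF w(1)] by (simp add: words_below_def)
    then have "p @ drop (Suc i) w \<in> words C A l" using w by simp
    from words_append_D[OF this] w show "length p = Suc i" "fst (p ! i) = a" "p \<in> words C A (Suc i)" "Suc i \<le> l"
      by (auto simp: words_def)
  qed
  have ex: "\<exists>y \<in> frags (words (C - fst ` set p) A (l - i)). bd y = strip p z" if p: "p \<in> Ps" for p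
  proof -
    have "Suc (l - Suc i) = l - i" using P[OF p] by auto
    \<comment> \<open>The prefix consumes as many colours as letters, so the inequality between word
      length and number of colours is inherited by the suffixes.\<close>
    moreover have "card (fst ` set p) = Suc i" "fst ` set p \<subseteq> C"
      using P[OF p] distinct_card[of "map fst p"] by (auto simp: words_def)
    then have "card (C - fst ` set p) = card C - Suc i"
      using fin by (simp add: card_Diff_subset finite_subset)
    then have "l - Suc i < card (C - fst ` set p)" "C - fst ` set p \<noteq> C"
      using l P(4)[OF p] by auto
    then have "l - Suc i < card (C - fst ` set p)" "C - fst ` set p \<subset> C" by auto
    moreover have "strip p z \<in> frags (words (C - fst ` set p) A (l - Suc i))"
    proof (rule additive_image_frags[OF additive_strip subgrp_frags _ z(1)])
      fix w assume "w \<in> words_below C A a (Suc i) l"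
      then have "take (length p) w @ drop (length p) w \<in> words C A l" by (simp add: words_below_def)
      from words_append_D(2)[OF this] show "strip p (frag_of w) \<in> frags (words (C - fst ` set p) A (l - Suc i))"
        using P(1)[OF p] by (auto simp: strip_of subgrp_zero[OF subgrp_frags])
    qed
    moreover have "bd (strip p z) = 0"
      using strip_bd[OF z(1) P(1,2)[OF p]] z(2) by (simp add: additive_zero[OF additive_strip])
    ultimately show ?thesis using IH[of "C - fst ` set p" "l - Suc i" "strip p z"] by auto
  qed
  then obtain Y where Y: "\<And>p. p \<in> Ps \<Longrightarrow> Y p \<in> frags (words (C - fst ` set p) A (l - i))"
    "\<And>p. p \<in> Ps \<Longrightarrow> bd (Y p) = strip p z" by metis
  \<comment> \<open>The Leibniz sign of a prefix of length \<open>i + 1\<close>. It squares to one,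
    so scaling by it makes the suffix part of the boundary contribute
    \<open>prep p (strip p z)\<close> with coefficient one.\<close>
  define s where "s = (- 1 :: int) ^ Suc i"
  have ss: "s * s = 1" by (simp add: s_def flip: power_add)
  define y where "y = (\<Sum>p\<in>Ps. frag_cmul s (prep p (Y p)))"
  have y: "y \<in> frags (words C A (Suc l))"
    unfolding y_def
  proof (intro subgrp_sum[OF subgrp_frags] subgrp_cmul[OF subgrp_frags])
    fix p assume p: "p \<in> Ps"
    show "prep p (Y p) \<in> frags (words C A (Suc l))"
    proof (rule additive_image_frags[OF additive_prep subgrp_frags _ Y(1)[OF p]])
      fix w assume "w \<in> words (C - fst ` set p) A (l - i)"
      from words_append[OF P(3)[OF p] this] show "prep p (frag_of w) \<in> frags (words C A (Suc l))"
        using P(4)[OF p] by auto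
    qed
  qed
  \<comment> \<open>The part of the boundary that deletes letters of the prefix.\<close>
  define B where "B p x = frag_extend (\<lambda>w. frag_extend (\<lambda>u. frag_of (u @ w)) (bd_list p)) x"
    for p :: "('a \<times> 'b) list" and x
  have bdp: "bd (prep p x) = B p x + frag_cmul s (prep p (bd x))" if "p \<in> Ps" for p x
  proof (rule additive_eq_frags[OF additive_compose[OF additive_bd additive_prep] _ frags_UNIV])
    show "additive (\<lambda>x. B p x + frag_cmul s (prep p (bd x)))"
      unfolding B_def by (intro additive_plus_fun additive_frag_extend
        additive_compose[OF additive_frag_cmul additive_compose[OF additive_prep additive_bd]])
    show "bd (prep p (frag_of w)) = B p (frag_of w) + frag_cmul s (prep p (bd (frag_of w)))" for w
      by (simp add: B_def bd_list_append prep_def s_def P(1)[OF that])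
  qed
  \<comment> \<open>A deletion inside \<open>p\<close> drops the letter of colour \<open>a\<close>
    or shifts it to position \<open>i - 1\<close>, and \<open>w\<close> contains no colour of
    \<open>p\<close>.\<close>
  have BW: "B p (Y p) \<in> frags (words_below C A a i l)" if p: "p \<in> Ps" for p
    unfolding B_def
  proof (rule additive_image_frags[OF additive_frag_extend subgrp_frags _ Y(1)[OF p]])
    fix w assume w: "w \<in> words (C - fst ` set p) A (l - i)"
    have *: "frag_of (del j p @ w) \<in> frags (words_below C A a i l)" if j: "j < Suc i" for j
    proof -
      from del_in_words[OF P(3)[OF p] j] have d: "del j p \<in> words C A i" "set (del j p) \<subseteq> set p" by auto
      from d(2) w have "w \<in> words (C - fst ` set (del j p)) A (l - i)" by (auto simp: words_def)
      from words_append[OF d(1) this] have "del j p @ w \<in> words C A l" using P(4)[OF p] by simp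
      moreover have "k < i" if k: "k < length (del j p @ w)" "fst ((del j p @ w) ! k) = a" for k
      proof (rule ccontr)
        assume "\<not> k < i"
        moreover have "length (del j p) = i" using d(1) by (simp add: words_def)
        ultimately have "(del j p @ w) ! k \<in> set w" using k by (auto simp: nth_append)
        moreover have "fst x \<in> C - fst ` set p" if "x \<in> set w" for x
        proof -
          have "x \<in> (C - fst ` set p) \<times> A" using w that unfolding words_def by blast
          then show ?thesis by (simp add: mem_Times_iff)
        qed
        ultimately have "a \<in> C - fst ` set p" using k(2) by metis
        moreover have "a \<in> fst ` set p" using P(1,2)[OF p] by (metis image_eqI lessI nth_mem)
        ultimately show False by blast
      qed
      ultimately show ?thesis by (auto simp: words_below_def)
    qed
    show "frag_extend (\<lambda>w. frag_extend (\<lambda>u. frag_of (u @ w)) (bd_list p)) (frag_of w)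
        \<in> frags (words_below C A a i l)"
      unfolding frag_extend_of bd_list_sum additive_sum[OF additive_frag_extend] P(1)[OF p] frag_extend_cmul
      by (intro subgrp_sum[OF subgrp_frags] subgrp_cmul[OF subgrp_frags] *) simp
  qed
  have rest: "z - (\<Sum>p\<in>Ps. prep p (strip p z)) \<in> frags (words_below C A a i l)"
  proof (rule additive_image_frags[where F = "\<lambda>z. z - (\<Sum>p\<in>Ps. prep p (strip p z))" and S = "Poly_Mapping.keys z"])
    show "additive (\<lambda>z. z - (\<Sum>p\<in>Ps. prep p (strip p z)))"
      by (intro additive_minus_fun additive_id additive_sum_fun additive_compose[OF additive_prep additive_strip])
    fix w assume wz: "w \<in> Poly_Mapping.keys z"
    note w = zw[OF wz]
    have wl: "length w = l" using w by (simp add: words_below_def words_def)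
    have pr: "prep p (strip p (frag_of w)) = (if p = take (Suc i) w then frag_of w else 0)" if "p \<in> Ps" for p
      using P(1)[OF that] by (auto simp: strip_of additive_zero[OF additive_prep])
    have sum: "(\<Sum>p\<in>Ps. prep p (strip p (frag_of w))) = (if take (Suc i) w \<in> Ps then frag_of w else 0)"
      by (simp add: pr sum.delta finP cong: sum.cong)
    show "frag_of w - (\<Sum>p\<in>Ps. prep p (strip p (frag_of w))) \<in> frags (words_below C A a i l)"
    proof (cases "take (Suc i) w \<in> Ps")
      case True
      then show ?thesis by (simp add: sum subgrp_zero[OF subgrp_frags])
    next
      case False
      then have "\<not> (i < l \<and> fst (w ! i) = a)" using wz by (auto simp: Ps_def)
      then have "w \<in> words_below C A a i l" using w wl by (auto simp: words_below_def less_Suc_eq)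
      then show ?thesis using False by (simp add: sum)
    qed
  qed (auto simp: frags_def subgrp_frags[unfolded frags_def])
  have "bd y = (\<Sum>p\<in>Ps. frag_cmul s (B p (Y p))) + (\<Sum>p\<in>Ps. prep p (strip p z))"
  proof -
    have "bd (frag_cmul s x) = frag_cmul s (bd x)" for x :: "('a \<times> 'b) list \<Rightarrow>\<^sub>0 int"
      by (simp add: bd_def frag_extend_cmul)
    then show ?thesis
      by (simp add: y_def additive_sum[OF additive_bd] bdp Y(2) frag_cmul_distrib2 ss sum.distrib cong: sum.cong)
  qed
  then have "z - bd y = (z - (\<Sum>p\<in>Ps. prep p (strip p z))) - (\<Sum>p\<in>Ps. frag_cmul s (B p (Y p)))" by simp
  also have "\<dots> \<in> frags (words_below C A a i l)"
    by (intro subgrp_diff[OF subgrp_frags] rest subgrp_sum[OF subgrp_frags] subgrp_cmul[OF subgrp_frags] BW)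
  finally show ?thesis using y by blast
qed

text \<open>Outer induction on the number of colours, inner induction on the positions allowed for
  one chosen colour \<open>a\<close>. When \<open>a\<close> cannot occur at all, prefixing the
  letter \<open>(a, g0)\<close> is a cone.\<close>

theorem words_exact:
  assumes "finite C" "g0 \<in> A" "l < card C" "z \<in> frags (words C A l)" "bd z = 0"
  shows "\<exists>y \<in> frags (words C A (Suc l)). bd y = z"
  using assms(1,3-5)
proof (induction "card C" arbitrary: C l z rule: less_induct)
  case less
  have IH: "\<exists>y \<in> frags (words D A (Suc l)). bd y = z"
    if "D \<subset> C" "l < card D" "z \<in> frags (words D A l)" "bd z = 0" for D l z
    using that less.prems(1) less.hyps[of D l z] by (auto simp: psubset_card_mono finite_subset)
  obtain a where a: "a \<in> C" using less.prems by fastforce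
  have "\<exists>y \<in> frags (words C A (Suc l)). bd y = z'"
    if "z' \<in> frags (words_below C A a i l)" "bd z' = 0" for z' i
    using that
  proof (induction i arbitrary: z')
    case 0
    have "words_below C A a 0 l \<subseteq> words (C - {a}) A l"
      by (auto simp: words_below_def words_def) (metis fst_conv in_set_conv_nth)
    with 0 have "z' \<in> frags (words (C - {a}) A l)" using frags_mono by blast
    then have "cns (a, g0) z' \<in> frags (words C A (Suc l))"
      by (rule additive_image_frags[OF additive_cns subgrp_frags, rotated])
         (use a assms(2) in \<open>auto simp: words_def\<close>)
    moreover have "bd (cns (a, g0) z') = z'" using 0 by (simp add: bd_cns op_diff)
    ultimately show ?case by blast
  next
    case (Suc i)
    from words_exact_step[OF IH less.prems(1,2) Suc.prems] obtain y
      where y: "y \<in> frags (words C A (Suc l))" "z' - bd y \<in> frags (words_below C A a i l)" by blast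
    have "bd (z' - bd y) = 0" using Suc.prems by (simp add: op_diff bd_bd)
    from Suc.IH[OF y(2) this] obtain x where "x \<in> frags (words C A (Suc l))" "bd x = z' - bd y" by blast
    then have "x + y \<in> frags (words C A (Suc l))" "bd (x + y) = z'"
      using y by (auto simp: subgrp_add[OF subgrp_frags] additive_add[OF additive_bd])
    then show ?case by blast
  qed
  moreover have "words C A l \<subseteq> words_below C A a l l" by (auto simp: words_below_def words_def)
  ultimately show ?case using less.prems frags_mono by blast
qed

section \<open>Contraction of the injective word complex\<close>

text \<open>Exactness is needed with labels attached, and a contraction given on single words
  carries over to labelled chains by \<open>lift\<close>. It is chosen degree by degree, each time
  filling the cycle left over from the previous degree. For \<open>l = 0\<close> the truncated index
  \<open>l - 1\<close> does no harm, as the empty word has boundary zero.\<close>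

lemma words_contraction:
  assumes C: "finite C" and g0: "g0 \<in> A"
  obtains h where "\<And>l w. l < card C \<Longrightarrow> w \<in> words C A l \<Longrightarrow> h l w \<in> frags (words C A (Suc l))"
    "\<And>l w. l < card C \<Longrightarrow> w \<in> words C A l \<Longrightarrow> bd (h l w) + frag_extend (h (l - 1)) (bd_list w) = frag_of w"
proof -
  define h where "h = rec_nat
    (\<lambda>w. SOME y. y \<in> frags (words C A 1) \<and> bd y = frag_of w)
    (\<lambda>l f w. SOME y. y \<in> frags (words C A (Suc (Suc l))) \<and> bd y = frag_of w - frag_extend f (bd_list w))"
  have bdw: "bd_list w \<in> frags (words C A l)" if "w \<in> words C A (Suc l)" for l w
    unfolding bd_list_sum using that del_in_words[OF that]
    by (intro subgrp_sum[OF subgrp_frags] subgrp_cmul[OF subgrp_frags]) (auto simp: words_def)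
  have "h l w \<in> frags (words C A (Suc l)) \<and> bd (h l w) + frag_extend (h (l - 1)) (bd_list w) = frag_of w"
    if "l < card C" "w \<in> words C A l" for l w
    using that
  proof (induction l arbitrary: w)
    case 0
    then have "bd_list w = 0" by (simp add: words_def)
    with words_exact[OF C g0 0(1), of "frag_of w"] 0
    have "\<exists>y. y \<in> frags (words C A 1) \<and> bd y = frag_of w" by auto
    from someI_ex[OF this] show ?case using \<open>bd_list w = 0\<close> by (simp add: h_def)
  next
    case (Suc l)
    let ?z = "frag_of w - frag_extend (h l) (bd_list w)"
    have IH: "h l v \<in> frags (words C A (Suc l))" "bd (h l v) = frag_of v - frag_extend (h (l - 1)) (bd_list v)"
      if "v \<in> words C A l" for v
      using Suc.IH[OF _ that] Suc.prems(1) by (auto simp: algebra_simps)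
    have "frag_extend (h l) (bd_list w) \<in> frags (words C A (Suc l))"
      by (rule additive_image_frags[OF additive_frag_extend subgrp_frags _ bdw[OF Suc.prems(2)]]) (simp add: IH)
    moreover have "bd (frag_extend (h l) x) = x - frag_extend (h (l - 1)) (bd x)" if "x \<in> frags (words C A l)" for x
      by (rule additive_eq_frags[OF additive_compose[OF additive_bd additive_frag_extend]
            additive_minus_fun[OF additive_id additive_compose[OF additive_frag_extend additive_bd]] that])
         (simp add: IH)
    from this[OF bdw[OF Suc.prems(2)]] have "bd ?z = 0" by (simp add: op_diff bd_bd_list)
    ultimately have "\<exists>y \<in> frags (words C A (Suc (Suc l))). bd y = ?z"
      using Suc.prems by (intro words_exact[OF C g0]) (auto intro: subgrp_diff[OF subgrp_frags])
    then have "\<exists>y. y \<in> frags (words C A (Suc (Suc l))) \<and> bd y = ?z" by blast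
    from someI_ex[OF this] show ?case by (simp add: h_def)
  qed
  then show thesis by (intro that[of h]) blast+
qed

text \<open>Dividing \<open>x\<close> by a representative chosen as a function of its coset alone
  gives an equivariant map to \<open>H\<close>. It encodes that left translation is free, and it
  serves to normalize tuples through their first entry.\<close>

lemma (in group) equivariant_retraction:
  assumes H: "subgroup H G"
  obtains r where "\<And>x. x \<in> carrier G \<Longrightarrow> r x \<in> H"
    "\<And>h x. h \<in> H \<Longrightarrow> x \<in> carrier G \<Longrightarrow> r (h \<otimes> x) = h \<otimes> r x"
proof -
  define s where "s x = (SOME y. y \<in> H #> x)" for x
  have s: "s x \<in> H #> x" if "x \<in> carrier G" for x
    unfolding s_def using rcos_self[OF that H] by (rule someI)
  have sc: "s x \<in> carrier G" if "x \<in> carrier G" for x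
    using s[OF that] r_coset_subset_G[OF subgroup.subset[OF H] that] by blast
  show thesis
  proof (rule that[of "\<lambda>x. x \<otimes> inv (s x)"])
    fix x assume x: "x \<in> carrier G"
    obtain h where h: "h \<in> H" "s x = h \<otimes> x" using s[OF x] by (auto simp: r_coset_def)
    then have "x \<otimes> inv (s x) = inv h"
      using x subgroup.mem_carrier[OF H h(1)] by (simp add: inv_mult_group m_assoc[symmetric])
    then show "x \<otimes> inv (s x) \<in> H" using h(1) subgroup.m_inv_closed[OF H] by simp
  next
    fix h x assume h: "h \<in> H" and x: "x \<in> carrier G"
    have hc: "h \<in> carrier G" using subgroup.mem_carrier[OF H h] .
    have "H #> (h \<otimes> x) = H #> x"
      using coset_mult_assoc[OF subgroup.subset[OF H] hc x] coset_join2[OF hc H h] by simp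
    then have "s (h \<otimes> x) = s x" by (simp add: s_def)
    then show "h \<otimes> x \<otimes> inv (s (h \<otimes> x)) = h \<otimes> (x \<otimes> inv (s x))"
      using hc x sc[OF x] by (simp add: m_assoc)
  qed
qed

section \<open>Homological stability\<close>

text \<open>A letter is a colour together with a label from \<open>A\<close>, while
  \<open>Lab\<close> and \<open>Q\<close> present the coefficient group by generators and
  relations.\<close>

locale letters = \<Gamma>: group \<Gamma> for \<Gamma> :: "'a monoid" (structure) +
  fixes n :: nat and act :: "'a \<Rightarrow> nat \<times> 'g \<Rightarrow> nat \<times> 'g" and A :: "'g set" and g0 :: 'g
    and Lab :: "'c set" and Q :: "('c \<Rightarrow>\<^sub>0 int) set"
  assumes g0: "g0 \<in> A"
    and act_closed: "\<gamma> \<in> carrier \<Gamma> \<Longrightarrow> x \<in> {..<n} \<times> A \<Longrightarrow> act \<gamma> x \<in> {..<n} \<times> A"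
    and act_one: "x \<in> {..<n} \<times> A \<Longrightarrow> act \<one> x = x"
    and act_mult: "\<gamma> \<in> carrier \<Gamma> \<Longrightarrow> \<delta> \<in> carrier \<Gamma> \<Longrightarrow> x \<in> {..<n} \<times> A \<Longrightarrow>
      act (\<gamma> \<otimes> \<delta>) x = act \<gamma> (act \<delta> x)"
    and act_colour: "\<gamma> \<in> carrier \<Gamma> \<Longrightarrow> x \<in> {..<n} \<times> A \<Longrightarrow> y \<in> {..<n} \<times> A \<Longrightarrow>
      fst (act \<gamma> x) = fst (act \<gamma> y) \<longleftrightarrow> fst x = fst y"
    and Q: "Q \<subseteq> frags Lab"
begin

text \<open>The stabilizer of this word in \<open>U m\<close> is \<open>U (m - l)\<close>, so the
  nested groups reappear as stabilizers.\<close>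

definition base :: "nat \<Rightarrow> nat \<Rightarrow> (nat \<times> 'g) list" where
  "base m l = map (\<lambda>k. (k, g0)) [m - l..<m]"

text \<open>The \<open>m\<close>-th group of the stability sequence, realized inside the ambient
  group as a pointwise stabilizer.\<close>

definition U :: "nat \<Rightarrow> 'a set" where
  "U m = {\<gamma> \<in> carrier \<Gamma>. \<forall>k. m \<le> k \<and> k < n \<longrightarrow> act \<gamma> (k, g0) = (k, g0)}"

abbreviation W :: "nat \<Rightarrow> nat \<Rightarrow> (nat \<times> 'g) list set" where
  "W m l \<equiv> words {..<m} A l"

lemma U_subgroup: "subgroup (U m) \<Gamma>"
proof (rule \<Gamma>.subgroupI)
  show "U m \<subseteq> carrier \<Gamma>" by (auto simp: U_def)
  have "\<one> \<in> U m" by (simp add: U_def act_one g0)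
  then show "U m \<noteq> {}" by blast
  show "\<gamma> \<otimes> \<delta> \<in> U m" if "\<gamma> \<in> U m" "\<delta> \<in> U m" for \<gamma> \<delta>
    using that by (simp add: U_def act_mult g0)
  show "inv \<gamma> \<in> U m" if g: "\<gamma> \<in> U m" for \<gamma>
  proof -
    have "act (inv \<gamma>) (k, g0) = (k, g0)" if "m \<le> k" "k < n" for k
    proof -
      have "act (inv \<gamma>) (act \<gamma> (k, g0)) = (k, g0)"
        using g that act_mult[of "inv \<gamma>" \<gamma> "(k, g0)"] by (simp add: U_def g0 act_one)
      moreover have "act \<gamma> (k, g0) = (k, g0)" using g that by (simp add: U_def)
      ultimately show ?thesis by simp
    qed
    then show ?thesis using g by (simp add: U_def)
  qed
qed

lemma U_carrier: "\<gamma> \<in> U m \<Longrightarrow> \<gamma> \<in> carrier \<Gamma>"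
  by (simp add: U_def)

lemma U_mono: "m \<le> m' \<Longrightarrow> U m \<subseteq> U m'"
  by (auto simp: U_def)

text \<open>Each colour from \<open>m\<close> on is the image of itself, because its standard letter
  is fixed, and distinct colours have distinct images; so no smaller colour can land there.\<close>

lemma act_U_colour:
  assumes "\<gamma> \<in> U m" "m \<le> n" "x \<in> {..<m} \<times> A"
  shows "act \<gamma> x \<in> {..<m} \<times> A"
proof -
  have x: "x \<in> {..<n} \<times> A" using assms by (auto simp: mem_Times_iff)
  have "fst (act \<gamma> x) < m"
  proof (rule ccontr)
    assume "\<not> fst (act \<gamma> x) < m"
    moreover have y: "act \<gamma> x \<in> {..<n} \<times> A" using act_closed[OF U_carrier[OF assms(1)] x] .
    ultimately have "fst (act \<gamma> (fst (act \<gamma> x), g0)) = fst (act \<gamma> x)"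
      using assms(1) by (auto simp: U_def mem_Times_iff)
    then have "fst (act \<gamma> x) = fst x"
      using act_colour[OF U_carrier[OF assms(1)] _ x, of "(fst (act \<gamma> x), g0)"] y g0 by (auto simp: mem_Times_iff)
    then show False using \<open>\<not> fst (act \<gamma> x) < m\<close> assms(3) by (auto simp: mem_Times_iff)
  qed
  then show ?thesis using act_closed[OF U_carrier[OF assms(1)] x] by (auto simp: mem_Times_iff)
qed

end

text \<open>By \<open>trans\<close>, words of length \<open>l\<close> are cosets of
  \<open>U (m - l)\<close>. By \<open>cycle\<close>, each face of the base word is carried to the
  shorter base word by an element centralizing \<open>U (m - l)\<close>; this is what makes every
  face map on stabilizers homotopic to the inclusion.\<close>

locale stability = letters +
  assumes trans: "m \<le> n \<Longrightarrow> l \<le> m \<Longrightarrow> w \<in> W m l \<Longrightarrow> \<exists>\<gamma>\<in>U m. map (act \<gamma>) (base m l) = w"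
    and cycle: "m \<le> n \<Longrightarrow> l \<le> m \<Longrightarrow> i < l \<Longrightarrow>
      \<exists>\<tau>\<in>U m. (\<forall>\<gamma>\<in>U (m - l). \<tau> \<otimes> \<gamma> = \<gamma> \<otimes> \<tau>) \<and> map (act \<tau>) (del i (base m l)) = base m (l - 1)"
begin

section \<open>Coinvariant chains of the stabilizers and the horizontal differentials\<close>

definition T :: "nat \<Rightarrow> 'a list set" where
  "T k = tup (carrier \<Gamma>) k"

definition gr :: "nat \<Rightarrow> nat \<Rightarrow> ('a list \<Rightarrow>\<^sub>0 int) set" where
  "gr m k = {frag_of (map (\<lambda>x. \<gamma> \<otimes> x) t) - frag_of t | \<gamma> t. \<gamma> \<in> U m \<and> t \<in> T k}"

definition V :: "nat \<Rightarrow> ('a list \<times> 'c \<Rightarrow>\<^sub>0 int) set" where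
  "V k = frags (T k \<times> Lab)"

text \<open>The kernel of the map from \<open>V k\<close> to the \<open>U m\<close>-coinvariants of
  chains on tuples, tensored with the coefficients. Nonempty tuples run over all of
  \<open>\<Gamma>\<close>, on which \<open>U m\<close> acts freely, so \<open>V\<close> modulo
  \<open>L m\<close> computes the homology of \<open>U m\<close>, and enlarging \<open>m\<close> is
  induced by the identity of \<open>V k\<close>.\<close>

definition L :: "nat \<Rightarrow> nat \<Rightarrow> ('a list \<times> 'c \<Rightarrow>\<^sub>0 int) set" where
  "L m k = rels (gr m k) (T k) Lab Q"

definition D :: "('a list \<times> 'c \<Rightarrow>\<^sub>0 int) \<Rightarrow> ('a list \<times> 'c \<Rightarrow>\<^sub>0 int)" where
  "D = lift bd"

lemma act_words:
  assumes "\<gamma> \<in> U m" "m \<le> n" "w \<in> W m l"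
  shows "map (act \<gamma>) w \<in> W m l"
proof -
  have w: "x \<in> {..<m} \<times> A" if "x \<in> set w" for x using assms(3) that by (auto simp: words_def)
  then have w': "x \<in> {..<n} \<times> A" if "x \<in> set w" for x using assms(2) that by (fastforce simp: mem_Times_iff)
  have "inj_on (\<lambda>x. fst (act \<gamma> x)) (set w)"
    using assms(3) act_colour[OF U_carrier[OF assms(1)] w' w']
    by (auto simp: inj_on_def words_def distinct_map)
  then have "distinct (map fst (map (act \<gamma>) w))"
    using assms(3) by (simp add: words_def distinct_map comp_def)
  moreover have "set (map (act \<gamma>) w) \<subseteq> {..<m} \<times> A"
    using w act_U_colour[OF assms(1,2)] by (simp add: image_subset_iff)
  ultimately show ?thesis using assms(3) by (simp add: words_def)
qed

lemma base_words: "l \<le> m \<Longrightarrow> base m l \<in> W m l"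
  using g0 by (auto simp: base_def words_def comp_def)

lemma set_base: "set (base m l) \<subseteq> {..<m} \<times> A"
  using g0 by (auto simp: base_def)

lemma stab_base:
  assumes "\<gamma> \<in> U m" "m \<le> n" "l \<le> m" "map (act \<gamma>) (base m l) = base m l"
  shows "\<gamma> \<in> U (m - l)"
  unfolding U_def
proof (intro CollectI conjI allI impI)
  fix k assume k: "m - l \<le> k \<and> k < n"
  show "act \<gamma> (k, g0) = (k, g0)"
  proof (cases "k < m")
    case True
    then have "(k, g0) \<in> set (base m l)" using k by (auto simp: base_def)
    moreover have "map (act \<gamma>) (base m l) = map (\<lambda>x. x) (base m l)" using assms(4) by simp
    ultimately show ?thesis by (meson map_eq_conv)
  next
    case False
    then show ?thesis using assms(1) k by (simp add: U_def)
  qed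
qed (use assms(1) in \<open>simp add: U_def\<close>)

lemma act_map_mult:
  assumes "\<gamma> \<in> carrier \<Gamma>" "\<delta> \<in> carrier \<Gamma>" "set w \<subseteq> {..<n} \<times> A"
  shows "map (act (\<gamma> \<otimes> \<delta>)) w = map (act \<gamma>) (map (act \<delta>) w)"
  using assms by (auto simp: act_mult subset_iff)

lemma act_map_inv:
  assumes "\<gamma> \<in> carrier \<Gamma>" "set w \<subseteq> {..<n} \<times> A" "map (act \<gamma>) w = v"
  shows "map (act (inv \<gamma>)) v = w"
proof -
  have "map (act (inv \<gamma> \<otimes> \<gamma>)) w = map (act (inv \<gamma>)) v"
    unfolding assms(3)[symmetric] using assms(1,2) by (intro act_map_mult) auto
  moreover have "map (act \<one>) w = w" using assms(2) act_one by (intro map_idI) auto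
  ultimately show ?thesis using assms(1) by simp
qed

text \<open>The value one outside the range keeps membership in \<open>U m\<close> and commutation
  with \<open>U (m - l)\<close> free of side conditions.\<close>

definition \<tau> :: "nat \<Rightarrow> nat \<Rightarrow> nat \<Rightarrow> 'a" where
  "\<tau> m l i = (if m \<le> n \<and> l \<le> m \<and> i < l then
     SOME t. t \<in> U m \<and> (\<forall>\<gamma>\<in>U (m - l). t \<otimes> \<gamma> = \<gamma> \<otimes> t) \<and> map (act t) (del i (base m l)) = base m (l - 1)
     else \<one>)"

lemma tau_aux:
  assumes "m \<le> n" "l \<le> m" "i < l"
  shows "\<tau> m l i \<in> U m \<and> (\<forall>\<gamma>\<in>U (m - l). \<tau> m l i \<otimes> \<gamma> = \<gamma> \<otimes> \<tau> m l i) \<and>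
    map (act (\<tau> m l i)) (del i (base m l)) = base m (l - 1)"
proof -
  have "\<exists>t. t \<in> U m \<and> (\<forall>\<gamma>\<in>U (m - l). t \<otimes> \<gamma> = \<gamma> \<otimes> t) \<and> map (act t) (del i (base m l)) = base m (l - 1)"
    using cycle[OF assms] by blast
  from someI_ex[OF this] show ?thesis using assms by (simp add: \<tau>_def)
qed

lemma tau_U: "\<tau> m l i \<in> U m"
  using tau_aux[of m l i] subgroup.one_closed[OF U_subgroup, of m]
  by (cases "m \<le> n \<and> l \<le> m \<and> i < l") (auto simp: \<tau>_def)

lemma tau_carrier [simp]: "\<tau> m l i \<in> carrier \<Gamma>"
  using tau_U U_carrier by blast

lemma tau_commute: "\<gamma> \<in> U (m - l) \<Longrightarrow> \<tau> m l i \<otimes> \<gamma> = \<gamma> \<otimes> \<tau> m l i"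
  using tau_aux[of m l i] U_carrier
  by (cases "m \<le> n \<and> l \<le> m \<and> i < l") (auto simp: \<tau>_def)

lemma tau_base: "m \<le> n \<Longrightarrow> l \<le> m \<Longrightarrow> i < l \<Longrightarrow> map (act (inv \<tau> m l i)) (base m (l - 1)) = del i (base m l)"
proof (rule act_map_inv)
  assume a: "m \<le> n" "l \<le> m" "i < l"
  show "map (act (\<tau> m l i)) (del i (base m l)) = base m (l - 1)" using tau_aux[OF a] by blast
  have "set (del i (base m l)) \<subseteq> set (base m l)" by (auto simp: del_def dest: in_set_takeD in_set_dropD)
  then show "set (del i (base m l)) \<subseteq> {..<n} \<times> A" using set_base[of m l] a by fastforce
qed simp

lemma V_sub: "subgrp (V k)" and L_sub: "subgrp (L m k)"
  by (simp_all add: V_def L_def subgrp_frags subgrp_rels)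

lemma L_mono: "m \<le> m' \<Longrightarrow> x \<in> L m k \<Longrightarrow> x \<in> L m' k"
proof -
  assume "m \<le> m'" "x \<in> L m k"
  moreover from \<open>m \<le> m'\<close> have "gr m k \<subseteq> gr m' k" using U_mono by (fastforce simp: gr_def)
  ultimately show ?thesis using rels_mono[OF spn_mono] unfolding L_def by blast
qed

text \<open>Only the empty tuple has length zero, and every translation fixes it. The low-degree
  cases of the induction rest on this equality.\<close>

lemma L_zero_level: "L m 0 = L m' 0"
proof -
  have "gr m 0 = {0}" for m
    using subgroup.one_closed[OF U_subgroup, of m] by (auto simp: gr_def T_def tup_def)
  then show ?thesis by (simp add: L_def)
qed

lemma additive_D: "additive D"
  unfolding D_def by (rule additive_lift)

lemma D_V: "x \<in> V k \<Longrightarrow> D x \<in> V (k - 1)"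
  unfolding V_def D_def
proof (rule lift_frags)
  fix t assume "t \<in> T k"
  then show "bd (frag_of t) \<in> frags (T (k - 1))"
    by (cases k) (auto simp: T_def bd_list_Nil bd_list_frags subgrp_zero[OF subgrp_frags])
qed

lemma D_V0: "x \<in> V 0 \<Longrightarrow> D x = 0"
  unfolding V_def D_def
  using lift_cong[of "T 0" bd "\<lambda>x. 0" x Lab] by (simp add: T_def bd_list_Nil lift_zero)

lemma D_D: "D (D x) = 0"
  unfolding D_def by (simp add: lift_compose[OF additive_bd] bd_bd lift_zero)

lemma lact_gr_spn:
  assumes "additive F" "\<And>\<gamma> t. \<gamma> \<in> U m \<Longrightarrow> t \<in> T k \<Longrightarrow> F (lact (\<lambda>x. \<gamma> \<otimes> x) (frag_of t)) = lact (\<lambda>x. \<gamma> \<otimes> x) (F (frag_of t))"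
    "\<And>t. t \<in> T k \<Longrightarrow> F (frag_of t) \<in> frags (T j)" "r \<in> gr m k"
  shows "F r \<in> spn (gr m j)"
proof -
  obtain \<gamma> t where r: "r = frag_of (map (\<lambda>x. \<gamma> \<otimes> x) t) - frag_of t" "\<gamma> \<in> U m" "t \<in> T k"
    using assms(4) by (auto simp: gr_def)
  have "F r = lact (\<lambda>x. \<gamma> \<otimes> x) (F (frag_of t)) - F (frag_of t)"
    using assms(2)[OF r(2,3)] by (simp add: r(1) additive_diff[OF assms(1)])
  also have "\<dots> \<in> spn (gr m j)"
    by (rule additive_cong_frags[OF additive_lact additive_id subgrp_spn assms(3)[OF r(3)]])
       (use r(2) in \<open>auto simp: gr_def intro!: spn_base\<close>)
  finally show ?thesis .
qed

lemma D_L: "x \<in> L m k \<Longrightarrow> D x \<in> L m (k - 1)"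
  unfolding L_def D_def
proof (erule lift_rels[OF additive_bd, rotated 2])
  show t: "bd (frag_of t) \<in> frags (T (k - 1))" if "t \<in> T k" for t
    using that by (cases k) (auto simp: T_def bd_list_Nil bd_list_frags subgrp_zero[OF subgrp_frags])
  show "bd r \<in> spn (gr m (k - 1))" if "r \<in> gr m k" for r
    by (rule lact_gr_spn[OF additive_bd bd_lact t that])
qed

text \<open>The horizontal differential of the double complex. Column \<open>l\<close> is
  \<open>V\<close> modulo \<open>L (m - l)\<close>, and deleting letter \<open>i\<close> of the base
  word becomes left translation by \<open>\<tau> m l i\<close> into column
  \<open>l - 1\<close>.\<close>

definition \<theta> :: "nat \<Rightarrow> nat \<Rightarrow> ('a list \<Rightarrow>\<^sub>0 int) \<Rightarrow> ('a list \<Rightarrow>\<^sub>0 int)" where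
  "\<theta> m l x = (\<Sum>i<l. frag_cmul ((- 1) ^ i) (lact (\<lambda>a. \<tau> m l i \<otimes> a) x))"

definition hp :: "nat \<Rightarrow> nat \<Rightarrow> ('a list \<Rightarrow>\<^sub>0 int) \<Rightarrow> ('a list \<Rightarrow>\<^sub>0 int)" where
  "hp m l x = (\<Sum>i<l. frag_cmul ((- 1) ^ i) (prism (\<lambda>a. \<tau> m l i \<otimes> a) x))"

definition Th :: "nat \<Rightarrow> nat \<Rightarrow> ('a list \<times> 'c \<Rightarrow>\<^sub>0 int) \<Rightarrow> ('a list \<times> 'c \<Rightarrow>\<^sub>0 int)" where
  "Th m l = lift (\<theta> m l)"

definition Hp :: "nat \<Rightarrow> nat \<Rightarrow> ('a list \<times> 'c \<Rightarrow>\<^sub>0 int) \<Rightarrow> ('a list \<times> 'c \<Rightarrow>\<^sub>0 int)" where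
  "Hp m l = lift (hp m l)"

lemma additive_theta: "additive (\<theta> m l)" and additive_hp: "additive (hp m l)"
  unfolding \<theta>_def hp_def
  by (intro additive_sum_fun additive_compose[OF additive_frag_cmul] additive_lact additive_prism)+

lemma additive_Th: "additive (Th m l)" and additive_Hp: "additive (Hp m l)"
  by (simp_all add: Th_def Hp_def additive_lift)

lemma lact_T: "\<gamma> \<in> carrier \<Gamma> \<Longrightarrow> t \<in> T k \<Longrightarrow> map (\<lambda>x. \<gamma> \<otimes> x) t \<in> T k"
  by (auto simp: T_def tup_def)

lemma theta_T: "t \<in> T k \<Longrightarrow> \<theta> m l (frag_of t) \<in> frags (T k)"
  unfolding \<theta>_def by (intro subgrp_sum[OF subgrp_frags] subgrp_cmul[OF subgrp_frags]) (simp add: lact_T)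

lemma hp_T: "t \<in> T k \<Longrightarrow> hp m l (frag_of t) \<in> frags (T (Suc k))"
  unfolding hp_def T_def
  by (intro subgrp_sum[OF subgrp_frags] subgrp_cmul[OF subgrp_frags]) (auto intro: prism_list_frags)

lemma Th_V: "x \<in> V k \<Longrightarrow> Th m l x \<in> V k" and Hp_V: "x \<in> V k \<Longrightarrow> Hp m l x \<in> V (Suc k)"
  unfolding V_def Th_def Hp_def by (rule lift_frags; simp add: theta_T hp_T)+

lemma lact_cmul: "lact g (frag_cmul c x) = frag_cmul c (lact g x)"
  by (simp add: lact_def frag_extend_cmul)

lemma bd_cmul: "bd (frag_cmul c x) = frag_cmul c (bd x)"
  by (simp add: bd_def frag_extend_cmul)

lemma bd_theta: "bd (\<theta> m l x) = \<theta> m l (bd x)"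
  by (simp add: \<theta>_def additive_sum[OF additive_bd] bd_cmul bd_lact)

lemma D_Th: "D (Th m l x) = Th m l (D x)"
  by (simp add: D_def Th_def lift_compose additive_bd additive_theta bd_theta)

lemma comm_map:
  assumes "\<gamma> \<in> U (m - l)" "t \<in> T k"
  shows "map (\<lambda>a. \<tau> m l i \<otimes> a) (map (\<lambda>x. \<gamma> \<otimes> x) t) = map (\<lambda>x. \<gamma> \<otimes> x) (map (\<lambda>a. \<tau> m l i \<otimes> a) t)"
  using assms U_carrier[OF assms(1)] by (auto simp: T_def tup_def subset_iff tau_commute simp flip: \<Gamma>.m_assoc)

text \<open>The translations commute with \<open>U (m - l)\<close>, so even the relations of the
  source column are preserved; they are contained in those of column \<open>l - 1\<close>.\<close>

lemma Th_L: "x \<in> L (m - l) k \<Longrightarrow> Th m l x \<in> L (m - l) k"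
  unfolding L_def Th_def
proof (erule lift_rels[OF additive_theta theta_T, rotated 2])
  show "\<theta> m l r \<in> spn (gr (m - l) k)" if "r \<in> gr (m - l) k" for r
  proof (rule lact_gr_spn[OF additive_theta _ theta_T that])
    fix \<gamma> t assume "\<gamma> \<in> U (m - l)" "t \<in> T k"
    from comm_map[OF this] show "\<theta> m l (lact (\<lambda>x. \<gamma> \<otimes> x) (frag_of t)) = lact (\<lambda>x. \<gamma> \<otimes> x) (\<theta> m l (frag_of t))"
      by (simp add: \<theta>_def additive_sum[OF additive_lact] lact_cmul del: map_map map_eq_conv)
  qed
qed

lemma Hp_L: "x \<in> L (m - l) k \<Longrightarrow> Hp m l x \<in> L (m - l) (Suc k)"
  unfolding L_def Hp_def
proof (erule lift_rels[OF additive_hp hp_T, rotated 2])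
  show "hp m l r \<in> spn (gr (m - l) (Suc k))" if "r \<in> gr (m - l) k" for r
  proof (rule lact_gr_spn[OF additive_hp _ hp_T that])
    fix \<gamma> t assume a: "\<gamma> \<in> U (m - l)" "t \<in> T k"
    have "lact (\<lambda>x. \<gamma> \<otimes> x) (prism_list (\<lambda>a. \<tau> m l i \<otimes> a) t) = prism_list (\<lambda>a. \<tau> m l i \<otimes> a) (map (\<lambda>x. \<gamma> \<otimes> x) t)" for i
      using a U_carrier[OF a(1)]
      by (intro lact_prism_list) (auto simp: T_def tup_def subset_iff tau_commute simp flip: \<Gamma>.m_assoc)
    then show "hp m l (lact (\<lambda>x. \<gamma> \<otimes> x) (frag_of t)) = lact (\<lambda>x. \<gamma> \<otimes> x) (hp m l (frag_of t))"
      by (simp add: hp_def additive_sum[OF additive_lact] lact_cmul)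
  qed
qed

lemma alternating_sum: "(\<Sum>i<l. frag_cmul ((- 1) ^ i) x) = (if odd l then x else 0)"
  by (induction l) (auto simp: uminus_poly_mapping_def[symmetric])

text \<open>Each translation is homotopic to the identity through its prism, so only an alternating
  sum of \<open>l\<close> identities remains: one for odd \<open>l\<close>, none for even
  \<open>l\<close>. On representatives the identity is the stabilization map.\<close>

lemma theta_homotopy: "bd (hp m l x) + hp m l (bd x) = \<theta> m l x - (if odd l then x else 0)"
proof -
  have "bd (hp m l x) + hp m l (bd x) =
      (\<Sum>i<l. frag_cmul ((- 1) ^ i) (bd (prism (\<lambda>a. \<tau> m l i \<otimes> a) x) + prism (\<lambda>a. \<tau> m l i \<otimes> a) (bd x)))"
    by (simp add: hp_def additive_sum[OF additive_bd] bd_cmul frag_cmul_distrib2 sum.distrib)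
  also have "\<dots> = \<theta> m l x - (\<Sum>i<l. frag_cmul ((- 1) ^ i) x)"
    by (simp add: bd_prism \<theta>_def additive_diff[OF additive_frag_cmul] sum_subtractf)
  finally show ?thesis by (simp add: alternating_sum)
qed

lemma Th_homotopy: "Th m l x = (if odd l then x else 0) + D (Hp m l x) + Hp m l (D x)"
proof -
  have "lift (\<lambda>y. (if odd l then y else 0) + (bd (hp m l y) + hp m l (bd y))) x
      = lift (\<lambda>y. if odd l then y else 0) x + (D (Hp m l x) + Hp m l (D x))"
    by (simp add: lift_plus D_def Hp_def lift_compose additive_bd additive_hp)
  then show ?thesis by (simp add: theta_homotopy Th_def lift_id lift_zero)
qed

lemma Th_V0: "x \<in> V 0 \<Longrightarrow> Th m l x = (if odd l then x else 0)"
proof -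
  assume "x \<in> V 0"
  have "\<theta> m l (frag_of t) = (if odd l then frag_of t else 0)" if "t \<in> T 0" for t
    using that by (simp add: \<theta>_def T_def tup_def alternating_sum)
  then have "Th m l x = lift (\<lambda>y. if odd l then y else 0) x"
    unfolding Th_def using \<open>x \<in> V 0\<close> unfolding V_def by (rule lift_cong)
  then show ?thesis by (simp add: lift_id lift_zero)
qed

text \<open>Modulo the relations of \<open>U m\<close>, translation by an element of
  \<open>U m\<close> is the identity on the nose and not just up to homotopy. This is used for
  column 0.\<close>

lemma theta_mod:
  assumes "t \<in> T k"
  shows "\<theta> m l (frag_of t) - (if odd l then frag_of t else 0) \<in> spn (gr m k)"
proof -
  have "\<theta> m l (frag_of t) - (\<Sum>i<l. frag_cmul ((- 1) ^ i) (frag_of t)) =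
      (\<Sum>i<l. frag_cmul ((- 1) ^ i) (lact (\<lambda>a. \<tau> m l i \<otimes> a) (frag_of t) - frag_of t))"
    by (simp add: \<theta>_def additive_diff[OF additive_frag_cmul] sum_subtractf)
  also have "\<dots> \<in> spn (gr m k)"
    by (intro subgrp_sum[OF subgrp_spn] subgrp_cmul[OF subgrp_spn] spn_base)
       (use assms tau_U[of m l] in \<open>fastforce simp: gr_def\<close>)
  finally show ?thesis by (simp add: alternating_sum)
qed

lemma Th_mod: "x \<in> V k \<Longrightarrow> Th m l x - (if odd l then x else 0) \<in> L m k"
proof -
  assume x: "x \<in> V k"
  have "lift (\<lambda>y. \<theta> m l y - (if odd l then y else 0)) x \<in> L m k"
    unfolding L_def using theta_mod x unfolding V_def by (rule lift_into_rels)
  then show ?thesis by (cases "odd l") (simp_all add: lift_minus Th_def lift_id lift_zero)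
qed

text \<open>For nonempty tuples the first entry yields an equivariant map to \<open>U m\<close>,
  which trivializes the action. Through it \<open>phi\<close> and \<open>sig\<close> compare the
  coinvariants of the stabilizer with chains on pairs of a word and a tuple, and turn the horizontal
  differential into the boundary of words. The contraction of injective words then gives exactness
  of the row as long as one more letter fits.\<close>

lemma rows:
  assumes m: "m \<le> n"
  shows row_exact_pos: "\<And>l k x. 1 \<le> l \<Longrightarrow> 1 \<le> k \<Longrightarrow> l + 1 \<le> m \<Longrightarrow> x \<in> V k \<Longrightarrow> Th m l x \<in> L (m - (l - 1)) k \<Longrightarrow>
      \<exists>y\<in>V k. x - Th m (l + 1) y \<in> L (m - l) k"
    and ThTh_pos: "\<And>l k x. 1 \<le> l \<Longrightarrow> 1 \<le> k \<Longrightarrow> l + 1 \<le> m \<Longrightarrow> x \<in> V k \<Longrightarrow>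
      Th m l (Th m (l + 1) x) \<in> L (m - (l - 1)) k"
proof -
  obtain r where r: "\<And>x. x \<in> carrier \<Gamma> \<Longrightarrow> r x \<in> U m"
    "\<And>\<gamma> x. \<gamma> \<in> U m \<Longrightarrow> x \<in> carrier \<Gamma> \<Longrightarrow> r (\<gamma> \<otimes> x) = \<gamma> \<otimes> r x"
    using \<Gamma>.equivariant_retraction[OF U_subgroup] by blast
  obtain h where h: "\<And>l w. l < m \<Longrightarrow> w \<in> W m l \<Longrightarrow> h l w \<in> frags (W m (Suc l))"
    "\<And>l w. l < m \<Longrightarrow> w \<in> W m l \<Longrightarrow> bd (h l w) + frag_extend (h (l - 1)) (bd_list w) = frag_of w"
    using words_contraction[OF finite_lessThan g0, of m] by auto
  \<comment> \<open>Stated through the inverse, \<open>g l w\<close> carries \<open>w\<close> to the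
    base word, just as \<open>r (hd t)\<close> does with the word recorded by
    \<open>phi l\<close>.\<close>
  define g where "g l w = (SOME \<gamma>. \<gamma> \<in> U m \<and> map (act (inv \<gamma>)) (base m l) = w)" for l w
  have g: "g l w \<in> U m" "map (act (inv (g l w))) (base m l) = w" if lw: "l \<le> m" "w \<in> W m l" for l w
  proof -
    obtain \<gamma> where "\<gamma> \<in> U m" "map (act \<gamma>) (base m l) = w" using trans[OF m lw] by blast
    then have "inv \<gamma> \<in> U m \<and> map (act (inv (inv \<gamma>))) (base m l) = w"
      using subgroup.m_inv_closed[OF U_subgroup] U_carrier by simp
    from someI[of "\<lambda>\<gamma>. \<gamma> \<in> U m \<and> map (act (inv \<gamma>)) (base m l) = w", OF this]
    show "g l w \<in> U m" "map (act (inv (g l w))) (base m l) = w" by (simp_all add: g_def)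
  qed
  have bn: "set (base m l) \<subseteq> {..<n} \<times> A" for l using set_base[of m l] m by fastforce
  \<comment> \<open>The tuple is translated so that its first entry retracts to one; the word
    records the translation up to the stabilizer of the base word.\<close>
  define phi where "phi l = frag_extend (\<lambda>t. frag_of (map (act (inv (r (hd t)))) (base m l), map (\<lambda>x. inv (r (hd t)) \<otimes> x) t))" for l
  define sig where "sig l = frag_extend (\<lambda>(w, u). frag_of (map (\<lambda>x. g l w \<otimes> x) u))" for l
  have aphi: "additive (phi l)" and asig: "additive (sig l)" for l
    by (simp_all add: phi_def sig_def additive_frag_extend)
  have phi_of: "phi l (frag_of t) = frag_of (map (act (inv (r (hd t)))) (base m l), map (\<lambda>x. inv (r (hd t)) \<otimes> x) t)" for l t
    by (simp add: phi_def)
  have sig_of: "sig l (frag_of (w, u)) = frag_of (map (\<lambda>x. g l w \<otimes> x) u)" for l w u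
    by (simp add: sig_def)
  have Tm: "map (\<lambda>x. a \<otimes> x) (map (\<lambda>x. b \<otimes> x) t) = map (\<lambda>x. (a \<otimes> b) \<otimes> x) t"
    if "a \<in> carrier \<Gamma>" "b \<in> carrier \<Gamma>" "t \<in> T k" for a b t k
    using that by (auto simp: T_def tup_def subset_iff \<Gamma>.m_assoc)
  have hdT: "hd t \<in> carrier \<Gamma>" if "t \<in> T k" "1 \<le> k" for t k
    using that by (cases t) (auto simp: T_def tup_def)
  have rU: "r (hd t) \<in> U m" "inv (r (hd t)) \<in> U m" "r (hd t) \<in> carrier \<Gamma>" if "t \<in> T k" "1 \<le> k" for t k
    using r(1)[OF hdT[OF that]] subgroup.m_inv_closed[OF U_subgroup] U_carrier by auto
  have phi_in: "phi l (frag_of t) \<in> frags (W m l \<times> T k)" if "t \<in> T k" "1 \<le> k" "l \<le> m" for l t k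
    using act_words[OF rU(2)[OF that(1,2)] m base_words[OF that(3)]] lact_T[OF _ that(1)] rU[OF that(1,2)]
    by (simp add: phi_of)
  have sig_in: "sig l (frag_of s) \<in> frags (T k)" if "s \<in> W m l \<times> T k" "l \<le> m" for l s k
    using that g(1)[of l "fst s"] U_carrier by (cases s) (auto simp: sig_of intro!: lact_T)
  \<comment> \<open>two elements moving the base word to the same word differ by its stabilizer\<close>
  have diff: "frag_of (map (\<lambda>x. a \<otimes> x) u) - frag_of (map (\<lambda>x. b \<otimes> x) u) \<in> spn (gr (m - l) k)"
    if "a \<in> U m" "b \<in> U m" "l \<le> m" "map (act (inv a)) (base m l) = map (act (inv b)) (base m l)" "u \<in> T k" for a b l u k
  proof -
    have c: "a \<in> carrier \<Gamma>" "b \<in> carrier \<Gamma>" using that U_carrier by auto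
    have "map (act (a \<otimes> inv b)) (base m l) = map (act a) (map (act (inv b)) (base m l))"
      using c bn by (intro act_map_mult) auto
    also have "\<dots> = map (act a) (map (act (inv a)) (base m l))" using that(4) by metis
    also have "\<dots> = map (act (a \<otimes> inv a)) (base m l)"
      using c bn by (intro act_map_mult[symmetric]) auto
    also have "\<dots> = base m l" using c bn[of l] act_one by (intro map_idI) auto
    finally have "a \<otimes> inv b \<in> U (m - l)"
      using that subgroup.m_inv_closed[OF U_subgroup] subgroup.m_closed[OF U_subgroup]
      by (intro stab_base[OF _ m]) auto
    moreover have eq: "map (\<lambda>x. a \<otimes> x) u = map (\<lambda>x. (a \<otimes> inv b) \<otimes> x) (map (\<lambda>x. b \<otimes> x) u)"
      using c Tm[OF _ _ that(5), of "a \<otimes> inv b" b] by (simp add: \<Gamma>.m_assoc)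
    ultimately show ?thesis
      unfolding eq gr_def using lact_T[OF c(2) that(5)] by (intro spn_base) blast
  qed
  \<comment> \<open>By \<open>diff\<close>, \<open>sig\<close> undoes \<open>phi\<close> up to an
    element of the stabilizer.\<close>
  have sigphi: "sig l (phi l (frag_of t)) - frag_of t \<in> spn (gr (m - l) k)" if "t \<in> T k" "1 \<le> k" "l \<le> m" for l t k
  proof -
    let ?b = "r (hd t)"
    have b: "?b \<in> U m" "inv ?b \<in> U m" "?b \<in> carrier \<Gamma>" using rU[OF that(1,2)] by auto
    let ?w = "map (act (inv ?b)) (base m l)"
    have w: "?w \<in> W m l" using act_words[OF b(2) m base_words[OF that(3)]] .
    have "map (\<lambda>x. ?b \<otimes> x) (map (\<lambda>x. inv ?b \<otimes> x) t) = t"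
      using b Tm[OF _ _ that(1), of ?b "inv ?b"] that(1) by (auto simp: T_def tup_def subset_iff intro!: map_idI)
    then show ?thesis
      using diff[OF g(1)[OF that(3) w] b(1) that(3) g(2)[OF that(3) w] lact_T[OF _ that(1), of "inv ?b"]] b
      by (simp add: phi_of sig_of del: map_map)
  qed
  \<comment> \<open>Translation by \<open>\<tau> m l i\<close> multiplies the retracted element by
    \<open>\<tau> m l i\<close>, so the word becomes its \<open>i\<close>-th face while the
    normalized tuple is unchanged.\<close>
  have phi_theta: "phi (l - 1) (\<theta> m l (frag_of t)) = lift bd (phi l (frag_of t))" if "t \<in> T k" "1 \<le> k" "l \<le> m" for l t k
  proof -
    let ?b = "r (hd t)"
    have b: "?b \<in> U m" "inv ?b \<in> U m" "?b \<in> carrier \<Gamma>" using rU[OF that(1,2)] by auto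
    have t0: "t \<noteq> []" using that by (auto simp: T_def tup_def)
    have c: "phi (l - 1) (frag_cmul n x) = frag_cmul n (phi (l - 1) x)" for n x
      by (simp add: phi_def frag_extend_cmul)
    have e: "phi (l - 1) (frag_of (map (\<lambda>a. \<tau> m l i \<otimes> a) t)) =
        frag_of (del i (map (act (inv ?b)) (base m l)), map (\<lambda>x. inv ?b \<otimes> x) t)" if i: "i < l" for i
    proof -
      have hd: "hd (map (\<lambda>a. \<tau> m l i \<otimes> a) t) = \<tau> m l i \<otimes> hd t" using t0 by (simp add: hd_map)
      have inv: "inv (\<tau> m l i \<otimes> ?b) = inv ?b \<otimes> inv (\<tau> m l i)" using b by (simp add: \<Gamma>.inv_mult_group)
      have "map (act (inv ?b \<otimes> inv (\<tau> m l i))) (base m (l - 1)) = map (act (inv ?b)) (map (act (inv (\<tau> m l i))) (base m (l - 1)))"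
        using b bn by (intro act_map_mult) auto
      also have "\<dots> = del i (map (act (inv ?b)) (base m l))"
        by (simp only: tau_base[OF m \<open>l \<le> m\<close> i]) (simp add: del_def take_map drop_map)
      finally have 1: "map (act (inv ?b \<otimes> inv (\<tau> m l i))) (base m (l - 1)) = del i (map (act (inv ?b)) (base m l))" .
      have "map (\<lambda>x. (inv ?b \<otimes> inv (\<tau> m l i)) \<otimes> x) (map (\<lambda>a. \<tau> m l i \<otimes> a) t) =
          map (\<lambda>x. ((inv ?b \<otimes> inv (\<tau> m l i)) \<otimes> \<tau> m l i) \<otimes> x) t"
        using b by (intro Tm[OF _ _ \<open>t \<in> T k\<close>]) auto
      also have "(inv ?b \<otimes> inv (\<tau> m l i)) \<otimes> \<tau> m l i = inv ?b" using b by (simp add: \<Gamma>.m_assoc)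
      finally show ?thesis
        unfolding phi_of hd r(2)[OF tau_U hdT[OF \<open>t \<in> T k\<close> \<open>1 \<le> k\<close>]] inv 1 by (simp only:)
    qed
    have lb: "length (base m l) = l" using that by (simp add: base_def)
    have "phi (l - 1) (\<theta> m l (frag_of t)) =
        (\<Sum>i<l. frag_cmul ((- 1) ^ i) (phi (l - 1) (frag_of (map (\<lambda>a. \<tau> m l i \<otimes> a) t))))"
      by (simp only: \<theta>_def additive_sum[OF aphi] c lact_of)
    also have "\<dots> = (\<Sum>i<l. frag_cmul ((- 1) ^ i)
        (frag_of (del i (map (act (inv ?b)) (base m l)), map (\<lambda>x. inv ?b \<otimes> x) t)))"
      by (intro sum.cong refl) (simp only: e lessThan_iff)
    also have "\<dots> = lift bd (phi l (frag_of t))"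
      by (simp add: phi_of bd_list_sum lb tens_def additive_sum[OF additive_frag_extend] frag_extend_cmul)
    finally show ?thesis .
  qed
  \<comment> \<open>In this direction the identity holds only modulo the stabilizer, since
    \<open>g\<close> is chosen independently for a word and for its faces.\<close>
  have theta_sig: "\<theta> m (l + 1) (sig (l + 1) (frag_of s)) - sig l (lift bd (frag_of s)) \<in> spn (gr (m - l) k)"
    if s0: "s \<in> W m (l + 1) \<times> T k" and "l + 1 \<le> m" for l s k
  proof -
    obtain w u where s: "s = (w, u)" "w \<in> W m (l + 1)" "u \<in> T k" using s0 by auto
    note gw = g[OF \<open>l + 1 \<le> m\<close> s(2)]
    have lw: "length w = l + 1" using s by (simp add: words_def)
    have c: "sig l (frag_cmul n x) = frag_cmul n (sig l x)" for n x
      by (simp add: sig_def frag_extend_cmul)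
    have "\<theta> m (l + 1) (sig (l + 1) (frag_of s)) - sig l (lift bd (frag_of s)) =
      (\<Sum>i<l + 1. frag_cmul ((- 1) ^ i) (frag_of (map (\<lambda>a. \<tau> m (l + 1) i \<otimes> a) (map (\<lambda>x. g (l + 1) w \<otimes> x) u))
          - frag_of (map (\<lambda>x. g l (del i w) \<otimes> x) u)))"
      by (simp add: s(1) sig_of \<theta>_def bd_list_sum lw additive_sum[OF additive_frag_extend] additive_sum[OF asig]
          tens_def frag_extend_cmul c additive_diff[OF additive_frag_cmul] sum_subtractf del: sum.lessThan_Suc map_map)
    also have "\<dots> \<in> spn (gr (m - l) k)"
    proof (intro subgrp_sum[OF subgrp_spn] subgrp_cmul[OF subgrp_spn])
      fix i assume "i \<in> {..<l + 1}"
      then have i: "i < l + 1" by simp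
      let ?t = "\<tau> m (l + 1) i" and ?g = "g (l + 1) w"
      have dw: "del i w \<in> W m l" using del_in_words[OF s(2) i] by simp
      have gc: "?g \<in> carrier \<Gamma>" using gw U_carrier by blast
      have "map (act (inv (?t \<otimes> ?g))) (base m l) = map (act (inv ?g \<otimes> inv ?t)) (base m l)"
        using gc by (simp add: \<Gamma>.inv_mult_group)
      also have "\<dots> = map (act (inv ?g)) (map (act (inv ?t)) (base m l))"
        using gc bn by (intro act_map_mult) auto
      also have "\<dots> = del i (map (act (inv ?g)) (base m (l + 1)))"
        using tau_base[OF m that(2) i] by (simp del: map_map) (simp add: del_def take_map drop_map)
      also have "\<dots> = del i w" using gw by simp
      finally have eq: "map (act (inv (?t \<otimes> ?g))) (base m l) = map (act (inv (g l (del i w)))) (base m l)"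
        using g(2)[OF _ dw] that by simp
      have "frag_of (map (\<lambda>x. (?t \<otimes> ?g) \<otimes> x) u) - frag_of (map (\<lambda>x. g l (del i w) \<otimes> x) u) \<in> spn (gr (m - l) k)"
        by (rule diff[OF subgroup.m_closed[OF U_subgroup tau_U gw(1)] g(1)[OF _ dw] _ eq s(3)])
           (use \<open>l + 1 \<le> m\<close> in simp_all)
      then show "frag_of (map (\<lambda>a. ?t \<otimes> a) (map (\<lambda>x. ?g \<otimes> x) u)) - frag_of (map (\<lambda>x. g l (del i w) \<otimes> x) u)
          \<in> spn (gr (m - l) k)"
        using Tm[OF tau_carrier gc s(3), of m "l + 1" i] by (simp del: map_map)
    qed
    finally show ?thesis .
  qed
  \<comment> \<open>A translation by the stabilizer is absorbed by the normalization and does not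
    change the word, so \<open>phi\<close> vanishes exactly on the translation relations.\<close>
  have phi_gr: "phi l x \<in> spn {}" if x0: "x \<in> gr (m - l) k" and lk: "1 \<le> k" "l \<le> m" for l x k
  proof -
    obtain \<gamma> t where x: "x = frag_of (map (\<lambda>x. \<gamma> \<otimes> x) t) - frag_of t" "\<gamma> \<in> U (m - l)" "t \<in> T k"
      using x0 by (auto simp: gr_def)
    have gm: "\<gamma> \<in> U m" using U_mono[of "m - l" m] x by auto
    let ?b = "r (hd t)"
    have b: "?b \<in> U m" "?b \<in> carrier \<Gamma>" "\<gamma> \<in> carrier \<Gamma>" using rU[OF x(3) lk(1)] gm U_carrier by auto
    have t0: "t \<noteq> []" using that x by (auto simp: T_def tup_def)
    have hd: "hd (map (\<lambda>a. \<gamma> \<otimes> a) t) = \<gamma> \<otimes> hd t" using t0 by (simp add: hd_map)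
    have inv: "inv (\<gamma> \<otimes> ?b) = inv ?b \<otimes> inv \<gamma>" using b by (simp add: \<Gamma>.inv_mult_group)
    have "map (act \<gamma>) (base m l) = base m l"
      using x(2) lk(2) m by (auto simp: base_def U_def)
    then have ib: "map (act (inv \<gamma>)) (base m l) = base m l" using act_map_inv[OF b(3) bn] by blast
    have "map (act (inv ?b \<otimes> inv \<gamma>)) (base m l) = map (act (inv ?b)) (map (act (inv \<gamma>)) (base m l))"
      using b bn by (intro act_map_mult) auto
    then have 1: "map (act (inv ?b \<otimes> inv \<gamma>)) (base m l) = map (act (inv ?b)) (base m l)" using ib by metis
    have "map (\<lambda>x. (inv ?b \<otimes> inv \<gamma>) \<otimes> x) (map (\<lambda>a. \<gamma> \<otimes> a) t) = map (\<lambda>x. ((inv ?b \<otimes> inv \<gamma>) \<otimes> \<gamma>) \<otimes> x) t"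
      using b by (intro Tm[OF _ _ x(3)]) auto
    also have "(inv ?b \<otimes> inv \<gamma>) \<otimes> \<gamma> = inv ?b" using b by (simp add: \<Gamma>.m_assoc)
    finally have "phi l (frag_of (map (\<lambda>x. \<gamma> \<otimes> x) t)) = phi l (frag_of t)"
      unfolding phi_of hd r(2)[OF gm hdT[OF x(3) lk(1)]] inv 1 by (simp only:)
    then show ?thesis by (simp add: x(1) additive_diff[OF aphi] spn.zero)
  qed

  show "Th m l (Th m (l + 1) x) \<in> L (m - (l - 1)) k"
    if a: "1 \<le> l" "1 \<le> k" "l + 1 \<le> m" and x: "x \<in> V k" for l k x
    unfolding Th_def lift_compose[OF additive_theta] L_def
  proof (rule lift_into_rels)
    show "x \<in> frags (T k \<times> Lab)" using x by (simp add: V_def)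
    fix t assume t: "t \<in> T k"
    let ?y = "\<theta> m l (\<theta> m (l + 1) (frag_of t))"
    have phi_theta': "phi (l' - 1) (\<theta> m l' y) = lift bd (phi l' y)" if "y \<in> frags (T k)" "l' \<le> m" for y l'
      by (rule additive_eq_frags[OF additive_compose[OF aphi additive_theta] additive_compose[OF additive_lift aphi] that(1)])
         (use phi_theta[OF _ a(2) that(2)] in auto)
    have theta_in: "\<theta> m l' y \<in> frags (T k)" if "y \<in> frags (T k)" for y l'
      by (rule additive_image_frags[OF additive_theta subgrp_frags _ that]) (rule theta_T)
    \<comment> \<open>Under \<open>phi\<close> the composite is the square of the word boundary, and
      \<open>sig\<close> recovers the original chain modulo relations.\<close>
    have "phi (l - 1) ?y = lift bd (lift bd (phi (l + 1) (frag_of t)))"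
      using phi_theta'[OF theta_in, of "frag_of t" l] phi_theta'[of "frag_of t" "l + 1"] t a by simp
    also have "\<dots> = 0" by (simp add: lift_compose[OF additive_bd] bd_bd lift_zero)
    finally have "phi (l - 1) ?y = 0" .
    moreover have sp: "sig (l - 1) (phi (l - 1) (frag_of s)) - frag_of s \<in> spn (gr (m - (l - 1)) k)" if "s \<in> T k" for s
      by (rule sigphi[OF that a(2)]) (use a in linarith)
    have "sig (l - 1) (phi (l - 1) ?y) - ?y \<in> spn (gr (m - (l - 1)) k)"
      by (rule additive_cong_frags[OF additive_compose[OF asig aphi] additive_id subgrp_spn theta_in[OF theta_in] sp])
         (use t in simp_all)
    ultimately show "?y \<in> spn (gr (m - (l - 1)) k)"
      using subgrp_uminus[OF subgrp_spn, of "- ?y"] by (simp add: additive_zero[OF asig])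
  qed

  show "\<exists>y\<in>V k. x - Th m (l + 1) y \<in> L (m - l) k"
    if a: "1 \<le> l" "1 \<le> k" "l + 1 \<le> m" and x: "x \<in> V k" "Th m l x \<in> L (m - (l - 1)) k" for l k x
  proof -
    \<comment> \<open>On the side of words and tuples only label relations remain, and the row
      condition on \<open>x\<close> makes the word boundary of \<open>X\<close> a combination of
      these.\<close>
    define X where "X = lift (phi l) x"
    have X: "X \<in> frags ((W m l \<times> T k) \<times> Lab)"
      unfolding X_def using x(1) unfolding V_def by (rule lift_frags[rotated]) (use phi_in a in auto)
    define eta where "eta l = frag_extend (h l)" for l
    have aeta: "additive (eta l)" for l by (simp add: eta_def additive_frag_extend)
    have "lift (phi (l - 1)) (Th m l x) = lift (\<lambda>y. phi (l - 1) (\<theta> m l y)) x"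
      by (simp add: Th_def lift_compose[OF aphi])
    also have "\<dots> = lift (\<lambda>y. lift bd (phi l y)) x"
      using x(1) unfolding V_def by (rule lift_cong[rotated]) (use phi_theta a in auto)
    also have "\<dots> = lift (lift bd) X" by (simp add: X_def lift_compose[OF additive_lift])
    finally have "lift (phi (l - 1)) (Th m l x) = lift (lift bd) X" .
    have dX: "lift (lift bd) X \<in> rels {} (W m (l - 1) \<times> T k) Lab Q"
    proof -
      have p1: "phi (l - 1) (frag_of t) \<in> frags (W m (l - 1) \<times> T k)" if "t \<in> T k" for t
        by (rule phi_in[OF that a(2)]) (use a in linarith)
      have p2: "phi (l - 1) z \<in> spn {}" if "z \<in> gr (m - (l - 1)) k" for z
        by (rule phi_gr[OF that a(2)]) (use a in linarith)
      from lift_rels[OF aphi p1 p2 x(2)[unfolded L_def]] show ?thesis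
        using \<open>lift (phi (l - 1)) (Th m l x) = lift (lift bd) X\<close> by simp
    qed
    have e0: "lift (eta (l - 1)) (frag_of s) \<in> frags (W m l \<times> T k)" if "s \<in> W m (l - 1) \<times> T k" for s
      using that h(1)[of "l - 1" "fst s"] a by (cases s) (auto simp: eta_def intro!: tens_frags)
    have edX: "lift (lift (eta (l - 1))) (lift (lift bd) X) \<in> rels {} (W m l \<times> T k) Lab Q"
    proof (rule lift_rels[OF additive_lift])
      show "lift (eta (l - 1)) (frag_of s) \<in> frags (W m l \<times> T k)" if "s \<in> W m (l - 1) \<times> T k" for s
        by (rule e0[OF that])
      show "lift (lift bd) X \<in> rels {} (W m (l - 1) \<times> T k) Lab Q" by (rule dX)
    qed blast
    have e1: "lift (eta l) (frag_of s) \<in> frags (W m (l + 1) \<times> T k)" if "s \<in> W m l \<times> T k" for s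
      using that h(1)[of l "fst s"] a by (cases s) (auto simp: eta_def intro!: tens_frags)
    define Y where "Y = lift (lift (eta l)) X"
    have Y: "Y \<in> frags ((W m (l + 1) \<times> T k) \<times> Lab)"
      unfolding Y_def using e1 X by (rule lift_frags)
    \<comment> \<open>The contraction identity in the word factor; its second term is a combination
      of label relations by \<open>edX\<close>.\<close>
    have split: "X = lift (lift bd) Y + lift (lift (eta (l - 1))) (lift (lift bd) X)"
    proof -
      have "lift (\<lambda>z. lift bd (lift (eta l) z) + lift (eta (l - 1)) (lift bd z)) X = lift (\<lambda>z. z) X"
      proof (rule lift_cong[OF _ X])
        fix s assume "s \<in> W m l \<times> T k"
        then obtain w u where s: "s = (w, u)" "w \<in> W m l" by auto
        have "tens (bd (h l w) + frag_extend (h (l - 1)) (bd_list w)) u = frag_of (w, u)"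
          using h(2)[OF _ s(2)] a by simp
        then show "lift bd (lift (eta l) (frag_of s)) + lift (eta (l - 1)) (lift bd (frag_of s)) = frag_of s"
          by (simp add: s(1) lift_tens[OF additive_bd] lift_tens[OF aeta] additive_add[OF additive_tens]) (simp add: eta_def)
      qed
      then show ?thesis by (simp add: Y_def lift_plus lift_id lift_compose additive_lift)
    qed
    define y where "y = lift (sig (l + 1)) Y"
    have yV: "y \<in> V k" unfolding y_def V_def using Y by (rule lift_frags[rotated]) (rule sig_in, use a in auto)
    have 1: "lift (sig l) X - x \<in> L (m - l) k"
    proof -
      have "lift (\<lambda>z. sig l (phi l z) - z) x \<in> L (m - l) k"
        unfolding L_def using x(1) unfolding V_def by (rule lift_into_rels[rotated]) (use sigphi a in auto)
      then show ?thesis by (simp add: lift_minus lift_id X_def lift_compose[OF asig])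
    qed
    have 2: "Th m (l + 1) y - lift (sig l) (lift (lift bd) Y) \<in> L (m - l) k"
    proof -
      have "lift (\<lambda>z. \<theta> m (l + 1) (sig (l + 1) z) - sig l (lift bd z)) Y \<in> L (m - l) k"
        unfolding L_def using theta_sig[OF _ a(3)] Y by (rule lift_into_rels)
      then show ?thesis by (simp add: lift_minus y_def Th_def lift_compose asig additive_theta)
    qed
    have 3: "lift (sig l) (lift (lift (eta (l - 1))) (lift (lift bd) X)) \<in> L (m - l) k"
    proof -
      have "sig l (frag_of s) \<in> frags (T k)" if "s \<in> W m l \<times> T k" for s
        using that a by (intro sig_in) auto
      from lift_rels[OF asig this _ edX] show ?thesis unfolding L_def by simp
    qed
    have "lift (sig l) X = lift (sig l) (lift (lift bd) Y) + lift (sig l) (lift (lift (eta (l - 1))) (lift (lift bd) X))"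
      using split additive_add[OF additive_lift] by metis
    then have "x - Th m (l + 1) y = lift (sig l) (lift (lift (eta (l - 1))) (lift (lift bd) X))
        - (lift (sig l) X - x) - (Th m (l + 1) y - lift (sig l) (lift (lift bd) Y))" by simp
    also have "\<dots> \<in> L (m - l) k" by (rule subgrp_diff[OF L_sub subgrp_diff[OF L_sub 3 1] 2])
    finally show ?thesis using yV by blast
  qed
qed

end

section \<open>The induction proving homological stability\<close>

context stability
begin

text \<open>In row 0 the differentials are alternately the identity and zero on equal quotients, so
  exactness holds in every column \<open>l >= 1\<close>; the other rows need room for one more
  letter.\<close>

lemma row_exact:
  assumes "m \<le> n" "1 \<le> l" "k = 0 \<or> l + 1 \<le> m" "x \<in> V k" "Th m l x \<in> L (m - (l - 1)) k"
  shows "\<exists>y\<in>V k. x - Th m (l + 1) y \<in> L (m - l) k"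
proof (cases "k = 0")
  case True
  show ?thesis
  proof (cases "odd l")
    case True
    then have "x \<in> L (m - (l - 1)) 0" using assms(4,5) \<open>k = 0\<close> by (simp add: Th_V0)
    then have "x - Th m (l + 1) 0 \<in> L (m - l) k"
      using L_zero_level[of "m - (l - 1)" "m - l"] \<open>k = 0\<close> by (simp add: additive_zero[OF additive_Th])
    then show ?thesis using subgrp_zero[OF V_sub] by blast
  next
    case False
    then have "x - Th m (l + 1) x = 0" using assms(4) \<open>k = 0\<close> by (simp add: Th_V0)
    then show ?thesis using assms(4) subgrp_zero[OF L_sub] by metis
  qed
next
  case False
  then show ?thesis using row_exact_pos[of m l k x] assms by auto
qed

lemma ThTh:
  assumes "m \<le> n" "1 \<le> l" "k = 0 \<or> l + 1 \<le> m" "x \<in> V k"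
  shows "Th m l (Th m (l + 1) x) \<in> L (m - (l - 1)) k"
proof (cases "k = 0")
  case True
  have "Th m (l + 1) x \<in> V 0" using assms True Th_V by blast
  then have "Th m l (Th m (l + 1) x) = 0"
    using assms True by (cases "odd l") (simp_all add: Th_V0 additive_zero[OF additive_Th])
  then show ?thesis by (simp add: subgrp_zero[OF L_sub])
next
  case False
  then show ?thesis using ThTh_pos[of m l k x] assms by auto
qed

text \<open>Together with \<open>inj_at\<close>: surjectivity and injectivity of stabilization from
  \<open>U (m - 1)\<close> to \<open>U m\<close> on augmented homology in degree
  \<open>k - 1\<close>, with classes given by chains that are cycles modulo relations.\<close>

definition surj_at :: "nat \<Rightarrow> nat \<Rightarrow> bool" where
  "surj_at m k \<longleftrightarrow> (\<forall>w\<in>V k. D w \<in> L m (k - 1) \<longrightarrow>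
     (\<exists>w'\<in>V k. \<exists>u\<in>V (Suc k). D w' \<in> L (m - 1) (k - 1) \<and> w - w' - D u \<in> L m k))"

definition inj_at :: "nat \<Rightarrow> nat \<Rightarrow> bool" where
  "inj_at m k \<longleftrightarrow> (\<forall>w\<in>V k. \<forall>u\<in>V (Suc k). D w \<in> L (m - 1) (k - 1) \<longrightarrow> w - D u \<in> L m k \<longrightarrow>
     (\<exists>u'\<in>V (Suc k). w - D u' \<in> L (m - 1) k))"

lemmas ops = additive_diff[OF additive_D] additive_diff[OF additive_Th] additive_diff[OF additive_Hp]
  additive_add[OF additive_D] additive_add[OF additive_Th] additive_add[OF additive_Hp]
  additive_zero[OF additive_D] additive_zero[OF additive_Th] additive_zero[OF additive_Hp]
  additive_uminus[OF additive_D] additive_uminus[OF additive_Th] additive_uminus[OF additive_Hp]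

lemmas Vc = subgrp_diff[OF V_sub] subgrp_add[OF V_sub] subgrp_zero[OF V_sub] subgrp_uminus[OF V_sub]
lemmas Lc = subgrp_diff[OF L_sub] subgrp_add[OF L_sub] subgrp_zero[OF L_sub] subgrp_uminus[OF L_sub]

lemma D_V': "x \<in> V (Suc k) \<Longrightarrow> D x \<in> V k"
  using D_V[of x "Suc k"] by simp

text \<open>The columns \<open>l\<close> and \<open>l + 1\<close> of the double complex, for even \<open>l\<close>, form the cone of a map
  homotopic to stabilization; this and the next lemma are the two halves of the resulting vanishing.\<close>

lemma column_pair:
  assumes m: "m \<le> n" and l: "even l" "2 \<le> l" and k: "1 \<le> k" "2 * k + l \<le> m + 2"
    and inj: "inj_at (m - l) (k - 1)"
    and Z: "\<And>z. 2 \<le> k \<Longrightarrow> z \<in> V (k - 2) \<Longrightarrow> Th m (l + 2) (D z) \<in> L (m - (l + 1)) (k - 2 - 1) \<Longrightarrow>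
      \<exists>u\<in>V (k - 1). \<exists>v\<in>V (k - 2). z - D u - Th m (l + 3) v \<in> L (m - (l + 2)) (k - 2)"
    and x: "x \<in> V k" "Th m l (D x) \<in> L (m - (l - 1)) (k - 1)"
  shows "\<exists>u\<in>V (Suc k). \<exists>v\<in>V k. \<exists>c\<in>V k. x - Th m (l + 1) v - c - D u \<in> L (m - l) k \<and> D c \<in> L (m - l) (k - 1)"
proof -
  obtain j where j: "k = Suc j" using k(1) by (cases k) auto
  have Dx: "D x \<in> V j" using D_V' x j by simp
  have "j = 0 \<or> l + 1 \<le> m" using k j by auto
  from row_exact[OF m _ this Dx] obtain y where y: "y \<in> V j" "D x - Th m (l + 1) y \<in> L (m - l) j"
    using x(2) l j by auto
  \<comment> \<open>The chain \<open>y\<close> need not be a cycle modulo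
    \<open>L (m - (l + 1))\<close>, but its boundary comes from some \<open>z\<close> in column
    \<open>l + 2\<close>, which \<open>Z\<close> writes as a boundary \<open>D u\<close> plus a
    horizontal image. Subtracting the horizontal image of \<open>u\<close> from \<open>y\<close>
    makes it a cycle.\<close>
  have "\<exists>w\<in>V j. D x - Th m (l + 1) w \<in> L (m - l) j \<and> D w \<in> L (m - (l + 1)) (j - 1)"
  proof (cases "j = 0")
    case True
    then have "D y = 0" using y(1) D_V0 by simp
    then show ?thesis using y Lc(3) by auto
  next
    case False
    then obtain i where i: "j = Suc i" by (cases j) auto
    have Dy: "D y \<in> V i" using D_V' y(1) i by simp
    have "- D (D x - Th m (l + 1) y) \<in> L (m - l) i" using Lc(4)[OF D_L[OF y(2)]] i by simp
    then have "Th m (l + 1) (D y) \<in> L (m - l) i" by (simp add: ops D_D D_Th)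
    moreover have "i = 0 \<or> l + 1 + 1 \<le> m" using k j i by auto
    ultimately obtain z where z: "z \<in> V i" "D y - Th m (l + 2) z \<in> L (m - (l + 1)) i"
      using row_exact[OF m _ _ Dy, of "l + 1"] by (auto simp: numeral_2_eq_2)
    have "- D (D y - Th m (l + 2) z) \<in> L (m - (l + 1)) (i - 1)" using Lc(4)[OF D_L[OF z(2)]] by simp
    then have "Th m (l + 2) (D z) \<in> L (m - (l + 1)) (i - 1)" by (simp add: ops D_D D_Th)
    then obtain u v where uv: "u \<in> V j" "v \<in> V i" "z - D u - Th m (l + 3) v \<in> L (m - (l + 2)) i"
      using Z[of z] z(1) i j by auto
    have "Th m (l + 2) (z - D u - Th m (l + 3) v) \<in> L (m - (l + 2)) i" using Th_L uv(3) by blast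
    then have 1: "Th m (l + 2) (z - D u - Th m (l + 3) v) \<in> L (m - (l + 1)) i" using L_mono[of "m - (l + 2)" "m - (l + 1)"] by simp
    have "i = 0 \<or> l + 2 + 1 \<le> m" using k j i l by auto
    then have 2: "Th m (l + 2) (Th m (l + 3) v) \<in> L (m - (l + 1)) i"
      using ThTh[OF m _ _ uv(2), of "l + 2"] by (simp add: numeral_eq_Suc)
    have "j = 0 \<or> l + 1 + 1 \<le> m" using k j i l by auto
    then have 3: "Th m (l + 1) (Th m (l + 2) u) \<in> L (m - l) j"
      using ThTh[OF m _ _ uv(1), of "l + 1"] by (simp add: numeral_eq_Suc)
    let ?w = "y - Th m (l + 2) u"
    have "D ?w = (D y - Th m (l + 2) z) + Th m (l + 2) (z - D u - Th m (l + 3) v) + Th m (l + 2) (Th m (l + 3) v)"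
      by (simp add: ops D_Th)
    also have "\<dots> \<in> L (m - (l + 1)) i" by (rule Lc(2)[OF Lc(2)[OF z(2) 1] 2])
    finally have "D ?w \<in> L (m - (l + 1)) i" .
    moreover have "D x - Th m (l + 1) ?w = (D x - Th m (l + 1) y) + Th m (l + 1) (Th m (l + 2) u)" by (simp add: ops)
    then have "D x - Th m (l + 1) ?w \<in> L (m - l) j" using y(2) 3 Lc(2) by metis
    moreover have "?w \<in> V j" by (rule Vc(1)[OF y(1) Th_V[OF uv(1)]])
    ultimately show ?thesis using i by auto
  qed
  then obtain w where w: "w \<in> V j" "D x - Th m (l + 1) w \<in> L (m - l) j" "D w \<in> L (m - (l + 1)) (j - 1)" by blast
  define H where "H = Hp m (l + 1)"
  have HV: "H y \<in> V (Suc i)" if "y \<in> V i" for y i using that by (simp add: H_def Hp_V)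
  have HL: "H y \<in> L (m - l) (Suc i)" if "y \<in> L (m - (l + 1)) i" for y i
    using Hp_L[OF that] L_mono[of "m - (l + 1)" "m - l"] by (simp add: H_def)
  have Ht: "Th m (l + 1) y = y + D (H y) + H (D y)" for y
    using Th_homotopy[of m "l + 1" y] l by (simp add: H_def)
  \<comment> \<open>As \<open>l + 1\<close> is odd, \<open>Th m (l + 1) w\<close> is homotopic to
    \<open>w\<close>; absorbing the homotopy gives \<open>D x' = w\<close> modulo
    \<open>L (m - l)\<close>. The class of \<open>w\<close> thus dies under stabilization, and
    injectivity makes \<open>w\<close> bound already for \<open>U (m - l - 1)\<close>.\<close>
  define x' where "x' = x - H w"
  have x': "x' \<in> V k" using Vc(1)[OF x(1), of "H w"] HV[OF w(1)] j by (simp add: x'_def)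
  have HDw: "H (D w) \<in> L (m - l) j"
  proof (cases "j = 0")
    case True
    then have "D w = 0" using w(1) D_V0 by simp
    then show ?thesis by (simp add: H_def ops Lc(3))
  next
    case False
    then show ?thesis using HL[OF w(3)] by simp
  qed
  have "D x' - w = (D x - Th m (l + 1) w) + H (D w)" using Ht[of w] by (simp add: x'_def ops)
  then have 1: "D x' - w \<in> L (m - l) j" using w(2) HDw Lc(2) by metis
  then have "- (D x' - w) \<in> L (m - l) j" by (rule Lc(4))
  then have "w - D x' \<in> L (m - l) j" by simp
  moreover have "D w \<in> L (m - l - 1) (j - 1)" using w(3) by simp
  ultimately obtain u where u: "u \<in> V k" "w - D u \<in> L (m - l - 1) j"
    using inj w(1) x' j unfolding inj_at_def by auto
  define c where "c = x' - u"
  have c: "c \<in> V k" unfolding c_def by (rule Vc(1)[OF x' u(1)])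
  have "D c = (D x' - w) + (w - D u)" by (simp add: c_def ops)
  moreover have "w - D u \<in> L (m - l) j" using L_mono[OF _ u(2), of "m - l"] by simp
  ultimately have Dc: "D c \<in> L (m - l) j" using 1 Lc(2) by metis
  have "x - Th m (l + 1) u - c - D (- H u) = H (w - D u)"
  proof -
    have "H (w - D u) = H w - H (D u)" "D (- H u) = - D (H u)" by (simp_all add: H_def ops)
    then show ?thesis using Ht[of u] by (simp add: c_def x'_def)
  qed
  moreover have "H (w - D u) \<in> L (m - l) k" using HL[of "w - D u" j] u(2) j by simp
  moreover have "- H u \<in> V (Suc k)" by (rule Vc(4)[OF HV[OF u(1)]])
  ultimately show ?thesis using u c Dc j by (intro bexI[of _ "- H u"] bexI[of _ u] bexI[of _ c]) auto
qed

lemma column_pair_vanish: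
  assumes m: "m \<le> n" and IH: "\<And>m' k. m' < m \<Longrightarrow> 2 * k \<le> m' + 1 \<Longrightarrow> surj_at m' k"
    "\<And>m' k. m' < m \<Longrightarrow> 2 * k \<le> m' \<Longrightarrow> inj_at m' k"
    and l: "even l" "2 \<le> l" and k: "2 * k + l \<le> m + 1 \<or> k = 0"
    and x: "x \<in> V k" "Th m l (D x) \<in> L (m - (l - 1)) (k - 1)"
  shows "\<exists>u\<in>V (Suc k). \<exists>v\<in>V k. x - D u - Th m (l + 1) v \<in> L (m - l) k"
  using l k x
proof (induction k arbitrary: l x rule: less_induct)
  case (less k)
  show ?case
  proof (cases "k = 0")
    case True
    then have "x - D 0 - Th m (l + 1) x = 0" using less.prems by (simp add: Th_V0 ops)
    then show ?thesis using less.prems Vc(3) Lc(3) by metis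
  next
    case False
    \<comment> \<open>The two uses of the induction hypothesis require
      \<open>2 * (k - 1) <= m - l\<close> and, further down, \<open>2 * k <= m - l + 1\<close>; both
      follow from \<open>2 * k + l <= m + 1\<close>.\<close>
    have "inj_at (m - l) (k - 1)" using less.prems False m by (intro IH(2)) auto
    moreover have "\<exists>u\<in>V (k - 1). \<exists>v\<in>V (k - 2). z - D u - Th m (l + 3) v \<in> L (m - (l + 2)) (k - 2)"
      if "2 \<le> k" "z \<in> V (k - 2)" "Th m (l + 2) (D z) \<in> L (m - (l + 1)) (k - 2 - 1)" for z
    proof -
      have e: "Suc (k - 2) = k - 1" "l + 2 + 1 = l + 3" "k - 2 < k" using that(1) by auto
      have c1: "2 * (k - 2) + (l + 2) \<le> m + 1 \<or> k - 2 = 0" using that(1) less.prems(3) by auto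
      have c2: "Th m (l + 2) (D z) \<in> L (m - (l + 2 - 1)) (k - 2 - 1)" using that(3) by simp
      have "\<exists>u\<in>V (Suc (k - 2)). \<exists>v\<in>V (k - 2). z - D u - Th m (l + 2 + 1) v \<in> L (m - (l + 2)) (k - 2)"
        by (rule less.IH[OF e(3) _ _ c1 that(2) c2]) (use less.prems(1) in simp_all)
      then show ?thesis unfolding e .
    qed
    ultimately obtain u v c where uvc: "u \<in> V (Suc k)" "v \<in> V k" "c \<in> V k"
      "x - Th m (l + 1) v - c - D u \<in> L (m - l) k" "D c \<in> L (m - l) (k - 1)"
      using column_pair[OF m less.prems(1,2) _ _ _ _ less.prems(4,5)] less.prems(3) False by auto
    have "surj_at (m - l) k" using less.prems False m by (intro IH(1)) auto
    then obtain w' u' where w: "w' \<in> V k" "u' \<in> V (Suc k)" "D w' \<in> L (m - l - 1) (k - 1)" "c - w' - D u' \<in> L (m - l) k"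
      using uvc(3,5) unfolding surj_at_def by blast
    define H where "H = Hp m (l + 1)"
    have Ht: "Th m (l + 1) y = y + D (H y) + H (D y)" for y
      using Th_homotopy[of m "l + 1" y] less.prems by (simp add: H_def)
    have "H (D w') \<in> L (m - (l + 1)) (Suc (k - 1))" unfolding H_def using w(3) by (intro Hp_L) simp
    then have HD: "H (D w') \<in> L (m - l) k" using L_mono[of "m - (l + 1)" "m - l"] False by simp
    \<comment> \<open>By surjectivity the remaining cycle \<open>c\<close> is represented by
      \<open>w'\<close>, and \<open>w'\<close> equals its own horizontal image up to homotopy
      because \<open>l + 1\<close> is odd.\<close>
    have "x - D (u + u' - H w') - Th m (l + 1) (v + w') = (x - Th m (l + 1) v - c - D u) + (c - w' - D u') - H (D w')"
      using Ht[of w'] by (simp add: ops)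
    also have "\<dots> \<in> L (m - l) k" by (rule Lc(1)[OF Lc(2)[OF uvc(4) w(4)] HD])
    finally have "x - D (u + u' - H w') - Th m (l + 1) (v + w') \<in> L (m - l) k" .
    moreover have "H w' \<in> V (Suc k)" unfolding H_def using w Hp_V by blast
    ultimately show ?thesis
      using Vc(1)[OF Vc(2)[OF uvc(1) w(2)]] Vc(2)[OF uvc(2) w(1)] by blast
  qed
qed

text \<open>Prefixing the neutral element is not equivariant and does not pass to coinvariants in
  general. It does so on the empty tuple, which is what homology of degree 0 needs.\<close>

definition cone :: "'a \<Rightarrow> ('a list \<times> 'c \<Rightarrow>\<^sub>0 int) \<Rightarrow> ('a list \<times> 'c \<Rightarrow>\<^sub>0 int)" where
  "cone a = lift (cns a)"

lemma cone_D: "D (cone a x) = x - cone a (D x)"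
proof -
  have "D (cone a x) = lift (\<lambda>y. bd (cns a y)) x" by (simp add: D_def cone_def lift_compose[OF additive_bd])
  also have "\<dots> = lift (\<lambda>y. y - cns a (bd y)) x" by (simp add: bd_cns)
  also have "\<dots> = x - cone a (D x)" by (simp add: lift_minus lift_id D_def cone_def lift_compose[OF additive_cns])
  finally show ?thesis .
qed

lemma cone_V: "x \<in> V k \<Longrightarrow> cone \<one> x \<in> V (Suc k)"
  unfolding V_def cone_def by (rule lift_frags) (auto simp: T_def intro!: cns_frags simp del: cns_of)

lemma cone_L0: "x \<in> L m 0 \<Longrightarrow> cone \<one> x \<in> L m 1"
  unfolding L_def cone_def
proof (rule lift_rels[OF additive_cns])
  show "cns \<one> (frag_of t) \<in> frags (T 1)" if "t \<in> T 0" for t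
    using that by (auto simp: T_def tup_def)
  show "cns \<one> r \<in> spn (gr m 1)" if "r \<in> gr m 0" for r
    using that by (auto simp: gr_def T_def tup_def additive_zero[OF additive_cns] spn.zero)
qed

text \<open>Strong induction on \<open>m\<close>: column 0 belongs to \<open>U m\<close>, column 1
  to \<open>U (m - 1)\<close>, and the columns from 2 on involve smaller groups, so that the
  induction hypothesis controls them in pairs of an even and an odd column.\<close>

theorem stability_aux:
  "m \<le> n \<Longrightarrow> (\<forall>k. 2 * k \<le> m + 1 \<longrightarrow> surj_at m k) \<and> (\<forall>k. 2 * k \<le> m \<longrightarrow> inj_at m k)"
proof (induction m rule: less_induct)
  case (less m)
  have IH: "m' < m \<Longrightarrow> 2 * k \<le> m' + 1 \<Longrightarrow> surj_at m' k" "m' < m \<Longrightarrow> 2 * k \<le> m' \<Longrightarrow> inj_at m' k" for m' k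
    using less by auto
  have Z: "\<exists>u\<in>V (Suc k). \<exists>v\<in>V k. x - D u - Th m (l + 1) v \<in> L (m - l) k"
    if "even l" "2 \<le> l" "2 * k + l \<le> m + 1 \<or> k = 0" "x \<in> V k" "Th m l (D x) \<in> L (m - (l - 1)) (k - 1)" for l k x
    by (rule column_pair_vanish[OF less.prems _ _ that]) (auto intro: IH)
  have "surj_at m k" if km: "2 * k \<le> m + 1" for k
    unfolding surj_at_def
  proof (intro ballI impI)
    fix w assume w: "w \<in> V k" "D w \<in> L m (k - 1)"
    show "\<exists>w'\<in>V k. \<exists>u\<in>V (Suc k). D w' \<in> L (m - 1) (k - 1) \<and> w - w' - D u \<in> L m k"
    proof (cases "k \<le> 1")
      case True
      then have "k - 1 = 0" by simp
      then have "D w \<in> L (m - 1) (k - 1)" using w(2) L_zero_level by metis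
      moreover have "w - w - D 0 \<in> L m k" by (simp add: ops Lc(3))
      ultimately show ?thesis using w Vc(3) by blast
    next
      case False
      then obtain j where j: "k = Suc j" "1 \<le> j" by (cases k) auto
      have Dw: "D w \<in> V j" using w j D_V' by blast
      \<comment> \<open>Modulo the relations of \<open>U m\<close> the map \<open>Th m 1\<close> is
        the stabilization map, so \<open>D w\<close> is a horizontal cycle in column 1.\<close>
      have "Th m 1 (D w) - D w \<in> L m j" using Th_mod[OF Dw, of m 1] by simp
      moreover have "D w \<in> L m j" using w(2) j by simp
      ultimately have "Th m 1 (D w) - D w + D w \<in> L m j" by (rule Lc(2))
      then have "Th m 1 (D w) \<in> L (m - (1 - 1)) j" by simp
      from row_exact[OF less.prems _ _ Dw this] obtain y where y: "y \<in> V j" "D w - Th m 2 y \<in> L (m - 1) j"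
        using km j by (auto simp: numeral_2_eq_2)
      have "- D (D w - Th m 2 y) \<in> L (m - 1) (j - 1)" using Lc(4)[OF D_L[OF y(2)]] by simp
      then have "Th m 2 (D y) \<in> L (m - (2 - 1)) (j - 1)" by (simp add: ops D_D D_Th)
      then obtain u v where uv: "u \<in> V k" "v \<in> V j" "y - D u - Th m 3 v \<in> L (m - 2) j"
        using Z[of 2 j y] y(1) km j by auto
      have "Th m 2 (y - D u - Th m 3 v) \<in> L (m - 2) j" using uv(3) Th_L by blast
      then have 1: "Th m 2 (y - D u - Th m 3 v) \<in> L (m - 1) j" using L_mono[of "m - 2" "m - 1"] by simp
      have 2: "Th m 2 (Th m 3 v) \<in> L (m - 1) j" using ThTh[OF less.prems _ _ uv(2), of 2] that j by simp
      have "D (w - Th m 2 u) = (D w - Th m 2 y) + Th m 2 (y - D u - Th m 3 v) + Th m 2 (Th m 3 v)"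
        by (simp add: ops D_Th)
      also have "\<dots> \<in> L (m - 1) j" by (rule Lc(2)[OF Lc(2)[OF y(2) 1] 2])
      finally have "D (w - Th m 2 u) \<in> L (m - 1) (k - 1)" using j by simp
      \<comment> \<open>The correction does not change the class of \<open>w\<close>, since
        \<open>Th m 2\<close> vanishes modulo the relations of \<open>U m\<close>.\<close>
      moreover have "w - (w - Th m 2 u) - D 0 \<in> L m k" using Th_mod[OF uv(1), of m 2] by (simp add: ops)
      moreover have "w - Th m 2 u \<in> V k" by (rule Vc(1)[OF w(1) Th_V[OF uv(1)]])
      ultimately show ?thesis using Vc(3) by blast
    qed
  qed
  moreover have "inj_at m k" if km: "2 * k \<le> m" for k
    unfolding inj_at_def
  proof (intro ballI impI)
    fix w u0 assume w: "w \<in> V k" "u0 \<in> V (Suc k)" "D w \<in> L (m - 1) (k - 1)" "w - D u0 \<in> L m k"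
    show "\<exists>u'\<in>V (Suc k). w - D u' \<in> L (m - 1) k"
    proof (cases "k \<le> 1")
      case True
      show ?thesis
      proof (cases "k = 0")
        case True
        then show ?thesis using w L_zero_level by metis
      next
        case False
        then have k: "k = 1" using True by simp
        have "w - D (cone \<one> w) = cone \<one> (D w)" by (simp add: cone_D)
        also have "\<dots> \<in> L (m - 1) 1" using cone_L0 w(3) k by simp
        finally show ?thesis using cone_V w k by blast
      qed
    next
      case False
      define a where "a = w - D u0"
      have a: "a \<in> V k" "a \<in> L m k" "D a \<in> L (m - 1) (k - 1)"
        using Vc(1)[OF w(1) D_V'[OF w(2)]] w by (simp_all add: a_def ops D_D)
      have "Th m 1 a - a \<in> L m k" using Th_mod[OF a(1), of m 1] by simp
      then have "Th m 1 a - a + a \<in> L m k" using a(2) by (rule Lc(2))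
      then have "Th m 1 a \<in> L (m - (1 - 1)) k" by simp
      from row_exact[OF less.prems _ _ a(1) this] obtain y where y: "y \<in> V k" "a - Th m 2 y \<in> L (m - 1) k"
        using km False by (auto simp: numeral_2_eq_2)
      have "D (a - Th m 2 y) \<in> L (m - 1) (k - 1)" using y(2) D_L by blast
      then have "D a - D (a - Th m 2 y) \<in> L (m - 1) (k - 1)" by (rule Lc(1)[OF a(3)])
      then have 0: "Th m 2 (D y) \<in> L (m - (2 - 1)) (k - 1)" by (simp add: ops D_Th)
      have i: "inj_at (m - 2) (k - 1)" using that False by (intro IH) auto
      have "\<exists>u\<in>V (k - 1). \<exists>v\<in>V (k - 2). z - D u - Th m (2 + 3) v \<in> L (m - (2 + 2)) (k - 2)"
        if "2 \<le> k" "z \<in> V (k - 2)" "Th m (2 + 2) (D z) \<in> L (m - (2 + 1)) (k - 2 - 1)" for z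
      proof -
        have e: "Suc (k - 2) = k - 1" "(4::nat) + 1 = 2 + 3" "(4::nat) = 2 + 2" using False by auto
        have c1: "2 * (k - 2) + 4 \<le> m + 1 \<or> k - 2 = 0" using False km by auto
        have c2: "Th m 4 (D z) \<in> L (m - (4 - 1)) (k - 2 - 1)" using that(3) by simp
        have "\<exists>u\<in>V (Suc (k - 2)). \<exists>v\<in>V (k - 2). z - D u - Th m (4 + 1) v \<in> L (m - 4) (k - 2)"
          by (rule Z[OF _ _ c1 that(2) c2]) simp_all
        then show ?thesis using e(1) by simp
      qed
      note this
      \<comment> \<open>Only \<open>2 * k + 2 <= m + 2\<close> is available here, one short of the
        bound of \<open>column_pair_vanish\<close>. The leftover cycle \<open>c\<close> is disposed
        of by \<open>Th m 2\<close>, which is null-homotopic because 2 is even.\<close>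
      from column_pair[OF less.prems _ _ _ _ i this y(1) 0] obtain u v c where
        uvc: "u \<in> V (Suc k)" "v \<in> V k" "c \<in> V k" "y - Th m 3 v - c - D u \<in> L (m - 2) k" "D c \<in> L (m - 2) (k - 1)"
        using km False by auto
      have "Th m 2 (y - Th m 3 v - c - D u) \<in> L (m - 2) k" using uvc(4) Th_L by blast
      then have 1: "Th m 2 (y - Th m 3 v - c - D u) \<in> L (m - 1) k" using L_mono[of "m - 2" "m - 1"] by simp
      have 2: "Th m 2 (Th m 3 v) \<in> L (m - 1) k" using ThTh[OF less.prems _ _ uvc(2), of 2] that False by simp
      have "Hp m 2 (D c) \<in> L (m - 2) (Suc (k - 1))" using uvc(5) by (rule Hp_L)
      then have 3: "Hp m 2 (D c) \<in> L (m - 1) k" using L_mono[of "m - 2" "m - 1"] False by simp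
      have "Th m 2 c = D (Hp m 2 c) + Hp m 2 (D c)" using Th_homotopy[of m 2 c] by simp
      then have "w - D (u0 + Th m 2 u + Hp m 2 c) = (a - Th m 2 y) + Th m 2 (y - Th m 3 v - c - D u)
          + Th m 2 (Th m 3 v) + Hp m 2 (D c)"
        by (simp add: ops D_Th a_def)
      also have "\<dots> \<in> L (m - 1) k" by (rule Lc(2)[OF Lc(2)[OF Lc(2)[OF y(2) 1] 2] 3])
      finally show ?thesis
        using Vc(2)[OF Vc(2)[OF w(2) Th_V[OF uvc(1)]] Hp_V[OF uvc(3)]] by blast
    qed
  qed
  ultimately show ?case by blast
qed

end

section \<open>Double complexes with exact rows and columns\<close>

text \<open>A relation inducing an isomorphism \<open>Z / B \<cong> Z' / B'\<close>.\<close>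

definition hcorr :: "('v::ab_group_add \<Rightarrow> 'w::ab_group_add \<Rightarrow> bool) \<Rightarrow> 'v set \<Rightarrow> 'v set \<Rightarrow> 'w set \<Rightarrow> 'w set \<Rightarrow> bool" where
  "hcorr C Z B Z' B' \<longleftrightarrow>
     (\<forall>x y. C x y \<longrightarrow> x \<in> Z \<and> y \<in> Z' \<and> (x \<in> B \<longleftrightarrow> y \<in> B')) \<and>
     (\<forall>x\<in>Z. \<exists>y. C x y) \<and> (\<forall>y\<in>Z'. \<exists>x. C x y) \<and>
     (\<forall>x y x' y'. C x y \<longrightarrow> C x' y' \<longrightarrow> C (x - x') (y - y'))"

lemma hcorr_comp:
  assumes C: "hcorr C Z B Z' B'" and C': "hcorr C' Z' B' Z'' B''"
  shows "hcorr (\<lambda>x z. \<exists>y. C x y \<and> C' y z) Z B Z'' B''"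
proof -
  have "\<exists>y. C (x - x') y \<and> C' y (z - z')" if "C x y" "C' y z" "C x' y'" "C' y' z'" for x x' y y' z z'
    using that C C' unfolding hcorr_def by (intro exI[of _ "y - y'"]) blast
  then show ?thesis using C C' unfolding hcorr_def by meson
qed

lemma hcorr_map:
  assumes F: "additive F" and sub: "subgrp Z" "subgrp Z'" "subgrp B'" "B' \<subseteq> Z'"
    and FZ: "\<And>x. x \<in> Z \<Longrightarrow> F x \<in> Z'" and FB: "\<And>x. x \<in> Z \<Longrightarrow> F x \<in> B' \<longleftrightarrow> x \<in> B"
    and surj: "\<And>y. y \<in> Z' \<Longrightarrow> \<exists>x\<in>Z. y - F x \<in> B'"
  shows "hcorr (\<lambda>x y. x \<in> Z \<and> y \<in> Z' \<and> y - F x \<in> B') Z B Z' B'"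
  unfolding hcorr_def
proof (intro conjI allI impI ballI)
  fix x y assume a: "x \<in> Z \<and> y \<in> Z' \<and> y - F x \<in> B'"
  then show "x \<in> Z" "y \<in> Z'" by auto
  have "F x \<in> B' \<longleftrightarrow> y \<in> B'"
  proof
    assume "F x \<in> B'"
    then have "(y - F x) + F x \<in> B'" using a subgrp_add[OF sub(3)] by blast
    then show "y \<in> B'" by simp
  next
    assume "y \<in> B'"
    then have "y - (y - F x) \<in> B'" using a subgrp_diff[OF sub(3)] by blast
    then show "F x \<in> B'" by simp
  qed
  then show "x \<in> B \<longleftrightarrow> y \<in> B'" using FB a by blast
next
  fix x assume "x \<in> Z"
  then show "\<exists>y. x \<in> Z \<and> y \<in> Z' \<and> y - F x \<in> B'"
    using FZ subgrp_zero[OF sub(3)] by (intro exI[of _ "F x"]) simp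
next
  fix y assume "y \<in> Z'"
  then show "\<exists>x. x \<in> Z \<and> y \<in> Z' \<and> y - F x \<in> B'" using surj by blast
next
  fix x y x' y' assume a: "x \<in> Z \<and> y \<in> Z' \<and> y - F x \<in> B'" "x' \<in> Z \<and> y' \<in> Z' \<and> y' - F x' \<in> B'"
  then have "(y - F x) - (y' - F x') \<in> B'" using subgrp_diff[OF sub(3)] by blast
  moreover have "(y - F x) - (y' - F x') = y - y' - F (x - x')" by (simp add: additive_diff[OF F])
  ultimately have "y - y' - F (x - x') \<in> B'" by metis
  then show "x - x' \<in> Z" "y - y' \<in> Z'" "y - y' - F (x - x') \<in> B'"
    using a subgrp_diff[OF sub(1)] subgrp_diff[OF sub(2)] by blast+
qed

text \<open>On the right both correspondences share the same element \<open>y\<close>, so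
  \<open>F\<close> corresponds to the inclusion of cycles there; bijectivity of that inclusion on
  homology carries over to \<open>F\<close>.\<close>

lemma hcorr_square:
  assumes C1: "hcorr C1 Z1 B1 W1 D1" and C2: "hcorr C2 Z2 B2 W2 D2"
    and nat: "\<And>x y. C1 x y \<Longrightarrow> C2 (F x) y"
    and inj: "\<And>y. y \<in> W1 \<Longrightarrow> y \<in> D2 \<Longrightarrow> y \<in> D1"
    and surj: "\<And>y. y \<in> W2 \<Longrightarrow> \<exists>y1\<in>W1. y - y1 \<in> D2"
  shows "\<And>x. x \<in> Z1 \<Longrightarrow> F x \<in> B2 \<Longrightarrow> x \<in> B1" "\<And>x. x \<in> Z2 \<Longrightarrow> \<exists>x1\<in>Z1. x - F x1 \<in> B2"
proof -
  fix x assume "x \<in> Z1" "F x \<in> B2"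
  then obtain y where "C1 x y" using C1 unfolding hcorr_def by blast
  then show "x \<in> B1" using nat[of x y] inj[of y] \<open>F x \<in> B2\<close> C1 C2 unfolding hcorr_def by blast
next
  fix x assume "x \<in> Z2"
  then obtain y where y: "C2 x y" "y \<in> W2" using C2 unfolding hcorr_def by blast
  then obtain y1 where y1: "y1 \<in> W1" "y - y1 \<in> D2" using surj by blast
  then obtain x1 where x1: "C1 x1 y1" "x1 \<in> Z1" using C1 unfolding hcorr_def by blast
  have "C2 (x - F x1) (y - y1)" using y(1) nat[OF x1(1)] C2 unfolding hcorr_def by blast
  then have "x - F x1 \<in> B2" using y1(2) C2 unfolding hcorr_def by blast
  then show "\<exists>x1\<in>Z1. x - F x1 \<in> B2" using x1(2) by blast
qed

text \<open>The parts with first or second index 0 are the two complexes to be compared; exactness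
  elsewhere is added in the extensions. The corner is zero as a quotient, so that every chain in the
  lowest degree of either outer complex counts as a cycle.\<close>

locale double_complex =
  fixes S L :: "nat \<Rightarrow> nat \<Rightarrow> 'v::ab_group_add set"
    and dh dv :: "nat \<Rightarrow> nat \<Rightarrow> 'v \<Rightarrow> 'v"
  assumes subS: "subgrp (S i j)" and subL: "subgrp (L i j)" and LS: "L i j \<subseteq> S i j"
    and add_dh: "additive (dh i j)" and add_dv: "additive (dv i j)"
    and dh_S: "x \<in> S (Suc i) j \<Longrightarrow> dh i j x \<in> S i j"
    and dv_S: "x \<in> S i (Suc j) \<Longrightarrow> dv i j x \<in> S i j"
    and dh_L: "x \<in> L (Suc i) j \<Longrightarrow> dh i j x \<in> L i j"
    and dv_L: "x \<in> L i (Suc j) \<Longrightarrow> dv i j x \<in> L i j"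
    and dh_dh: "x \<in> S (Suc (Suc i)) j \<Longrightarrow> dh i j (dh (Suc i) j x) \<in> L i j"
    and dv_dv: "x \<in> S i (Suc (Suc j)) \<Longrightarrow> dv i j (dv i (Suc j) x) \<in> L i j"
    and dh_dv: "x \<in> S (Suc i) (Suc j) \<Longrightarrow> dh i j (dv (Suc i) j x) - dv i j (dh i (Suc j) x) \<in> L i j"
    and corner: "L 0 0 = S 0 0"
begin

text \<open>A staircase from \<open>a\<close> at first index \<open>i\<close> to \<open>y\<close> at
  second index 0: each entry maps horizontally to the vertical image of its predecessor. The case
  \<open>i = 0\<close> is the correspondence of interest; general \<open>i\<close> serves the
  induction on \<open>j\<close>.\<close>

definition stair :: "nat \<Rightarrow> nat \<Rightarrow> 'v \<Rightarrow> 'v \<Rightarrow> (nat \<Rightarrow> 'v) \<Rightarrow> bool" where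
  "stair i j a y \<xi> \<longleftrightarrow> (\<forall>k\<le>j. \<xi> k \<in> S (Suc (i + k)) (Suc j - k)) \<and>
     dh i (Suc j) (\<xi> 0) - a \<in> L i (Suc j) \<and>
     (\<forall>k<j. dh (Suc (i + k)) (j - k) (\<xi> (Suc k)) - dv (Suc (i + k)) (j - k) (\<xi> k) \<in> L (Suc (i + k)) (j - k)) \<and>
     dv (Suc (i + j)) 0 (\<xi> j) - y \<in> L (Suc (i + j)) 0"

definition ZX :: "nat \<Rightarrow> 'v set" where "ZX q = {x \<in> S 0 (Suc q). dv 0 q x \<in> L 0 q}"
definition BX :: "nat \<Rightarrow> 'v set" where
  "BX q = {x \<in> S 0 (Suc q). \<exists>u\<in>S 0 (Suc (Suc q)). x - dv 0 (Suc q) u \<in> L 0 (Suc q)}"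
definition ZY :: "nat \<Rightarrow> 'v set" where "ZY q = {y \<in> S (Suc q) 0. dh q 0 y \<in> L q 0}"
definition BY :: "nat \<Rightarrow> 'v set" where
  "BY q = {y \<in> S (Suc q) 0. \<exists>u\<in>S (Suc (Suc q)) 0. y - dh (Suc q) 0 u \<in> L (Suc q) 0}"

definition rel :: "nat \<Rightarrow> 'v \<Rightarrow> 'v \<Rightarrow> bool" where
  "rel q x y \<longleftrightarrow> x \<in> ZX q \<and> y \<in> ZY q \<and> (\<exists>\<xi>. stair 0 q x y \<xi>)"

lemma stair_Suc:
  "stair i (Suc j) a y \<xi> \<longleftrightarrow> \<xi> 0 \<in> S (Suc i) (Suc (Suc j)) \<and> dh i (Suc (Suc j)) (\<xi> 0) - a \<in> L i (Suc (Suc j)) \<and>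
     stair (Suc i) j (dv (Suc i) (Suc j) (\<xi> 0)) y (\<lambda>k. \<xi> (Suc k))"
proof -
  have 1: "(\<forall>k\<le>Suc j. P k) \<longleftrightarrow> P 0 \<and> (\<forall>k\<le>j. P (Suc k))" for P :: "nat \<Rightarrow> bool"
    by (metis Suc_le_mono le0 not0_implies_Suc)
  have 2: "(\<forall>k<Suc j. P k) \<longleftrightarrow> P 0 \<and> (\<forall>k<j. P (Suc k))" for P :: "nat \<Rightarrow> bool"
    by (metis Suc_less_eq zero_less_Suc not0_implies_Suc)
  show ?thesis unfolding stair_def 1 2 by auto
qed

lemma stair_diff:
  assumes "stair i j a y \<xi>" "stair i j a' y' \<xi>'"
  shows "stair i j (a - a') (y - y') (\<lambda>k. \<xi> k - \<xi>' k)"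
proof -
  have e: "additive f \<Longrightarrow> f u - x \<in> L i' j' \<Longrightarrow> f u' - x' \<in> L i' j' \<Longrightarrow> f (u - u') - (x - x') \<in> L i' j'"
    for f u u' x x' i' j'
    using subgrp_diff[OF subL, of "f u - x" i' j' "f u' - x'"] by (simp add: additive_diff algebra_simps)
  have e2: "additive f \<Longrightarrow> additive g \<Longrightarrow> f u - g x \<in> L i' j' \<Longrightarrow> f u' - g x' \<in> L i' j' \<Longrightarrow> f (u - u') - g (x - x') \<in> L i' j'"
    for f g u u' x x' i' j'
    using e[of f u "g x" i' j' u' "g x'"] by (simp add: additive_diff)
  show ?thesis
    using assms unfolding stair_def
    by (auto intro!: e[OF add_dh] e[OF add_dv] e2[OF add_dh add_dv] subgrp_diff[OF subS])
qed

end

locale row_exact_complex = double_complex +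
  assumes row0: "x \<in> S 0 (Suc j) \<Longrightarrow> \<exists>y\<in>S (Suc 0) (Suc j). x - dh 0 (Suc j) y \<in> L 0 (Suc j)"
    and row: "x \<in> S (Suc i) (Suc j) \<Longrightarrow> dh i (Suc j) x \<in> L i (Suc j) \<Longrightarrow>
      \<exists>y\<in>S (Suc (Suc i)) (Suc j). x - dh (Suc i) (Suc j) y \<in> L (Suc i) (Suc j)"
begin

definition hclosed :: "nat \<Rightarrow> nat \<Rightarrow> 'a \<Rightarrow> bool" where
  "hclosed i j x \<longleftrightarrow> x \<in> S i j \<and> (case i of 0 \<Rightarrow> True | Suc i' \<Rightarrow> dh i' j x \<in> L i' j)"

lemma row_lift:
  assumes "hclosed i (Suc j) x"
  shows "\<exists>y\<in>S (Suc i) (Suc j). x - dh i (Suc j) y \<in> L i (Suc j)"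
  using assms row0 row by (cases i) (auto simp: hclosed_def)

text \<open>Lift \<open>a\<close> along its row and apply the vertical differential: the result is
  again horizontally closed, with the first index raised and the second lowered by one, so the
  construction can be repeated.\<close>

lemma stair_exists:
  assumes "hclosed i (Suc j) a" "dv i j a \<in> L i j"
  shows "\<exists>y \<xi>. stair i j a y \<xi> \<and> y \<in> S (Suc (i + j)) 0 \<and> dh (i + j) 0 y \<in> L (i + j) 0"
  using assms
proof (induction j arbitrary: i a)
  case (0 i a)
  obtain \<xi> where x: "\<xi> \<in> S (Suc i) 1" "a - dh i 1 \<xi> \<in> L i 1" using row_lift[OF 0(1)] by auto
  then have "dh i 1 \<xi> - a \<in> L i 1" using subgrp_uminus[OF subL, of "a - dh i 1 \<xi>"] by simp
  then have "dv i 0 (dh i 1 \<xi> - a) \<in> L i 0" using dv_L by simp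
  then have "dv i 0 (dh i 1 \<xi> - a) + dv i 0 a \<in> L i 0" using 0(2) by (rule subgrp_add[OF subL])
  then have "dv i 0 (dh i 1 \<xi>) \<in> L i 0" by (simp add: additive_diff[OF add_dv])
  moreover have "dh i 0 (dv (Suc i) 0 \<xi>) - dv i 0 (dh i 1 \<xi>) \<in> L i 0" using dh_dv[of \<xi> i 0] x by simp
  ultimately have "dh i 0 (dv (Suc i) 0 \<xi>) - dv i 0 (dh i 1 \<xi>) + dv i 0 (dh i 1 \<xi>) \<in> L i 0"
    using subgrp_add[OF subL] by blast
  then have "dh i 0 (dv (Suc i) 0 \<xi>) \<in> L i 0" by simp
  moreover have "stair i 0 a (dv (Suc i) 0 \<xi>) (\<lambda>_. \<xi>)"
    using x \<open>dh i 1 \<xi> - a \<in> L i 1\<close> by (simp add: stair_def subgrp_zero[OF subL])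
  ultimately show ?case using dv_S[of \<xi> "Suc i" 0] x by auto
next
  case (Suc j i a)
  obtain \<xi> where x: "\<xi> \<in> S (Suc i) (Suc (Suc j))" "a - dh i (Suc (Suc j)) \<xi> \<in> L i (Suc (Suc j))"
    using row_lift[OF Suc.prems(1)] by auto
  then have d: "dh i (Suc (Suc j)) \<xi> - a \<in> L i (Suc (Suc j))"
    using subgrp_uminus[OF subL, of "a - dh i (Suc (Suc j)) \<xi>"] by simp
  then have "dv i (Suc j) (dh i (Suc (Suc j)) \<xi> - a) \<in> L i (Suc j)" using dv_L by simp
  then have "dv i (Suc j) (dh i (Suc (Suc j)) \<xi> - a) + dv i (Suc j) a \<in> L i (Suc j)"
    using Suc.prems(2) by (rule subgrp_add[OF subL])
  then have "dv i (Suc j) (dh i (Suc (Suc j)) \<xi>) \<in> L i (Suc j)" by (simp add: additive_diff[OF add_dv])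
  with dh_dv[OF x(1)] have "dh i (Suc j) (dv (Suc i) (Suc j) \<xi>) - dv i (Suc j) (dh i (Suc (Suc j)) \<xi>)
      + dv i (Suc j) (dh i (Suc (Suc j)) \<xi>) \<in> L i (Suc j)"
    using subgrp_add[OF subL] by blast
  then have "hclosed (Suc i) (Suc j) (dv (Suc i) (Suc j) \<xi>)" using dv_S[OF x(1)] by (simp add: hclosed_def)
  from Suc.IH[OF this dv_dv[OF x(1)]] obtain y \<xi>' where y: "stair (Suc i) j (dv (Suc i) (Suc j) \<xi>) y \<xi>'"
    "y \<in> S (Suc (Suc i + j)) 0" "dh (Suc i + j) 0 y \<in> L (Suc i + j) 0" by blast
  have "stair i (Suc j) a y (\<lambda>k. case k of 0 \<Rightarrow> \<xi> | Suc k \<Rightarrow> \<xi>' k)"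
    unfolding stair_Suc using x d y by simp
  then show ?case using y by auto
qed

text \<open>If \<open>a\<close> bounds, the bounding chain is lifted as well and its vertical image
  subtracted from the first step. The difference is horizontally closed, hence the horizontal image
  of some \<open>z\<close>, and that image takes over the role of \<open>\<eta>\<close> for the
  shorter staircase.\<close>

lemma stair_boundary:
  assumes "stair i j a y \<xi>" "hclosed i (Suc (Suc j)) \<eta>" "a - dv i (Suc j) \<eta> \<in> L i (Suc j)"
  shows "\<exists>w\<in>S (Suc (Suc (i + j))) 0. y - dh (Suc (i + j)) 0 w \<in> L (Suc (i + j)) 0"
  using assms
proof (induction j arbitrary: i a \<xi> \<eta>)
  case (0 i a)
  note stair = 0
  show ?case
  proof -
    obtain \<eta>' where e: "\<eta>' \<in> S (Suc i) 2" "\<eta> - dh i 2 \<eta>' \<in> L i 2"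
      using row_lift[OF 0(2)] by (auto simp: numeral_2_eq_2)
    have x: "\<xi> 0 \<in> S (Suc i) 1" "dh i 1 (\<xi> 0) - a \<in> L i 1" "dv (Suc i) 0 (\<xi> 0) - y \<in> L (Suc i) 0"
      using 0(1) by (auto simp: stair_def)
    let ?u = "\<xi> 0 - dv (Suc i) 1 \<eta>'"
    have uS: "?u \<in> S (Suc i) 1" using x(1) dv_S[of \<eta>' "Suc i" 1] e subgrp_diff[OF subS] by (simp add: numeral_2_eq_2)
    have 1: "dv i 1 (\<eta> - dh i 2 \<eta>') \<in> L i 1" using dv_L[of _ i 1] e(2) by (simp add: numeral_2_eq_2)
    have 2: "dh i 1 (dv (Suc i) 1 \<eta>') - dv i 1 (dh i 2 \<eta>') \<in> L i 1"
      using dh_dv[of \<eta>' i 1] e(1) by (simp add: numeral_2_eq_2)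
    have 3: "a - dv i 1 \<eta> \<in> L i 1" using 0(3) by simp
    have "dh i 1 ?u = (dh i 1 (\<xi> 0) - a) + (a - dv i 1 \<eta>) + dv i 1 (\<eta> - dh i 2 \<eta>')
        - (dh i 1 (dv (Suc i) 1 \<eta>') - dv i 1 (dh i 2 \<eta>'))"
      by (simp add: additive_diff[OF add_dh] additive_diff[OF add_dv])
    also have "\<dots> \<in> L i 1" by (rule subgrp_diff[OF subL subgrp_add[OF subL subgrp_add[OF subL x(2) 3] 1] 2])
    finally have "hclosed (Suc i) 1 ?u" using uS by (simp add: hclosed_def)
    then obtain z where z: "z \<in> S (Suc (Suc i)) 1" "?u - dh (Suc i) 1 z \<in> L (Suc i) 1"
      using row_lift[of "Suc i" 0 ?u] by auto
    have 4: "dv (Suc i) 0 (?u - dh (Suc i) 1 z) \<in> L (Suc i) 0" using dv_L[of _ "Suc i" 0] z(2) by simp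
    have 5: "dv (Suc i) 0 (dv (Suc i) 1 \<eta>') \<in> L (Suc i) 0" using dv_dv[of \<eta>' "Suc i" 0] e(1) by (simp add: numeral_2_eq_2)
    have 6: "dh (Suc i) 0 (dv (Suc (Suc i)) 0 z) - dv (Suc i) 0 (dh (Suc i) 1 z) \<in> L (Suc i) 0"
      using dh_dv[of z "Suc i" 0] z(1) by simp
    have "y - dh (Suc i) 0 (dv (Suc (Suc i)) 0 z) =
        dv (Suc i) 0 (?u - dh (Suc i) 1 z) + dv (Suc i) 0 (dv (Suc i) 1 \<eta>') - (dv (Suc i) 0 (\<xi> 0) - y)
        - (dh (Suc i) 0 (dv (Suc (Suc i)) 0 z) - dv (Suc i) 0 (dh (Suc i) 1 z))"
      by (simp add: additive_diff[OF add_dv])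
    also have "\<dots> \<in> L (Suc i) 0"
      by (rule subgrp_diff[OF subL subgrp_diff[OF subL subgrp_add[OF subL 4 5] x(3)] 6])
    finally show ?thesis using dv_S[of z "Suc (Suc i)" 0] z(1) by auto
  qed
next
  case (Suc j i a)
  obtain \<eta>' where e: "\<eta>' \<in> S (Suc i) (Suc (Suc (Suc j)))" "\<eta> - dh i (Suc (Suc (Suc j))) \<eta>' \<in> L i (Suc (Suc (Suc j)))"
    using row_lift[OF Suc.prems(2)] by auto
  let ?j = "Suc (Suc j)"
  have x: "\<xi> 0 \<in> S (Suc i) ?j" "dh i ?j (\<xi> 0) - a \<in> L i ?j"
    "stair (Suc i) j (dv (Suc i) (Suc j) (\<xi> 0)) y (\<lambda>k. \<xi> (Suc k))"
    using Suc.prems(1) by (auto simp: stair_Suc)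
  let ?u = "\<xi> 0 - dv (Suc i) ?j \<eta>'"
  have uS: "?u \<in> S (Suc i) ?j" using x(1) dv_S[OF e(1)] subgrp_diff[OF subS] by blast
  have 1: "dv i ?j (\<eta> - dh i (Suc ?j) \<eta>') \<in> L i ?j" using dv_L[OF e(2)] .
  have 2: "dh i ?j (dv (Suc i) ?j \<eta>') - dv i ?j (dh i (Suc ?j) \<eta>') \<in> L i ?j" using dh_dv[OF e(1)] .
  have "dh i ?j ?u = (dh i ?j (\<xi> 0) - a) + (a - dv i ?j \<eta>) + dv i ?j (\<eta> - dh i (Suc ?j) \<eta>')
      - (dh i ?j (dv (Suc i) ?j \<eta>') - dv i ?j (dh i (Suc ?j) \<eta>'))"
    by (simp add: additive_diff[OF add_dh] additive_diff[OF add_dv])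
  also have "\<dots> \<in> L i ?j"
    by (rule subgrp_diff[OF subL subgrp_add[OF subL subgrp_add[OF subL x(2) Suc.prems(3)] 1] 2])
  finally have "hclosed (Suc i) ?j ?u" using uS by (simp add: hclosed_def)
  then obtain z where z: "z \<in> S (Suc (Suc i)) ?j" "?u - dh (Suc i) ?j z \<in> L (Suc i) ?j"
    using row_lift by blast
  have "hclosed (Suc i) ?j (dh (Suc i) ?j z)" using dh_dh[OF z(1)] dh_S[OF z(1)] by (simp add: hclosed_def)
  moreover have "dv (Suc i) (Suc j) (\<xi> 0) - dv (Suc i) (Suc j) (dh (Suc i) ?j z) \<in> L (Suc i) (Suc j)"
  proof -
    have "dv (Suc i) (Suc j) (?u - dh (Suc i) ?j z) + dv (Suc i) (Suc j) (dv (Suc i) ?j \<eta>') \<in> L (Suc i) (Suc j)"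
      by (rule subgrp_add[OF subL dv_L[OF z(2)] dv_dv[OF e(1)]])
    then show ?thesis by (simp add: additive_diff[OF add_dv])
  qed
  ultimately show ?case using Suc.IH[OF x(3)] by auto
qed

lemma rel_exists:
  assumes "x \<in> ZX q"
  shows "\<exists>y. rel q x y"
  using stair_exists[of 0 q x] assms unfolding rel_def ZX_def ZY_def hclosed_def by auto

lemma rel_boundary:
  assumes "rel q x y" "x \<in> BX q"
  shows "y \<in> BY q"
  using stair_boundary[of 0 q x y] assms unfolding rel_def BX_def BY_def ZY_def hclosed_def by auto

end

locale exact_double_complex = row_exact_complex +
  assumes col0: "x \<in> S (Suc i) 0 \<Longrightarrow> \<exists>y\<in>S (Suc i) (Suc 0). x - dv (Suc i) 0 y \<in> L (Suc i) 0"
    and col: "x \<in> S (Suc i) (Suc j) \<Longrightarrow> dv (Suc i) j x \<in> L (Suc i) j \<Longrightarrow>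
      \<exists>y\<in>S (Suc i) (Suc (Suc j)). x - dv (Suc i) (Suc j) y \<in> L (Suc i) (Suc j)"
begin

text \<open>The hypotheses are symmetric in the two directions, so the transposed complex supplies
  the converse existence and boundary statements.\<close>

interpretation tr: row_exact_complex "\<lambda>i j. S j i" "\<lambda>i j. L j i" "\<lambda>i j. dv j i" "\<lambda>i j. dh j i"
proof (unfold_locales, goal_cases)
  case (12 x j i)
  have "- (dh i j (dv (Suc i) j x) - dv i j (dh i (Suc j) x)) \<in> L i j"
    using 12 by (intro subgrp_uminus[OF subL] dh_dv)
  then show ?case by simp
qed (simp_all add: subS subL LS add_dh add_dv dh_S dv_S dh_L dv_L dh_dh dv_dv corner row0 row col0 col)

text \<open>A staircase of the transposed complex is a staircase of the original one read from its
  other end.\<close>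

lemma tr_rel: "tr.rel q y x \<longleftrightarrow> rel q x y"
proof -
  have Z: "tr.ZX q = ZY q" "tr.ZY q = ZX q"
    by (simp_all add: tr.ZX_def tr.ZY_def ZX_def ZY_def)
  have neg: "a - b \<in> L i j \<longleftrightarrow> b - a \<in> L i j" for a b i j
    using subgrp_uminus[OF subL, of "a - b" i j] subgrp_uminus[OF subL, of "b - a" i j] by auto
  have 1: "stair 0 q x y (\<lambda>k. \<xi> (q - k))" if s: "tr.stair 0 q y x \<xi>" for \<xi>
    unfolding stair_def
  proof (intro conjI allI impI)
    fix k assume "k \<le> q"
    then show "\<xi> (q - k) \<in> S (Suc (0 + k)) (Suc q - k)"
      using s[unfolded tr.stair_def, THEN conjunct1, rule_format, of "q - k"] by (simp add: Suc_diff_le)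
  next
    fix k assume k: "k < q"
    then have "Suc (q - Suc k) = q - k" "q - (q - Suc k) = Suc k" by auto
    then show "dh (Suc (0 + k)) (q - k) (\<xi> (q - Suc k)) - dv (Suc (0 + k)) (q - k) (\<xi> (q - k)) \<in> L (Suc (0 + k)) (q - k)"
      using s[unfolded tr.stair_def, THEN conjunct2, THEN conjunct2, THEN conjunct1, rule_format, of "q - Suc k"] k
      by (simp add: neg)
  qed (use s in \<open>simp_all add: tr.stair_def\<close>)
  have 2: "tr.stair 0 q y x (\<lambda>k. \<xi> (q - k))" if s: "stair 0 q x y \<xi>" for \<xi>
    unfolding tr.stair_def
  proof (intro conjI allI impI)
    fix k assume "k \<le> q"
    then show "\<xi> (q - k) \<in> S (Suc q - k) (Suc (0 + k))"
      using s[unfolded stair_def, THEN conjunct1, rule_format, of "q - k"] by (simp add: Suc_diff_le)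
  next
    fix k assume k: "k < q"
    then have "Suc (q - Suc k) = q - k" "q - (q - Suc k) = Suc k" by auto
    then show "dv (q - k) (Suc (0 + k)) (\<xi> (q - Suc k)) - dh (q - k) (Suc (0 + k)) (\<xi> (q - k)) \<in> L (q - k) (Suc (0 + k))"
      using s[unfolded stair_def, THEN conjunct2, THEN conjunct2, THEN conjunct1, rule_format, of "q - Suc k"] k
      by (simp add: neg)
  qed (use s in \<open>simp_all add: stair_def\<close>)
  show ?thesis unfolding rel_def tr.rel_def Z using 1 2 by blast
qed

theorem hcorr_rel: "hcorr (rel q) (ZX q) (BX q) (ZY q) (BY q)"
proof -
  have B: "tr.BX q = BY q" "tr.BY q = BX q" "tr.ZX q = ZY q"
    by (simp_all add: tr.BX_def tr.BY_def BX_def BY_def tr.ZX_def ZY_def)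
  have sub: "subgrp (ZX q)" "subgrp (ZY q)"
    using subS subL by (auto simp: ZX_def ZY_def subgrp_def additive_diff[OF add_dv] additive_diff[OF add_dh]
        additive_zero[OF add_dv] additive_zero[OF add_dh])
  have diffs: "rel q (x - x') (y - y')" if "rel q x y" "rel q x' y'" for x x' y y'
    using that stair_diff[of 0 q x y _ x' y'] subgrp_diff[OF sub(1)] subgrp_diff[OF sub(2)]
    unfolding rel_def by blast
  have bds: "x \<in> BX q \<longleftrightarrow> y \<in> BY q" if "rel q x y" for x y
    using that rel_boundary[OF that] tr.rel_boundary[of q y x] by (auto simp: tr_rel B)
  have ex: "\<exists>x. rel q x y" if "y \<in> ZY q" for y
    using tr.rel_exists[of y q] that by (simp add: tr_rel B)
  have mem: "x \<in> ZX q \<and> y \<in> ZY q" if "rel q x y" for x y using that by (simp add: rel_def)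
  show ?thesis unfolding hcorr_def using rel_exists diffs bds ex mem by blast
qed

end

section \<open>Modules\<close>

context left_module
begin

lemma smult_zero_right: "a \<in> carrier R \<Longrightarrow> a \<odot>\<^bsub>M\<^esub> \<zero>\<^bsub>M\<^esub> = \<zero>\<^bsub>M\<^esub>"
  using smult_r_distr[of a "\<zero>\<^bsub>M\<^esub>" "\<zero>\<^bsub>M\<^esub>"] smult_closed[of a "\<zero>\<^bsub>M\<^esub>"] by (simp add: M.add.r_cancel_one')

lemma smult_zero_left: "x \<in> carrier M \<Longrightarrow> \<zero> \<odot>\<^bsub>M\<^esub> x = \<zero>\<^bsub>M\<^esub>"
  using smult_l_distr[of \<zero> \<zero> x] smult_closed[of \<zero> x] by (simp add: M.add.r_cancel_one')

lemma smult_finsum_left: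
  assumes "finite F" "f \<in> F \<rightarrow> carrier R" "x \<in> carrier M"
  shows "(\<Oplus>\<^bsub>R\<^esub>i\<in>F. f i) \<odot>\<^bsub>M\<^esub> x = (\<Oplus>\<^bsub>M\<^esub>i\<in>F. f i \<odot>\<^bsub>M\<^esub> x)"
  using assms(1,2)
proof (induction F rule: finite_induct)
  case (insert i F)
  then have f: "f i \<in> carrier R" "f \<in> F \<rightarrow> carrier R" by auto
  then have "(\<lambda>i. f i \<odot>\<^bsub>M\<^esub> x) \<in> F \<rightarrow> carrier M" using assms(3) smult_closed by auto
  with insert f show ?case
    by (simp add: R.finsum_insert M.finsum_insert smult_l_distr assms(3) smult_closed R.finsum_closed)
qed (simp add: smult_zero_left assms(3))

end

lemma linear_from_free:
  fixes R :: "'a ring" (structure) and M :: "('a, 'm) module"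
  assumes "left_module R M"
    and r: "r \<in> linear_maps R (free_left_module R X) M"
    and F: "finite F" "F \<subseteq> X" and phi: "\<phi> \<in> formal_combinations R X" "{b. \<phi> b \<noteq> \<zero>} \<subseteq> F"
  shows "r \<phi> = (\<Oplus>\<^bsub>M\<^esub>b\<in>F. \<phi> b \<odot>\<^bsub>M\<^esub> r (\<lambda>x. if x = b then \<one> else \<zero>))"
proof -
  interpret left_module R M by fact
  show ?thesis
  using F phi
proof (induction F arbitrary: \<phi> rule: finite_induct)
  have fc: "carrier (free_left_module R X) = formal_combinations R X" by (simp add: free_left_module_def)
  have radd: "r (\<lambda>x. f x \<oplus> g x) = r f \<oplus>\<^bsub>M\<^esub> r g" if "f \<in> formal_combinations R X" "g \<in> formal_combinations R X" for f g
    using r that by (auto simp: semilinear_maps_def free_left_module_def)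
  have rsm: "r (\<lambda>x. a \<otimes> f x) = a \<odot>\<^bsub>M\<^esub> r f" if "f \<in> formal_combinations R X" "a \<in> carrier R" for f a
    using r that by (auto simp: semilinear_maps_def free_left_module_def)
  have rc: "r f \<in> carrier M" if "f \<in> formal_combinations R X" for f
    using r that by (auto simp: semilinear_maps_def fc)
  {
    case empty
    then have "\<phi> = (\<lambda>x. \<zero> \<otimes> \<phi> x)"
      by (auto simp: formal_combinations_def fun_eq_iff)
    then have "r \<phi> = \<zero> \<odot>\<^bsub>M\<^esub> r \<phi>" using rsm[OF empty(2), of \<zero>] by simp
    then show ?case using rc[OF empty(2)] by (simp add: smult_zero_left)
  next
    case (insert b F)
    let ?\<delta> = "\<lambda>b x. if x = b then \<one> else \<zero>"
    have b: "b \<in> X" "\<phi> b \<in> carrier R" "F \<subseteq> X" using insert.prems by (auto simp: formal_combinations_def)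
    have \<delta>: "?\<delta> c \<in> formal_combinations R X" if "c \<in> X" for c
      using that by (auto simp: formal_combinations_def intro: finite_subset[of _ "{c}"])
    have p0: "\<phi>(b := \<zero>) \<in> formal_combinations R X"
      using insert.prems(2) by (auto simp: formal_combinations_def elim: rev_finite_subset)
    have p1: "(\<lambda>x. \<phi> b \<otimes> ?\<delta> b x) \<in> formal_combinations R X"
      using b \<delta>[OF b(1)] by (auto simp: formal_combinations_def intro: finite_subset[of _ "{b}"])
    have "\<phi> x \<in> carrier R" for x using insert.prems(2) by (cases "x \<in> X") (auto simp: formal_combinations_def)
    then have "\<phi> = (\<lambda>x. (\<phi>(b := \<zero>)) x \<oplus> \<phi> b \<otimes> ?\<delta> b x)" using b by (auto simp: fun_eq_iff)
    then have "r \<phi> = r (\<phi>(b := \<zero>)) \<oplus>\<^bsub>M\<^esub> \<phi> b \<odot>\<^bsub>M\<^esub> r (?\<delta> b)"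
      using radd[OF p0 p1] rsm[OF \<delta>[OF b(1)] b(2)] by simp
    also have "r (\<phi>(b := \<zero>)) = (\<Oplus>\<^bsub>M\<^esub>c\<in>F. (\<phi>(b := \<zero>)) c \<odot>\<^bsub>M\<^esub> r (?\<delta> c))"
      using insert.prems by (intro insert.IH b p0) auto
    also have "\<dots> = (\<Oplus>\<^bsub>M\<^esub>c\<in>F. \<phi> c \<odot>\<^bsub>M\<^esub> r (?\<delta> c))"
      using insert b rc[OF \<delta>] insert.prems(2)
      by (intro M.finsum_cong' refl) (auto simp: formal_combinations_def intro!: smult_closed)
    finally have eq: "r \<phi> = (\<Oplus>\<^bsub>M\<^esub>c\<in>F. \<phi> c \<odot>\<^bsub>M\<^esub> r (?\<delta> c)) \<oplus>\<^bsub>M\<^esub> \<phi> b \<odot>\<^bsub>M\<^esub> r (?\<delta> b)" .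
    have c: "(\<lambda>c. \<phi> c \<odot>\<^bsub>M\<^esub> r (?\<delta> c)) \<in> F \<rightarrow> carrier M" "\<phi> b \<odot>\<^bsub>M\<^esub> r (?\<delta> b) \<in> carrier M"
      using b rc[OF \<delta>] insert.prems(2) by (auto simp: formal_combinations_def intro!: smult_closed)
    show ?case
      unfolding eq M.finsum_insert[OF insert.hyps c] by (rule M.a_comm[OF M.finsum_closed[OF c(1)] c(2)])
  }
qed
qed

text \<open>The identity of the first factor tensored with \<open>f\<close>. On labels
  \<open>f\<close> is a plain function; its additivity matters only modulo relations.\<close>

definition lab :: "('c \<Rightarrow> 'c2) \<Rightarrow> ('s \<times> 'c \<Rightarrow>\<^sub>0 int) \<Rightarrow> ('s \<times> 'c2 \<Rightarrow>\<^sub>0 int)" where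
  "lab f = frag_extend (\<lambda>(t, x). frag_of (t, f x))"

lemma additive_lab: "additive (lab f)"
  unfolding lab_def by (rule additive_frag_extend)

lemma lab_of [simp]: "lab f (frag_of (t, x)) = frag_of (t, f x)"
  by (simp add: lab_def)

lemma lab_tens: "lab f (tens u x) = tens u (f x)"
  by (rule additive_eq_frags[OF additive_compose[OF additive_lab additive_tens] additive_tens frags_UNIV]) simp

lemma lab_lift: "lab f (lift F x) = lift F (lab f x)"
  by (rule additive_eq_frags[OF additive_compose[OF additive_lab additive_lift]
        additive_compose[OF additive_lift additive_lab] frags_UNIV]) (auto simp: lab_tens)

section \<open>The double complex of a group ring quotient\<close>

text \<open>The map \<open>R \<rightarrow> k[H]\<close> with kernel \<open>N\<close> splits as a map of right \<open>R\<close>-modules because of \<open>z\<close>; the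
  functions \<open>\<kappa> \<gamma>\<close> are its coordinates. The group \<open>H\<close> acts freely on the larger group \<open>\<Gamma>\<close>.\<close>

locale tor_side = R?: ring R + \<Gamma>: group \<Gamma>
  for R :: "'r ring" (structure) and \<Gamma> :: "'a monoid" +
  fixes P :: "nat \<Rightarrow> ('r, 'p) module" and d :: "nat \<Rightarrow> 'p \<Rightarrow> 'p"
    and H :: "'a set" and \<beta> :: "'a \<Rightarrow> 'r" and N :: "'r set" and z :: 'r and \<kappa> :: "'a \<Rightarrow> 'r \<Rightarrow> 'r"
  assumes H: "subgroup H \<Gamma>"
    and proj: "projective_module R (P i)"
    and d_lin: "d i \<in> linear_maps R (P (Suc i)) (P i)"
    and exact: "{x \<in> carrier (P (Suc i)). d i x = \<zero>\<^bsub>P i\<^esub>} = d (Suc i) ` carrier (P (Suc (Suc i)))"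
    and \<beta>_closed: "\<gamma> \<in> H \<Longrightarrow> \<beta> \<gamma> \<in> carrier R"
    and \<beta>_one: "\<beta> \<one>\<^bsub>\<Gamma>\<^esub> = \<one>"
    and \<beta>_mult: "\<gamma> \<in> H \<Longrightarrow> \<delta> \<in> H \<Longrightarrow> \<beta> (\<gamma> \<otimes>\<^bsub>\<Gamma>\<^esub> \<delta>) = \<beta> \<gamma> \<otimes> \<beta> \<delta>"
    and N_carrier: "N \<subseteq> carrier R"
    and \<beta>_N: "\<gamma> \<in> H \<Longrightarrow> \<nu> \<in> N \<Longrightarrow> \<beta> \<gamma> \<otimes> \<nu> \<in> N"
    and z: "z \<in> carrier R" and z_N: "\<nu> \<in> N \<Longrightarrow> z \<otimes> \<nu> = \<zero>" and one_z: "\<one> \<ominus> z \<in> N"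
    and \<kappa>_closed: "\<gamma> \<in> H \<Longrightarrow> a \<in> carrier R \<Longrightarrow> \<kappa> \<gamma> a \<in> carrier R"
    and \<kappa>_add: "\<gamma> \<in> H \<Longrightarrow> a \<in> carrier R \<Longrightarrow> b \<in> carrier R \<Longrightarrow> \<kappa> \<gamma> (a \<oplus> b) = \<kappa> \<gamma> a \<oplus> \<kappa> \<gamma> b"
    and \<kappa>_finite: "a \<in> carrier R \<Longrightarrow> finite {\<gamma> \<in> H. \<kappa> \<gamma> a \<noteq> \<zero>}"
    and \<kappa>_N: "\<gamma> \<in> H \<Longrightarrow> \<nu> \<in> N \<Longrightarrow> a \<in> carrier R \<Longrightarrow> \<kappa> \<gamma> (\<nu> \<otimes> a) = \<zero>"
    and \<kappa>_\<beta>: "\<gamma> \<in> H \<Longrightarrow> \<delta> \<in> H \<Longrightarrow> a \<in> carrier R \<Longrightarrow> \<kappa> (\<delta> \<otimes>\<^bsub>\<Gamma>\<^esub> \<gamma>) (\<beta> \<delta> \<otimes> a) = \<kappa> \<gamma> a"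
    and \<kappa>_decomp: "a \<in> carrier R \<Longrightarrow> a \<ominus> (\<Oplus>\<gamma>\<in>{\<gamma> \<in> H. \<kappa> \<gamma> a \<noteq> \<zero>}. \<beta> \<gamma> \<otimes> \<kappa> \<gamma> a) \<in> N"
begin

lemma lm: "left_module R (P j)"
  using proj by (simp add: projective_module_def)

lemma ab: "abelian_group (P j)"
  using lm by (simp add: left_module_def)

lemma H_carrier: "\<gamma> \<in> H \<Longrightarrow> \<gamma> \<in> carrier \<Gamma>"
  using subgroup.mem_carrier[OF H] .

lemma H_mult: "\<gamma> \<in> H \<Longrightarrow> \<delta> \<in> H \<Longrightarrow> \<gamma> \<otimes>\<^bsub>\<Gamma>\<^esub> \<delta> \<in> H"
  using subgroup.m_closed[OF H] .

lemma H_inv: "\<gamma> \<in> H \<Longrightarrow> inv\<^bsub>\<Gamma>\<^esub> \<gamma> \<in> H"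
  using subgroup.m_inv_closed[OF H] .

lemmas sm_closed = left_module.smult_closed[OF lm]
lemmas sm_assoc = left_module.smult_assoc[OF lm]
lemmas sm_one = left_module.smult_one[OF lm]
lemmas sm_rdist = left_module.smult_r_distr[OF lm]
lemmas sm_ldist = left_module.smult_l_distr[OF lm]
lemmas sm_zero = left_module.smult_zero_right[OF lm]
lemmas sm_zero' = left_module.smult_zero_left[OF lm]
lemmas pl_closed = abelian_monoid.a_closed[OF abelian_group.axioms(1)[OF ab]]
lemmas ze_closed = abelian_monoid.zero_closed[OF abelian_group.axioms(1)[OF ab]]
lemmas pl_zero = abelian_monoid.l_zero[OF abelian_group.axioms(1)[OF ab]]
  abelian_monoid.r_zero[OF abelian_group.axioms(1)[OF ab]]

lemma d_closed: "x \<in> carrier (P (Suc i)) \<Longrightarrow> d i x \<in> carrier (P i)"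
  and d_add: "x \<in> carrier (P (Suc i)) \<Longrightarrow> y \<in> carrier (P (Suc i)) \<Longrightarrow> d i (x \<oplus>\<^bsub>P (Suc i)\<^esub> y) = d i x \<oplus>\<^bsub>P i\<^esub> d i y"
  and d_smult: "x \<in> carrier (P (Suc i)) \<Longrightarrow> a \<in> carrier R \<Longrightarrow> d i (a \<odot>\<^bsub>P (Suc i)\<^esub> x) = a \<odot>\<^bsub>P i\<^esub> d i x"
  using d_lin[of i] by (auto simp: semilinear_maps_def)

lemma d_zero: "d i \<zero>\<^bsub>P (Suc i)\<^esub> = \<zero>\<^bsub>P i\<^esub>"
  using d_smult[of "\<zero>\<^bsub>P (Suc i)\<^esub>" i \<zero>] d_closed ze_closed by (simp add: sm_zero')

lemma d_d: "x \<in> carrier (P (Suc (Suc i))) \<Longrightarrow> d i (d (Suc i) x) = \<zero>\<^bsub>P i\<^esub>"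
  using exact[of i] by blast

definition T :: "nat \<Rightarrow> 'a list set" where
  "T k = tup (carrier \<Gamma>) k"

text \<open>Truncation is intended: indices 0 and 1 both take their generators from
  \<open>P 0\<close>, and index 0 merely has more relations.\<close>

definition pj :: "nat \<Rightarrow> nat" where
  "pj j = j - 1"

text \<open>Relations presenting the quotient of \<open>P j\<close> by \<open>N P j\<close> as an
  abelian group on its own elements.\<close>

definition QQ :: "nat \<Rightarrow> ('p \<Rightarrow>\<^sub>0 int) set" where
  "QQ j = {frag_of (x \<oplus>\<^bsub>P j\<^esub> y) - frag_of x - frag_of y | x y. x \<in> carrier (P j) \<and> y \<in> carrier (P j)} \<union>
     {frag_of (\<nu> \<odot>\<^bsub>P j\<^esub> x) | \<nu> x. \<nu> \<in> N \<and> x \<in> carrier (P j)}"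

text \<open>Column \<open>j + 1\<close> of the double complex is built from \<open>P j\<close>, and column \<open>0\<close> from the cokernel of
  \<open>d 0\<close>.\<close>

definition QE :: "nat \<Rightarrow> ('p \<Rightarrow>\<^sub>0 int) set" where
  "QE j = QQ (pj j) \<union> (if j = 0 then {frag_of (d 0 x) | x. x \<in> carrier (P 1)} else {})"

text \<open>Coinvariants for the diagonal action, where \<open>H\<close> acts on the second factor
  through \<open>\<beta>\<close>.\<close>

definition gR :: "nat \<Rightarrow> nat \<Rightarrow> ('a list \<times> 'p \<Rightarrow>\<^sub>0 int) set" where
  "gR i j = {frag_of (map (\<lambda>a. \<gamma> \<otimes>\<^bsub>\<Gamma>\<^esub> a) t, \<beta> \<gamma> \<odot>\<^bsub>P j\<^esub> x) - frag_of (t, x) | \<gamma> t x. \<gamma> \<in> H \<and> t \<in> T i \<and> x \<in> carrier (P j)}"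

definition S :: "nat \<Rightarrow> nat \<Rightarrow> ('a list \<times> 'p \<Rightarrow>\<^sub>0 int) set" where
  "S i j = frags (T i \<times> carrier (P (pj j)))"

definition L' :: "nat \<Rightarrow> nat \<Rightarrow> ('a list \<times> 'p \<Rightarrow>\<^sub>0 int) set" where
  "L' i j = spn (gR i (pj j) \<union> {ten2 t q | t q. t \<in> T i \<and> q \<in> QE j})"

definition L :: "nat \<Rightarrow> nat \<Rightarrow> ('a list \<times> 'p \<Rightarrow>\<^sub>0 int) set" where
  "L i j = (if i = 0 \<and> j = 0 then S 0 0 else L' i j)"

definition dh :: "nat \<Rightarrow> nat \<Rightarrow> ('a list \<times> 'p \<Rightarrow>\<^sub>0 int) \<Rightarrow> ('a list \<times> 'p \<Rightarrow>\<^sub>0 int)" where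
  "dh i j = lift bd"

text \<open>For \<open>j = 0\<close> the projection of \<open>P 0\<close> to the cokernel is the
  identity on generators, as both sides have the same generators.\<close>

definition dv :: "nat \<Rightarrow> nat \<Rightarrow> ('a list \<times> 'p \<Rightarrow>\<^sub>0 int) \<Rightarrow> ('a list \<times> 'p \<Rightarrow>\<^sub>0 int)" where
  "dv i j = (case j of 0 \<Rightarrow> (\<lambda>x. x) | Suc j' \<Rightarrow> lab (d j'))"

lemma pj_simps [simp]: "pj 0 = 0" "pj (Suc j) = j"
  by (simp_all add: pj_def)

lemma subgrp_L': "subgrp (L' i j)"
  unfolding L'_def by (rule subgrp_spn)

lemma subgrp_S: "subgrp (S i j)"
  unfolding S_def by (rule subgrp_frags)

lemma subgrp_L: "subgrp (L i j)"
  by (simp add: L_def subgrp_L' subgrp_S)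

lemma T_act: "\<gamma> \<in> carrier \<Gamma> \<Longrightarrow> t \<in> T i \<Longrightarrow> map (\<lambda>a. \<gamma> \<otimes>\<^bsub>\<Gamma>\<^esub> a) t \<in> T i"
  by (auto simp: T_def tup_def)

lemma ten2_diff: "ten2 t (a - b) = ten2 t a - ten2 t b"
  by (rule additive_diff[OF additive_ten2])

lemma L_S: "L' i j \<subseteq> S i j"
proof -
  have q: "q \<in> frags (carrier (P (pj j)))" if "q \<in> QE j" for q
    using that N_carrier by (auto simp: QE_def QQ_def intro!: subgrp_diff[OF subgrp_frags] pl_closed sm_closed d_closed
        split: if_splits)
  have "ten2 t q \<in> S i j" if "t \<in> T i" "q \<in> QE j" for t q
    unfolding S_def by (rule additive_image_frags[OF additive_ten2 subgrp_frags _ q[OF that(2)]]) (use that in simp)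
  moreover have "gR i (pj j) \<subseteq> S i j"
    by (auto simp: gR_def S_def intro!: subgrp_diff[OF subgrp_frags] T_act H_carrier sm_closed \<beta>_closed)
  ultimately show ?thesis
    unfolding L'_def by (intro spn_least[OF subgrp_S] Un_least) blast+
qed

lemma rel_add: "t \<in> T i \<Longrightarrow> x \<in> carrier (P (pj j)) \<Longrightarrow> y \<in> carrier (P (pj j)) \<Longrightarrow>
    frag_of (t, x \<oplus>\<^bsub>P (pj j)\<^esub> y) - frag_of (t, x) - frag_of (t, y) \<in> L' i j"
proof -
  assume a: "t \<in> T i" "x \<in> carrier (P (pj j))" "y \<in> carrier (P (pj j))"
  then have "frag_of (x \<oplus>\<^bsub>P (pj j)\<^esub> y) - frag_of x - frag_of y \<in> QE j" by (auto simp: QE_def QQ_def)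
  then have "ten2 t (frag_of (x \<oplus>\<^bsub>P (pj j)\<^esub> y) - frag_of x - frag_of y) \<in> L' i j"
    unfolding L'_def using a(1) by (intro spn_base) blast
  then show ?thesis by (simp add: ten2_diff)
qed

lemma rel_N: "t \<in> T i \<Longrightarrow> \<nu> \<in> N \<Longrightarrow> x \<in> carrier (P (pj j)) \<Longrightarrow> frag_of (t, \<nu> \<odot>\<^bsub>P (pj j)\<^esub> x) \<in> L' i j"
proof -
  assume a: "t \<in> T i" "\<nu> \<in> N" "x \<in> carrier (P (pj j))"
  then have "frag_of (\<nu> \<odot>\<^bsub>P (pj j)\<^esub> x) \<in> QE j" by (auto simp: QE_def QQ_def)
  then have "ten2 t (frag_of (\<nu> \<odot>\<^bsub>P (pj j)\<^esub> x)) \<in> L' i j"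
    unfolding L'_def using a(1) by (intro spn_base) blast
  then show ?thesis by simp
qed

lemma rel_d: "t \<in> T i \<Longrightarrow> x \<in> carrier (P 1) \<Longrightarrow> frag_of (t, d 0 x) \<in> L' i 0"
proof -
  assume a: "t \<in> T i" "x \<in> carrier (P 1)"
  then have "frag_of (d 0 x) \<in> QE 0" by (auto simp: QE_def)
  then have "ten2 t (frag_of (d 0 x)) \<in> L' i 0"
    unfolding L'_def using a(1) by (intro spn_base) blast
  then show ?thesis by simp
qed

lemma rel_g: "t \<in> T i \<Longrightarrow> \<gamma> \<in> H \<Longrightarrow> x \<in> carrier (P (pj j)) \<Longrightarrow>
    frag_of (map (\<lambda>a. \<gamma> \<otimes>\<^bsub>\<Gamma>\<^esub> a) t, \<beta> \<gamma> \<odot>\<^bsub>P (pj j)\<^esub> x) - frag_of (t, x) \<in> L' i j"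
  unfolding L'_def by (rule spn_base) (auto simp: gR_def)

lemma rel_zero: "t \<in> T i \<Longrightarrow> frag_of (t, \<zero>\<^bsub>P (pj j)\<^esub>) \<in> L' i j"
proof -
  assume "t \<in> T i"
  then have "- (frag_of (t, \<zero>\<^bsub>P (pj j)\<^esub> \<oplus>\<^bsub>P (pj j)\<^esub> \<zero>\<^bsub>P (pj j)\<^esub>) - frag_of (t, \<zero>\<^bsub>P (pj j)\<^esub>) - frag_of (t, \<zero>\<^bsub>P (pj j)\<^esub>)) \<in> L' i j"
    by (intro subgrp_uminus[OF subgrp_L'] rel_add ze_closed)
  then show ?thesis by (simp add: pl_zero ze_closed)
qed

lemma rel_sum:
  assumes "t \<in> T i" "finite F" "f \<in> F \<rightarrow> carrier (P (pj j))"
  shows "frag_of (t, finsum (P (pj j)) f F) - (\<Sum>b\<in>F. frag_of (t, f b)) \<in> L' i j"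
  using assms(2,3)
proof (induction F rule: finite_induct)
  case empty
  show ?case using rel_zero[OF assms(1)] by (simp add: abelian_monoid.finsum_empty[OF abelian_group.axioms(1)[OF ab]])
next
  case (insert b F)
  interpret A: abelian_group "P (pj j)" by (rule ab)
  have f: "f \<in> F \<rightarrow> carrier (P (pj j))" "f b \<in> carrier (P (pj j))" using insert by auto
  have "frag_of (t, f b \<oplus>\<^bsub>P (pj j)\<^esub> finsum (P (pj j)) f F) - frag_of (t, f b) - frag_of (t, finsum (P (pj j)) f F)
    + (frag_of (t, finsum (P (pj j)) f F) - (\<Sum>b\<in>F. frag_of (t, f b))) \<in> L' i j"
    by (intro subgrp_add[OF subgrp_L'] rel_add assms(1) insert.IH f A.finsum_closed)
  then show ?case using insert f by (simp add: A.finsum_insert algebra_simps)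
qed

lemma L'_induct:
  assumes "additive F" "subgrp M" "x \<in> L' i j"
    "\<And>\<gamma> t x. \<gamma> \<in> H \<Longrightarrow> t \<in> T i \<Longrightarrow> x \<in> carrier (P (pj j)) \<Longrightarrow>
      F (frag_of (map (\<lambda>a. \<gamma> \<otimes>\<^bsub>\<Gamma>\<^esub> a) t, \<beta> \<gamma> \<odot>\<^bsub>P (pj j)\<^esub> x)) - F (frag_of (t, x)) \<in> M"
    "\<And>t x y. t \<in> T i \<Longrightarrow> x \<in> carrier (P (pj j)) \<Longrightarrow> y \<in> carrier (P (pj j)) \<Longrightarrow>
      F (frag_of (t, x \<oplus>\<^bsub>P (pj j)\<^esub> y)) - F (frag_of (t, x)) - F (frag_of (t, y)) \<in> M"
    "\<And>t \<nu> x. t \<in> T i \<Longrightarrow> \<nu> \<in> N \<Longrightarrow> x \<in> carrier (P (pj j)) \<Longrightarrow> F (frag_of (t, \<nu> \<odot>\<^bsub>P (pj j)\<^esub> x)) \<in> M"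
    "\<And>t x. j = 0 \<Longrightarrow> t \<in> T i \<Longrightarrow> x \<in> carrier (P 1) \<Longrightarrow> F (frag_of (t, d 0 x)) \<in> M"
  shows "F x \<in> M"
proof (rule spn_image[OF assms(1,2) _ assms(3)[unfolded L'_def]])
  fix r assume "r \<in> gR i (pj j) \<union> {ten2 t q | t q. t \<in> T i \<and> q \<in> QE j}"
  then show "F r \<in> M"
  proof (elim UnE)
    assume "r \<in> gR i (pj j)"
    then show "F r \<in> M" using assms(4) by (auto simp: gR_def additive_diff[OF assms(1)])
  next
    assume "r \<in> {ten2 t q | t q. t \<in> T i \<and> q \<in> QE j}"
    then obtain t q where r: "r = ten2 t q" "t \<in> T i" "q \<in> QE j" by blast
    then show "F r \<in> M"
      using assms(5,6)[OF r(2)] assms(7)[OF _ r(2)]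
      by (auto simp: QE_def QQ_def ten2_diff additive_diff[OF assms(1)] split: if_splits)
  qed
qed

end

section \<open>Exact rows: a contraction obtained from projectivity\<close>

context tor_side
begin

lemma \<kappa>_zero: "\<gamma> \<in> H \<Longrightarrow> \<kappa> \<gamma> \<zero> = \<zero>"
  using \<kappa>_add[of \<gamma> \<zero> \<zero>] \<kappa>_closed[of \<gamma> \<zero>] by (simp add: R.add.r_cancel_one')

lemma \<beta>_smult: "\<gamma> \<in> H \<Longrightarrow> \<delta> \<in> H \<Longrightarrow> x \<in> carrier (P j) \<Longrightarrow>
    \<beta> (\<gamma> \<otimes>\<^bsub>\<Gamma>\<^esub> \<delta>) \<odot>\<^bsub>P j\<^esub> x = \<beta> \<gamma> \<odot>\<^bsub>P j\<^esub> (\<beta> \<delta> \<odot>\<^bsub>P j\<^esub> x)"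
  by (simp add: \<beta>_mult \<beta>_closed sm_assoc)

text \<open>A projective module is a retract of a free one, and modulo \<open>N\<close> each
  coefficient \<open>a\<close> of a basis element is the sum of the products
  \<open>\<beta> \<gamma> \<otimes> \<kappa> \<gamma> a\<close>. Prefixing \<open>\<gamma>\<close>
  to the tuple on the corresponding summand of \<open>x\<close> is the standard contraction for an
  induced module; unlike a cone over a fixed vertex it is equivariant.\<close>

lemma row_contraction:
  obtains h where "additive h"
    "\<And>i x. x \<in> frags (T i \<times> carrier (P j)) \<Longrightarrow> h x \<in> frags (T (Suc i) \<times> carrier (P j))"
    "\<And>i x. x \<in> L' i (Suc j) \<Longrightarrow> h x \<in> L' (Suc i) (Suc j)"
    "\<And>i x. x \<in> frags (T i \<times> carrier (P j)) \<Longrightarrow> lift bd (h x) + h (lift bd x) - x \<in> L' i (Suc j)"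
proof -
  obtain X :: "'p set" and s r where
    s: "s \<in> linear_maps R (P j) (free_left_module R X)" and
    r: "r \<in> linear_maps R (free_left_module R X) (P j)" and
    rs: "\<And>x. x \<in> carrier (P j) \<Longrightarrow> r (s x) = x"
    using proj[of j] unfolding projective_module_def by blast
  interpret A: left_module R "P j" by (rule lm)
  define rb where "rb b = r (\<lambda>x. if x = b then \<one> else \<zero>)" for b
  have fc: "carrier (free_left_module R X) = formal_combinations R X" by (simp add: free_left_module_def)
  have sx: "s x \<in> formal_combinations R X" if "x \<in> carrier (P j)" for x
    using s that by (auto simp: semilinear_maps_def fc)
  have rb: "rb b \<in> carrier (P j)" if "b \<in> X" for b
  proof -
    have "(\<lambda>x. if x = b then \<one> else \<zero>) \<in> formal_combinations R X"
      using that by (auto simp: formal_combinations_def intro: finite_subset[of _ "{b}"])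
    then show ?thesis using r by (auto simp: semilinear_maps_def fc rb_def)
  qed
  define B where "B x = {b. s x b \<noteq> \<zero>}" for x
  define G where "G a = {\<gamma> \<in> H. \<kappa> \<gamma> a \<noteq> \<zero>}" for a
  have B: "finite (B x)" "B x \<subseteq> X" and sc: "\<And>b. s x b \<in> carrier R" if "x \<in> carrier (P j)" for x
  proof -
    show "finite (B x)" "B x \<subseteq> X" using sx[OF that] by (auto simp: formal_combinations_def B_def)
    show "s x b \<in> carrier R" for b using sx[OF that] by (cases "b \<in> X") (auto simp: formal_combinations_def)
  qed
  have G: "finite (G a)" "G a \<subseteq> H" if "a \<in> carrier R" for a
    using \<kappa>_finite[OF that] by (auto simp: G_def)
  define y where "y b \<gamma> x = \<beta> \<gamma> \<odot>\<^bsub>P j\<^esub> (\<kappa> \<gamma> (s x b) \<odot>\<^bsub>P j\<^esub> rb b)" for b \<gamma> x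
  have yc: "y b \<gamma> x \<in> carrier (P j)" if "b \<in> X" "\<gamma> \<in> H" "x \<in> carrier (P j)" for b \<gamma> x
    unfolding y_def using that by (intro sm_closed \<beta>_closed \<kappa>_closed sc rb)
  \<comment> \<open>Only terms that vanish are omitted from \<open>I x\<close>. Enlarging the index
    set adds generators with label zero, which are relations (see \<open>sup\<close> below), so
    different elements can be compared over a common index set.\<close>
  define I where "I x = Sigma (B x) (\<lambda>b. G (s x b))" for x
  have I: "finite (I x)" "I x \<subseteq> X \<times> H" if "x \<in> carrier (P j)" for x
    using B[OF that] G[OF sc[OF that]] by (auto simp: I_def)
  have y0: "y b \<gamma> x = \<zero>\<^bsub>P j\<^esub>" if "b \<in> X" "\<gamma> \<in> H" "x \<in> carrier (P j)" "(b, \<gamma>) \<notin> I x" for b \<gamma> x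
  proof -
    have "\<kappa> \<gamma> (s x b) = \<zero>" using that \<kappa>_zero by (auto simp: I_def B_def G_def)
    then show ?thesis using that rb by (simp add: y_def sm_zero' sm_zero \<beta>_closed)
  qed
  define h0 where "h0 t x = (\<Sum>(b, \<gamma>)\<in>I x. frag_of (\<gamma> # t, y b \<gamma> x))" for t x
  define h where "h = frag_extend (\<lambda>(t, x). h0 t x)"
  have ah: "additive h" by (simp add: h_def additive_frag_extend)
  have h_of: "h (frag_of (t, x)) = h0 t x" for t x by (simp add: h_def)
  have gT: "\<gamma> # t \<in> T (Suc i)" if "\<gamma> \<in> H" "t \<in> T i" for \<gamma> t i
    using that H_carrier by (auto simp: T_def tup_def)
  have sup: "h0 t x - (\<Sum>(b, \<gamma>)\<in>F. frag_of (\<gamma> # t, y b \<gamma> x)) \<in> L' (Suc i) (Suc j)"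
    if "finite F" "I x \<subseteq> F" "F \<subseteq> X \<times> H" "t \<in> T i" "x \<in> carrier (P j)" for F x t i
  proof -
    have "(\<Sum>(b, \<gamma>)\<in>F. frag_of (\<gamma> # t, y b \<gamma> x)) = h0 t x + (\<Sum>(b, \<gamma>)\<in>F - I x. frag_of (\<gamma> # t, y b \<gamma> x))"
      using that(1,2) by (simp add: h0_def sum.subset_diff[of "I x" F])
    moreover have "(\<Sum>(b, \<gamma>)\<in>F - I x. frag_of (\<gamma> # t, y b \<gamma> x)) \<in> L' (Suc i) (Suc j)"
    proof (intro subgrp_sum[OF subgrp_L'], clarify)
      fix b \<gamma> assume "(b, \<gamma>) \<in> F" "(b, \<gamma>) \<notin> I x"
      then show "frag_of (\<gamma> # t, y b \<gamma> x) \<in> L' (Suc i) (Suc j)"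
        using rel_zero[OF gT[OF _ that(4)], of \<gamma> "Suc j"] y0[of b \<gamma> x] that(3,5) by auto
    qed
    ultimately show ?thesis using subgrp_uminus[OF subgrp_L'] by simp
  qed
  have h_in: "h0 t x \<in> frags (T (Suc i) \<times> carrier (P j))" if "t \<in> T i" "x \<in> carrier (P j)" for t x i
    unfolding h0_def using I(2)[OF that(2)] that by (auto intro!: subgrp_sum[OF subgrp_frags] gT yc)
  have h_add: "h0 t (x \<oplus>\<^bsub>P j\<^esub> x') - h0 t x - h0 t x' \<in> L' (Suc i) (Suc j)"
    if t: "t \<in> T i" and x: "x \<in> carrier (P j)" "x' \<in> carrier (P j)" for t x x' i
  proof -
    let ?x = "x \<oplus>\<^bsub>P j\<^esub> x'"
    have xx: "?x \<in> carrier (P j)" using x by (rule pl_closed)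
    define F where "F = I x \<union> I x' \<union> I ?x"
    have F: "finite F" "F \<subseteq> X \<times> H" using I[OF x(1)] I[OF x(2)] I[OF xx] by (auto simp: F_def)
    define g where "g u = (\<Sum>(b, \<gamma>)\<in>F. frag_of (\<gamma> # t, y b \<gamma> u))" for u
    have 1: "h0 t u - g u \<in> L' (Suc i) (Suc j)" if "I u \<subseteq> F" "u \<in> carrier (P j)" for u
      unfolding g_def by (rule sup[OF F(1) that(1) F(2) t that(2)])
    have "g ?x - g x - g x' = (\<Sum>(b, \<gamma>)\<in>F. frag_of (\<gamma> # t, y b \<gamma> ?x) - frag_of (\<gamma> # t, y b \<gamma> x) - frag_of (\<gamma> # t, y b \<gamma> x'))"
      by (simp add: g_def sum_subtractf case_prod_unfold)
    also have "\<dots> \<in> L' (Suc i) (Suc j)"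
    proof (intro subgrp_sum[OF subgrp_L'], clarify)
      fix b \<gamma> assume "(b, \<gamma>) \<in> F"
      then have bg: "b \<in> X" "\<gamma> \<in> H" using F by auto
      have "s ?x b = s x b \<oplus> s x' b" using s x by (auto simp: semilinear_maps_def free_left_module_def)
      then have "y b \<gamma> ?x = y b \<gamma> x \<oplus>\<^bsub>P j\<^esub> y b \<gamma> x'"
        using bg x rb by (simp add: y_def \<kappa>_add sc sm_ldist \<kappa>_closed sm_rdist \<beta>_closed sm_closed)
      then show "frag_of (\<gamma> # t, y b \<gamma> ?x) - frag_of (\<gamma> # t, y b \<gamma> x) - frag_of (\<gamma> # t, y b \<gamma> x') \<in> L' (Suc i) (Suc j)"
        using rel_add[OF gT[OF bg(2) t], of "y b \<gamma> x" "Suc j" "y b \<gamma> x'"] yc bg x by simp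
    qed
    finally have 2: "g ?x - g x - g x' \<in> L' (Suc i) (Suc j)" .
    have "h0 t ?x - h0 t x - h0 t x' = (g ?x - g x - g x') + (h0 t ?x - g ?x) - (h0 t x - g x) - (h0 t x' - g x')" by simp
    also have "\<dots> \<in> L' (Suc i) (Suc j)"
      by (rule subgrp_diff[OF subgrp_L' subgrp_diff[OF subgrp_L' subgrp_add[OF subgrp_L' 2 1] 1] 1])
         (use x xx in \<open>auto simp: F_def\<close>)
    finally show ?thesis .
  qed
  have s_sm: "s (a \<odot>\<^bsub>P j\<^esub> x) b = a \<otimes> s x b" if "a \<in> carrier R" "x \<in> carrier (P j)" for a x b
    using s that by (auto simp: semilinear_maps_def free_left_module_def)
  have h_N: "h0 t (\<nu> \<odot>\<^bsub>P j\<^esub> x) = 0" if "\<nu> \<in> N" "x \<in> carrier (P j)" for t \<nu> x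
  proof -
    have "I (\<nu> \<odot>\<^bsub>P j\<^esub> x) = {}"
      using that N_carrier by (auto simp: I_def G_def s_sm \<kappa>_N sc subset_iff)
    then show ?thesis by (simp add: h0_def)
  qed
  have h_g: "h0 (map (\<lambda>a. \<delta> \<otimes>\<^bsub>\<Gamma>\<^esub> a) t) (\<beta> \<delta> \<odot>\<^bsub>P j\<^esub> x) - h0 t x \<in> L' (Suc i) (Suc j)"
    if d: "\<delta> \<in> H" and t: "t \<in> T i" and x: "x \<in> carrier (P j)" for \<delta> t x i
  proof -
    have sb: "s (\<beta> \<delta> \<odot>\<^bsub>P j\<^esub> x) b = \<beta> \<delta> \<otimes> s x b" for b using s_sm[OF \<beta>_closed[OF d] x] .
    have k: "\<kappa> (\<delta> \<otimes>\<^bsub>\<Gamma>\<^esub> \<gamma>) (\<beta> \<delta> \<otimes> s x b) = \<kappa> \<gamma> (s x b)" if "\<gamma> \<in> H" for \<gamma> b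
      by (rule \<kappa>_\<beta>[OF that d sc[OF x]])
    have inv: "\<delta> \<otimes>\<^bsub>\<Gamma>\<^esub> (inv\<^bsub>\<Gamma>\<^esub> \<delta> \<otimes>\<^bsub>\<Gamma>\<^esub> \<gamma>) = \<gamma>" "inv\<^bsub>\<Gamma>\<^esub> \<delta> \<otimes>\<^bsub>\<Gamma>\<^esub> (\<delta> \<otimes>\<^bsub>\<Gamma>\<^esub> \<gamma>) = \<gamma>" if "\<gamma> \<in> H" for \<gamma>
      using that d H_carrier by (simp_all add: \<Gamma>.m_assoc[symmetric])
    have bz: "s x b \<noteq> \<zero>" if "\<kappa> \<gamma> (s x b) \<noteq> \<zero>" "\<gamma> \<in> H" for b \<gamma> using that \<kappa>_zero by auto
    have bz': "\<beta> \<delta> \<otimes> s x b \<noteq> \<zero>" if "\<kappa> \<gamma> (\<beta> \<delta> \<otimes> s x b) \<noteq> \<zero>" "\<gamma> \<in> H" for b \<gamma> using that \<kappa>_zero by auto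
    have Ib: "(b, \<delta> \<otimes>\<^bsub>\<Gamma>\<^esub> \<gamma>) \<in> I (\<beta> \<delta> \<odot>\<^bsub>P j\<^esub> x)" if "(b, \<gamma>) \<in> I x" for b \<gamma>
    proof -
      have g: "\<gamma> \<in> H" "\<kappa> \<gamma> (s x b) \<noteq> \<zero>" using that by (auto simp: I_def G_def)
      then have "\<kappa> (\<delta> \<otimes>\<^bsub>\<Gamma>\<^esub> \<gamma>) (\<beta> \<delta> \<otimes> s x b) \<noteq> \<zero>" using k by simp
      then show ?thesis using bz'[of "\<delta> \<otimes>\<^bsub>\<Gamma>\<^esub> \<gamma>" b] H_mult[OF d g(1)] by (auto simp: I_def B_def G_def sb)
    qed
    have Ib': "(b, inv\<^bsub>\<Gamma>\<^esub> \<delta> \<otimes>\<^bsub>\<Gamma>\<^esub> \<gamma>) \<in> I x" if "(b, \<gamma>) \<in> I (\<beta> \<delta> \<odot>\<^bsub>P j\<^esub> x)" for b \<gamma>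
    proof -
      have g: "\<gamma> \<in> H" "\<kappa> \<gamma> (\<beta> \<delta> \<otimes> s x b) \<noteq> \<zero>" using that by (auto simp: I_def G_def sb)
      then have "inv\<^bsub>\<Gamma>\<^esub> \<delta> \<otimes>\<^bsub>\<Gamma>\<^esub> \<gamma> \<in> H" using H_inv[OF d] H_mult by blast
      moreover from this have "\<kappa> (inv\<^bsub>\<Gamma>\<^esub> \<delta> \<otimes>\<^bsub>\<Gamma>\<^esub> \<gamma>) (s x b) \<noteq> \<zero>" using k[of "inv\<^bsub>\<Gamma>\<^esub> \<delta> \<otimes>\<^bsub>\<Gamma>\<^esub> \<gamma>" b] g inv(1) by simp
      ultimately show ?thesis using bz by (auto simp: I_def B_def G_def)
    qed
    \<comment> \<open>By \<open>\<kappa>_\<beta>\<close> the coordinates are permuted by left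
      translation, so the sum is reindexed from \<open>\<gamma>\<close> to the product of
      \<open>\<delta>\<close> and \<open>\<gamma>\<close>.\<close>
    have "h0 (map (\<lambda>a. \<delta> \<otimes>\<^bsub>\<Gamma>\<^esub> a) t) (\<beta> \<delta> \<odot>\<^bsub>P j\<^esub> x) =
      (\<Sum>(b, \<gamma>)\<in>I x. frag_of ((\<delta> \<otimes>\<^bsub>\<Gamma>\<^esub> \<gamma>) # map (\<lambda>a. \<delta> \<otimes>\<^bsub>\<Gamma>\<^esub> a) t, \<beta> \<delta> \<odot>\<^bsub>P j\<^esub> y b \<gamma> x))"
      unfolding h0_def
    proof (rule sum.reindex_bij_witness[of _ "\<lambda>(b, \<gamma>). (b, \<delta> \<otimes>\<^bsub>\<Gamma>\<^esub> \<gamma>)" "\<lambda>(b, \<gamma>). (b, inv\<^bsub>\<Gamma>\<^esub> \<delta> \<otimes>\<^bsub>\<Gamma>\<^esub> \<gamma>)"], goal_cases)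
      case (5 p)
      obtain b \<gamma> where p: "p = (b, \<gamma>)" by (cases p)
      have i: "(b, inv\<^bsub>\<Gamma>\<^esub> \<delta> \<otimes>\<^bsub>\<Gamma>\<^esub> \<gamma>) \<in> I x" using 5 p Ib' by simp
      then have h: "inv\<^bsub>\<Gamma>\<^esub> \<delta> \<otimes>\<^bsub>\<Gamma>\<^esub> \<gamma> \<in> H" "b \<in> X" "\<gamma> \<in> H" using I(2)[OF x] 5 p by (auto simp: I_def G_def)
      have "y b \<gamma> (\<beta> \<delta> \<odot>\<^bsub>P j\<^esub> x) = \<beta> \<delta> \<odot>\<^bsub>P j\<^esub> y b (inv\<^bsub>\<Gamma>\<^esub> \<delta> \<otimes>\<^bsub>\<Gamma>\<^esub> \<gamma>) x"
        using \<beta>_smult[OF d h(1), of "\<kappa> \<gamma> (\<beta> \<delta> \<otimes> s x b) \<odot>\<^bsub>P j\<^esub> rb b" j] k[OF h(1), of b] inv(1)[OF h(3)] h x d rb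
        by (simp add: y_def sb sm_closed \<kappa>_closed sc)
      then show ?case using p inv(1)[OF h(3)] by simp
    qed (use Ib Ib' I(2) I_def G_def inv x in \<open>auto simp: I_def G_def\<close>)
    then have "h0 (map (\<lambda>a. \<delta> \<otimes>\<^bsub>\<Gamma>\<^esub> a) t) (\<beta> \<delta> \<odot>\<^bsub>P j\<^esub> x) - h0 t x =
      (\<Sum>(b, \<gamma>)\<in>I x. frag_of (map (\<lambda>a. \<delta> \<otimes>\<^bsub>\<Gamma>\<^esub> a) (\<gamma> # t), \<beta> \<delta> \<odot>\<^bsub>P j\<^esub> y b \<gamma> x) - frag_of (\<gamma> # t, y b \<gamma> x))"
      by (simp add: h0_def sum_subtractf case_prod_unfold)
    also have "\<dots> \<in> L' (Suc i) (Suc j)"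
    proof (intro subgrp_sum[OF subgrp_L'], clarify)
      fix b \<gamma> assume "(b, \<gamma>) \<in> I x"
      then have "b \<in> X" "\<gamma> \<in> H" using I(2)[OF x] by auto
      then show "frag_of (map (\<lambda>a. \<delta> \<otimes>\<^bsub>\<Gamma>\<^esub> a) (\<gamma> # t), \<beta> \<delta> \<odot>\<^bsub>P j\<^esub> y b \<gamma> x) - frag_of (\<gamma> # t, y b \<gamma> x) \<in> L' (Suc i) (Suc j)"
        using rel_g[OF gT[OF _ t] d, of \<gamma> "y b \<gamma> x" "Suc j"] yc[OF _ _ x] by simp
    qed
    finally show ?thesis .
  qed
  \<comment> \<open>The components of \<open>x\<close> add up to \<open>x\<close>: first over
    \<open>\<gamma>\<close>, modulo \<open>N\<close>, for each basis element, and then over the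
    basis.\<close>
  have unit: "(\<Sum>(b, \<gamma>)\<in>I x. frag_of (t, y b \<gamma> x)) - frag_of (t, x) \<in> L' i (Suc j)"
    if t: "t \<in> T i" and x: "x \<in> carrier (P j)" for t x i
  proof -
    have sum: "(\<Sum>(b, \<gamma>)\<in>I x. frag_of (t, y b \<gamma> x)) = (\<Sum>b\<in>B x. \<Sum>\<gamma>\<in>G (s x b). frag_of (t, y b \<gamma> x))"
      unfolding I_def using B(1)[OF x] G(1)[OF sc[OF x]] by (subst sum.Sigma) auto
    have in1: "(\<Sum>\<gamma>\<in>G (s x b). frag_of (t, y b \<gamma> x)) - frag_of (t, s x b \<odot>\<^bsub>P j\<^esub> rb b) \<in> L' i (Suc j)" if b: "b \<in> B x" for b
    proof -
      let ?a = "s x b"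
      have bX: "b \<in> X" and a: "?a \<in> carrier R" using B(2)[OF x] b sc[OF x] by auto
      define f where "f = (\<Oplus>\<gamma>\<in>G ?a. \<beta> \<gamma> \<otimes> \<kappa> \<gamma> ?a)"
      have fin: "(\<lambda>\<gamma>. \<beta> \<gamma> \<otimes> \<kappa> \<gamma> ?a) \<in> G ?a \<rightarrow> carrier R" using a by (auto simp: G_def \<beta>_closed \<kappa>_closed)
      have f: "f \<in> carrier R" unfolding f_def using fin by (rule R.finsum_closed)
      have nu: "?a \<ominus> f \<in> N" using \<kappa>_decomp[OF a] by (simp add: f_def G_def)
      have "(\<Oplus>\<^bsub>P j\<^esub>\<gamma>\<in>G ?a. y b \<gamma> x) = f \<odot>\<^bsub>P j\<^esub> rb b"
        unfolding f_def A.smult_finsum_left[OF G(1)[OF a] fin rb[OF bX]]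
        using a rb[OF bX] by (intro A.M.finsum_cong' refl) (auto simp: y_def G_def sm_assoc \<beta>_closed \<kappa>_closed sm_closed)
      then have 1: "frag_of (t, f \<odot>\<^bsub>P j\<^esub> rb b) - (\<Sum>\<gamma>\<in>G ?a. frag_of (t, y b \<gamma> x)) \<in> L' i (Suc j)"
        using rel_sum[OF t G(1)[OF a], of "\<lambda>\<gamma>. y b \<gamma> x" "Suc j"] yc[OF bX _ x] by (auto simp: G_def)
      have "?a = (?a \<ominus> f) \<oplus> f" using a f by (simp add: R.minus_eq R.a_assoc R.l_neg)
      then have "?a \<odot>\<^bsub>P j\<^esub> rb b = (?a \<ominus> f) \<odot>\<^bsub>P j\<^esub> rb b \<oplus>\<^bsub>P j\<^esub> f \<odot>\<^bsub>P j\<^esub> rb b"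
        using a f rb[OF bX] sm_ldist[of "?a \<ominus> f" f "rb b" j] by simp
      then have 2: "frag_of (t, ?a \<odot>\<^bsub>P j\<^esub> rb b) - frag_of (t, (?a \<ominus> f) \<odot>\<^bsub>P j\<^esub> rb b) - frag_of (t, f \<odot>\<^bsub>P j\<^esub> rb b) \<in> L' i (Suc j)"
        using rel_add[OF t, of "(?a \<ominus> f) \<odot>\<^bsub>P j\<^esub> rb b" "Suc j" "f \<odot>\<^bsub>P j\<^esub> rb b"] a f rb[OF bX] by (simp add: sm_closed)
      have 3: "frag_of (t, (?a \<ominus> f) \<odot>\<^bsub>P j\<^esub> rb b) \<in> L' i (Suc j)"
        using rel_N[OF t nu, of "rb b" "Suc j"] rb[OF bX] by simp
      have "- (frag_of (t, ?a \<odot>\<^bsub>P j\<^esub> rb b) - frag_of (t, (?a \<ominus> f) \<odot>\<^bsub>P j\<^esub> rb b) - frag_of (t, f \<odot>\<^bsub>P j\<^esub> rb b)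
         + frag_of (t, (?a \<ominus> f) \<odot>\<^bsub>P j\<^esub> rb b)
         + (frag_of (t, f \<odot>\<^bsub>P j\<^esub> rb b) - (\<Sum>\<gamma>\<in>G ?a. frag_of (t, y b \<gamma> x)))) \<in> L' i (Suc j)"
        by (rule subgrp_uminus[OF subgrp_L' subgrp_add[OF subgrp_L' subgrp_add[OF subgrp_L' 2 3] 1]])
      then show ?thesis by simp
    qed
    have "x = (\<Oplus>\<^bsub>P j\<^esub>b\<in>B x. s x b \<odot>\<^bsub>P j\<^esub> rb b)"
      using linear_from_free[OF lm r B(1,2)[OF x] sx[OF x]] rs[OF x] by (simp add: rb_def B_def)
    then have "frag_of (t, x) - (\<Sum>b\<in>B x. frag_of (t, s x b \<odot>\<^bsub>P j\<^esub> rb b)) \<in> L' i (Suc j)"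
      using rel_sum[OF t B(1)[OF x], of "\<lambda>b. s x b \<odot>\<^bsub>P j\<^esub> rb b" "Suc j"] B(2)[OF x] rb sc[OF x]
      by (auto simp: sm_closed subset_iff)
    moreover have "(\<Sum>b\<in>B x. (\<Sum>\<gamma>\<in>G (s x b). frag_of (t, y b \<gamma> x)) - frag_of (t, s x b \<odot>\<^bsub>P j\<^esub> rb b)) \<in> L' i (Suc j)"
      by (intro subgrp_sum[OF subgrp_L'] in1)
    ultimately have "(\<Sum>b\<in>B x. (\<Sum>\<gamma>\<in>G (s x b). frag_of (t, y b \<gamma> x)) - frag_of (t, s x b \<odot>\<^bsub>P j\<^esub> rb b))
        - (frag_of (t, x) - (\<Sum>b\<in>B x. frag_of (t, s x b \<odot>\<^bsub>P j\<^esub> rb b))) \<in> L' i (Suc j)"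
      using subgrp_diff[OF subgrp_L'] by blast
    then show ?thesis unfolding sum by (simp add: sum_subtractf)
  qed
  have h_tens: "h (tens u x) = (\<Sum>(b, \<gamma>)\<in>I x. tens (cns \<gamma> u) (y b \<gamma> x))" for u x
  proof (rule additive_eq_frags[OF additive_compose[OF ah additive_tens] _ frags_UNIV])
    show "additive (\<lambda>u. \<Sum>(b, \<gamma>)\<in>I x. tens (cns \<gamma> u) (y b \<gamma> x))"
      unfolding case_prod_unfold by (intro additive_sum_fun additive_compose[OF additive_tens additive_cns])
  qed (simp add: h_of h0_def)
  have unit': "lift bd (h x) + h (lift bd x) - x \<in> L' i (Suc j)" if x: "x \<in> frags (T i \<times> carrier (P j))" for i x
  proof (rule additive_cong_frags[OF _ additive_id subgrp_L' x])
    show "additive (\<lambda>x. lift bd (h x) + h (lift bd x))"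
      by (intro additive_plus_fun additive_compose[OF additive_lift ah] additive_compose[OF ah additive_lift])
    fix p assume "p \<in> T i \<times> carrier (P j)"
    then obtain t x where p: "p = (t, x)" "t \<in> T i" "x \<in> carrier (P j)" by blast
    have "lift bd (h (frag_of p)) + h (lift bd (frag_of p)) = (\<Sum>(b, \<gamma>)\<in>I x. frag_of (t, y b \<gamma> x))"
      by (simp add: p(1) h_of h0_def additive_sum[OF additive_lift] case_prod_unfold additive_diff[OF additive_tens]
          h_tens sum_subtractf)
    then show "lift bd (h (frag_of p)) + h (lift bd (frag_of p)) - frag_of p \<in> L' i (Suc j)"
      using unit[OF p(2,3)] p(1) by simp
  qed
  show thesis
  proof (rule that[OF ah])
    show "h x \<in> frags (T (Suc i) \<times> carrier (P j))" if "x \<in> frags (T i \<times> carrier (P j))" for i x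
      by (rule additive_image_frags[OF ah subgrp_frags _ that]) (auto simp: h_of intro: h_in)
    show "h x \<in> L' (Suc i) (Suc j)" if "x \<in> L' i (Suc j)" for i x
      by (rule L'_induct[OF ah subgrp_L' that])
         (use h_add h_g h_N in \<open>simp_all add: h_of subgrp_zero[OF subgrp_L']\<close>)
  qed (rule unit')
qed

lemma tens_g:
  assumes "u \<in> frags (T i)" "\<gamma> \<in> H" "x \<in> carrier (P (pj j))"
  shows "tens (lact (\<lambda>a. \<gamma> \<otimes>\<^bsub>\<Gamma>\<^esub> a) u) (\<beta> \<gamma> \<odot>\<^bsub>P (pj j)\<^esub> x) - tens u x \<in> L' i j"
  by (rule additive_cong_frags[OF additive_compose[OF additive_tens additive_lact] additive_tens subgrp_L' assms(1)])
     (use assms(2,3) rel_g in simp)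

lemma tens_mem:
  assumes "u \<in> frags (T i)" "\<And>t. t \<in> T i \<Longrightarrow> frag_of (t, x) \<in> L' i j"
  shows "tens u x \<in> L' i j"
  by (rule additive_image_frags[OF additive_tens subgrp_L' _ assms(1)]) (simp add: assms(2))

lemma tens_add:
  assumes "u \<in> frags (T i)" "x \<in> carrier (P (pj j))" "y \<in> carrier (P (pj j))"
  shows "tens u (x \<oplus>\<^bsub>P (pj j)\<^esub> y) - tens u x - tens u y \<in> L' i j"
proof -
  have "additive (\<lambda>u. tens u (x \<oplus>\<^bsub>P (pj j)\<^esub> y) - tens u x - tens u y)"
    by (intro additive_minus_fun additive_tens)
  from additive_image_frags[OF this subgrp_L' _ assms(1)] show ?thesis using rel_add assms(2,3) by simp
qed

lemma bd_T: "t \<in> T (Suc i) \<Longrightarrow> bd_list t \<in> frags (T i)"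
  unfolding T_def by (rule bd_list_frags)

lemma lift_bd_S: "x \<in> frags (T (Suc i) \<times> C) \<Longrightarrow> lift bd x \<in> frags (T i \<times> C)"
  by (erule lift_frags[rotated]) (simp add: bd_T)

lemma lift_bd_L': "x \<in> L' (Suc i) j \<Longrightarrow> lift bd x \<in> L' i j"
proof (rule L'_induct[OF additive_lift subgrp_L'])
  fix \<gamma> t x assume a: "\<gamma> \<in> H" "t \<in> T (Suc i)" "x \<in> carrier (P (pj j))"
  show "lift bd (frag_of (map (\<lambda>a. \<gamma> \<otimes>\<^bsub>\<Gamma>\<^esub> a) t, \<beta> \<gamma> \<odot>\<^bsub>P (pj j)\<^esub> x)) - lift bd (frag_of (t, x)) \<in> L' i j"
    using tens_g[OF bd_T[OF a(2)] a(1,3)] by (simp add: bd_map)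
next
  fix t x y assume a: "t \<in> T (Suc i)" "x \<in> carrier (P (pj j))" "y \<in> carrier (P (pj j))"
  then show "lift bd (frag_of (t, x \<oplus>\<^bsub>P (pj j)\<^esub> y)) - lift bd (frag_of (t, x)) - lift bd (frag_of (t, y)) \<in> L' i j"
    using tens_add[OF bd_T[OF a(1)] a(2,3)] by simp
next
  fix t \<nu> x assume a: "t \<in> T (Suc i)" "\<nu> \<in> N" "x \<in> carrier (P (pj j))"
  show "lift bd (frag_of (t, \<nu> \<odot>\<^bsub>P (pj j)\<^esub> x)) \<in> L' i j"
    using tens_mem[OF bd_T[OF a(1)], of "\<nu> \<odot>\<^bsub>P (pj j)\<^esub> x" j] rel_N[OF _ a(2,3)] by simp
next
  fix t x assume a: "j = 0" "t \<in> T (Suc i)" "x \<in> carrier (P 1)"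
  then show "lift bd (frag_of (t, d 0 x)) \<in> L' i j"
    using tens_mem[OF bd_T[OF a(2)], of "d 0 x" j] rel_d[OF _ a(3)] by simp
qed

lemma lift_bd_zero: "x \<in> frags (T 0 \<times> C) \<Longrightarrow> lift bd x = 0"
  using lift_cong[of "T 0" bd "\<lambda>x. 0" x C] by (simp add: T_def bd_list_Nil lift_zero)

lemma row_exactness:
  assumes "x \<in> S i (Suc j)" "i = 0 \<or> lift bd x \<in> L' (i - 1) (Suc j)"
  shows "\<exists>y\<in>S (Suc i) (Suc j). x - lift bd y \<in> L' i (Suc j)"
proof -
  show ?thesis
  proof (rule row_contraction[of j])
  fix h assume h: "additive h"
    "\<And>i x. x \<in> frags (T i \<times> carrier (P j)) \<Longrightarrow> h x \<in> frags (T (Suc i) \<times> carrier (P j))"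
    "\<And>i x. x \<in> L' i (Suc j) \<Longrightarrow> h x \<in> L' (Suc i) (Suc j)"
    "\<And>i x. x \<in> frags (T i \<times> carrier (P j)) \<Longrightarrow> lift bd (h x) + h (lift bd x) - x \<in> L' i (Suc j)"
  have x: "x \<in> frags (T i \<times> carrier (P j))" using assms(1) by (simp add: S_def)
  have 1: "h (lift bd x) \<in> L' i (Suc j)"
  proof (cases i)
    case 0
    then have "lift bd x = 0" using lift_bd_zero x by blast
    then show ?thesis by (simp add: additive_zero[OF h(1)] subgrp_zero[OF subgrp_L'])
  next
    case (Suc i')
    then show ?thesis using assms(2) h(3)[of "lift bd x" i'] by simp
  qed
  have "h (lift bd x) - (lift bd (h x) + h (lift bd x) - x) \<in> L' i (Suc j)"
    by (rule subgrp_diff[OF subgrp_L' 1 h(4)[OF x]])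
  then have "x - lift bd (h x) \<in> L' i (Suc j)" by simp
  then show ?thesis using h(2)[OF x] by (auto simp: S_def)
  qed
qed

lemma lab_d_L': "x \<in> L' i (Suc (Suc j)) \<Longrightarrow> lab (d j) x \<in> L' i (Suc j)"
proof (rule L'_induct[OF additive_lab subgrp_L'])
  fix \<gamma> t x assume a: "\<gamma> \<in> H" "t \<in> T i" "x \<in> carrier (P (pj (Suc (Suc j))))"
  then show "lab (d j) (frag_of (map (\<lambda>a. \<gamma> \<otimes>\<^bsub>\<Gamma>\<^esub> a) t, \<beta> \<gamma> \<odot>\<^bsub>P (pj (Suc (Suc j)))\<^esub> x)) - lab (d j) (frag_of (t, x)) \<in> L' i (Suc j)"
    using rel_g[OF a(2,1), of "d j x" "Suc j"] d_closed[of x j] by (simp add: d_smult \<beta>_closed)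
next
  fix t x y assume a: "t \<in> T i" "x \<in> carrier (P (pj (Suc (Suc j))))" "y \<in> carrier (P (pj (Suc (Suc j))))"
  then show "lab (d j) (frag_of (t, x \<oplus>\<^bsub>P (pj (Suc (Suc j)))\<^esub> y)) - lab (d j) (frag_of (t, x)) - lab (d j) (frag_of (t, y)) \<in> L' i (Suc j)"
    using rel_add[OF a(1), of "d j x" "Suc j" "d j y"] d_closed[of _ j] by (simp add: d_add)
next
  fix t \<nu> x assume a: "t \<in> T i" "\<nu> \<in> N" "x \<in> carrier (P (pj (Suc (Suc j))))"
  then show "lab (d j) (frag_of (t, \<nu> \<odot>\<^bsub>P (pj (Suc (Suc j)))\<^esub> x)) \<in> L' i (Suc j)"
    using rel_N[OF a(1,2), of "d j x" "Suc j"] d_closed[of x j] N_carrier by (simp add: d_smult subset_iff)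
qed simp_all

lemma L'_0_1: "L' i (Suc 0) \<subseteq> L' i 0"
  unfolding L'_def by (rule spn_mono) (auto simp: QE_def)

lemma lab_d_S: "x \<in> frags (T' \<times> carrier (P (Suc j))) \<Longrightarrow> lab (d j) x \<in> frags (T' \<times> carrier (P j))"
  by (rule additive_image_frags[OF additive_lab subgrp_frags]) (auto intro: d_closed)

lemma lab_d_0: "x \<in> frags (T i \<times> carrier (P 1)) \<Longrightarrow> lab (d 0) x \<in> L' i 0"
  by (rule additive_image_frags[OF additive_lab subgrp_L']) (use rel_d in auto)

lemma lab_d_d: "x \<in> frags (T i \<times> carrier (P (Suc (Suc j)))) \<Longrightarrow> lab (d j) (lab (d (Suc j)) x) \<in> L' i (Suc j)"
  by (rule additive_image_frags[OF additive_compose[OF additive_lab additive_lab] subgrp_L'])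
     (use rel_zero[of _ i "Suc j"] in \<open>auto simp: d_d\<close>)

end

section \<open>Exact columns: splitting the reduction modulo N by the element z\<close>

context tor_side
begin

text \<open>On nonempty tuples \<open>H\<close> acts freely, so chains modulo relations are sums
  over normalized tuples of copies of \<open>P / N P\<close>. Multiplication by \<open>z\<close> is
  a natural section of the projection from \<open>P\<close>, since \<open>z\<close> kills
  \<open>N\<close> and \<open>\<one> \<ominus> z\<close> lies in \<open>N\<close>. It turns a cycle
  modulo relations into honest cycles of the resolution, to which exactness applies.\<close>

lemma column_exactness:
  assumes x: "x \<in> frags (T (Suc i) \<times> carrier (P (Suc j)))" and dx: "lab (d j) x \<in> L' (Suc i) (Suc j)"
  shows "\<exists>y\<in>frags (T (Suc i) \<times> carrier (P (Suc (Suc j)))). x - lab (d (Suc j)) y \<in> L' (Suc i) (Suc (Suc j))"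
proof -
  obtain r where r: "\<And>x. x \<in> carrier \<Gamma> \<Longrightarrow> r x \<in> H"
    "\<And>\<gamma> x. \<gamma> \<in> H \<Longrightarrow> x \<in> carrier \<Gamma> \<Longrightarrow> r (\<gamma> \<otimes>\<^bsub>\<Gamma>\<^esub> x) = \<gamma> \<otimes>\<^bsub>\<Gamma>\<^esub> r x"
    using \<Gamma>.equivariant_retraction[OF H] by blast
  define g where "g t = inv\<^bsub>\<Gamma>\<^esub> (r (hd t))" for t
  define nf where "nf t = map (\<lambda>a. g t \<otimes>\<^bsub>\<Gamma>\<^esub> a) t" for t
  have hd: "hd t \<in> carrier \<Gamma>" if "t \<in> T (Suc i)" for t using that by (cases t) (auto simp: T_def tup_def)
  have gH: "g t \<in> H" if "t \<in> T (Suc i)" for t using r(1)[OF hd[OF that]] H_inv by (simp add: g_def)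
  have nfT: "nf t \<in> T (Suc i)" if "t \<in> T (Suc i)" for t
    unfolding nf_def by (rule T_act[OF H_carrier[OF gH[OF that]] that])
  have g_act: "g (map (\<lambda>a. \<gamma> \<otimes>\<^bsub>\<Gamma>\<^esub> a) t) = g t \<otimes>\<^bsub>\<Gamma>\<^esub> inv\<^bsub>\<Gamma>\<^esub> \<gamma>" if "\<gamma> \<in> H" "t \<in> T (Suc i)" for \<gamma> t
  proof -
    have "hd (map (\<lambda>a. \<gamma> \<otimes>\<^bsub>\<Gamma>\<^esub> a) t) = \<gamma> \<otimes>\<^bsub>\<Gamma>\<^esub> hd t" using that(2) by (cases t) (auto simp: T_def tup_def)
    then show ?thesis
      using r(2)[OF that(1) hd[OF that(2)]] r(1)[OF hd[OF that(2)]] that(1) H_carrier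
      by (simp add: g_def \<Gamma>.inv_mult_group)
  qed
  have nf_act: "nf (map (\<lambda>a. \<gamma> \<otimes>\<^bsub>\<Gamma>\<^esub> a) t) = nf t" if "\<gamma> \<in> H" "t \<in> T (Suc i)" for \<gamma> t
    unfolding nf_def g_act[OF that]
    using that H_carrier[OF gH[OF that(2)]] H_carrier[OF that(1)]
    by (auto simp: T_def tup_def subset_iff \<Gamma>.m_assoc) (simp add: \<Gamma>.m_assoc[symmetric])
  \<comment> \<open>\<open>\<Psi> u\<close> collects the coefficient of the normalized tuple
    \<open>u\<close> and lifts it by \<open>z\<close>. Its values lie in the additive group of a
    module, a group with carrier rather than a type class instance; hence the universal property
    instead of \<open>frag_extend\<close>.\<close>
  have coeff: "\<exists>\<Psi>. (\<forall>u. \<Psi> u \<in> hom (free_Abelian_group (T (Suc i) \<times> carrier (P k))) (add_monoid (P k))) \<and>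
      (\<forall>u. \<forall>t\<in>T (Suc i). \<forall>x\<in>carrier (P k). \<Psi> u (frag_of (t, x)) =
        (if nf t = u then z \<odot>\<^bsub>P k\<^esub> (\<beta> (g t) \<odot>\<^bsub>P k\<^esub> x) else \<zero>\<^bsub>P k\<^esub>))" for k
  proof -
    interpret A: abelian_group "P k" by (rule ab)
    have "\<exists>\<Psi>. \<Psi> \<in> hom (free_Abelian_group (T (Suc i) \<times> carrier (P k))) (add_monoid (P k)) \<and>
        (\<forall>s\<in>T (Suc i) \<times> carrier (P k). \<Psi> (frag_of s) = (if nf (fst s) = u then z \<odot>\<^bsub>P k\<^esub> (\<beta> (g (fst s)) \<odot>\<^bsub>P k\<^esub> snd s) else \<zero>\<^bsub>P k\<^esub>))" for u
    proof (rule comm_group.free_Abelian_group_universal[OF A.a_comm_group])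
      show "(\<lambda>s. if nf (fst s) = u then z \<odot>\<^bsub>P k\<^esub> (\<beta> (g (fst s)) \<odot>\<^bsub>P k\<^esub> snd s) else \<zero>\<^bsub>P k\<^esub>) ` (T (Suc i) \<times> carrier (P k))
          \<subseteq> carrier (add_monoid (P k))"
        by (auto intro!: sm_closed z \<beta>_closed gH)
    qed blast
    then obtain \<Psi> where "\<And>u. \<Psi> u \<in> hom (free_Abelian_group (T (Suc i) \<times> carrier (P k))) (add_monoid (P k)) \<and>
        (\<forall>s\<in>T (Suc i) \<times> carrier (P k). \<Psi> u (frag_of s) = (if nf (fst s) = u then z \<odot>\<^bsub>P k\<^esub> (\<beta> (g (fst s)) \<odot>\<^bsub>P k\<^esub> snd s) else \<zero>\<^bsub>P k\<^esub>))"
      by metis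
    then show ?thesis by (intro exI[of _ \<Psi>]) force
  qed
  then obtain \<Psi> where \<Psi>0: "\<And>k u. \<Psi> k u \<in> hom (free_Abelian_group (T (Suc i) \<times> carrier (P k))) (add_monoid (P k))"
    and \<Psi>_of: "\<And>k u t x. t \<in> T (Suc i) \<Longrightarrow> x \<in> carrier (P k) \<Longrightarrow>
      \<Psi> k u (frag_of (t, x)) = (if nf t = u then z \<odot>\<^bsub>P k\<^esub> (\<beta> (g t) \<odot>\<^bsub>P k\<^esub> x) else \<zero>\<^bsub>P k\<^esub>)"
    by metis
  define F where "F k = frags (T (Suc i) \<times> carrier (P k))" for k
  have Fsub: "subgrp (F k)" for k by (simp add: F_def subgrp_frags)
  have \<Psi>c: "\<Psi> k u a \<in> carrier (P k)" if "a \<in> F k" for k u a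
    using \<Psi>0[of k u] that by (auto simp: hom_def F_def frags_def)
  have \<Psi>add: "\<Psi> k u (a + b) = \<Psi> k u a \<oplus>\<^bsub>P k\<^esub> \<Psi> k u b" if "a \<in> F k" "b \<in> F k" for k u a b
    using \<Psi>0[of k u] that by (auto simp: hom_def F_def frags_def)
  have \<Psi>0: "\<Psi> k u 0 = \<zero>\<^bsub>P k\<^esub>" for k u
  proof -
    interpret A: abelian_group "P k" by (rule ab)
    show ?thesis using \<Psi>add[of 0 k 0 u] \<Psi>c[of 0 k u] subgrp_zero[OF Fsub] by (simp add: A.add.r_cancel_one')
  qed
  have \<Psi>diff: "\<Psi> k u a = \<Psi> k u (a - b) \<oplus>\<^bsub>P k\<^esub> \<Psi> k u b" if "a \<in> F k" "b \<in> F k" for k u a b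
    using \<Psi>add[of "a - b" k b u] that subgrp_diff[OF Fsub] by simp
  have dcancel: "a = \<zero>\<^bsub>P k\<^esub>" if "\<zero>\<^bsub>P k\<^esub> = a \<oplus>\<^bsub>P k\<^esub> \<zero>\<^bsub>P k\<^esub>" "a \<in> carrier (P k)" for a k
    using that pl_zero(2)[OF that(2)] by simp
  \<comment> \<open>the coefficient of a normalized tuple vanishes on the relations\<close>
  have \<Psi>_L: "\<Psi> k u a = \<zero>\<^bsub>P k\<^esub>" if a: "a \<in> L' (Suc i) (Suc k)" for k u a
  proof -
    interpret A: abelian_group "P k" by (rule ab)
    have canc: "a = \<zero>\<^bsub>P k\<^esub>" if "a \<oplus>\<^bsub>P k\<^esub> b = b" "a \<in> carrier (P k)" "b \<in> carrier (P k)" for a b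
      using that A.add.r_cancel_one[of b a] by simp
    define M where "M = {a \<in> F k. \<Psi> k u a = \<zero>\<^bsub>P k\<^esub>}"
    have M: "subgrp M"
      unfolding subgrp_def
    proof (intro conjI ballI)
      show "0 \<in> M" by (simp add: M_def \<Psi>0 subgrp_zero[OF Fsub])
      fix a b assume ab: "a \<in> M" "b \<in> M"
      then have "a - b \<in> F k" by (auto simp: M_def intro: subgrp_diff[OF Fsub])
      then show "a - b \<in> M" using ab \<Psi>diff[of a k b u] \<Psi>c[of "a - b" k u] dcancel by (auto simp: M_def)
    qed
    have "a \<in> M"
    proof (rule L'_induct[OF additive_id M a])
      fix \<gamma> t x assume h: "\<gamma> \<in> H" "t \<in> T (Suc i)" "x \<in> carrier (P (pj (Suc k)))"
      let ?a = "frag_of (map (\<lambda>a. \<gamma> \<otimes>\<^bsub>\<Gamma>\<^esub> a) t, \<beta> \<gamma> \<odot>\<^bsub>P (pj (Suc k))\<^esub> x)" and ?b = "frag_of (t, x)"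
      have ab: "?a \<in> F k" "?b \<in> F k" "?a - ?b \<in> F k"
        using h T_act[OF H_carrier[OF h(1)] h(2)] by (auto simp: F_def sm_closed \<beta>_closed intro!: subgrp_diff[OF subgrp_frags])
      have "\<beta> (g t \<otimes>\<^bsub>\<Gamma>\<^esub> inv\<^bsub>\<Gamma>\<^esub> \<gamma>) \<odot>\<^bsub>P k\<^esub> (\<beta> \<gamma> \<odot>\<^bsub>P k\<^esub> x) = \<beta> (g t) \<odot>\<^bsub>P k\<^esub> x"
      proof -
        have "\<beta> (g t \<otimes>\<^bsub>\<Gamma>\<^esub> inv\<^bsub>\<Gamma>\<^esub> \<gamma>) \<odot>\<^bsub>P k\<^esub> (\<beta> \<gamma> \<odot>\<^bsub>P k\<^esub> x) = \<beta> ((g t \<otimes>\<^bsub>\<Gamma>\<^esub> inv\<^bsub>\<Gamma>\<^esub> \<gamma>) \<otimes>\<^bsub>\<Gamma>\<^esub> \<gamma>) \<odot>\<^bsub>P k\<^esub> x"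
          using h gH by (simp add: \<beta>_smult H_mult H_inv)
        also have "(g t \<otimes>\<^bsub>\<Gamma>\<^esub> inv\<^bsub>\<Gamma>\<^esub> \<gamma>) \<otimes>\<^bsub>\<Gamma>\<^esub> \<gamma> = g t"
          using h gH H_carrier by (simp add: \<Gamma>.m_assoc)
        finally show ?thesis .
      qed
      then have "\<Psi> k u ?a = \<Psi> k u ?b"
        using h \<Psi>_of[OF T_act[OF H_carrier[OF h(1)] h(2)], of "\<beta> \<gamma> \<odot>\<^bsub>P k\<^esub> x" k u]
          \<Psi>_of[OF h(2), of x k u] by (simp add: sm_closed \<beta>_closed nf_act g_act)
      then have "\<Psi> k u ?b = \<Psi> k u (?a - ?b) \<oplus>\<^bsub>P k\<^esub> \<Psi> k u ?b" using \<Psi>diff[OF ab(1,2)] by metis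
      then have "\<Psi> k u (?a - ?b) = \<zero>\<^bsub>P k\<^esub>"
        by (rule canc[OF sym \<Psi>c[OF ab(3)] \<Psi>c[OF ab(2)]])
      then show "?a - ?b \<in> M" using ab by (simp add: M_def)
    next
      fix t x y assume h: "t \<in> T (Suc i)" "x \<in> carrier (P (pj (Suc k)))" "y \<in> carrier (P (pj (Suc k)))"
      let ?s = "frag_of (t, x \<oplus>\<^bsub>P (pj (Suc k))\<^esub> y)" and ?x = "frag_of (t, x)" and ?y = "frag_of (t, y)"
      have F: "?s \<in> F k" "?x \<in> F k" "?y \<in> F k" "?s - ?x - ?y \<in> F k" "?s - ?x \<in> F k"
        using h by (auto simp: F_def pl_closed intro!: subgrp_diff[OF subgrp_frags])
      have "\<Psi> k u ?s = \<Psi> k u ?x \<oplus>\<^bsub>P k\<^esub> \<Psi> k u ?y"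
        using h gH z by (auto simp: \<Psi>_of pl_closed sm_rdist \<beta>_closed sm_closed pl_zero ze_closed)
      moreover have "\<Psi> k u ?s = \<Psi> k u (?s - ?x - ?y) \<oplus>\<^bsub>P k\<^esub> \<Psi> k u ?y \<oplus>\<^bsub>P k\<^esub> \<Psi> k u ?x"
        using \<Psi>diff[OF F(1,2)] \<Psi>diff[OF F(5,3)] by simp
      ultimately have "\<Psi> k u (?s - ?x - ?y) \<oplus>\<^bsub>P k\<^esub> (\<Psi> k u ?x \<oplus>\<^bsub>P k\<^esub> \<Psi> k u ?y) = \<Psi> k u ?x \<oplus>\<^bsub>P k\<^esub> \<Psi> k u ?y"
        using \<Psi>c[OF F(2), of u] \<Psi>c[OF F(3), of u] \<Psi>c[OF F(4), of u] by (simp add: A.a_ac)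
      then have "\<Psi> k u (?s - ?x - ?y) = \<zero>\<^bsub>P k\<^esub>"
        using canc[OF _ \<Psi>c[OF F(4)] A.a_closed[OF \<Psi>c[OF F(2)] \<Psi>c[OF F(3)]]] by blast
      then show "?s - ?x - ?y \<in> M" using F by (simp add: M_def)
    next
      fix t \<nu> x assume h: "t \<in> T (Suc i)" "\<nu> \<in> N" "x \<in> carrier (P (pj (Suc k)))"
      have \<nu>: "\<nu> \<in> carrier R" using N_carrier h(2) by blast
      have "z \<odot>\<^bsub>P k\<^esub> (\<beta> (g t) \<odot>\<^bsub>P k\<^esub> (\<nu> \<odot>\<^bsub>P k\<^esub> x)) = (z \<otimes> (\<beta> (g t) \<otimes> \<nu>)) \<odot>\<^bsub>P k\<^esub> x"
        using h \<nu> gH z by (simp add: sm_assoc \<beta>_closed sm_closed)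
      also have "\<dots> = \<zero>\<^bsub>P k\<^esub>" using z_N[OF \<beta>_N[OF gH[OF h(1)] h(2)]] h by (simp add: sm_zero')
      finally show "frag_of (t, \<nu> \<odot>\<^bsub>P (pj (Suc k))\<^esub> x) \<in> M"
        using h \<nu> by (auto simp: M_def F_def \<Psi>_of sm_closed)
    qed simp
    then show ?thesis by (simp add: M_def)
  qed
  have \<Psi>_d: "\<Psi> j u (lab (d j) a) = d j (\<Psi> (Suc j) u a)" if a: "a \<in> F (Suc j)" for u a
  proof -
    interpret A: abelian_group "P j" by (rule ab)
    have "lab (d j) a \<in> F j \<and> a \<in> F (Suc j) \<and> \<Psi> j u (lab (d j) a) = d j (\<Psi> (Suc j) u a)"
      using a[unfolded F_def]
    proof (induction rule: frags_induct)
      case zero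
      then show ?case by (simp add: additive_zero[OF additive_lab] \<Psi>0 d_zero subgrp_zero[OF Fsub])
    next
      case (one s)
      then show ?case using gH z by (auto simp: \<Psi>_of d_closed d_smult sm_closed \<beta>_closed d_zero F_def)
    next
      case (diff a b)
      have ab: "a - b \<in> F (Suc j)" "lab (d j) a - lab (d j) b \<in> F j" using diff subgrp_diff[OF Fsub] by auto
      have "d j (\<Psi> (Suc j) u a) = d j (\<Psi> (Suc j) u (a - b)) \<oplus>\<^bsub>P j\<^esub> d j (\<Psi> (Suc j) u b)"
        using \<Psi>diff[of a "Suc j" b u] diff ab \<Psi>c by (metis d_add)
      moreover have "\<Psi> j u (lab (d j) a) = \<Psi> j u (lab (d j) a - lab (d j) b) \<oplus>\<^bsub>P j\<^esub> \<Psi> j u (lab (d j) b)"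
        using \<Psi>diff[of "lab (d j) a" j "lab (d j) b" u] diff by blast
      ultimately have "\<Psi> j u (lab (d j) a - lab (d j) b) \<oplus>\<^bsub>P j\<^esub> \<Psi> j u (lab (d j) b)
          = d j (\<Psi> (Suc j) u (a - b)) \<oplus>\<^bsub>P j\<^esub> \<Psi> j u (lab (d j) b)" using diff by metis
      moreover have "\<Psi> j u (lab (d j) a - lab (d j) b) \<in> carrier (P j)" "\<Psi> j u (lab (d j) b) \<in> carrier (P j)"
        "d j (\<Psi> (Suc j) u (a - b)) \<in> carrier (P j)"
        using \<Psi>c ab diff d_closed by blast+
      ultimately have "\<Psi> j u (lab (d j) a - lab (d j) b) = d j (\<Psi> (Suc j) u (a - b))"
        by (simp add: A.add.right_cancel)
      then show ?case using ab by (simp add: additive_diff[OF additive_lab])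
    qed
    then show ?thesis by blast
  qed
  define Us where "Us = nf ` fst ` Poly_Mapping.keys x"
  have Us: "finite Us" by (simp add: Us_def)
  have keys: "Poly_Mapping.keys x \<subseteq> T (Suc i) \<times> carrier (P (Suc j))" using x by (simp add: frags_def)
  have UsT: "u \<in> T (Suc i)" if "u \<in> Us" for u using that keys nfT by (auto simp: Us_def)
  \<comment> \<open>Each generator is moved to its normal form by \<open>rel_g\<close>, and its
    label is replaced by the multiple with \<open>z\<close>; the difference is a multiple by an
    element of \<open>N\<close>.\<close>
  have normal: "x - (\<Sum>u\<in>Us. frag_of (u, \<Psi> (Suc j) u x)) \<in> L' (Suc i) (Suc (Suc j))"
  proof -
    let ?k = "Suc j" and ?L = "L' (Suc i) (Suc (Suc j))"
    let ?E = "{(t, y). t \<in> T (Suc i) \<and> y \<in> carrier (P ?k) \<and> nf t \<in> Us}"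
    have "x \<in> frags ?E" using keys by (force simp: frags_def Us_def)
    then have "x \<in> F ?k \<and> x - (\<Sum>u\<in>Us. frag_of (u, \<Psi> ?k u x)) \<in> ?L"
    proof (induction rule: frags_induct)
      case zero
      have "(\<Sum>u\<in>Us. frag_of (u, \<Psi> ?k u 0)) \<in> ?L"
        using UsT rel_zero[of _ "Suc i" "Suc (Suc j)"] by (intro subgrp_sum[OF subgrp_L']) (simp add: \<Psi>0)
      then show ?case using subgrp_uminus[OF subgrp_L'] subgrp_zero[OF Fsub] by simp
    next
      case (one s)
      then obtain t y where s: "s = (t, y)" "t \<in> T (Suc i)" "y \<in> carrier (P ?k)" "nf t \<in> Us" by blast
      have y': "\<beta> (g t) \<odot>\<^bsub>P ?k\<^esub> y \<in> carrier (P ?k)" using s gH by (simp add: sm_closed \<beta>_closed)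
      let ?y = "\<beta> (g t) \<odot>\<^bsub>P ?k\<^esub> y"
      have "(\<Sum>u\<in>Us. frag_of (u, \<Psi> ?k u (frag_of s))) =
          frag_of (nf t, z \<odot>\<^bsub>P ?k\<^esub> ?y) + (\<Sum>u\<in>Us - {nf t}. frag_of (u, \<zero>\<^bsub>P ?k\<^esub>))"
        using s Us by (subst sum.remove[of Us "nf t"]) (auto simp: \<Psi>_of intro!: sum.cong split: if_splits)
      moreover have 1: "(\<Sum>u\<in>Us - {nf t}. frag_of (u, \<zero>\<^bsub>P ?k\<^esub>)) \<in> ?L"
        using UsT rel_zero[of _ "Suc i" "Suc (Suc j)"] by (intro subgrp_sum[OF subgrp_L']) simp
      moreover have "?y = (z \<odot>\<^bsub>P ?k\<^esub> ?y) \<oplus>\<^bsub>P ?k\<^esub> ((\<one> \<ominus> z) \<odot>\<^bsub>P ?k\<^esub> ?y)"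
      proof -
        have "z \<oplus> (\<one> \<ominus> z) = \<one>" using z by (simp add: R.minus_eq R.a_lcomm[of z] R.r_neg)
        then show ?thesis using sm_ldist[of z "\<one> \<ominus> z" ?y ?k] y' z by (simp add: sm_one)
      qed
      then have 2: "frag_of (nf t, ?y) - frag_of (nf t, z \<odot>\<^bsub>P ?k\<^esub> ?y) - frag_of (nf t, (\<one> \<ominus> z) \<odot>\<^bsub>P ?k\<^esub> ?y) \<in> ?L"
        using rel_add[OF nfT[OF s(2)], of "z \<odot>\<^bsub>P ?k\<^esub> ?y" "Suc ?k" "(\<one> \<ominus> z) \<odot>\<^bsub>P ?k\<^esub> ?y"] y' z by (simp add: sm_closed)
      have 3: "frag_of (nf t, (\<one> \<ominus> z) \<odot>\<^bsub>P ?k\<^esub> ?y) \<in> ?L"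
        using rel_N[OF nfT[OF s(2)] one_z, of ?y "Suc ?k"] y' by simp
      have 4: "frag_of (nf t, ?y) - frag_of (t, y) \<in> ?L"
        using rel_g[OF s(2) gH[OF s(2)], of y "Suc ?k"] s by (simp add: nf_def)
      have "(frag_of (nf t, ?y) - frag_of (nf t, z \<odot>\<^bsub>P ?k\<^esub> ?y) - frag_of (nf t, (\<one> \<ominus> z) \<odot>\<^bsub>P ?k\<^esub> ?y))
         + frag_of (nf t, (\<one> \<ominus> z) \<odot>\<^bsub>P ?k\<^esub> ?y) - (frag_of (nf t, ?y) - frag_of (t, y))
         - (\<Sum>u\<in>Us - {nf t}. frag_of (u, \<zero>\<^bsub>P ?k\<^esub>)) \<in> ?L"
        by (rule subgrp_diff[OF subgrp_L' subgrp_diff[OF subgrp_L' subgrp_add[OF subgrp_L' 2 3] 4] 1])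
      ultimately show ?case using s by (simp add: F_def diff_diff_eq)
    next
      case (diff a b)
      let ?s = "\<lambda>a. \<Sum>u\<in>Us. frag_of (u, \<Psi> ?k u a)"
      have ab: "a - b \<in> F ?k" using diff subgrp_diff[OF Fsub] by blast
      have "(\<Sum>u\<in>Us. frag_of (u, \<Psi> ?k u a) - frag_of (u, \<Psi> ?k u (a - b)) - frag_of (u, \<Psi> ?k u b)) \<in> ?L"
      proof (rule subgrp_sum[OF subgrp_L'])
        fix u assume "u \<in> Us"
        then show "frag_of (u, \<Psi> ?k u a) - frag_of (u, \<Psi> ?k u (a - b)) - frag_of (u, \<Psi> ?k u b) \<in> ?L"
          using rel_add[OF UsT, of u "\<Psi> ?k u (a - b)" "Suc ?k" "\<Psi> ?k u b"] \<Psi>c ab diff \<Psi>diff[of a ?k b u] by simp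
      qed
      then have "?s a - ?s (a - b) - ?s b \<in> ?L" by (simp add: sum_subtractf)
      moreover have "a - ?s a \<in> ?L" "b - ?s b \<in> ?L" using diff by auto
      ultimately have "(a - ?s a) - (b - ?s b) + (?s a - ?s (a - b) - ?s b) \<in> ?L"
        using subgrp_add[OF subgrp_L'] subgrp_diff[OF subgrp_L'] by blast
      then show ?case using ab by simp
    qed
    then show ?thesis by blast
  qed
  have "\<exists>w\<in>carrier (P (Suc (Suc j))). \<Psi> (Suc j) u x = d (Suc j) w" for u
  proof -
    have "d j (\<Psi> (Suc j) u x) = \<zero>\<^bsub>P j\<^esub>" using \<Psi>_d[of x u] \<Psi>_L[OF dx] x by (simp add: F_def)
    then show ?thesis using exact[of j] \<Psi>c[of x "Suc j" u] x by (auto simp: F_def)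
  qed
  then obtain w where w: "\<And>u. w u \<in> carrier (P (Suc (Suc j)))" "\<And>u. \<Psi> (Suc j) u x = d (Suc j) (w u)" by metis
  define y where "y = (\<Sum>u\<in>Us. frag_of (u, w u))"
  have "y \<in> frags (T (Suc i) \<times> carrier (P (Suc (Suc j))))"
    unfolding y_def using UsT w by (intro subgrp_sum[OF subgrp_frags]) simp
  moreover have "lab (d (Suc j)) y = (\<Sum>u\<in>Us. frag_of (u, \<Psi> (Suc j) u x))"
    by (simp add: y_def additive_sum[OF additive_lab] w(2))
  ultimately show ?thesis using normal by (intro bexI[of _ y]) simp_all
qed

text \<open>The relations at index 0 are those at index 1 together with the image of
  \<open>d 0\<close>, and the latter part is collected in \<open>y\<close>.\<close>

lemma column_exactness_0:
  assumes x: "x \<in> L' i 0"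
  shows "\<exists>y\<in>frags (T i \<times> carrier (P 1)). x - lab (d 0) y \<in> L' i (Suc 0)"
proof -
  define M where "M = {x. \<exists>y\<in>frags (T i \<times> carrier (P 1)). x - lab (d 0) y \<in> L' i (Suc 0)}"
  have M: "subgrp M"
    unfolding subgrp_def
  proof (intro conjI ballI)
    show "0 \<in> M" unfolding M_def
      by (intro CollectI bexI[of _ 0])
        (simp_all add: subgrp_zero[OF subgrp_frags] subgrp_zero[OF subgrp_L'] additive_zero[OF additive_lab])
    fix a b assume "a \<in> M" "b \<in> M"
    then obtain ya yb where y: "ya \<in> frags (T i \<times> carrier (P 1))" "a - lab (d 0) ya \<in> L' i (Suc 0)"
      "yb \<in> frags (T i \<times> carrier (P 1))" "b - lab (d 0) yb \<in> L' i (Suc 0)" by (auto simp: M_def)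
    have "(a - lab (d 0) ya) - (b - lab (d 0) yb) \<in> L' i (Suc 0)" by (rule subgrp_diff[OF subgrp_L' y(2,4)])
    moreover have "(a - lab (d 0) ya) - (b - lab (d 0) yb) = (a - b) - lab (d 0) (ya - yb)"
      by (simp add: additive_diff[OF additive_lab])
    ultimately show "a - b \<in> M" unfolding M_def using subgrp_diff[OF subgrp_frags y(1,3)] by auto
  qed
  have sub: "a \<in> M" if "a \<in> L' i (Suc 0)" for a
    unfolding M_def using that
    by (intro CollectI bexI[of _ 0]) (simp_all add: subgrp_zero[OF subgrp_frags] additive_zero[OF additive_lab])
  have "x \<in> M"
  proof (rule L'_induct[OF additive_id M x])
    show "frag_of (t, d 0 x) \<in> M" if "t \<in> T i" "x \<in> carrier (P 1)" for t x
      unfolding M_def using that subgrp_zero[OF subgrp_L'] by (intro CollectI bexI[of _ "frag_of (t, x)"]) auto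
    show "frag_of (map (\<lambda>a. \<gamma> \<otimes>\<^bsub>\<Gamma>\<^esub> a) t, \<beta> \<gamma> \<odot>\<^bsub>P (pj 0)\<^esub> x) - frag_of (t, x) \<in> M"
      if "\<gamma> \<in> H" "t \<in> T i" "x \<in> carrier (P (pj 0))" for \<gamma> t x
      using rel_g[OF that(2,1), of x "Suc 0"] that(3) by (intro sub) simp
    show "frag_of (t, x \<oplus>\<^bsub>P (pj 0)\<^esub> y) - frag_of (t, x) - frag_of (t, y) \<in> M"
      if "t \<in> T i" "x \<in> carrier (P (pj 0))" "y \<in> carrier (P (pj 0))" for t x y
      using rel_add[OF that(1), of x "Suc 0" y] that by (intro sub) simp
    show "frag_of (t, \<nu> \<odot>\<^bsub>P (pj 0)\<^esub> x) \<in> M" if "t \<in> T i" "\<nu> \<in> N" "x \<in> carrier (P (pj 0))" for t \<nu> x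
      using rel_N[OF that(1,2), of x "Suc 0"] that by (intro sub) simp
  qed
  then show ?thesis by (simp add: M_def)
qed

lemma L_Suc [simp]: "L (Suc i) j = L' (Suc i) j" "L i (Suc j) = L' i (Suc j)"
  by (simp_all add: L_def)

lemma lift_bd_lab: "lift bd (lab f x) = lab f (lift bd x)"
  by (simp add: lab_lift)

sublocale dc: exact_double_complex S L dh dv
proof (unfold_locales, goal_cases)
  case (1 i j) then show ?case by (rule subgrp_S)
next
  case (2 i j) then show ?case by (rule subgrp_L)
next
  case (3 i j) then show ?case using L_S by (simp add: L_def)
next
  case (4 i j) then show ?case by (simp add: dh_def additive_lift)
next
  case (5 i j) then show ?case by (cases j) (simp_all add: dv_def additive_lab additive_id)
next
  case (6 x i j) then show ?case by (simp add: dh_def S_def lift_bd_S)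
next
  case (7 x i j) then show ?case by (cases j) (simp_all add: dv_def S_def lab_d_S)
next
  case (8 x i j)
  then have "lift bd x \<in> L' i j" "x \<in> S (Suc i) j" using lift_bd_L' subsetD[OF L_S] by simp_all
  then show ?case using lift_bd_S[of x i] by (auto simp: dh_def L_def S_def)
next
  case (9 x i j)
  then show ?case
  proof (cases j)
    case 0
    then show ?thesis using 9 subsetD[OF L'_0_1] subsetD[OF L_S, of x i "Suc 0"] by (auto simp: dv_def L_def S_def)
  next
    case (Suc j')
    then show ?thesis using 9 lab_d_L' by (simp add: dv_def)
  qed
next
  case (10 x i j)
  have "dh i j (dh (Suc i) j x) = 0" by (simp add: dh_def lift_compose[OF additive_bd] bd_bd lift_zero)
  then show ?case by (simp add: subgrp_zero[OF subgrp_L])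
next
  case (11 x i j)
  then show ?case
  proof (cases j)
    case 0
    have "lab (d 0) x \<in> S i 0" using 11 0 by (simp add: S_def lab_d_S)
    moreover have "lab (d 0) x \<in> L' i 0" using 11 0 lab_d_0 by (simp add: S_def)
    ultimately show ?thesis using 0 by (auto simp: dv_def L_def)
  next
    case (Suc j')
    then show ?thesis using 11 lab_d_d by (simp add: dv_def S_def)
  qed
next
  case (12 x i j)
  have "dh i j (dv (Suc i) j x) = dv i j (dh i (Suc j) x)"
    by (cases j) (simp_all add: dh_def dv_def lift_bd_lab)
  then show ?case by (simp add: subgrp_zero[OF subgrp_L])
next
  case 13 then show ?case by (simp add: L_def)
next
  case (14 x j) then show ?case using row_exactness[of x 0 j] by (simp add: dh_def)
next
  case (15 x i j) then show ?case using row_exactness[of x "Suc i" j] by (simp add: dh_def)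
next
  case (16 x i)
  then show ?case using subgrp_zero[OF subgrp_L'] by (intro bexI[of _ x]) (simp_all add: dv_def S_def)
next
  case (17 x i j)
  then show ?case
  proof (cases j)
    case 0
    then show ?thesis using 17 column_exactness_0[of x "Suc i"] by (auto simp: dv_def S_def)
  next
    case (Suc j')
    then show ?thesis using 17 column_exactness[of x i j'] by (auto simp: dv_def S_def)
  qed
qed

end

section \<open>Trivial coefficients\<close>

lemma hcorr_equiv:
  assumes F: "additive F" and sub: "subgrp Z" "subgrp Z'" "subgrp B" "subgrp B'" "B \<subseteq> Z" "B' \<subseteq> Z'"
    and FZ: "\<And>x. x \<in> Z \<Longrightarrow> F x \<in> Z'" and GZ: "\<And>y. y \<in> Z' \<Longrightarrow> G y \<in> Z"
    and FB: "\<And>x. x \<in> B \<Longrightarrow> F x \<in> B'" and GB: "\<And>y. y \<in> B' \<Longrightarrow> G y \<in> B"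
    and FG: "\<And>y. y \<in> Z' \<Longrightarrow> y - F (G y) \<in> B'" and GF: "\<And>x. x \<in> Z \<Longrightarrow> x - G (F x) \<in> B"
  shows "hcorr (\<lambda>x y. x \<in> Z \<and> y \<in> Z' \<and> y - F x \<in> B') Z B Z' B'"
proof (rule hcorr_map[OF F sub(1,2,4,6) FZ])
  show "F x \<in> B' \<longleftrightarrow> x \<in> B" if "x \<in> Z" for x
  proof
    assume "F x \<in> B'"
    then have "(x - G (F x)) + G (F x) \<in> B" by (intro subgrp_add[OF sub(3)] GF GB that)
    then show "x \<in> B" by simp
  qed (rule FB)
  show "\<exists>x\<in>Z. y - F x \<in> B'" if "y \<in> Z'" for y using FG GZ that by blast
qed

text \<open>Links the subgroup used in the definition of the tensor product to the inductive
  span.\<close>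

lemma generate_free_Abelian_group:
  assumes "R \<subseteq> frags S"
  shows "generate (free_Abelian_group S) R = spn R"
proof
  show "generate (free_Abelian_group S) R \<subseteq> spn R"
  proof
    fix x assume "x \<in> generate (free_Abelian_group S) R"
    then show "x \<in> spn R"
    proof induction
      case (inv h)
      then have "Poly_Mapping.keys h \<subseteq> S" using assms by (auto simp: frags_def)
      then show ?case using inv by (simp add: spn_base subgrp_uminus[OF subgrp_spn])
    next
      case (eng a b) then show ?case by (simp add: subgrp_add[OF subgrp_spn])
    qed (auto simp: spn.zero spn_base)
  qed
  show "spn R \<subseteq> generate (free_Abelian_group S) R"
  proof
    fix x assume "x \<in> spn R"
    then show "x \<in> generate (free_Abelian_group S) R"
    proof induction
      case zero
      show ?case using generate.one[of "free_Abelian_group S" R] by simp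
    next
      case (add x r)
      then show ?case using generate.eng[OF add.IH generate.incl[OF add.hyps(2)]] by simp
    next
      case (diff x r)
      then have "Poly_Mapping.keys r \<subseteq> S" using assms by (auto simp: frags_def)
      then show ?case using generate.eng[OF diff.IH generate.inv[OF diff.hyps(2)]] by simp
    qed
  qed
qed

text \<open>Presents the additive group of \<open>K\<close> by its own elements; this is the
  \<open>Q\<close> to which the stability theorem is applied.\<close>

definition sumrel :: "('k, 'm) ring_scheme \<Rightarrow> ('k \<Rightarrow>\<^sub>0 int) set" where
  "sumrel K = {frag_of (c \<oplus>\<^bsub>K\<^esub> c') - frag_of c - frag_of c' | c c'. c \<in> carrier K \<and> c' \<in> carrier K}"

text \<open>\<open>\<iota>\<close> maps scalars to central elements of \<open>R\<close>. The
  condition \<open>\<iota>_smult\<close> says that \<open>a\<close> acts on \<open>E\<close> by the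
  sum of its coordinates, which ties the abstract \<open>\<kappa>\<close> to the
  augmentation.\<close>

locale tor_triv = tor_side R \<Gamma> P d H \<beta> N z \<kappa>
  for R :: "'r ring" (structure) and \<Gamma> :: "'a monoid" and P :: "nat \<Rightarrow> ('r, 'p) module" and d H \<beta> N z \<kappa> +
  fixes K :: "'k ring" and E :: "('r, 'k) module" and e :: "'p \<Rightarrow> 'k" and \<iota> :: "'k \<Rightarrow> 'r"
  assumes K: "abelian_group K" and one_K: "\<one>\<^bsub>K\<^esub> \<in> carrier K"
    and E: "carrier E = carrier K" "add E = add K" "ring.zero E = ring.zero K"
    and e_lin: "e \<in> linear_maps R (P 0) E" and e_surj: "e ` carrier (P 0) = carrier E"
    and e_ker: "{x \<in> carrier (P 0). e x = \<zero>\<^bsub>E\<^esub>} = d 0 ` carrier (P (Suc 0))"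
    and E_smult: "a \<in> carrier R \<Longrightarrow> c \<in> carrier K \<Longrightarrow> a \<odot>\<^bsub>E\<^esub> c \<in> carrier K"
    and E_N: "\<nu> \<in> N \<Longrightarrow> c \<in> carrier K \<Longrightarrow> \<nu> \<odot>\<^bsub>E\<^esub> c = \<zero>\<^bsub>K\<^esub>"
    and E_\<beta>: "\<gamma> \<in> H \<Longrightarrow> c \<in> carrier K \<Longrightarrow> \<beta> \<gamma> \<odot>\<^bsub>E\<^esub> c = c"
    and \<iota>_closed: "c \<in> carrier K \<Longrightarrow> \<iota> c \<in> carrier R"
    and \<iota>_add: "c \<in> carrier K \<Longrightarrow> c' \<in> carrier K \<Longrightarrow> \<iota> (c \<oplus>\<^bsub>K\<^esub> c') = \<iota> c \<oplus> \<iota> c'"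
    and \<iota>_one: "\<iota> \<one>\<^bsub>K\<^esub> = \<one>"
    and \<iota>_E: "c \<in> carrier K \<Longrightarrow> \<iota> c \<odot>\<^bsub>E\<^esub> \<one>\<^bsub>K\<^esub> = c"
    and \<iota>_central: "c \<in> carrier K \<Longrightarrow> a \<in> carrier R \<Longrightarrow> \<iota> c \<otimes> a = a \<otimes> \<iota> c"
    and \<iota>_smult: "a \<in> carrier R \<Longrightarrow> c \<in> carrier K \<Longrightarrow>
      \<iota> (a \<odot>\<^bsub>E\<^esub> c) = (\<Oplus>\<gamma>\<in>{\<gamma> \<in> H. \<kappa> \<gamma> a \<noteq> \<zero>}. \<kappa> \<gamma> a) \<otimes> \<iota> c"
begin

lemma e_closed: "x \<in> carrier (P 0) \<Longrightarrow> e x \<in> carrier K"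
  and e_add: "x \<in> carrier (P 0) \<Longrightarrow> y \<in> carrier (P 0) \<Longrightarrow> e (x \<oplus>\<^bsub>P 0\<^esub> y) = e x \<oplus>\<^bsub>K\<^esub> e y"
  and e_smult: "a \<in> carrier R \<Longrightarrow> x \<in> carrier (P 0) \<Longrightarrow> e (a \<odot>\<^bsub>P 0\<^esub> x) = a \<odot>\<^bsub>E\<^esub> e x"
  using e_lin by (auto simp: semilinear_maps_def E)

lemma e_d: "x \<in> carrier (P (Suc 0)) \<Longrightarrow> e (d 0 x) = \<zero>\<^bsub>K\<^esub>"
  using e_ker by (auto simp: E)

definition grK :: "nat \<Rightarrow> ('a list \<Rightarrow>\<^sub>0 int) set" where
  "grK i = {frag_of (map (\<lambda>x. \<gamma> \<otimes>\<^bsub>\<Gamma>\<^esub> x) t) - frag_of t | \<gamma> t. \<gamma> \<in> H \<and> t \<in> T i}"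

definition LK :: "nat \<Rightarrow> ('a list \<times> 'k \<Rightarrow>\<^sub>0 int) set" where
  "LK i = rels (grK i) (T i) (carrier K) (sumrel K)"

definition SK :: "nat \<Rightarrow> ('a list \<times> 'k \<Rightarrow>\<^sub>0 int) set" where
  "SK i = frags (T i \<times> carrier K)"

text \<open>Degree \<open>q\<close> lives on tuples of length \<open>q + 1\<close>; the clause
  \<open>q = 0\<close> mirrors the zero corner of the double complex.\<close>

definition WK :: "nat \<Rightarrow> ('a list \<times> 'k \<Rightarrow>\<^sub>0 int) set" where
  "WK q = {w \<in> SK (Suc q). q = 0 \<or> lift bd w \<in> LK q}"

definition DK :: "nat \<Rightarrow> ('a list \<times> 'k \<Rightarrow>\<^sub>0 int) set" where
  "DK q = {w \<in> SK (Suc q). \<exists>u\<in>SK (Suc (Suc q)). w - lift bd u \<in> LK (Suc q)}"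

text \<open>A set-theoretic section of the augmentation. It need not be additive; additivity modulo
  relations comes from \<open>ker_rel\<close>.\<close>

definition sec :: "'k \<Rightarrow> 'p" where
  "sec c = (SOME x. x \<in> carrier (P 0) \<and> e x = c)"

lemma sec: "c \<in> carrier K \<Longrightarrow> sec c \<in> carrier (P 0) \<and> e (sec c) = c"
proof -
  assume "c \<in> carrier K"
  then have "c \<in> e ` carrier (P 0)" using e_surj by (simp add: E)
  then have "\<exists>x. x \<in> carrier (P 0) \<and> e x = c" by blast
  then show ?thesis unfolding sec_def by (rule someI_ex)
qed

text \<open>By exactness at \<open>P 0\<close> the difference of \<open>x\<close> and
  \<open>y\<close> is some \<open>d 0 v\<close>, and such elements are relations at index 0.\<close>

lemma ker_rel: "t \<in> T i \<Longrightarrow> x \<in> carrier (P 0) \<Longrightarrow> y \<in> carrier (P 0) \<Longrightarrow> e x = e y \<Longrightarrow>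
    frag_of (t, x) - frag_of (t, y) \<in> L' i 0"
proof -
  interpret A: abelian_group "P 0" by (rule ab)
  interpret K: abelian_group K by (rule K)
  assume a: "t \<in> T i" "x \<in> carrier (P 0)" "y \<in> carrier (P 0)" "e x = e y"
  let ?w = "x \<oplus>\<^bsub>P 0\<^esub> \<ominus>\<^bsub>P 0\<^esub> y"
  have w: "?w \<in> carrier (P 0)" "?w \<oplus>\<^bsub>P 0\<^esub> y = x" using a by (simp_all add: A.a_assoc A.l_neg)
  have "e ?w \<oplus>\<^bsub>K\<^esub> e y = e y" using e_add[OF w(1) a(3)] w(2) a(4) by simp
  then have "e ?w = \<zero>\<^bsub>K\<^esub>" using e_closed[OF w(1)] e_closed[OF a(3)] K.add.r_cancel_one[of "e y" "e ?w"] by simp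
  then obtain v where v: "v \<in> carrier (P 1)" "?w = d 0 v" using e_ker w(1) by (auto simp: E)
  have "frag_of (t, x) - frag_of (t, ?w) - frag_of (t, y) \<in> L' i 0"
    using rel_add[OF a(1), of ?w 0 y] w a by simp
  moreover have "frag_of (t, ?w) \<in> L' i 0" unfolding v(2) by (rule rel_d[OF a(1) v(1)])
  ultimately have "frag_of (t, x) - frag_of (t, ?w) - frag_of (t, y) + frag_of (t, ?w) \<in> L' i 0"
    by (rule subgrp_add[OF subgrp_L'])
  then show ?thesis by simp
qed

lemma rels_sub: "subgrp (LK i)"
  by (simp add: LK_def subgrp_rels)

lemma SK_sub: "subgrp (SK i)"
  by (simp add: SK_def subgrp_frags)

lemma LK_zero: "t \<in> T i \<Longrightarrow> frag_of (t, \<zero>\<^bsub>K\<^esub>) \<in> LK i"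
proof -
  interpret K: abelian_group K by (rule K)
  assume t: "t \<in> T i"
  have "frag_of (\<zero>\<^bsub>K\<^esub> \<oplus>\<^bsub>K\<^esub> \<zero>\<^bsub>K\<^esub>) - frag_of \<zero>\<^bsub>K\<^esub> - frag_of \<zero>\<^bsub>K\<^esub> \<in> sumrel K"
    unfolding sumrel_def using K.zero_closed by blast
  from ten2_rels[OF t this] have "- frag_of (t, \<zero>\<^bsub>K\<^esub>) \<in> LK i"
    by (simp add: LK_def ten2_diff K.l_zero additive_uminus[OF additive_ten2])
  then show ?thesis using subgrp_uminus[OF rels_sub] by fastforce
qed

lemma LK_add: "t \<in> T i \<Longrightarrow> c \<in> carrier K \<Longrightarrow> c' \<in> carrier K \<Longrightarrow>
    frag_of (t, c \<oplus>\<^bsub>K\<^esub> c') - frag_of (t, c) - frag_of (t, c') \<in> LK i"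
proof -
  assume a: "t \<in> T i" "c \<in> carrier K" "c' \<in> carrier K"
  then have "frag_of (c \<oplus>\<^bsub>K\<^esub> c') - frag_of c - frag_of c' \<in> sumrel K" by (auto simp: sumrel_def)
  from ten2_rels[OF a(1) this] show ?thesis by (simp add: LK_def ten2_diff)
qed

lemma LK_g: "t \<in> T i \<Longrightarrow> \<gamma> \<in> H \<Longrightarrow> c \<in> carrier K \<Longrightarrow>
    frag_of (map (\<lambda>x. \<gamma> \<otimes>\<^bsub>\<Gamma>\<^esub> x) t, c) - frag_of (t, c) \<in> LK i"
proof -
  assume a: "t \<in> T i" "\<gamma> \<in> H" "c \<in> carrier K"
  then have "frag_of (map (\<lambda>x. \<gamma> \<otimes>\<^bsub>\<Gamma>\<^esub> x) t) - frag_of t \<in> grK i" by (auto simp: grK_def)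
  from tens_rels[OF spn_base[OF this] a(3)] show ?thesis by (simp add: LK_def additive_diff[OF additive_tens])
qed

lemma lab_e_L: "x \<in> L' i 0 \<Longrightarrow> lab e x \<in> LK i"
proof (rule L'_induct[OF additive_lab rels_sub])
  fix \<gamma> t x assume a: "\<gamma> \<in> H" "t \<in> T i" "x \<in> carrier (P (pj 0))"
  then show "lab e (frag_of (map (\<lambda>a. \<gamma> \<otimes>\<^bsub>\<Gamma>\<^esub> a) t, \<beta> \<gamma> \<odot>\<^bsub>P (pj 0)\<^esub> x)) - lab e (frag_of (t, x)) \<in> LK i"
    using LK_g[OF a(2,1)] by (simp add: e_smult \<beta>_closed E_\<beta> e_closed)
next
  fix t x y assume a: "t \<in> T i" "x \<in> carrier (P (pj 0))" "y \<in> carrier (P (pj 0))"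
  then show "lab e (frag_of (t, x \<oplus>\<^bsub>P (pj 0)\<^esub> y)) - lab e (frag_of (t, x)) - lab e (frag_of (t, y)) \<in> LK i"
    using LK_add[OF a(1)] by (simp add: e_add e_closed)
next
  fix t \<nu> x assume a: "t \<in> T i" "\<nu> \<in> N" "x \<in> carrier (P (pj 0))"
  moreover have "\<nu> \<in> carrier R" using a(2) N_carrier by blast
  ultimately show "lab e (frag_of (t, \<nu> \<odot>\<^bsub>P (pj 0)\<^esub> x)) \<in> LK i"
    using LK_zero by (simp add: e_smult E_N e_closed)
next
  fix t x assume "t \<in> T i" "x \<in> carrier (P 1)"
  then show "lab e (frag_of (t, d 0 x)) \<in> LK i" using LK_zero by (simp add: e_d)
qed

lemma lab_sec_L: "y \<in> LK i \<Longrightarrow> lab sec y \<in> L' i 0"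
proof -
  interpret K: abelian_group K by (rule K)
  assume "y \<in> LK i"
  then show ?thesis unfolding LK_def rels_def
  proof (rule spn_image[OF additive_lab subgrp_L', rotated])
    fix r assume "r \<in> {tens r c | r c. r \<in> grK i \<and> c \<in> carrier K} \<union> {ten2 t q | t q. t \<in> T i \<and> q \<in> sumrel K}"
    then show "lab sec r \<in> L' i 0"
    proof (elim UnE)
      assume "r \<in> {tens r c | r c. r \<in> grK i \<and> c \<in> carrier K}"
      then obtain \<gamma> t c where r: "r = tens (frag_of (map (\<lambda>x. \<gamma> \<otimes>\<^bsub>\<Gamma>\<^esub> x) t) - frag_of t) c" "\<gamma> \<in> H" "t \<in> T i" "c \<in> carrier K"
        by (auto simp: grK_def)
      let ?t = "map (\<lambda>x. \<gamma> \<otimes>\<^bsub>\<Gamma>\<^esub> x) t" and ?x = "sec c"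
      have t: "?t \<in> T i" by (rule T_act[OF H_carrier[OF r(2)] r(3)])
      have x: "?x \<in> carrier (P 0)" "e ?x = c" using sec[OF r(4)] by auto
      have bx: "\<beta> \<gamma> \<odot>\<^bsub>P 0\<^esub> ?x \<in> carrier (P 0)" "e (\<beta> \<gamma> \<odot>\<^bsub>P 0\<^esub> ?x) = c"
        using x r by (simp_all add: sm_closed \<beta>_closed e_smult E_\<beta>)
      have "frag_of (?t, ?x) - frag_of (?t, \<beta> \<gamma> \<odot>\<^bsub>P 0\<^esub> ?x) \<in> L' i 0"
        using x bx by (intro ker_rel t) auto
      moreover have "frag_of (?t, \<beta> \<gamma> \<odot>\<^bsub>P 0\<^esub> ?x) - frag_of (t, ?x) \<in> L' i 0"
        using rel_g[OF r(3,2), of ?x 0] x by simp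
      ultimately have "frag_of (?t, ?x) - frag_of (?t, \<beta> \<gamma> \<odot>\<^bsub>P 0\<^esub> ?x) + (frag_of (?t, \<beta> \<gamma> \<odot>\<^bsub>P 0\<^esub> ?x) - frag_of (t, ?x)) \<in> L' i 0"
        by (rule subgrp_add[OF subgrp_L'])
      then show "lab sec r \<in> L' i 0"
        by (simp add: r(1) additive_diff[OF additive_tens] additive_diff[OF additive_lab])
    next
      assume "r \<in> {ten2 t q | t q. t \<in> T i \<and> q \<in> sumrel K}"
      then obtain t c c' where r: "r = ten2 t (frag_of (c \<oplus>\<^bsub>K\<^esub> c') - frag_of c - frag_of c')" "t \<in> T i" "c \<in> carrier K" "c' \<in> carrier K"
        by (auto simp: sumrel_def)
      have s: "sec c \<in> carrier (P 0)" "e (sec c) = c" "sec c' \<in> carrier (P 0)" "e (sec c') = c'"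
        "sec (c \<oplus>\<^bsub>K\<^esub> c') \<in> carrier (P 0)" "e (sec (c \<oplus>\<^bsub>K\<^esub> c')) = c \<oplus>\<^bsub>K\<^esub> c'"
        using sec r by auto
      have "frag_of (t, sec (c \<oplus>\<^bsub>K\<^esub> c')) - frag_of (t, sec c \<oplus>\<^bsub>P 0\<^esub> sec c') \<in> L' i 0"
        using s r by (intro ker_rel) (simp_all add: pl_closed e_add)
      moreover have "frag_of (t, sec c \<oplus>\<^bsub>P 0\<^esub> sec c') - frag_of (t, sec c) - frag_of (t, sec c') \<in> L' i 0"
        using rel_add[OF r(2), of "sec c" 0 "sec c'"] s by simp
      ultimately have "frag_of (t, sec (c \<oplus>\<^bsub>K\<^esub> c')) - frag_of (t, sec c \<oplus>\<^bsub>P 0\<^esub> sec c')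
          + (frag_of (t, sec c \<oplus>\<^bsub>P 0\<^esub> sec c') - frag_of (t, sec c) - frag_of (t, sec c')) \<in> L' i 0"
        by (rule subgrp_add[OF subgrp_L'])
      then show "lab sec r \<in> L' i 0"
        by (simp add: r(1) ten2_diff additive_diff[OF additive_lab] add_diff_eq)
    qed
  qed
qed

lemma lab_e_S: "x \<in> frags (T i \<times> carrier (P 0)) \<Longrightarrow> lab e x \<in> SK i"
  unfolding SK_def by (rule additive_image_frags[OF additive_lab subgrp_frags]) (auto intro: e_closed)

lemma lab_sec_S: "y \<in> SK i \<Longrightarrow> lab sec y \<in> frags (T i \<times> carrier (P 0))"
  unfolding SK_def by (rule additive_image_frags[OF additive_lab subgrp_frags]) (use sec in auto)

lemma lab_e_sec: "y \<in> SK i \<Longrightarrow> lab e (lab sec y) = y"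
  unfolding SK_def
  by (rule additive_eq_frags[OF additive_compose[OF additive_lab additive_lab] additive_id]) (use sec in auto)

lemma lab_sec_e: "x \<in> frags (T i \<times> carrier (P 0)) \<Longrightarrow> x - lab sec (lab e x) \<in> L' i 0"
  by (rule additive_cong_frags[OF additive_id additive_compose[OF additive_lab additive_lab] subgrp_L'])
     (use ker_rel sec e_closed in auto)

lemma lift_bd_LK: "w \<in> LK (Suc i) \<Longrightarrow> lift bd w \<in> LK i"
  unfolding LK_def
proof (erule lift_rels[OF additive_bd, rotated 2])
  fix r assume "r \<in> grK (Suc i)"
  then obtain \<gamma> t where r: "r = frag_of (map (\<lambda>x. \<gamma> \<otimes>\<^bsub>\<Gamma>\<^esub> x) t) - frag_of t" "\<gamma> \<in> H" "t \<in> T (Suc i)"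
    by (auto simp: grK_def)
  have "lact (\<lambda>x. \<gamma> \<otimes>\<^bsub>\<Gamma>\<^esub> x) (bd_list t) - bd_list t \<in> spn (grK i)"
    by (rule additive_cong_frags[OF additive_lact additive_id subgrp_spn bd_T[OF r(3)]])
       (use r(2) in \<open>auto simp: grK_def intro!: spn_base\<close>)
  then show "bd r \<in> spn (grK i)" by (simp add: r(1) op_diff bd_map)
qed (simp add: bd_T)

lemma sub_WK: "subgrp (WK q)"
  using SK_sub rels_sub
  by (auto simp: WK_def subgrp_def additive_diff[OF additive_lift] additive_zero[OF additive_lift])

lemma sub_DK: "subgrp (DK q)"
proof -
  have "w - w' \<in> DK q" if w: "w \<in> DK q" "w' \<in> DK q" for w w'
  proof -
    obtain u u' where u: "u \<in> SK (Suc (Suc q))" "w - lift bd u \<in> LK (Suc q)"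
      "u' \<in> SK (Suc (Suc q))" "w' - lift bd u' \<in> LK (Suc q)" using w by (auto simp: DK_def)
    have "(w - lift bd u) - (w' - lift bd u') \<in> LK (Suc q)" by (rule subgrp_diff[OF rels_sub u(2,4)])
    moreover have "(w - lift bd u) - (w' - lift bd u') = (w - w') - lift bd (u - u')"
      by (simp add: additive_diff[OF additive_lift])
    ultimately show ?thesis using subgrp_diff[OF SK_sub u(1,3)] w subgrp_diff[OF SK_sub]
      by (auto simp: DK_def)
  qed
  moreover have "0 \<in> DK q"
    unfolding DK_def by (intro CollectI conjI bexI[of _ 0])
      (simp_all add: subgrp_zero[OF SK_sub] subgrp_zero[OF rels_sub] additive_zero[OF additive_lift])
  ultimately show ?thesis by (simp add: subgrp_def)
qed

lemma DK_WK: "DK q \<subseteq> WK q"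
proof
  fix w assume "w \<in> DK q"
  then obtain u where w: "w \<in> SK (Suc q)" "u \<in> SK (Suc (Suc q))" "w - lift bd u \<in> LK (Suc q)" by (auto simp: DK_def)
  have "lift bd (w - lift bd u) \<in> LK q" by (rule lift_bd_LK[OF w(3)])
  then show "w \<in> WK q"
    using w(1) by (simp add: WK_def additive_diff[OF additive_lift] lift_compose[OF additive_bd] bd_bd lift_zero)
qed

end

context double_complex
begin

lemma subgrp_ZX: "subgrp (ZX q)" and subgrp_ZY: "subgrp (ZY q)"
  using subS subL by (auto simp: ZX_def ZY_def subgrp_def additive_diff[OF add_dv] additive_diff[OF add_dh]
      additive_zero[OF add_dv] additive_zero[OF add_dh])

lemma subgrp_BX: "subgrp (BX q)"
proof -
  have "x - x' \<in> BX q" if x: "x \<in> BX q" "x' \<in> BX q" for x x'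
  proof -
    obtain u u' where u: "u \<in> S 0 (Suc (Suc q))" "x - dv 0 (Suc q) u \<in> L 0 (Suc q)"
      "u' \<in> S 0 (Suc (Suc q))" "x' - dv 0 (Suc q) u' \<in> L 0 (Suc q)" using x by (auto simp: BX_def)
    have "(x - dv 0 (Suc q) u) - (x' - dv 0 (Suc q) u') \<in> L 0 (Suc q)" by (rule subgrp_diff[OF subL u(2,4)])
    moreover have "(x - dv 0 (Suc q) u) - (x' - dv 0 (Suc q) u') = (x - x') - dv 0 (Suc q) (u - u')"
      by (simp add: additive_diff[OF add_dv])
    ultimately show ?thesis using subgrp_diff[OF subS u(1,3)] x subgrp_diff[OF subS]
      by (auto simp: BX_def)
  qed
  moreover have "0 \<in> BX q"
    unfolding BX_def by (intro CollectI conjI bexI[of _ 0])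
      (simp_all add: subgrp_zero[OF subS] subgrp_zero[OF subL] additive_zero[OF add_dv])
  ultimately show ?thesis by (simp add: subgrp_def)
qed

lemma BX_ZX: "BX q \<subseteq> ZX q"
proof
  fix x assume "x \<in> BX q"
  then obtain u where x: "x \<in> S 0 (Suc q)" "u \<in> S 0 (Suc (Suc q))" "x - dv 0 (Suc q) u \<in> L 0 (Suc q)" by (auto simp: BX_def)
  have "dv 0 q (x - dv 0 (Suc q) u) + dv 0 q (dv 0 (Suc q) u) \<in> L 0 q"
    by (rule subgrp_add[OF subL dv_L[OF x(3)] dv_dv[OF x(2)]])
  then show "x \<in> ZX q" using x(1) by (simp add: ZX_def additive_diff[OF add_dv])
qed

lemma subgrp_BY: "subgrp (BY q)"
proof -
  have "x - x' \<in> BY q" if x: "x \<in> BY q" "x' \<in> BY q" for x x'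
  proof -
    obtain u u' where u: "u \<in> S (Suc (Suc q)) 0" "x - dh (Suc q) 0 u \<in> L (Suc q) 0"
      "u' \<in> S (Suc (Suc q)) 0" "x' - dh (Suc q) 0 u' \<in> L (Suc q) 0" using x by (auto simp: BY_def)
    have "(x - dh (Suc q) 0 u) - (x' - dh (Suc q) 0 u') \<in> L (Suc q) 0" by (rule subgrp_diff[OF subL u(2,4)])
    moreover have "(x - dh (Suc q) 0 u) - (x' - dh (Suc q) 0 u') = (x - x') - dh (Suc q) 0 (u - u')"
      by (simp add: additive_diff[OF add_dh])
    ultimately show ?thesis using subgrp_diff[OF subS u(1,3)] x subgrp_diff[OF subS]
      by (auto simp: BY_def)
  qed
  moreover have "0 \<in> BY q"
    unfolding BY_def by (intro CollectI conjI bexI[of _ 0])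
      (simp_all add: subgrp_zero[OF subS] subgrp_zero[OF subL] additive_zero[OF add_dh])
  ultimately show ?thesis by (simp add: subgrp_def)
qed

lemma BY_ZY: "BY q \<subseteq> ZY q"
proof
  fix x assume "x \<in> BY q"
  then obtain u where x: "x \<in> S (Suc q) 0" "u \<in> S (Suc (Suc q)) 0" "x - dh (Suc q) 0 u \<in> L (Suc q) 0" by (auto simp: BY_def)
  have "dh q 0 (x - dh (Suc q) 0 u) + dh q 0 (dh (Suc q) 0 u) \<in> L q 0"
    by (rule subgrp_add[OF subL dh_L[OF x(3)] dh_dh[OF x(2)]])
  then show "x \<in> ZY q" using x(1) by (simp add: ZY_def additive_diff[OF add_dh])
qed

end

section \<open>The outer complexes as group homology and as Tor\<close>

context tor_triv
begin

text \<open>At second index 0 the augmentation identifies the cokernel of \<open>d 0\<close> with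
  \<open>K\<close>, which leaves the chains of \<open>H\<close> with coefficients in
  \<open>K\<close>; \<open>sec\<close> provides the inverse.\<close>

lemma hcorr_Y: "hcorr (\<lambda>y w. y \<in> dc.ZY q \<and> w \<in> WK q \<and> w - lab e y \<in> DK q) (dc.ZY q) (dc.BY q) (WK q) (DK q)"
proof (rule hcorr_equiv[OF additive_lab dc.subgrp_ZY sub_WK dc.subgrp_BY sub_DK dc.BY_ZY DK_WK, where G = "lab sec"])
  fix y assume y: "y \<in> dc.ZY q"
  then have yS: "y \<in> frags (T (Suc q) \<times> carrier (P 0))" and yL: "lift bd y \<in> L q 0"
    by (auto simp: dc.ZY_def S_def dh_def)
  have "lift bd (lab e y) \<in> LK q" if "q \<noteq> 0"
    using yL that lab_e_L[of "lift bd y" q] by (simp add: lift_bd_lab L_def)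
  then show "lab e y \<in> WK q" using lab_e_S[OF yS] by (auto simp: WK_def)
  have d: "y - lab sec (lab e y) \<in> L' (Suc q) 0" by (rule lab_sec_e[OF yS])
  have "y - lab sec (lab e y) \<in> S (Suc q) 0" using d L_S by blast
  then show "y - lab sec (lab e y) \<in> dc.BY q"
    using d subgrp_zero[OF subgrp_S] unfolding dc.BY_def
    by (intro CollectI conjI bexI[of _ 0]) (simp_all add: dh_def additive_zero[OF additive_lift])
next
  fix w assume w: "w \<in> WK q"
  then have wS: "w \<in> SK (Suc q)" by (simp add: WK_def)
  have "lift bd (lab sec w) \<in> L q 0"
  proof (cases "q = 0")
    case True
    then show ?thesis using lift_bd_S[OF lab_sec_S[OF wS]] by (simp add: L_def S_def)
  next
    case False
    then have "lift bd w \<in> LK q" using w by (simp add: WK_def)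
    then show ?thesis using lab_sec_L[of "lift bd w" q] False by (simp add: lift_bd_lab L_def)
  qed
  then show "lab sec w \<in> dc.ZY q" using lab_sec_S[OF wS] by (simp add: dc.ZY_def S_def dh_def)
  show "w - lab e (lab sec w) \<in> DK q" using lab_e_sec[OF wS] subgrp_zero[OF sub_DK] by simp
next
  fix y assume "y \<in> dc.BY q"
  then obtain u where y: "y \<in> frags (T (Suc q) \<times> carrier (P 0))" "u \<in> frags (T (Suc (Suc q)) \<times> carrier (P 0))"
    "y - lift bd u \<in> L' (Suc q) 0" by (auto simp: dc.BY_def S_def dh_def)
  have "lab e y - lift bd (lab e u) \<in> LK (Suc q)"
    using lab_e_L[OF y(3)] by (simp add: lift_bd_lab additive_diff[OF additive_lab])
  then show "lab e y \<in> DK q" using lab_e_S y by (auto simp: DK_def)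
next
  fix w assume "w \<in> DK q"
  then obtain u where w: "w \<in> SK (Suc q)" "u \<in> SK (Suc (Suc q))" "w - lift bd u \<in> LK (Suc q)" by (auto simp: DK_def)
  have "lab sec w - lift bd (lab sec u) \<in> L' (Suc q) 0"
    using lab_sec_L[OF w(3)] by (simp add: lift_bd_lab additive_diff[OF additive_lab])
  then show "lab sec w \<in> dc.BY q" using lab_sec_S w by (auto simp: dc.BY_def S_def dh_def)
qed

definition ST :: "nat \<Rightarrow> ('k \<times> 'p \<Rightarrow>\<^sub>0 int) set" where
  "ST j = frags (carrier E \<times> carrier (P j))"

definition LT :: "nat \<Rightarrow> ('k \<times> 'p \<Rightarrow>\<^sub>0 int) set" where
  "LT j = tensor_kernel R E (P j)"

definition ZT :: "nat \<Rightarrow> ('k \<times> 'p \<Rightarrow>\<^sub>0 int) set" where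
  "ZT q = {w \<in> ST q. q = 0 \<or> lab (d (q - 1)) w \<in> LT (q - 1)}"

definition BT :: "nat \<Rightarrow> ('k \<times> 'p \<Rightarrow>\<^sub>0 int) set" where
  "BT q = {w \<in> ST q. \<exists>u\<in>ST (Suc q). w - lab (d q) u \<in> LT q}"

text \<open>Tensoring \<open>P j\<close> with the trivial module amounts to dividing by
  \<open>N\<close> and by the action of \<open>H\<close>. In one direction the pair of
  \<open>c\<close> and \<open>x\<close> goes to the multiple of \<open>x\<close> by
  \<open>\<iota> c\<close>; in the other, \<open>tot\<close> pairs \<open>x\<close> with
  one.\<close>

definition tox :: "nat \<Rightarrow> ('k \<times> 'p \<Rightarrow>\<^sub>0 int) \<Rightarrow> ('a list \<times> 'p \<Rightarrow>\<^sub>0 int)" where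
  "tox j = frag_extend (\<lambda>(c, x). frag_of ([], \<iota> c \<odot>\<^bsub>P j\<^esub> x))"

definition tot :: "('a list \<times> 'p \<Rightarrow>\<^sub>0 int) \<Rightarrow> ('k \<times> 'p \<Rightarrow>\<^sub>0 int)" where
  "tot = frag_extend (\<lambda>(t, x). frag_of (\<one>\<^bsub>K\<^esub>, x))"

lemma additive_tox: "additive (tox j)" and additive_tot: "additive tot"
  by (simp_all add: tox_def tot_def additive_frag_extend)

lemma tox_of [simp]: "tox j (frag_of (c, x)) = frag_of ([], \<iota> c \<odot>\<^bsub>P j\<^esub> x)"
  and tot_of [simp]: "tot (frag_of (t, x)) = frag_of (\<one>\<^bsub>K\<^esub>, x)"
  by (simp_all add: tox_def tot_def)

lemma T0: "t \<in> T 0 \<longleftrightarrow> t = []"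
  by (auto simp: T_def tup_def)

lemma relators_ST: "tensor_relators R E (P j) \<subseteq> ST j"
proof -
  interpret K: abelian_group K by (rule K)
  show ?thesis
    unfolding tensor_relators_def ST_def
    by (auto simp: E intro!: subgrp_diff[OF subgrp_frags] pl_closed sm_closed E_smult)
qed

lemma LT_spn: "LT j = spn (tensor_relators R E (P j))"
  using relators_ST unfolding LT_def tensor_kernel_def ST_def by (rule generate_free_Abelian_group)

lemma sub_LT: "subgrp (LT j)" and sub_ST: "subgrp (ST j)"
  by (simp_all add: LT_spn subgrp_spn ST_def subgrp_frags)

lemma LT_ST: "LT j \<subseteq> ST j"
  unfolding LT_spn by (rule spn_least[OF sub_ST relators_ST])

lemma LT_add1: "x \<in> carrier K \<Longrightarrow> x' \<in> carrier K \<Longrightarrow> y \<in> carrier (P j) \<Longrightarrow>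
    frag_of (x \<oplus>\<^bsub>K\<^esub> x', y) - frag_of (x, y) - frag_of (x', y) \<in> LT j"
  unfolding LT_spn tensor_relators_def by (rule spn_base) (auto simp: E)

lemma LT_add2: "x \<in> carrier K \<Longrightarrow> y \<in> carrier (P j) \<Longrightarrow> y' \<in> carrier (P j) \<Longrightarrow>
    frag_of (x, y \<oplus>\<^bsub>P j\<^esub> y') - frag_of (x, y) - frag_of (x, y') \<in> LT j"
  unfolding LT_spn tensor_relators_def by (rule spn_base) (auto simp: E)

lemma LT_bal: "a \<in> carrier R \<Longrightarrow> x \<in> carrier K \<Longrightarrow> y \<in> carrier (P j) \<Longrightarrow>
    frag_of (a \<odot>\<^bsub>E\<^esub> x, y) - frag_of (x, a \<odot>\<^bsub>P j\<^esub> y) \<in> LT j"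
  unfolding LT_spn tensor_relators_def by (rule spn_base) (auto simp: E)

text \<open>Modulo \<open>N\<close> the element \<open>a\<close> is the sum of the products
  \<open>\<beta> \<gamma> \<otimes> \<kappa> \<gamma> a\<close>, and on the empty tuple each
  \<open>\<beta> \<gamma>\<close> may be dropped by a relation. What remains is the sum of the
  coordinates, the scalar by which \<open>a\<close> acts on \<open>E\<close>; this is the balancing
  relation of the tensor product.\<close>

lemma bottom_row:
  assumes a: "a \<in> carrier R" and c: "c \<in> carrier K" and x: "x \<in> carrier (P j)"
  shows "frag_of ([], \<iota> (a \<odot>\<^bsub>E\<^esub> c) \<odot>\<^bsub>P j\<^esub> x) - frag_of ([], \<iota> c \<odot>\<^bsub>P j\<^esub> (a \<odot>\<^bsub>P j\<^esub> x)) \<in> L' 0 (Suc j)"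
proof -
  interpret A: left_module R "P j" by (rule lm)
  let ?L = "L' 0 (Suc j)"
  have t: "[] \<in> T 0" by (simp add: T0)
  define y where "y = \<iota> c \<odot>\<^bsub>P j\<^esub> x"
  have y: "y \<in> carrier (P j)" using x c by (simp add: y_def sm_closed \<iota>_closed)
  define G where "G = {\<gamma> \<in> H. \<kappa> \<gamma> a \<noteq> \<zero>}"
  have G: "finite G" "\<And>\<gamma>. \<gamma> \<in> G \<Longrightarrow> \<gamma> \<in> H" using \<kappa>_finite[OF a] by (auto simp: G_def)
  have k: "\<kappa> \<gamma> a \<in> carrier R" "\<beta> \<gamma> \<in> carrier R" if "\<gamma> \<in> G" for \<gamma> using G that a \<kappa>_closed \<beta>_closed by auto
  define f where "f = (\<Oplus>\<gamma>\<in>G. \<beta> \<gamma> \<otimes> \<kappa> \<gamma> a)"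
  have f: "f \<in> carrier R" unfolding f_def using k by (intro R.finsum_closed) auto
  have nu: "a \<ominus> f \<in> N" using \<kappa>_decomp[OF a] by (simp add: f_def G_def)
  have eq: "a \<odot>\<^bsub>P j\<^esub> y = (a \<ominus> f) \<odot>\<^bsub>P j\<^esub> y \<oplus>\<^bsub>P j\<^esub> f \<odot>\<^bsub>P j\<^esub> y"
  proof -
    have "a = (a \<ominus> f) \<oplus> f" using a f by (simp add: R.minus_eq R.a_assoc R.l_neg)
    then show ?thesis using sm_ldist[of "a \<ominus> f" f y j] a f y by simp
  qed
  have 1: "frag_of ([], a \<odot>\<^bsub>P j\<^esub> y) - frag_of ([], (a \<ominus> f) \<odot>\<^bsub>P j\<^esub> y) - frag_of ([], f \<odot>\<^bsub>P j\<^esub> y) \<in> ?L"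
    unfolding eq using rel_add[OF t, of "(a \<ominus> f) \<odot>\<^bsub>P j\<^esub> y" "Suc j" "f \<odot>\<^bsub>P j\<^esub> y"] a f y by (simp add: sm_closed)
  have 2: "frag_of ([], (a \<ominus> f) \<odot>\<^bsub>P j\<^esub> y) \<in> ?L" using rel_N[OF t nu, of y "Suc j"] y by simp
  have fy: "f \<odot>\<^bsub>P j\<^esub> y = (\<Oplus>\<^bsub>P j\<^esub>\<gamma>\<in>G. \<beta> \<gamma> \<odot>\<^bsub>P j\<^esub> (\<kappa> \<gamma> a \<odot>\<^bsub>P j\<^esub> y))"
    unfolding f_def using k y
    by (subst A.smult_finsum_left) (auto simp: G(1) sm_assoc sm_closed intro!: A.M.finsum_cong')
  have 3: "frag_of ([], f \<odot>\<^bsub>P j\<^esub> y) - (\<Sum>\<gamma>\<in>G. frag_of ([], \<beta> \<gamma> \<odot>\<^bsub>P j\<^esub> (\<kappa> \<gamma> a \<odot>\<^bsub>P j\<^esub> y))) \<in> ?L"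
    unfolding fy using rel_sum[OF t G(1), of "\<lambda>\<gamma>. \<beta> \<gamma> \<odot>\<^bsub>P j\<^esub> (\<kappa> \<gamma> a \<odot>\<^bsub>P j\<^esub> y)" "Suc j"] k y by (simp add: sm_closed)
  have "(\<Sum>\<gamma>\<in>G. frag_of ([], \<beta> \<gamma> \<odot>\<^bsub>P j\<^esub> (\<kappa> \<gamma> a \<odot>\<^bsub>P j\<^esub> y)) - frag_of ([], \<kappa> \<gamma> a \<odot>\<^bsub>P j\<^esub> y)) \<in> ?L"
  proof (rule subgrp_sum[OF subgrp_L'])
    fix \<gamma> assume "\<gamma> \<in> G"
    then show "frag_of ([], \<beta> \<gamma> \<odot>\<^bsub>P j\<^esub> (\<kappa> \<gamma> a \<odot>\<^bsub>P j\<^esub> y)) - frag_of ([], \<kappa> \<gamma> a \<odot>\<^bsub>P j\<^esub> y) \<in> ?L"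
      using rel_g[OF t G(2), of \<gamma> "\<kappa> \<gamma> a \<odot>\<^bsub>P j\<^esub> y" "Suc j"] k y by (simp add: sm_closed)
  qed
  then have 4: "(\<Sum>\<gamma>\<in>G. frag_of ([], \<beta> \<gamma> \<odot>\<^bsub>P j\<^esub> (\<kappa> \<gamma> a \<odot>\<^bsub>P j\<^esub> y))) - (\<Sum>\<gamma>\<in>G. frag_of ([], \<kappa> \<gamma> a \<odot>\<^bsub>P j\<^esub> y)) \<in> ?L"
    by (simp add: sum_subtractf)
  have "\<iota> (a \<odot>\<^bsub>E\<^esub> c) \<odot>\<^bsub>P j\<^esub> x = (\<Oplus>\<gamma>\<in>G. \<kappa> \<gamma> a) \<odot>\<^bsub>P j\<^esub> y"
    using k by (simp add: \<iota>_smult[OF a c] G_def[symmetric] y_def sm_assoc \<iota>_closed c x R.finsum_closed Pi_def)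
  also have "\<dots> = (\<Oplus>\<^bsub>P j\<^esub>\<gamma>\<in>G. \<kappa> \<gamma> a \<odot>\<^bsub>P j\<^esub> y)"
    using k y by (subst A.smult_finsum_left) (auto simp: G(1))
  finally have 5: "frag_of ([], \<iota> (a \<odot>\<^bsub>E\<^esub> c) \<odot>\<^bsub>P j\<^esub> x) - (\<Sum>\<gamma>\<in>G. frag_of ([], \<kappa> \<gamma> a \<odot>\<^bsub>P j\<^esub> y)) \<in> ?L"
    using rel_sum[OF t G(1), of "\<lambda>\<gamma>. \<kappa> \<gamma> a \<odot>\<^bsub>P j\<^esub> y" "Suc j"] k y by (simp add: sm_closed)
  have 6: "\<iota> c \<odot>\<^bsub>P j\<^esub> (a \<odot>\<^bsub>P j\<^esub> x) = a \<odot>\<^bsub>P j\<^esub> y"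
    using a c x by (simp add: y_def \<iota>_closed \<iota>_central flip: sm_assoc)
  have "(frag_of ([], \<iota> (a \<odot>\<^bsub>E\<^esub> c) \<odot>\<^bsub>P j\<^esub> x) - (\<Sum>\<gamma>\<in>G. frag_of ([], \<kappa> \<gamma> a \<odot>\<^bsub>P j\<^esub> y)))
      - ((frag_of ([], a \<odot>\<^bsub>P j\<^esub> y) - frag_of ([], (a \<ominus> f) \<odot>\<^bsub>P j\<^esub> y) - frag_of ([], f \<odot>\<^bsub>P j\<^esub> y))
        + frag_of ([], (a \<ominus> f) \<odot>\<^bsub>P j\<^esub> y)
        + (frag_of ([], f \<odot>\<^bsub>P j\<^esub> y) - (\<Sum>\<gamma>\<in>G. frag_of ([], \<beta> \<gamma> \<odot>\<^bsub>P j\<^esub> (\<kappa> \<gamma> a \<odot>\<^bsub>P j\<^esub> y))))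
        + ((\<Sum>\<gamma>\<in>G. frag_of ([], \<beta> \<gamma> \<odot>\<^bsub>P j\<^esub> (\<kappa> \<gamma> a \<odot>\<^bsub>P j\<^esub> y))) - (\<Sum>\<gamma>\<in>G. frag_of ([], \<kappa> \<gamma> a \<odot>\<^bsub>P j\<^esub> y)))) \<in> ?L"
    by (rule subgrp_diff[OF subgrp_L' 5 subgrp_add[OF subgrp_L' subgrp_add[OF subgrp_L' subgrp_add[OF subgrp_L' 1 2] 3] 4]])
  then show ?thesis unfolding 6 by simp
qed

lemma tox_L: "w \<in> LT j \<Longrightarrow> tox j w \<in> L' 0 (Suc j)"
proof -
  interpret K: abelian_group K by (rule K)
  assume w: "w \<in> LT j"
  have t: "[] \<in> T 0" by (simp add: T0)
  show ?thesis
  proof (rule spn_image[OF additive_tox subgrp_L' _ w[unfolded LT_spn]])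
    fix r assume "r \<in> tensor_relators R E (P j)"
    then consider
      (a) x x' y where "r = frag_of (x \<oplus>\<^bsub>E\<^esub> x', y) - frag_of (x, y) - frag_of (x', y)" "x \<in> carrier E" "x' \<in> carrier E" "y \<in> carrier (P j)"
    | (b) x y y' where "r = frag_of (x, y \<oplus>\<^bsub>P j\<^esub> y') - frag_of (x, y) - frag_of (x, y')" "x \<in> carrier E" "y \<in> carrier (P j)" "y' \<in> carrier (P j)"
    | (c) a x y where "r = frag_of (a \<odot>\<^bsub>E\<^esub> x, y) - frag_of (x, a \<odot>\<^bsub>P j\<^esub> y)" "a \<in> carrier R" "x \<in> carrier E" "y \<in> carrier (P j)"
      unfolding tensor_relators_def by blast
    then show "tox j r \<in> L' 0 (Suc j)"
    proof cases
      case a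
      then show ?thesis
        using rel_add[OF t, of "\<iota> x \<odot>\<^bsub>P j\<^esub> y" "Suc j" "\<iota> x' \<odot>\<^bsub>P j\<^esub> y"]
        by (simp add: additive_diff[OF additive_tox] E \<iota>_add sm_ldist \<iota>_closed sm_closed)
    next
      case b
      then show ?thesis
        using rel_add[OF t, of "\<iota> x \<odot>\<^bsub>P j\<^esub> y" "Suc j" "\<iota> x \<odot>\<^bsub>P j\<^esub> y'"]
        by (simp add: additive_diff[OF additive_tox] E sm_rdist \<iota>_closed sm_closed)
    next
      case c
      then show ?thesis using bottom_row[of a x y j] by (simp add: additive_diff[OF additive_tox] E)
    qed
  qed
qed

lemma tot_L: "x \<in> L' 0 (Suc j) \<Longrightarrow> tot x \<in> LT j"
proof (rule L'_induct[OF additive_tot sub_LT])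
  fix \<gamma> t x assume a: "\<gamma> \<in> H" "t \<in> T 0" "x \<in> carrier (P (pj (Suc j)))"
  have "- (frag_of (\<beta> \<gamma> \<odot>\<^bsub>E\<^esub> \<one>\<^bsub>K\<^esub>, x) - frag_of (\<one>\<^bsub>K\<^esub>, \<beta> \<gamma> \<odot>\<^bsub>P j\<^esub> x)) \<in> LT j"
    using a one_K by (intro subgrp_uminus[OF sub_LT] LT_bal \<beta>_closed) auto
  then show "tot (frag_of (map (\<lambda>a. \<gamma> \<otimes>\<^bsub>\<Gamma>\<^esub> a) t, \<beta> \<gamma> \<odot>\<^bsub>P (pj (Suc j))\<^esub> x)) - tot (frag_of (t, x)) \<in> LT j"
    using a one_K by (simp add: E_\<beta>)
next
  fix t x y assume a: "t \<in> T 0" "x \<in> carrier (P (pj (Suc j)))" "y \<in> carrier (P (pj (Suc j)))"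
  then show "tot (frag_of (t, x \<oplus>\<^bsub>P (pj (Suc j))\<^esub> y)) - tot (frag_of (t, x)) - tot (frag_of (t, y)) \<in> LT j"
    using LT_add2[OF one_K] by simp
next
  interpret K: abelian_group K by (rule K)
  fix t \<nu> x assume a: "t \<in> T 0" "\<nu> \<in> N" "x \<in> carrier (P (pj (Suc j)))"
  have \<nu>: "\<nu> \<in> carrier R" using a N_carrier by blast
  have "frag_of (\<zero>\<^bsub>K\<^esub>, x) - frag_of (\<one>\<^bsub>K\<^esub>, \<nu> \<odot>\<^bsub>P j\<^esub> x) \<in> LT j"
    using LT_bal[OF \<nu> one_K, of x j] E_N[OF a(2) one_K] a by simp
  moreover have "frag_of (\<zero>\<^bsub>K\<^esub> \<oplus>\<^bsub>K\<^esub> \<zero>\<^bsub>K\<^esub>, x) - frag_of (\<zero>\<^bsub>K\<^esub>, x) - frag_of (\<zero>\<^bsub>K\<^esub>, x) \<in> LT j"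
    using a by (intro LT_add1) auto
  ultimately have "- ((frag_of (\<zero>\<^bsub>K\<^esub>, x) - frag_of (\<one>\<^bsub>K\<^esub>, \<nu> \<odot>\<^bsub>P j\<^esub> x)) + (frag_of (\<zero>\<^bsub>K\<^esub> \<oplus>\<^bsub>K\<^esub> \<zero>\<^bsub>K\<^esub>, x) - frag_of (\<zero>\<^bsub>K\<^esub>, x) - frag_of (\<zero>\<^bsub>K\<^esub>, x))) \<in> LT j"
    by (intro subgrp_uminus[OF sub_LT] subgrp_add[OF sub_LT])
  then show "tot (frag_of (t, \<nu> \<odot>\<^bsub>P (pj (Suc j))\<^esub> x)) \<in> LT j" by simp
qed simp_all

lemma tox_S: "w \<in> ST j \<Longrightarrow> tox j w \<in> S 0 (Suc j)"
  unfolding ST_def S_def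
  by (rule additive_image_frags[OF additive_tox subgrp_frags]) (auto simp: T0 E sm_closed \<iota>_closed)

lemma tot_S: "x \<in> S 0 (Suc j) \<Longrightarrow> tot x \<in> ST j"
  unfolding ST_def S_def
  by (rule additive_image_frags[OF additive_tot subgrp_frags]) (auto simp: E one_K)

lemma tox_tot: "x \<in> S 0 (Suc j) \<Longrightarrow> tox j (tot x) = x"
  unfolding S_def
  by (rule additive_eq_frags[OF additive_compose[OF additive_tox additive_tot] additive_id])
     (auto simp: T0 \<iota>_one sm_one)

lemma tot_tox: "w \<in> ST j \<Longrightarrow> w - tot (tox j w) \<in> LT j"
  unfolding ST_def
proof (rule additive_cong_frags[OF additive_id additive_compose[OF additive_tot additive_tox] sub_LT])
  fix s assume "s \<in> carrier E \<times> carrier (P j)"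
  then show "frag_of s - tot (tox j (frag_of s)) \<in> LT j"
    using LT_bal[OF \<iota>_closed one_K, of "fst s" "snd s" j] by (auto simp: E \<iota>_E)
qed

lemma tox_d: "w \<in> ST (Suc j) \<Longrightarrow> tox j (lab (d j) w) = lab (d j) (tox (Suc j) w)"
  unfolding ST_def
  by (rule additive_eq_frags[OF additive_compose[OF additive_tox additive_lab] additive_compose[OF additive_lab additive_tox]])
     (auto simp: E d_smult \<iota>_closed)

lemma tot_d: "tot (lab (d j) x) = lab (d j) (tot x)"
  by (rule additive_eq_frags[OF additive_compose[OF additive_tot additive_lab] additive_compose[OF additive_lab additive_tot] frags_UNIV])
     auto

lemma lab_d_ST: "w \<in> ST (Suc j) \<Longrightarrow> lab (d j) w \<in> ST j"
  unfolding ST_def by (rule lab_d_S)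

text \<open>Transported along \<open>tox\<close> and \<open>tot\<close> from
  \<open>lab_d_L'\<close>, so that the tensor relators are not examined a second time.\<close>

lemma lab_d_LT: "w \<in> LT (Suc j) \<Longrightarrow> lab (d j) w \<in> LT j"
proof -
  assume w: "w \<in> LT (Suc j)"
  then have wS: "w \<in> ST (Suc j)" using LT_ST by blast
  have "tox (Suc j) w \<in> L' 0 (Suc (Suc j))" by (rule tox_L[OF w])
  from tot_L[OF lab_d_L'[OF this]] have "tot (tox j (lab (d j) w)) \<in> LT j" by (simp add: tox_d[OF wS])
  moreover have "lab (d j) w - tot (tox j (lab (d j) w)) \<in> LT j" by (rule tot_tox[OF lab_d_ST[OF wS]])
  ultimately have "lab (d j) w - tot (tox j (lab (d j) w)) + tot (tox j (lab (d j) w)) \<in> LT j"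
    by (intro subgrp_add[OF sub_LT])
  then show ?thesis by simp
qed

lemma lab_d_d_LT: "w \<in> ST (Suc (Suc j)) \<Longrightarrow> lab (d j) (lab (d (Suc j)) w) \<in> LT j"
proof -
  interpret K: abelian_group K by (rule K)
  have z: "frag_of (c, \<zero>\<^bsub>P j\<^esub>) \<in> LT j" if "c \<in> carrier K" for c
  proof -
    have "- (frag_of (c, \<zero>\<^bsub>P j\<^esub> \<oplus>\<^bsub>P j\<^esub> \<zero>\<^bsub>P j\<^esub>) - frag_of (c, \<zero>\<^bsub>P j\<^esub>) - frag_of (c, \<zero>\<^bsub>P j\<^esub>)) \<in> LT j"
      using that by (intro subgrp_uminus[OF sub_LT] LT_add2 ze_closed)
    then show ?thesis by (simp add: pl_zero ze_closed)
  qed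
  assume "w \<in> ST (Suc (Suc j))"
  then show ?thesis unfolding ST_def
    by (rule additive_image_frags[OF additive_compose[OF additive_lab additive_lab] sub_LT, rotated]) (auto simp: d_d E z)
qed

lemma sub_ZT: "subgrp (ZT q)"
  using sub_ST[of q] sub_LT[of "q - 1"]
  by (auto simp: ZT_def subgrp_def additive_diff[OF additive_lab] additive_zero[OF additive_lab])

lemma sub_BT: "subgrp (BT q)"
proof -
  have "w - w' \<in> BT q" if w: "w \<in> BT q" "w' \<in> BT q" for w w'
  proof -
    obtain u u' where u: "u \<in> ST (Suc q)" "w - lab (d q) u \<in> LT q"
      "u' \<in> ST (Suc q)" "w' - lab (d q) u' \<in> LT q" using w by (auto simp: BT_def)
    have "(w - lab (d q) u) - (w' - lab (d q) u') \<in> LT q" by (rule subgrp_diff[OF sub_LT u(2,4)])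
    moreover have "(w - lab (d q) u) - (w' - lab (d q) u') = (w - w') - lab (d q) (u - u')"
      by (simp add: additive_diff[OF additive_lab])
    ultimately show ?thesis using subgrp_diff[OF sub_ST u(1,3)] w subgrp_diff[OF sub_ST]
      by (auto simp: BT_def)
  qed
  moreover have "0 \<in> BT q"
    unfolding BT_def by (intro CollectI conjI bexI[of _ 0])
      (simp_all add: subgrp_zero[OF sub_ST] subgrp_zero[OF sub_LT] additive_zero[OF additive_lab])
  ultimately show ?thesis by (simp add: subgrp_def)
qed

lemma BT_ZT: "BT q \<subseteq> ZT q"
proof
  fix w assume "w \<in> BT q"
  then obtain u where w: "w \<in> ST q" "u \<in> ST (Suc q)" "w - lab (d q) u \<in> LT q" by (auto simp: BT_def)
  show "w \<in> ZT q"
  proof (cases q)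
    case 0
    then show ?thesis using w by (simp add: ZT_def)
  next
    case (Suc j)
    have "lab (d j) (w - lab (d q) u) + lab (d j) (lab (d q) u) \<in> LT j"
      using w Suc lab_d_d_LT[of u j] lab_d_LT[of "w - lab (d q) u" j] by (intro subgrp_add[OF sub_LT]) simp_all
    then show ?thesis using w Suc by (simp add: ZT_def additive_diff[OF additive_lab])
  qed
qed

lemma hcorr_X: "hcorr (\<lambda>w x. w \<in> ZT q \<and> x \<in> dc.ZX q \<and> x - tox q w \<in> dc.BX q) (ZT q) (BT q) (dc.ZX q) (dc.BX q)"
proof (rule hcorr_equiv[OF additive_tox sub_ZT dc.subgrp_ZX sub_BT dc.subgrp_BX BT_ZT dc.BX_ZX, where G = tot])
  have dv: "dv 0 (Suc j) = lab (d j)" "dv 0 0 = (\<lambda>x. x)" for j by (simp_all add: dv_def)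
  have L00: "x \<in> L 0 0" if "x \<in> S 0 (Suc 0)" for x using that by (simp add: L_def S_def)
  fix w assume w: "w \<in> ZT q"
  then have wS: "w \<in> ST q" by (simp add: ZT_def)
  have "dv 0 q (tox q w) \<in> L 0 q"
  proof (cases q)
    case 0
    then show ?thesis using L00 tox_S[OF wS] by (simp add: dv)
  next
    case (Suc j)
    then show ?thesis using w tox_L[of "lab (d j) w" j] tox_d[of w j] wS by (simp add: ZT_def dv)
  qed
  then show "tox q w \<in> dc.ZX q" using tox_S[OF wS] by (simp add: dc.ZX_def)
  have "w - tot (tox q w) \<in> LT q" by (rule tot_tox[OF wS])
  moreover from this have "w - tot (tox q w) \<in> ST q" using LT_ST by blast
  ultimately show "w - tot (tox q w) \<in> BT q"
    unfolding BT_def using subgrp_zero[OF sub_ST]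
    by (intro CollectI conjI bexI[of _ 0]) (simp_all add: additive_zero[OF additive_lab])
next
  fix x assume x: "x \<in> dc.ZX q"
  then have xS: "x \<in> S 0 (Suc q)" by (simp add: dc.ZX_def)
  have "q = 0 \<or> lab (d (q - 1)) (tot x) \<in> LT (q - 1)"
  proof (cases q)
    case (Suc j)
    then show ?thesis using x tot_L[of "lab (d j) x" j] by (simp add: dc.ZX_def dv_def tot_d)
  qed simp
  then show "tot x \<in> ZT q" using tot_S[OF xS] by (simp add: ZT_def)
  show "x - tox q (tot x) \<in> dc.BX q" using tox_tot[OF xS] subgrp_zero[OF dc.subgrp_BX] by simp
next
  fix w assume "w \<in> BT q"
  then obtain u where w: "w \<in> ST q" "u \<in> ST (Suc q)" "w - lab (d q) u \<in> LT q" by (auto simp: BT_def)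
  have "tox q w - lab (d q) (tox (Suc q) u) \<in> L' 0 (Suc q)"
    using tox_L[OF w(3)] by (simp add: additive_diff[OF additive_tox] tox_d[OF w(2)])
  then show "tox q w \<in> dc.BX q" using tox_S w by (auto simp: dc.BX_def dv_def)
next
  fix x assume "x \<in> dc.BX q"
  then obtain u where x: "x \<in> S 0 (Suc q)" "u \<in> S 0 (Suc (Suc q))" "x - lab (d q) u \<in> L' 0 (Suc q)"
    by (auto simp: dc.BX_def dv_def)
  have "tot x - lab (d q) (tot u) \<in> LT q"
    using tot_L[OF x(3)] by (simp add: additive_diff[OF additive_tot] tot_d)
  then show "tot x \<in> BT q" using tot_S x by (auto simp: BT_def)
qed

definition corr :: "nat \<Rightarrow> ('k \<times> 'p \<Rightarrow>\<^sub>0 int) \<Rightarrow> ('a list \<times> 'k \<Rightarrow>\<^sub>0 int) \<Rightarrow> bool" where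
  "corr q w v \<longleftrightarrow> (\<exists>y. (\<exists>x. (w \<in> ZT q \<and> x \<in> dc.ZX q \<and> x - tox q w \<in> dc.BX q) \<and> dc.rel q x y) \<and>
     (y \<in> dc.ZY q \<and> v \<in> WK q \<and> v - lab e y \<in> DK q))"

theorem hcorr_corr: "hcorr (corr q) (ZT q) (BT q) (WK q) (DK q)"
  unfolding corr_def[abs_def] by (rule hcorr_comp[OF hcorr_comp[OF hcorr_X dc.hcorr_rel] hcorr_Y])

end

section \<open>Naturality\<close>

lemma stair_map:
  assumes A: "double_complex S L dh dv" and B: "double_complex S' L' dh' dv'"
    and add: "\<And>i j. additive (\<phi> i j)"
    and S: "\<And>i j x. x \<in> S i j \<Longrightarrow> \<phi> i j x \<in> S' i j" and L: "\<And>i j x. x \<in> L i j \<Longrightarrow> \<phi> i j x \<in> L' i j"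
    and h: "\<And>i j x. x \<in> S (Suc i) j \<Longrightarrow> \<phi> i j (dh i j x) = dh' i j (\<phi> (Suc i) j x)"
    and v: "\<And>i j x. x \<in> S i (Suc j) \<Longrightarrow> \<phi> i j (dv i j x) = dv' i j (\<phi> i (Suc j) x)"
    and s: "double_complex.stair S L dh dv i j a y \<xi>"
  shows "double_complex.stair S' L' dh' dv' i j (\<phi> i (Suc j) a) (\<phi> (Suc (i + j)) 0 y) (\<lambda>k. \<phi> (Suc (i + k)) (Suc j - k) (\<xi> k))"
proof -
  note sA = s[unfolded double_complex.stair_def[OF A]]
  have \<xi>: "\<xi> k \<in> S (Suc (i + k)) (Suc j - k)" if "k \<le> j" for k using sA that by blast
  have e: "\<phi> i' j' (u - u') = \<phi> i' j' u - \<phi> i' j' u'" for i' j' u u' by (rule additive_diff[OF add])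
  show ?thesis
    unfolding double_complex.stair_def[OF B]
  proof (intro conjI allI impI)
    show "\<phi> (Suc (i + k)) (Suc j - k) (\<xi> k) \<in> S' (Suc (i + k)) (Suc j - k)" if "k \<le> j" for k
      using S \<xi> that by blast
    have "\<phi> i (Suc j) (dh i (Suc j) (\<xi> 0) - a) \<in> L' i (Suc j)" using sA L by blast
    then show "dh' i (Suc j) (\<phi> (Suc (i + 0)) (Suc j - 0) (\<xi> 0)) - \<phi> i (Suc j) a \<in> L' i (Suc j)"
      using h[of "\<xi> 0" i "Suc j"] \<xi>[of 0] by (simp add: e)
    have "\<phi> (Suc (i + j)) 0 (dv (Suc (i + j)) 0 (\<xi> j) - y) \<in> L' (Suc (i + j)) 0" using sA L by blast
    then show "dv' (Suc (i + j)) 0 (\<phi> (Suc (i + j)) (Suc j - j) (\<xi> j)) - \<phi> (Suc (i + j)) 0 y \<in> L' (Suc (i + j)) 0"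
      using v[of "\<xi> j" "Suc (i + j)" 0] \<xi>[of j] by (simp add: e)
    fix k assume k: "k < j"
    have "\<phi> (Suc (i + k)) (j - k) (dh (Suc (i + k)) (j - k) (\<xi> (Suc k)) - dv (Suc (i + k)) (j - k) (\<xi> k)) \<in> L' (Suc (i + k)) (j - k)"
      using sA L k by blast
    then show "dh' (Suc (i + k)) (j - k) (\<phi> (Suc (i + Suc k)) (Suc j - Suc k) (\<xi> (Suc k)))
        - dv' (Suc (i + k)) (j - k) (\<phi> (Suc (i + k)) (Suc j - k) (\<xi> k)) \<in> L' (Suc (i + k)) (j - k)"
      using h[of "\<xi> (Suc k)" "Suc (i + k)" "j - k"] v[of "\<xi> k" "Suc (i + k)" "j - k"] \<xi>[of "Suc k"] \<xi>[of k] k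
      by (simp add: e Suc_diff_le)
  qed
qed

text \<open>Both subgroups lie in the same \<open>\<Gamma>\<close>. The chain map therefore acts on
  labels alone, and on the group homology side the comparison is the plain inclusion of
  chains.\<close>

locale tor_map = A: tor_triv R1 \<Gamma> P1 d1 H1 \<beta>1 N1 z1 \<kappa>1 K E1 e1 \<iota>1 + B: tor_triv R2 \<Gamma> P2 d2 H2 \<beta>2 N2 z2 \<kappa>2 K E2 e2 \<iota>2
  for R1 :: "'r1 ring" and \<Gamma> :: "'a monoid" and P1 :: "nat \<Rightarrow> ('r1, 'p1) module" and d1 H1 \<beta>1 N1 z1 \<kappa>1
    and K :: "'k ring" and E1 e1 \<iota>1
    and R2 :: "'r2 ring" and P2 :: "nat \<Rightarrow> ('r2, 'p2) module" and d2 H2 \<beta>2 N2 z2 \<kappa>2 E2 e2 \<iota>2 +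
  fixes \<phi> :: "'r1 \<Rightarrow> 'r2" and f :: "nat \<Rightarrow> 'p1 \<Rightarrow> 'p2"
  assumes f: "f j \<in> semilinear_maps \<phi> R1 (P1 j) (P2 j)"
    and f_d: "x \<in> carrier (P1 (Suc j)) \<Longrightarrow> f j (d1 j x) = d2 j (f (Suc j) x)"
    and e_f: "x \<in> carrier (P1 0) \<Longrightarrow> e2 (f 0 x) = e1 x"
    and HH: "H1 \<subseteq> H2" and \<phi>_\<beta>: "\<gamma> \<in> H1 \<Longrightarrow> \<phi> (\<beta>1 \<gamma>) = \<beta>2 \<gamma>"
    and \<phi>_N: "\<nu> \<in> N1 \<Longrightarrow> \<phi> \<nu> \<in> N2"
    and \<phi>_\<iota>: "c \<in> carrier K \<Longrightarrow> \<phi> (\<iota>1 c) = \<iota>2 c"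
begin

lemma f_closed: "x \<in> carrier (P1 j) \<Longrightarrow> f j x \<in> carrier (P2 j)"
  and f_add: "x \<in> carrier (P1 j) \<Longrightarrow> y \<in> carrier (P1 j) \<Longrightarrow> f j (x \<oplus>\<^bsub>P1 j\<^esub> y) = f j x \<oplus>\<^bsub>P2 j\<^esub> f j y"
  and f_smult: "x \<in> carrier (P1 j) \<Longrightarrow> a \<in> carrier R1 \<Longrightarrow> f j (a \<odot>\<^bsub>P1 j\<^esub> x) = \<phi> a \<odot>\<^bsub>P2 j\<^esub> f j x"
  using f[of j] by (auto simp: semilinear_maps_def)

lemma F_S: "x \<in> A.S i j \<Longrightarrow> lab (f (A.pj j)) x \<in> B.S i j"
  unfolding A.S_def B.S_def
  by (rule additive_image_frags[OF additive_lab subgrp_frags]) (auto intro: f_closed)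

lemma F_L': "x \<in> A.L' i j \<Longrightarrow> lab (f (A.pj j)) x \<in> B.L' i j"
proof (rule A.L'_induct[OF additive_lab B.subgrp_L'])
  fix \<gamma> t x assume a: "\<gamma> \<in> H1" "t \<in> A.T i" "x \<in> carrier (P1 (A.pj j))"
  then show "lab (f (A.pj j)) (frag_of (map (\<lambda>a. \<gamma> \<otimes>\<^bsub>\<Gamma>\<^esub> a) t, \<beta>1 \<gamma> \<odot>\<^bsub>P1 (A.pj j)\<^esub> x)) - lab (f (A.pj j)) (frag_of (t, x)) \<in> B.L' i j"
    using B.rel_g[OF a(2), of \<gamma> "f (A.pj j) x" j] HH f_closed[OF a(3)] by (auto simp: f_smult A.\<beta>_closed \<phi>_\<beta>)
next
  fix t x y assume a: "t \<in> A.T i" "x \<in> carrier (P1 (A.pj j))" "y \<in> carrier (P1 (A.pj j))"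
  then show "lab (f (A.pj j)) (frag_of (t, x \<oplus>\<^bsub>P1 (A.pj j)\<^esub> y)) - lab (f (A.pj j)) (frag_of (t, x)) - lab (f (A.pj j)) (frag_of (t, y)) \<in> B.L' i j"
    using B.rel_add[OF a(1), of "f (A.pj j) x" j "f (A.pj j) y"] by (simp add: f_add f_closed)
next
  fix t \<nu> x assume a: "t \<in> A.T i" "\<nu> \<in> N1" "x \<in> carrier (P1 (A.pj j))"
  then show "lab (f (A.pj j)) (frag_of (t, \<nu> \<odot>\<^bsub>P1 (A.pj j)\<^esub> x)) \<in> B.L' i j"
    using B.rel_N[OF a(1) \<phi>_N[OF a(2)], of "f (A.pj j) x" j] A.N_carrier by (auto simp: f_smult f_closed)
next
  fix t x assume a: "j = 0" "t \<in> A.T i" "x \<in> carrier (P1 1)"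
  then show "lab (f (A.pj j)) (frag_of (t, d1 0 x)) \<in> B.L' i j"
    using B.rel_d[OF a(2), of "f 1 x"] f_closed[of x 1] by (simp add: f_d)
qed

lemma F_L: "x \<in> A.L i j \<Longrightarrow> lab (f (A.pj j)) x \<in> B.L i j"
  using F_L'[of x i j] F_S[of x 0 0] by (auto simp: A.L_def B.L_def split: if_splits)

lemma F_dv: "x \<in> A.S i (Suc j) \<Longrightarrow> lab (f (A.pj j)) (A.dv i j x) = B.dv i j (lab (f (A.pj (Suc j))) x)"
proof (cases j)
  case 0
  then show ?thesis by (simp add: A.dv_def B.dv_def)
next
  case (Suc j')
  assume "x \<in> A.S i (Suc j)"
  then have x: "x \<in> frags (A.T i \<times> carrier (P1 (Suc j')))" using Suc by (simp add: A.S_def)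
  have "lab (f j') (lab (d1 j') x) = lab (d2 j') (lab (f (Suc j')) x)"
    by (rule additive_eq_frags[OF additive_compose[OF additive_lab additive_lab] additive_compose[OF additive_lab additive_lab] x])
       (auto simp: f_d)
  then show ?thesis using Suc by (simp add: A.dv_def B.dv_def)
qed

lemma F_ZX: "x \<in> A.dc.ZX q \<Longrightarrow> lab (f q) x \<in> B.dc.ZX q"
  using F_S[of x 0 "Suc q"] F_L[of "A.dv 0 q x" 0 q] F_dv[of x 0 q]
  by (auto simp: A.dc.ZX_def B.dc.ZX_def)

lemma F_BX: "x \<in> A.dc.BX q \<Longrightarrow> lab (f q) x \<in> B.dc.BX q"
proof -
  assume "x \<in> A.dc.BX q"
  then obtain u where u: "x \<in> A.S 0 (Suc q)" "u \<in> A.S 0 (Suc (Suc q))" "x - A.dv 0 (Suc q) u \<in> A.L 0 (Suc q)"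
    by (auto simp: A.dc.BX_def)
  have "lab (f q) x - B.dv 0 (Suc q) (lab (f (Suc q)) u) \<in> B.L 0 (Suc q)"
    using F_L[OF u(3)] F_dv[OF u(2)] by (simp add: additive_diff[OF additive_lab])
  then show ?thesis
    unfolding B.dc.BX_def using F_S[OF u(1)] F_S[OF u(2)] by (intro CollectI conjI bexI) simp_all
qed

lemma F_rel:
  assumes "A.dc.rel q x y"
  shows "B.dc.rel q (lab (f q) x) (lab (f 0) y)"
proof -
  obtain \<xi> where s: "A.dc.stair 0 q x y \<xi>" and xy: "x \<in> A.dc.ZX q" "y \<in> A.dc.ZY q"
    using assms by (auto simp: A.dc.rel_def)
  have h: "lab (f (A.pj j)) (A.dh i j u) = B.dh i j (lab (f (A.pj j)) u)" for i j u
    by (simp add: A.dh_def B.dh_def lab_lift)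
  have "B.dc.stair 0 q (lab (f (A.pj (Suc q))) x) (lab (f (A.pj 0)) y) (\<lambda>k. lab (f (A.pj (Suc q - k))) (\<xi> k))"
    by (rule stair_map[OF A.dc.double_complex_axioms B.dc.double_complex_axioms additive_lab F_S F_L h F_dv s])
  moreover have "lab (f 0) y \<in> B.dc.ZY q"
    using xy(2) F_S[of y "Suc q" 0] F_L[of "A.dh q 0 y" q 0] h[of 0 q y] by (auto simp: A.dc.ZY_def B.dc.ZY_def)
  ultimately show ?thesis using F_ZX[OF xy(1)] by (auto simp: B.dc.rel_def)
qed

lemma F_ST: "w \<in> A.ST j \<Longrightarrow> lab (f j) w \<in> B.ST j"
  unfolding A.ST_def B.ST_def
  by (rule additive_image_frags[OF additive_lab subgrp_frags]) (auto intro: f_closed simp: A.E B.E)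

lemma F_tox: "w \<in> A.ST j \<Longrightarrow> lab (f j) (A.tox j w) = B.tox j (lab (f j) w)"
  unfolding A.ST_def
  by (rule additive_eq_frags[OF additive_compose[OF additive_lab A.additive_tox] additive_compose[OF B.additive_tox additive_lab]])
     (auto simp: f_smult A.\<iota>_closed \<phi>_\<iota> A.E)

lemma F_LT: "w \<in> A.LT j \<Longrightarrow> lab (f j) w \<in> B.LT j"
proof -
  assume w: "w \<in> A.LT j"
  then have wS: "w \<in> A.ST j" using A.LT_ST by blast
  have "B.tox j (lab (f j) w) \<in> B.L' 0 (Suc j)" using F_L'[OF A.tox_L[OF w]] by (simp add: F_tox[OF wS])
  from B.tot_L[OF this] have "lab (f j) w - B.tot (B.tox j (lab (f j) w)) + B.tot (B.tox j (lab (f j) w)) \<in> B.LT j"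
    by (intro subgrp_add[OF B.sub_LT] B.tot_tox F_ST wS)
  then show ?thesis by simp
qed

lemma F_lab_d: "w \<in> A.ST (Suc j) \<Longrightarrow> lab (f j) (lab (d1 j) w) = lab (d2 j) (lab (f (Suc j)) w)"
  unfolding A.ST_def
  by (rule additive_eq_frags[OF additive_compose[OF additive_lab additive_lab] additive_compose[OF additive_lab additive_lab]])
     (auto simp: f_d)

lemma F_ZT: "w \<in> A.ZT q \<Longrightarrow> lab (f q) w \<in> B.ZT q"
  using F_ST[of w q] F_LT[of "lab (d1 (q - 1)) w" "q - 1"] F_lab_d[of w "q - 1"]
  by (cases q) (auto simp: A.ZT_def B.ZT_def)

lemma LK_mono: "w \<in> A.LK i \<Longrightarrow> w \<in> B.LK i"
proof -
  have "spn (A.grK i) \<subseteq> spn (B.grK i)" using HH by (intro spn_mono) (auto simp: A.grK_def B.grK_def)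
  from subsetD[OF rels_mono[OF this]] show "w \<in> A.LK i \<Longrightarrow> w \<in> B.LK i" by (simp add: A.LK_def B.LK_def)
qed

lemma WK_mono: "w \<in> A.WK q \<Longrightarrow> w \<in> B.WK q"
  using LK_mono by (auto simp: A.WK_def B.WK_def)

lemma DK_mono: "w \<in> A.DK q \<Longrightarrow> w \<in> B.DK q"
  using LK_mono unfolding A.DK_def B.DK_def by blast

text \<open>The element \<open>v\<close> stays the same because \<open>f\<close> covers the identity
  of \<open>K\<close>. With \<open>hcorr_square\<close> the question about Tor is thereby reduced to
  an inclusion in group homology.\<close>

lemma corr_natural:
  assumes "A.corr q w v"
  shows "B.corr q (lab (f q) w) v"
proof -
  obtain x y where c: "w \<in> A.ZT q" "x \<in> A.dc.ZX q" "x - A.tox q w \<in> A.dc.BX q" "A.dc.rel q x y"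
    "y \<in> A.dc.ZY q" "v \<in> A.WK q" "v - lab e1 y \<in> A.DK q" using assms unfolding A.corr_def by blast
  have wS: "w \<in> A.ST q" using c(1) by (simp add: A.ZT_def)
  have "lab (f q) x - B.tox q (lab (f q) w) \<in> B.dc.BX q"
    using F_BX[OF c(3)] by (simp add: additive_diff[OF additive_lab] F_tox[OF wS])
  moreover have "lab e2 (lab (f 0) y) = lab e1 y"
  proof -
    have "y \<in> frags (A.T (Suc q) \<times> carrier (P1 0))" using c(5) by (simp add: A.dc.ZY_def A.S_def)
    then show ?thesis
      by (rule additive_eq_frags[OF additive_compose[OF additive_lab additive_lab] additive_lab]) (auto simp: e_f)
  qed
  then have "v - lab e2 (lab (f 0) y) \<in> B.DK q" using DK_mono[OF c(7)] by simp
  ultimately show ?thesis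
    unfolding B.corr_def
    using F_ZT[OF c(1)] F_ZX[OF c(2)] F_rel[OF c(4)] WK_mono[OF c(6)] by (metis B.dc.rel_def)
qed

theorem tor_map_iso:
  assumes "\<And>w. w \<in> A.WK q \<Longrightarrow> w \<in> B.DK q \<Longrightarrow> w \<in> A.DK q"
    and "\<And>w. w \<in> B.WK q \<Longrightarrow> \<exists>w'\<in>A.WK q. w - w' \<in> B.DK q"
  shows "\<And>w. w \<in> A.ZT q \<Longrightarrow> lab (f q) w \<in> B.BT q \<Longrightarrow> w \<in> A.BT q"
    "\<And>w. w \<in> B.ZT q \<Longrightarrow> \<exists>w'\<in>A.ZT q. w - lab (f q) w' \<in> B.BT q"
proof -
  note sq = hcorr_square[where F = "lab (f q)", OF A.hcorr_corr[of q] B.hcorr_corr[of q]]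
  show "w \<in> A.BT q" if "w \<in> A.ZT q" "lab (f q) w \<in> B.BT q" for w
    by (rule sq(1)[OF _ _ _ that]) (auto intro: corr_natural assms)
  show "\<exists>w'\<in>A.ZT q. w - lab (f q) w' \<in> B.BT q" if "w \<in> B.ZT q" for w
    by (rule sq(2)[OF _ _ _ that]) (auto intro: corr_natural assms)
qed

end

section \<open>Homology of quotients of free abelian groups\<close>

text \<open>Bridges two styles: the homology groups of the statement are built from cosets of
  cosets, whereas all computations use representatives in free abelian groups.\<close>

locale frag_complex =
  fixes X :: "nat \<Rightarrow> 's set" and L :: "nat \<Rightarrow> ('s \<Rightarrow>\<^sub>0 int) set" and h :: "nat \<Rightarrow> ('s \<Rightarrow>\<^sub>0 int) \<Rightarrow> ('s \<Rightarrow>\<^sub>0 int)"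
  assumes subL: "subgrp (L i)" and LX: "L i \<subseteq> frags (X i)"
    and add_h: "additive (h i)"
    and h_X: "x \<in> frags (X (Suc i)) \<Longrightarrow> h i x \<in> frags (X i)" and h_L: "x \<in> L (Suc i) \<Longrightarrow> h i x \<in> L i"
begin

abbreviation Fr :: "nat \<Rightarrow> ('s \<Rightarrow>\<^sub>0 int) monoid" where
  "Fr i \<equiv> free_Abelian_group (X i)"

definition C :: "nat \<Rightarrow> ('s \<Rightarrow>\<^sub>0 int) set monoid" where
  "C i = Fr i Mod L i"

definition \<delta> :: "nat \<Rightarrow> ('s \<Rightarrow>\<^sub>0 int) set \<Rightarrow> ('s \<Rightarrow>\<^sub>0 int) set" where
  "\<delta> i = quotient_map (Fr i) (L i) (h i)"

definition cl :: "nat \<Rightarrow> ('s \<Rightarrow>\<^sub>0 int) \<Rightarrow> ('s \<Rightarrow>\<^sub>0 int) set" where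
  "cl i x = {l + x | l. l \<in> L i}"

definition cyc :: "nat \<Rightarrow> ('s \<Rightarrow>\<^sub>0 int) set" where
  "cyc q = {x \<in> frags (X q). q = 0 \<or> h (q - 1) x \<in> L (q - 1)}"

definition bnd :: "nat \<Rightarrow> ('s \<Rightarrow>\<^sub>0 int) set" where
  "bnd q = {x \<in> frags (X q). \<exists>u\<in>frags (X (Suc q)). x - h q u \<in> L q}"

text \<open>A homology class as it appears in the iterated quotient: the set of cosets of all chains
  that differ from \<open>x\<close> by a boundary.\<close>

definition tt :: "nat \<Rightarrow> ('s \<Rightarrow>\<^sub>0 int) \<Rightarrow> ('s \<Rightarrow>\<^sub>0 int) set set" where
  "tt q x = {cl q (h q u + x) | u. u \<in> frags (X (Suc q))}"

lemma r_coset_cl: "L i #>\<^bsub>Fr i\<^esub> x = cl i x"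
  by (auto simp: r_coset_def cl_def)

lemma cl_eq: "cl i x = cl i y \<longleftrightarrow> x - y \<in> L i"
proof
  assume "cl i x = cl i y"
  moreover have "0 + x \<in> cl i x" unfolding cl_def using subgrp_zero[OF subL] by blast
  ultimately have "x \<in> cl i y" by simp
  then show "x - y \<in> L i" by (auto simp: cl_def)
next
  assume a: "x - y \<in> L i"
  have "l + x \<in> cl i y" if "l \<in> L i" for l
    unfolding cl_def using subgrp_add[OF subL that a] by (intro CollectI exI[of _ "l + (x - y)"]) simp
  moreover have "l + y \<in> cl i x" if "l \<in> L i" for l
    unfolding cl_def using subgrp_diff[OF subL that a] by (intro CollectI exI[of _ "l - (x - y)"]) simp
  ultimately show "cl i x = cl i y" by (auto simp: cl_def)
qed

lemma carrier_C: "carrier (C i) = cl i ` frags (X i)"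
  by (auto simp: C_def FactGroup_def RCOSETS_def r_coset_cl frags_def)

lemma mult_cl: "cl i x \<otimes>\<^bsub>C i\<^esub> cl i y = cl i (x + y)"
proof -
  have "l + x + (l' + y) \<in> cl i (x + y)" if "l \<in> L i" "l' \<in> L i" for l l'
    unfolding cl_def using subgrp_add[OF subL that] by (intro CollectI exI[of _ "l + l'"]) (simp add: algebra_simps)
  moreover have "\<exists>a b. l + (x + y) = a + b \<and> a \<in> cl i x \<and> b \<in> cl i y" if "l \<in> L i" for l
    unfolding cl_def using that subgrp_zero[OF subL] by (intro exI[of _ "l + x"] exI[of _ "0 + y"]) (auto simp: algebra_simps)
  ultimately show ?thesis
    by (fastforce simp: C_def FactGroup_def set_mult_def cl_def)
qed

lemma \<delta>_cl: "\<delta> i (cl (Suc i) x) = cl i (h i x)"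
proof -
  have "L i #>\<^bsub>Fr i\<^esub> h i (l + x) = cl i (h i x)" if "l \<in> L (Suc i)" for l
    unfolding r_coset_cl cl_eq using h_L[OF that] by (simp add: additive_add[OF add_h])
  \<comment> \<open>The union in \<open>quotient_map\<close> runs over a nonempty coset, so the
    equal cosets collapse to a single one.\<close>
  moreover have "L (Suc i) \<noteq> {}" using subgrp_zero[OF subL] by blast
  ultimately show ?thesis unfolding \<delta>_def quotient_map_def cl_def[of "Suc i"] by auto
qed

lemma one_C: "\<one>\<^bsub>C i\<^esub> = cl i 0"
  by (simp add: C_def FactGroup_def cl_def)

lemma cycles_cl: "cycles C \<delta> q = cl q ` cyc q"
proof (cases q)
  case 0
  then show ?thesis by (simp add: cycles_def cyc_def carrier_C)
next
  case (Suc p)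
  have "{x \<in> cl (Suc p) ` frags (X (Suc p)). \<delta> p x = cl p 0} = cl (Suc p) ` {x \<in> frags (X (Suc p)). h p x \<in> L p}"
  proof -
    have "{x \<in> cl (Suc p) ` A. \<delta> p x = cl p 0} = cl (Suc p) ` {x \<in> A. \<delta> p (cl (Suc p) x) = cl p 0}" for A by blast
    then show ?thesis by (simp add: \<delta>_cl cl_eq)
  qed
  then show ?thesis using Suc by (simp add: cycles_def kernel_def carrier_C one_C cyc_def)
qed

lemma boundaries_cl: "boundaries C \<delta> q = (\<lambda>u. cl q (h q u)) ` frags (X (Suc q))"
  by (simp add: boundaries_def carrier_C image_image \<delta>_cl)

lemma coset_tt: "boundaries C \<delta> q #>\<^bsub>C q\<^esub> cl q x = tt q x"
  by (auto simp: r_coset_def boundaries_cl mult_cl tt_def)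

lemma tt_eq:
  assumes "x \<in> frags (X q)" "y \<in> frags (X q)"
  shows "tt q x = tt q y \<longleftrightarrow> x - y \<in> bnd q"
proof
  assume "tt q x = tt q y"
  moreover have "cl q (h q 0 + x) \<in> tt q x" unfolding tt_def using subgrp_zero[OF subgrp_frags] by blast
  ultimately obtain u where u: "cl q (h q 0 + x) = cl q (h q u + y)" "u \<in> frags (X (Suc q))" by (auto simp: tt_def)
  then have "x - y - h q u \<in> L q" by (simp add: cl_eq additive_zero[OF add_h] algebra_simps)
  then show "x - y \<in> bnd q" unfolding bnd_def using u subgrp_diff[OF subgrp_frags assms] by blast
next
  assume "x - y \<in> bnd q"
  then obtain v where v: "v \<in> frags (X (Suc q))" "x - y - h q v \<in> L q" by (auto simp: bnd_def)
  have 1: "cl q (h q u + x) = cl q (h q (u + v) + y)" for u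
    using v by (simp add: cl_eq additive_add[OF add_h] algebra_simps)
  have 2: "cl q (h q u + y) = cl q (h q (u - v) + x)" for u
    using 1[of "u - v"] by simp
  show "tt q x = tt q y"
    unfolding tt_def using 1 2 subgrp_add[OF subgrp_frags _ v(1)] subgrp_diff[OF subgrp_frags _ v(1)] by blast
qed

abbreviation HH :: "nat \<Rightarrow> ('s \<Rightarrow>\<^sub>0 int) set set monoid" where
  "HH q \<equiv> complex_homology C \<delta> q"

lemma carrier_HH: "carrier (HH q) = tt q ` cyc q"
proof -
  have "boundaries C \<delta> q #>\<^bsub>C q\<lparr>carrier := A\<rparr>\<^esub> c = boundaries C \<delta> q #>\<^bsub>C q\<^esub> c" for A c
    by (simp add: r_coset_def)
  then show ?thesis
    by (auto simp: complex_homology_def FactGroup_def RCOSETS_def cycles_cl coset_tt)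
qed

lemma mult_tt: "tt q x \<otimes>\<^bsub>HH q\<^esub> tt q y = tt q (x + y)"
proof -
  have "tt q x \<otimes>\<^bsub>HH q\<^esub> tt q y = {a \<otimes>\<^bsub>C q\<^esub> b | a b. a \<in> tt q x \<and> b \<in> tt q y}"
    by (auto simp: complex_homology_def FactGroup_def set_mult_def)
  also have "\<dots> = tt q (x + y)"
  proof (intro equalityI subsetI)
    fix c assume "c \<in> {a \<otimes>\<^bsub>C q\<^esub> b | a b. a \<in> tt q x \<and> b \<in> tt q y}"
    then obtain u v where "c = cl q (h q u + x) \<otimes>\<^bsub>C q\<^esub> cl q (h q v + y)" "u \<in> frags (X (Suc q))" "v \<in> frags (X (Suc q))"
      by (auto simp: tt_def)
    then show "c \<in> tt q (x + y)"
      unfolding tt_def using subgrp_add[OF subgrp_frags, of u "X (Suc q)" v]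
      by (intro CollectI exI[of _ "u + v"]) (simp add: mult_cl additive_add[OF add_h] algebra_simps)
  next
    fix c assume "c \<in> tt q (x + y)"
    then obtain u where "c = cl q (h q u + (x + y))" "u \<in> frags (X (Suc q))" by (auto simp: tt_def)
    moreover from this have "c = cl q (h q u + x) \<otimes>\<^bsub>C q\<^esub> cl q (h q 0 + y)"
      by (simp add: mult_cl additive_zero[OF add_h] algebra_simps)
    moreover have "cl q (h q 0 + y) \<in> tt q y"
      unfolding tt_def using subgrp_zero[OF subgrp_frags] by blast
    moreover have "cl q (h q u + x) \<in> tt q x" unfolding tt_def using \<open>u \<in> frags (X (Suc q))\<close> by blast
    ultimately show "c \<in> {a \<otimes>\<^bsub>C q\<^esub> b | a b. a \<in> tt q x \<and> b \<in> tt q y}" by blast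
  qed
  finally show ?thesis .
qed

end

lemma homology_iso:
  assumes A: "frag_complex X L h" and B: "frag_complex X' L' h'"
    and add: "additive g" and gX: "\<And>x. x \<in> frags (X q) \<Longrightarrow> g x \<in> frags (X' q)" and gL: "\<And>x. x \<in> L q \<Longrightarrow> g x \<in> L' q"
    and gh: "\<And>u. u \<in> frags (X (Suc q)) \<Longrightarrow> g (h q u) \<in> frag_complex.bnd X' L' h' q"
    and gcyc: "\<And>x. x \<in> frag_complex.cyc X L h q \<Longrightarrow> g x \<in> frag_complex.cyc X' L' h' q"
    and inj: "\<And>x. x \<in> frag_complex.cyc X L h q \<Longrightarrow> g x \<in> frag_complex.bnd X' L' h' q \<Longrightarrow> x \<in> frag_complex.bnd X L h q"
    and surj: "\<And>y. y \<in> frag_complex.cyc X' L' h' q \<Longrightarrow> \<exists>x\<in>frag_complex.cyc X L h q. y - g x \<in> frag_complex.bnd X' L' h' q"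
  shows "quotient_map (frag_complex.C X' L' q) (boundaries (frag_complex.C X' L') (frag_complex.\<delta> X' L' h') q)
      (quotient_map (free_Abelian_group (X' q)) (L' q) g)
    \<in> iso (complex_homology (frag_complex.C X L) (frag_complex.\<delta> X L h) q)
          (complex_homology (frag_complex.C X' L') (frag_complex.\<delta> X' L' h') q)"
proof -
  interpret A: frag_complex X L h by (rule A)
  interpret B: frag_complex X' L' h' by (rule B)
  let ?\<Phi> = "quotient_map (B.C q) (boundaries B.C B.\<delta> q) (quotient_map (B.Fr q) (L' q) g)"
  have cyc: "x \<in> frags (X q)" if "x \<in> A.cyc q" for x using that by (simp add: A.cyc_def)
  have cyc': "x \<in> frags (X' q)" if "x \<in> B.cyc q" for x using that by (simp add: B.cyc_def)
  have g_cl: "quotient_map (B.Fr q) (L' q) g (A.cl q x) = B.cl q (g x)" for x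
  proof -
    have "L' q #>\<^bsub>B.Fr q\<^esub> g (l + x) = B.cl q (g x)" if "l \<in> L q" for l
      unfolding B.r_coset_cl B.cl_eq using gL[OF that] by (simp add: additive_add[OF add])
    moreover have "L q \<noteq> {}" using subgrp_zero[OF A.subL] by blast
    ultimately show ?thesis unfolding quotient_map_def A.cl_def by auto
  qed
  have \<Phi>: "?\<Phi> (A.tt q x) = B.tt q (g x)" if x: "x \<in> frags (X q)" for x
  proof -
    have "boundaries B.C B.\<delta> q #>\<^bsub>B.C q\<^esub> B.cl q (g (h q u + x)) = B.tt q (g x)" if u: "u \<in> frags (X (Suc q))" for u
    proof -
      have "h q u + x \<in> frags (X q)" by (rule subgrp_add[OF subgrp_frags A.h_X[OF u] x])
      have "g (h q u + x) - g x \<in> B.bnd q" using gh[OF u] by (simp add: additive_add[OF add])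
      then show ?thesis unfolding B.coset_tt B.tt_eq[OF gX[OF \<open>h q u + x \<in> frags (X q)\<close>] gX[OF x]] .
    qed
    moreover have "frags (X (Suc q)) \<noteq> {}" using subgrp_zero[OF subgrp_frags] by blast
    ultimately show ?thesis unfolding quotient_map_def[of "B.C q"] A.tt_def by (auto simp: g_cl)
  qed
  have addcyc: "x + y \<in> A.cyc q" if "x \<in> A.cyc q" "y \<in> A.cyc q" for x y
    using that subgrp_add[OF subgrp_frags, of x "X q" y] subgrp_add[OF A.subL, of "h (q - 1) x" "q - 1" "h (q - 1) y"]
    by (auto simp: A.cyc_def additive_add[OF A.add_h])
  have "?\<Phi> \<in> hom (A.HH q) (B.HH q)"
    unfolding hom_def
  proof (intro CollectI conjI ballI)
    show "?\<Phi> \<in> carrier (A.HH q) \<rightarrow> carrier (B.HH q)"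
      using gcyc by (auto simp: A.carrier_HH B.carrier_HH \<Phi> cyc)
    fix a b assume "a \<in> carrier (A.HH q)" "b \<in> carrier (A.HH q)"
    then obtain x y where "a = A.tt q x" "b = A.tt q y" "x \<in> A.cyc q" "y \<in> A.cyc q" by (auto simp: A.carrier_HH)
    then show "?\<Phi> (a \<otimes>\<^bsub>A.HH q\<^esub> b) = ?\<Phi> a \<otimes>\<^bsub>B.HH q\<^esub> ?\<Phi> b"
      using addcyc[of x y] by (simp add: A.mult_tt B.mult_tt \<Phi> cyc additive_add[OF add])
  qed
  moreover have "inj_on ?\<Phi> (carrier (A.HH q))"
  proof (rule inj_onI)
    fix a b assume "a \<in> carrier (A.HH q)" "b \<in> carrier (A.HH q)" and eq: "?\<Phi> a = ?\<Phi> b"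
    then obtain x y where xy: "a = A.tt q x" "b = A.tt q y" "x \<in> A.cyc q" "y \<in> A.cyc q" by (auto simp: A.carrier_HH)
    have d: "x - y \<in> A.cyc q"
      using xy(3,4) subgrp_diff[OF subgrp_frags, of x "X q" y] subgrp_diff[OF A.subL, of "h (q - 1) x" "q - 1" "h (q - 1) y"]
      by (auto simp: A.cyc_def additive_diff[OF A.add_h])
    have "g (x - y) \<in> B.bnd q"
      using eq xy by (simp add: \<Phi> cyc B.tt_eq gX additive_diff[OF add])
    then show "a = b" using inj[OF d] xy by (simp add: A.tt_eq cyc)
  qed
  moreover have "?\<Phi> ` carrier (A.HH q) = carrier (B.HH q)"
  proof (intro equalityI subsetI)
    fix b assume "b \<in> carrier (B.HH q)"
    then obtain y where y: "b = B.tt q y" "y \<in> B.cyc q" by (auto simp: B.carrier_HH)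
    from surj[OF y(2)] obtain x where x: "x \<in> A.cyc q" "y - g x \<in> B.bnd q" by blast
    have "b = ?\<Phi> (A.tt q x)" using x y by (simp add: \<Phi> cyc B.tt_eq cyc' gX)
    then show "b \<in> ?\<Phi> ` carrier (A.HH q)" using x by (auto simp: A.carrier_HH)
  qed (use gcyc in \<open>auto simp: A.carrier_HH B.carrier_HH \<Phi> cyc\<close>)
  ultimately show ?thesis by (simp add: iso_def bij_betw_def)
qed

section \<open>The group of diagrams without missing edges\<close>

definition rook_units :: "'g monoid \<Rightarrow> nat \<Rightarrow> 'g diagram monoid" where
  "rook_units G n = \<lparr>carrier = {D \<in> rook_diagrams G n. no_missing_edges n D},
     mult = diagram_comp G, one = identity_diagram G n\<rparr>"

lemma rook_diagrams_iff:
  "D \<in> rook_diagrams G n \<longleftrightarrow> D \<subseteq> {..<n} \<times> carrier G \<times> {..<n} \<and>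
     (\<forall>x\<in>D. \<forall>y\<in>D. fst x = fst y \<or> snd (snd x) = snd (snd y) \<longrightarrow> x = y)"
  by (simp only: rook_diagrams_def case_prod_unfold prod.collapse mem_Collect_eq)

lemma rdD:
  assumes "D \<in> rook_diagrams G n" "(i, g, j) \<in> D"
  shows "i < n" "g \<in> carrier G" "j < n"
    "(i, g', j') \<in> D \<Longrightarrow> g' = g \<and> j' = j" "(i', g', j) \<in> D \<Longrightarrow> i' = i \<and> g' = g"
proof -
  have 1: "D \<subseteq> {..<n} \<times> carrier G \<times> {..<n}" using assms(1) by (simp add: rook_diagrams_def)
  then show "i < n" "g \<in> carrier G" "j < n" using assms(2) by auto
  have 2: "\<And>x y. x \<in> D \<Longrightarrow> y \<in> D \<Longrightarrow> fst x = fst y \<or> snd (snd x) = snd (snd y) \<Longrightarrow> x = y"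
    using assms(1) unfolding rook_diagrams_iff by blast
  show "(i, g', j') \<in> D \<Longrightarrow> g' = g \<and> j' = j" using 2[OF assms(2), of "(i, g', j')"] by auto
  show "(i', g', j) \<in> D \<Longrightarrow> i' = i \<and> g' = g" using 2[OF assms(2), of "(i', g', j)"] by auto
qed

lemma rdI:
  assumes "\<And>i g j. (i, g, j) \<in> D \<Longrightarrow> i < n \<and> g \<in> carrier G \<and> j < n"
    "\<And>i g j g' j'. (i, g, j) \<in> D \<Longrightarrow> (i, g', j') \<in> D \<Longrightarrow> g = g' \<and> j = j'"
    "\<And>i g j i' g'. (i, g, j) \<in> D \<Longrightarrow> (i', g', j) \<in> D \<Longrightarrow> i = i' \<and> g = g'"
  shows "D \<in> rook_diagrams G n"
proof -
  have "D \<subseteq> {..<n} \<times> carrier G \<times> {..<n}" using assms(1) by auto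
  moreover have "\<forall>x\<in>D. \<forall>y\<in>D. fst x = fst y \<or> snd (snd x) = snd (snd y) \<longrightarrow> x = y"
    using assms(2,3) by auto
  ultimately show ?thesis unfolding rook_diagrams_iff by (rule conjI)
qed

lemma left_nodes_sub: "D \<in> rook_diagrams G n \<Longrightarrow> left_nodes D \<subseteq> {..<n}"
  and right_nodes_sub: "D \<in> rook_diagrams G n \<Longrightarrow> right_nodes D \<subseteq> {..<n}"
  by (auto simp: left_nodes_def right_nodes_def dest: rdD)

lemma card_nodes:
  assumes "D \<in> rook_diagrams G n"
  shows "card (left_nodes D) = card (right_nodes D)"
proof -
  have "inj_on fst D" "inj_on (\<lambda>x. snd (snd x)) D"
    using rdD(4,5)[OF assms] by (auto simp: inj_on_def)
  moreover have "left_nodes D = fst ` D" "right_nodes D = (\<lambda>x. snd (snd x)) ` D"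
    by (force simp: left_nodes_def right_nodes_def)+
  ultimately show ?thesis by (simp add: card_image)
qed

text \<open>Left and right nodes are equinumerous in any diagram, so filling one of the finite
  columns fills the other.\<close>

lemma full_left: "D \<in> rook_diagrams G n \<Longrightarrow> {..<n} \<subseteq> left_nodes D \<Longrightarrow> no_missing_edges n D"
  and full_right: "D \<in> rook_diagrams G n \<Longrightarrow> {..<n} \<subseteq> right_nodes D \<Longrightarrow> no_missing_edges n D"
proof -
  assume D: "D \<in> rook_diagrams G n"
  note sub = left_nodes_sub[OF D] right_nodes_sub[OF D] card_nodes[OF D]
  have *: "A = {..<n}" if "A \<subseteq> {..<n}" "card A = n" for A
    using card_subset_eq[of "{..<n}" A] that by simp
  show "{..<n} \<subseteq> left_nodes D \<Longrightarrow> no_missing_edges n D"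
    unfolding no_missing_edges_def using sub *[of "right_nodes D"] by (metis card_lessThan subset_antisym)
  show "{..<n} \<subseteq> right_nodes D \<Longrightarrow> no_missing_edges n D"
    unfolding no_missing_edges_def using sub *[of "left_nodes D"] by (metis card_lessThan subset_antisym)
qed

lemma full_D:
  assumes "no_missing_edges n D" "k < n"
  shows "\<exists>g j. (k, g, j) \<in> D" "\<exists>i g. (i, g, k) \<in> D"
  using assms unfolding no_missing_edges_def left_nodes_def right_nodes_def by blast+

section \<open>Group structure on diagrams without missing edges and their action on letters\<close>

locale rook = G: group G + K: cring K
  for G :: "'g monoid" and K :: "'k ring" +
  fixes \<epsilon> :: 'k
  assumes \<epsilon>: "\<epsilon> \<in> Units K"
begin

abbreviation rd :: "nat \<Rightarrow> 'g diagram set" where "rd m \<equiv> rook_diagrams G m"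

abbreviation cmp :: "'g diagram \<Rightarrow> 'g diagram \<Rightarrow> 'g diagram" (infixl "\<bullet>" 70) where "x \<bullet> y \<equiv> diagram_comp G x y"

abbreviation idd :: "nat \<Rightarrow> 'g diagram" where "idd m \<equiv> identity_diagram G m"

abbreviation fl :: "nat \<Rightarrow> 'g diagram set" where "fl m \<equiv> {D \<in> rook_diagrams G m. no_missing_edges m D}"

lemma cmpI: "(i, g, k) \<in> x \<Longrightarrow> (k, h, j) \<in> y \<Longrightarrow> (i, g \<otimes>\<^bsub>G\<^esub> h, j) \<in> x \<bullet> y"
  unfolding diagram_comp_def by blast

lemma cmpE:
  assumes "(i, a, j) \<in> x \<bullet> y"
  obtains g k h where "a = g \<otimes>\<^bsub>G\<^esub> h" "(i, g, k) \<in> x" "(k, h, j) \<in> y"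
  using assms unfolding diagram_comp_def by blast

lemma cmp_rd: "x \<in> rd m \<Longrightarrow> y \<in> rd m \<Longrightarrow> x \<bullet> y \<in> rd m"
proof -
  assume x: "x \<in> rd m" and y: "y \<in> rd m"
  show ?thesis
  proof (rule rdI)
    fix i a j assume "(i, a, j) \<in> x \<bullet> y"
    then obtain g k h where 1: "a = g \<otimes>\<^bsub>G\<^esub> h" "(i, g, k) \<in> x" "(k, h, j) \<in> y" by (rule cmpE)
    then show "i < m \<and> a \<in> carrier G \<and> j < m" using rdD(1,2)[OF x 1(2)] rdD(2,3)[OF y 1(3)] by simp
    {
      fix a' j' assume "(i, a', j') \<in> x \<bullet> y"
      then obtain g' k' h' where 2: "a' = g' \<otimes>\<^bsub>G\<^esub> h'" "(i, g', k') \<in> x" "(k', h', j') \<in> y" by (rule cmpE)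
      have e: "g' = g \<and> k' = k" by (rule rdD(4)[OF x 1(2) 2(2)])
      then have "h' = h \<and> j' = j" using rdD(4)[OF y 1(3), of h' j'] 2(3) by simp
      then show "a = a' \<and> j = j'" using e 1(1) 2(1) by simp
    next
      fix i' a' assume "(i', a', j) \<in> x \<bullet> y"
      then obtain g' k' h' where 2: "a' = g' \<otimes>\<^bsub>G\<^esub> h'" "(i', g', k') \<in> x" "(k', h', j) \<in> y" by (rule cmpE)
      have e: "k' = k \<and> h' = h" by (rule rdD(5)[OF y 1(3) 2(3)])
      then have "i' = i \<and> g' = g" using rdD(5)[OF x 1(2), of i' g'] 2(2) by simp
      then show "i = i' \<and> a = a'" using e 1(1) 2(1) by simp
    }
  qed
qed

lemma idd_rd: "idd m \<in> rd m"
  by (rule rdI) (auto simp: identity_diagram_def)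

lemma idd_full: "idd m \<in> fl m"
  using idd_rd full_left[OF idd_rd] by (auto simp: left_nodes_def identity_diagram_def)

lemma cmp_assoc: "x \<in> rd m \<Longrightarrow> y \<in> rd m \<Longrightarrow> z \<in> rd m \<Longrightarrow> x \<bullet> y \<bullet> z = x \<bullet> (y \<bullet> z)"
proof -
  assume r: "x \<in> rd m" "y \<in> rd m" "z \<in> rd m"
  have "(i, a, j) \<in> x \<bullet> y \<bullet> z \<longleftrightarrow> (i, a, j) \<in> x \<bullet> (y \<bullet> z)" for i a j
  proof
    assume "(i, a, j) \<in> x \<bullet> y \<bullet> z"
    then obtain g k h g' k' where e: "a = g' \<otimes>\<^bsub>G\<^esub> g \<otimes>\<^bsub>G\<^esub> h" "(i, g', k') \<in> x" "(k', g, k) \<in> y" "(k, h, j) \<in> z"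
      by (elim cmpE) blast
    then show "(i, a, j) \<in> x \<bullet> (y \<bullet> z)"
      using cmpI[OF e(2) cmpI[OF e(3,4)]] rdD(2)[OF r(1) e(2)] rdD(2)[OF r(2) e(3)] rdD(2)[OF r(3) e(4)]
      by (simp add: G.m_assoc)
  next
    assume "(i, a, j) \<in> x \<bullet> (y \<bullet> z)"
    then obtain g k h g' k' where e: "a = g' \<otimes>\<^bsub>G\<^esub> (g \<otimes>\<^bsub>G\<^esub> h)" "(i, g', k') \<in> x" "(k', g, k) \<in> y" "(k, h, j) \<in> z"
      by (elim cmpE) blast
    then show "(i, a, j) \<in> x \<bullet> y \<bullet> z"
      using cmpI[OF cmpI[OF e(2,3)] e(4)] rdD(2)[OF r(1) e(2)] rdD(2)[OF r(2) e(3)] rdD(2)[OF r(3) e(4)]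
      by (simp add: G.m_assoc)
  qed
  then show ?thesis by auto
qed

lemma idd_cmp: "x \<in> rd m \<Longrightarrow> idd m \<bullet> x = x"
  and cmp_idd: "x \<in> rd m \<Longrightarrow> x \<bullet> idd m = x"
proof -
  assume x: "x \<in> rd m"
  have i: "(k, \<one>\<^bsub>G\<^esub>, k) \<in> idd m" if "k < m" for k using that by (simp add: identity_diagram_def)
  have 1: "(i, a, j) \<in> idd m \<bullet> x \<longleftrightarrow> (i, a, j) \<in> x" for i a j
  proof
    assume "(i, a, j) \<in> idd m \<bullet> x"
    then obtain g k h where e: "a = g \<otimes>\<^bsub>G\<^esub> h" "(i, g, k) \<in> idd m" "(k, h, j) \<in> x" by (rule cmpE)
    then have "g = \<one>\<^bsub>G\<^esub>" "k = i" by (simp_all add: identity_diagram_def)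
    then show "(i, a, j) \<in> x" using e(1,3) rdD(2)[OF x e(3)] by simp
  next
    assume e: "(i, a, j) \<in> x"
    show "(i, a, j) \<in> idd m \<bullet> x"
      using cmpI[OF i[OF rdD(1)[OF x e]] e] rdD(2)[OF x e] by simp
  qed
  have 2: "(i, a, j) \<in> x \<bullet> idd m \<longleftrightarrow> (i, a, j) \<in> x" for i a j
  proof
    assume "(i, a, j) \<in> x \<bullet> idd m"
    then obtain g k h where e: "a = g \<otimes>\<^bsub>G\<^esub> h" "(i, g, k) \<in> x" "(k, h, j) \<in> idd m" by (rule cmpE)
    then have "h = \<one>\<^bsub>G\<^esub>" "k = j" by (simp_all add: identity_diagram_def)
    then show "(i, a, j) \<in> x" using e(1,2) rdD(2)[OF x e(2)] by simp
  next
    assume e: "(i, a, j) \<in> x"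
    show "(i, a, j) \<in> x \<bullet> idd m"
      using cmpI[OF e i[OF rdD(3)[OF x e]]] rdD(2)[OF x e] by simp
  qed
  show "idd m \<bullet> x = x" "x \<bullet> idd m = x" using 1 2 by auto
qed

text \<open>Every edge of a product starts with an edge of its first factor. This and its mirror
  image make the diagrams with missing edges an ideal.\<close>

lemma cmp_full_left: "x \<in> rd m \<Longrightarrow> no_missing_edges m (x \<bullet> y) \<Longrightarrow> no_missing_edges m x"
proof (erule full_left, rule subsetI)
  fix k assume "no_missing_edges m (x \<bullet> y)" "k \<in> {..<m}"
  then obtain g j where "(k, g, j) \<in> x \<bullet> y" using full_D(1) by blast
  then show "k \<in> left_nodes x" by (elim cmpE) (auto simp: left_nodes_def)
qed

lemma cmp_full_right: "y \<in> rd m \<Longrightarrow> no_missing_edges m (x \<bullet> y) \<Longrightarrow> no_missing_edges m y"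
proof (erule full_right, rule subsetI)
  fix k assume "no_missing_edges m (x \<bullet> y)" "k \<in> {..<m}"
  then obtain g j where "(j, g, k) \<in> x \<bullet> y" using full_D(2) by blast
  then show "k \<in> right_nodes y" by (elim cmpE) (auto simp: right_nodes_def)
qed

lemma cmp_full: "x \<in> fl m \<Longrightarrow> y \<in> fl m \<Longrightarrow> x \<bullet> y \<in> fl m"
proof -
  assume x: "x \<in> fl m" and y: "y \<in> fl m"
  have r: "x \<bullet> y \<in> rd m" using x y by (intro cmp_rd) simp_all
  have "k \<in> left_nodes (x \<bullet> y)" if k: "k < m" for k
  proof -
    obtain g j where 1: "(k, g, j) \<in> x" using full_D(1)[of m x k] k x by blast
    then have "j < m" using rdD(3)[of x G m k g j] x by blast
    then obtain h l where 2: "(j, h, l) \<in> y" using full_D(1)[of m y j] y by blast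
    show ?thesis unfolding left_nodes_def using cmpI[OF 1 2] by blast
  qed
  then have "{..<m} \<subseteq> left_nodes (x \<bullet> y)" by blast
  from full_left[OF r this] show ?thesis using r by simp
qed

definition dinv :: "'g diagram \<Rightarrow> 'g diagram" where
  "dinv x = {(j, inv\<^bsub>G\<^esub> g, i) | i g j. (i, g, j) \<in> x}"

lemma dinv_full: "x \<in> fl m \<Longrightarrow> dinv x \<in> fl m"
proof -
  assume x: "x \<in> fl m"
  then have r: "x \<in> rd m" by simp
  have "dinv x \<in> rd m"
  proof (rule rdI)
    fix i a j assume "(i, a, j) \<in> dinv x"
    then obtain g where g: "a = inv\<^bsub>G\<^esub> g" "(j, g, i) \<in> x" by (auto simp: dinv_def)
    then show "i < m \<and> a \<in> carrier G \<and> j < m" using rdD(1-3)[OF r g(2)] by simp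
    {
      fix a' j' assume "(i, a', j') \<in> dinv x"
      then obtain g' where g': "a' = inv\<^bsub>G\<^esub> g'" "(j', g', i) \<in> x" by (auto simp: dinv_def)
      then show "a = a' \<and> j = j'" using rdD(5)[OF r g(2) g'(2)] g(1) by simp
    next
      fix i' a' assume "(i', a', j) \<in> dinv x"
      then obtain g' where g': "a' = inv\<^bsub>G\<^esub> g'" "(j, g', i') \<in> x" by (auto simp: dinv_def)
      then show "i = i' \<and> a = a'" using rdD(4)[OF r g(2) g'(2)] g(1) by simp
    }
  qed
  moreover have "{..<m} \<subseteq> left_nodes (dinv x)"
    using full_D(2) x unfolding left_nodes_def dinv_def by fast
  ultimately show ?thesis using full_left by blast
qed

lemma dinv_cmp: "x \<in> fl m \<Longrightarrow> dinv x \<bullet> x = idd m"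
proof -
  assume x: "x \<in> fl m"
  then have r: "x \<in> rd m" by simp
  have "(i, a, j) \<in> dinv x \<bullet> x \<longleftrightarrow> (i, a, j) \<in> idd m" for i a j
  proof
    assume "(i, a, j) \<in> dinv x \<bullet> x"
    then obtain g k h where "a = inv\<^bsub>G\<^esub> g \<otimes>\<^bsub>G\<^esub> h" "(k, g, i) \<in> x" "(k, h, j) \<in> x"
      by (elim cmpE) (auto simp: dinv_def)
    moreover from this have "h = g" "j = i" using rdD(4)[OF r] by blast+
    ultimately show "(i, a, j) \<in> idd m" using rdD(2,3)[OF r \<open>(k, g, i) \<in> x\<close>] by (auto simp: identity_diagram_def)
  next
    assume "(i, a, j) \<in> idd m"
    then have i: "i < m" "a = \<one>\<^bsub>G\<^esub>" "j = i" by (auto simp: identity_diagram_def)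
    obtain k g where k: "(k, g, i) \<in> x" using full_D(2)[OF _ i(1)] x by blast
    then have "(i, inv\<^bsub>G\<^esub> g, k) \<in> dinv x" by (auto simp: dinv_def)
    from cmpI[OF this k] show "(i, a, j) \<in> dinv x \<bullet> x" using i rdD(2)[OF r k] by simp
  qed
  then show ?thesis by auto
qed

lemma units_group: "group (rook_units G m)"
proof (rule groupI)
  show "\<exists>y\<in>carrier (rook_units G m). y \<otimes>\<^bsub>rook_units G m\<^esub> x = \<one>\<^bsub>rook_units G m\<^esub>"
    if "x \<in> carrier (rook_units G m)" for x
    using dinv_full[of x m] dinv_cmp[of x m] that by (intro bexI[of _ "dinv x"]) (simp_all add: rook_units_def)
qed (use cmp_full idd_full in \<open>auto simp: rook_units_def cmp_assoc idd_cmp\<close>)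

text \<open>Edges are read from right to left, sending a right node to a left node and multiplying
  the label on the left; in this direction composition of diagrams becomes a left action.\<close>

definition dact :: "'g diagram \<Rightarrow> nat \<times> 'g \<Rightarrow> nat \<times> 'g" where
  "dact D x = (let p = THE p. (fst p, snd p, fst x) \<in> D in (fst p, snd p \<otimes>\<^bsub>G\<^esub> snd x))"

lemma dact_eq: "D \<in> rd m \<Longrightarrow> (i, g, k) \<in> D \<Longrightarrow> dact D (k, h) = (i, g \<otimes>\<^bsub>G\<^esub> h)"
proof -
  assume D: "D \<in> rd m" "(i, g, k) \<in> D"
  have "(THE p. (fst p, snd p, k) \<in> D) = (i, g)"
  proof (rule the_equality)
    show "(fst (i, g), snd (i, g), k) \<in> D" using D(2) by simp
    show "p = (i, g)" if "(fst p, snd p, k) \<in> D" for p using rdD(5)[OF D that] by (simp add: prod_eq_iff)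
  qed
  then show ?thesis by (simp add: dact_def)
qed

lemma dact_full:
  assumes "D \<in> fl m" "k < m"
  obtains i g where "(i, g, k) \<in> D" "i < m" "g \<in> carrier G" "\<And>h. dact D (k, h) = (i, g \<otimes>\<^bsub>G\<^esub> h)"
proof -
  have r: "D \<in> rd m" using assms by simp
  obtain i g where i: "(i, g, k) \<in> D" using full_D(2)[of m D k] assms by blast
  show ?thesis by (rule that[OF i rdD(1,2)[OF r i] dact_eq[OF r i]])
qed

text \<open>The diagram counterpart of the monomial matrix with permutation \<open>p\<close> and
  entries \<open>c\<close>.\<close>

definition mk :: "nat \<Rightarrow> (nat \<Rightarrow> nat) \<Rightarrow> (nat \<Rightarrow> 'g) \<Rightarrow> 'g diagram" where
  "mk m p c = {(p k, c k, k) | k. k < m}"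

lemma mk_full:
  assumes "bij_betw p {..<m} {..<m}" "\<And>k. k < m \<Longrightarrow> c k \<in> carrier G"
  shows "mk m p c \<in> fl m"
proof -
  have "mk m p c \<in> rd m"
  proof (rule rdI)
    show "i < m \<and> g \<in> carrier G \<and> j < m" if "(i, g, j) \<in> mk m p c" for i g j
      using that bij_betwE[OF assms(1)] assms(2) by (auto simp: mk_def)
    show "i = i' \<and> g = g'" if "(i, g, j) \<in> mk m p c" "(i', g', j) \<in> mk m p c" for i g j i' g'
      using that by (simp add: mk_def)
    show "g = g' \<and> j = j'" if "(i, g, j) \<in> mk m p c" "(i, g', j') \<in> mk m p c" for i g j g' j'
    proof -
      have 1: "p j = p j'" "j \<in> {..<m}" "j' \<in> {..<m}" "g = c j" "g' = c j'" using that by (auto simp: mk_def)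
      from inj_onD[OF bij_betw_imp_inj_on[OF assms(1)] 1(1-3)] show ?thesis using 1(4,5) by simp
    qed
  qed
  moreover have "{..<m} \<subseteq> right_nodes (mk m p c)" by (auto simp: right_nodes_def mk_def)
  ultimately show ?thesis using full_right[of "mk m p c" G m] by simp
qed

lemma dact_mk:
  assumes "bij_betw p {..<m} {..<m}" "\<And>k. k < m \<Longrightarrow> c k \<in> carrier G" "k < m"
  shows "dact (mk m p c) (k, h) = (p k, c k \<otimes>\<^bsub>G\<^esub> h)"
  using mk_full[OF assms(1,2)] assms(3) by (intro dact_eq[of _ m]) (auto simp: mk_def)

text \<open>The images of the letters with label one reveal every edge, so equalities in the group
  can be checked on letters.\<close>

lemma dact_ext:
  assumes "D \<in> fl m" "D' \<in> fl m" "\<And>k. k < m \<Longrightarrow> dact D (k, \<one>\<^bsub>G\<^esub>) = dact D' (k, \<one>\<^bsub>G\<^esub>)"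
  shows "D = D'"
proof -
  have "D \<subseteq> D'" if D: "D \<in> fl m" "D' \<in> fl m" and eq: "\<And>k. k < m \<Longrightarrow> dact D (k, \<one>\<^bsub>G\<^esub>) = dact D' (k, \<one>\<^bsub>G\<^esub>)" for D D'
  proof
    fix x assume "x \<in> D"
    then obtain i g k where x: "x = (i, g, k)" "(i, g, k) \<in> D" by (cases x) auto
    have r: "D \<in> rd m" using D by simp
    note k = rdD(1-3)[OF r x(2)]
    obtain i' g' where "(i', g', k) \<in> D'" "g' \<in> carrier G" "\<And>h. dact D' (k, h) = (i', g' \<otimes>\<^bsub>G\<^esub> h)"
      using dact_full[OF D(2) k(3)] by metis
    then show "x \<in> D'" using eq[OF k(3)] dact_eq[OF r x(2), of "\<one>\<^bsub>G\<^esub>"] k(2) x(1) by simp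
  qed
  from this[of D D'] this[of D' D] show ?thesis using assms by auto
qed

lemma letters_rook:
  assumes "Q \<subseteq> frags Lab"
  shows "letters (rook_units G n) n dact (carrier G) \<one>\<^bsub>G\<^esub> Lab Q"
proof (intro letters.intro letters_axioms.intro units_group assms)
  have x: "\<exists>k h. x = (k, h) \<and> k < n \<and> h \<in> carrier G" if "x \<in> {..<n} \<times> carrier G" for x using that by auto
  show "\<one>\<^bsub>G\<^esub> \<in> carrier G" by simp
  show "dact \<gamma> x \<in> {..<n} \<times> carrier G" if a: "\<gamma> \<in> carrier (rook_units G n)" "x \<in> {..<n} \<times> carrier G" for \<gamma> x
  proof -
    have gd: "\<gamma> \<in> fl n" using a by (simp add: rook_units_def)
    obtain k h where k: "x = (k, h)" "k < n" "h \<in> carrier G" using x[OF a(2)] by blast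
    obtain i g where "i < n" "g \<in> carrier G" "\<And>h. dact \<gamma> (k, h) = (i, g \<otimes>\<^bsub>G\<^esub> h)"
      using dact_full[OF gd k(2)] by metis
    then show ?thesis using k by simp
  qed
  show "dact \<one>\<^bsub>rook_units G n\<^esub> x = x" if x': "x \<in> {..<n} \<times> carrier G" for x
  proof -
    obtain k h where k: "x = (k, h)" "k < n" "h \<in> carrier G" using x[OF x'] by blast
    have "dact (idd n) (k, h) = (k, \<one>\<^bsub>G\<^esub> \<otimes>\<^bsub>G\<^esub> h)"
      using k by (intro dact_eq[OF idd_rd]) (auto simp: identity_diagram_def)
    then show ?thesis using k by (simp add: rook_units_def)
  qed
  show "dact (\<gamma> \<otimes>\<^bsub>rook_units G n\<^esub> \<delta>) x = dact \<gamma> (dact \<delta> x)"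
    if a: "\<gamma> \<in> carrier (rook_units G n)" "\<delta> \<in> carrier (rook_units G n)" "x \<in> {..<n} \<times> carrier G" for \<gamma> \<delta> x
  proof -
    have gd: "\<gamma> \<in> fl n" "\<delta> \<in> fl n" using a by (auto simp: rook_units_def)
    obtain k h where k: "x = (k, h)" "k < n" "h \<in> carrier G" using x[OF a(3)] by blast
    obtain i g where i: "(i, g, k) \<in> \<delta>" "i < n" "g \<in> carrier G" "\<And>h. dact \<delta> (k, h) = (i, g \<otimes>\<^bsub>G\<^esub> h)"
      using dact_full[OF gd(2) k(2)] by metis
    obtain j f where j: "(j, f, i) \<in> \<gamma>" "f \<in> carrier G" "\<And>h. dact \<gamma> (i, h) = (j, f \<otimes>\<^bsub>G\<^esub> h)"
      using dact_full[OF gd(1) i(2)] by metis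
    have "dact (\<gamma> \<bullet> \<delta>) (k, h) = (j, (f \<otimes>\<^bsub>G\<^esub> g) \<otimes>\<^bsub>G\<^esub> h)"
      using gd by (intro dact_eq[of _ n] cmp_rd cmpI[OF j(1) i(1)]) auto
    then show ?thesis using k i j by (simp add: rook_units_def G.m_assoc)
  qed
  show "fst (dact \<gamma> x) = fst (dact \<gamma> y) \<longleftrightarrow> fst x = fst y"
    if a: "\<gamma> \<in> carrier (rook_units G n)" "x \<in> {..<n} \<times> carrier G" "y \<in> {..<n} \<times> carrier G" for \<gamma> x y
  proof -
    have gd: "\<gamma> \<in> fl n" using a by (auto simp: rook_units_def)
    obtain k h k' h' where k: "x = (k, h)" "k < n" "y = (k', h')" "k' < n" using x[OF a(2)] x[OF a(3)] by blast
    obtain i g where i: "(i, g, k) \<in> \<gamma>" "\<And>h. dact \<gamma> (k, h) = (i, g \<otimes>\<^bsub>G\<^esub> h)"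
      using dact_full[OF gd k(2)] by metis
    obtain j f where j: "(j, f, k') \<in> \<gamma>" "\<And>h. dact \<gamma> (k', h) = (j, f \<otimes>\<^bsub>G\<^esub> h)"
      using dact_full[OF gd k(4)] by metis
    have "i = j \<longleftrightarrow> k = k'" using rdD(4,5)[of \<gamma> G n] gd i(1) j(1) by auto
    then show ?thesis using k i j by simp
  qed
qed

lemma stability_rook:
  assumes Q: "Q \<subseteq> frags Lab"
  shows "stability (rook_units G n) n dact (carrier G) \<one>\<^bsub>G\<^esub> Lab Q"
proof -
  interpret letters "rook_units G n" n dact "carrier G" "\<one>\<^bsub>G\<^esub>" Lab Q
    by (rule letters_rook[OF Q])
  have nthb: "base m l ! j = (m - l + j, \<one>\<^bsub>G\<^esub>)" "length (base m l) = l" if "j < l" "l \<le> m" for m l j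
    using that by (auto simp: base_def)
  have lenb: "length (base m l) = l" if "l \<le> m" for m l using that by (simp add: base_def)
  show ?thesis
  proof (intro stability.intro letters_axioms stability_axioms.intro, goal_cases)
    case (1 m l w)
    note 2 = 1
    have w: "length w = l" "distinct (map fst w)" "set w \<subseteq> {..<m} \<times> carrier G" using 2 by (auto simp: words_def)
    \<comment> \<open>The word prescribes the images of the top \<open>l\<close> positions below
      \<open>m\<close>. The remaining positions below \<open>m\<close> are matched with the
      remaining colours by an arbitrary bijection, and everything from \<open>m\<close> on stays
      fixed.\<close>
    define S where "S = fst ` set w"
    have S: "S \<subseteq> {..<m}" "card S = l"
      using w distinct_card[OF w(2)] by (auto simp: S_def)
    have "card {..<m - l} = card ({..<m} - S)" using S 2 by (simp add: card_Diff_subset finite_subset[OF S(1)])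
    then obtain \<sigma> where \<sigma>: "bij_betw \<sigma> {..<m - l} ({..<m} - S)"
      using finite_same_card_bij[of "{..<m - l}" "{..<m} - S"] by auto
    define p where "p k = (if k < m - l then \<sigma> k else if k < m then fst (w ! (k - (m - l))) else k)" for k
    define c where "c k = (if m - l \<le> k \<and> k < m then snd (w ! (k - (m - l))) else \<one>\<^bsub>G\<^esub>)" for k
    have p1: "bij_betw p {..<m - l} ({..<m} - S)"
      using \<sigma> by (rule bij_betw_cong[THEN iffD1, rotated]) (auto simp: p_def)
    have p2: "bij_betw p {m - l..<m} S"
      unfolding bij_betw_def
    proof
      show "inj_on p {m - l..<m}"
      proof (rule inj_onI)
        fix a b assume ab: "a \<in> {m - l..<m}" "b \<in> {m - l..<m}" "p a = p b"
        then have "map fst w ! (a - (m - l)) = map fst w ! (b - (m - l))" using w 2 by (auto simp: p_def)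
        then have "a - (m - l) = b - (m - l)"
          using ab w 2 by (subst (asm) nth_eq_iff_index_eq[OF w(2)]) auto
        then show "a = b" using ab by auto
      qed
      show "p ` {m - l..<m} = S"
      proof -
        have "p ` {m - l..<m} = (\<lambda>j. fst (w ! j)) ` {..<l}"
        proof (intro equalityI subsetI)
          fix y assume "y \<in> p ` {m - l..<m}"
          then obtain k where "m - l \<le> k" "k < m" "y = fst (w ! (k - (m - l)))" by (auto simp: p_def)
          then show "y \<in> (\<lambda>j. fst (w ! j)) ` {..<l}" using 2 by (intro image_eqI[of _ _ "k - (m - l)"]) auto
        next
          fix y assume "y \<in> (\<lambda>j. fst (w ! j)) ` {..<l}"
          then obtain j where "j < l" "y = fst (w ! j)" by auto
          then show "y \<in> p ` {m - l..<m}" using 2 by (intro image_eqI[of _ _ "m - l + j"]) (auto simp: p_def)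
        qed
        also have "\<dots> = S" using w(1) by (auto simp: S_def set_conv_nth)
        finally show ?thesis .
      qed
    qed
    have p3: "bij_betw p {m..<n} {m..<n}"
      by (rule bij_betw_cong[THEN iffD2, OF _ bij_betw_id]) (auto simp: p_def)
    have "bij_betw p ({..<m - l} \<union> {m - l..<m}) (({..<m} - S) \<union> S)"
      by (rule bij_betw_combine[OF p1 p2]) auto
    moreover have "{..<m - l} \<union> {m - l..<m} = {..<m}" "({..<m} - S) \<union> S = {..<m}" using S by auto
    ultimately have "bij_betw p {..<m} {..<m}" by simp
    from this p3 have "bij_betw p ({..<m} \<union> {m..<n}) ({..<m} \<union> {m..<n})" by (rule bij_betw_combine) auto
    moreover have "{..<m} \<union> {m..<n} = {..<n}" using 2 by auto
    ultimately have p: "bij_betw p {..<n} {..<n}" by simp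
    have c: "c k \<in> carrier G" for k
    proof (cases "m - l \<le> k \<and> k < m")
      case True
      then have "w ! (k - (m - l)) \<in> set w" using w 2 by (intro nth_mem) auto
      then show ?thesis using w True by (auto simp: c_def)
    qed (auto simp: c_def)
    have a: "dact (mk n p c) (k, h) = (p k, c k \<otimes>\<^bsub>G\<^esub> h)" if "k < n" for k h
      using p c that by (rule dact_mk)
    have "mk n p c \<in> carrier (rook_units G n)" using mk_full[of p n c, OF p c] by (simp add: rook_units_def)
    then have "mk n p c \<in> U m" by (simp add: U_def a) (auto simp: p_def c_def)
    moreover have "map (dact (mk n p c)) (base m l) = w"
    proof (rule nth_equalityI)
      show "length (map (dact (mk n p c)) (base m l)) = length w" using w 2 by (simp add: lenb)
      fix j assume "j < length (map (dact (mk n p c)) (base m l))"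
      then have j: "j < l" using 2 by (simp add: lenb)
      then have "w ! j \<in> set w" using w by auto
      then have "w ! j \<in> {..<m} \<times> carrier G" using w by blast
      then show "map (dact (mk n p c)) (base m l) ! j = w ! j"
        using j 2 a[of "m - l + j" "\<one>\<^bsub>G\<^esub>"] by (auto simp: nthb p_def c_def prod_eq_iff mem_Times_iff)
    qed
    ultimately show ?case by blast
  next
    case (2 m l i)
    note 3 = 2
    \<comment> \<open>A cycle on the positions from \<open>m - l\<close> to
      \<open>m - l + i\<close>: the deleted position goes to \<open>m - l\<close> and the earlier
      ones move up by one. Positions below \<open>m - l\<close> are left alone, while
      \<open>U (m - l)\<close> moves only those, so the two commute.\<close>
    define p where "p k = (if k = m - l + i then m - l else if m - l \<le> k \<and> k < m - l + i then Suc k else k)" for k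
    have "inj_on p {..<n}" by (rule inj_onI) (auto simp: p_def split: if_splits)
    moreover have "p ` {..<n} \<subseteq> {..<n}" using 3 by (auto simp: p_def)
    ultimately have p: "bij_betw p {..<n} {..<n}"
      unfolding bij_betw_def using endo_inj_surj[of "{..<n}" p] by simp
    define t where "t = mk n p (\<lambda>_. \<one>\<^bsub>G\<^esub>)"
    have tf: "t \<in> carrier (rook_units G n)" using mk_full[OF p] by (simp add: t_def rook_units_def)
    have a: "dact t (k, h) = (p k, h)" if "k < n" "h \<in> carrier G" for k h
      using dact_mk[OF p, of "\<lambda>_. \<one>\<^bsub>G\<^esub>" k h] that by (simp add: t_def)
    have tU: "t \<in> U m" using tf 3 by (auto simp: U_def a p_def)
    have "t \<otimes>\<^bsub>rook_units G n\<^esub> \<gamma> = \<gamma> \<otimes>\<^bsub>rook_units G n\<^esub> t" if g: "\<gamma> \<in> U (m - l)" for \<gamma>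
    proof -
      have gc: "\<gamma> \<in> carrier (rook_units G n)" using g U_carrier by blast
      have "t \<otimes>\<^bsub>rook_units G n\<^esub> \<gamma> \<in> fl n" "\<gamma> \<otimes>\<^bsub>rook_units G n\<^esub> t \<in> fl n"
        using gc tf cmp_full by (auto simp: rook_units_def)
      then show ?thesis
      proof (rule dact_ext)
        fix k assume k: "k < n"
        have b: "(k', \<one>\<^bsub>G\<^esub>) \<in> {..<n} \<times> carrier G" if "k' < n" for k' using that by simp
        have pk: "p k < n" using p k by (auto dest: bij_betwE)
        show "dact (t \<otimes>\<^bsub>rook_units G n\<^esub> \<gamma>) (k, \<one>\<^bsub>G\<^esub>) = dact (\<gamma> \<otimes>\<^bsub>rook_units G n\<^esub> t) (k, \<one>\<^bsub>G\<^esub>)"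
        proof (cases "k < m - l")
          case True
          have "dact \<gamma> (k, \<one>\<^bsub>G\<^esub>) \<in> {..<m - l} \<times> carrier G"
            using act_U_colour[OF g, of "(k, \<one>\<^bsub>G\<^esub>)"] True 3 by (simp add: mem_Times_iff)
          then obtain k' h where k': "dact \<gamma> (k, \<one>\<^bsub>G\<^esub>) = (k', h)" "k' < m - l" "h \<in> carrier G" by auto
          have "p k = k" "p k' = k'" "k' < n" using True k'(2) 3 by (auto simp: p_def)
          then show ?thesis
            using k' by (simp add: act_mult[OF tf gc b[OF k]] act_mult[OF gc tf b[OF k]] a k)
        next
          case False
          have "dact \<gamma> (k, \<one>\<^bsub>G\<^esub>) = (k, \<one>\<^bsub>G\<^esub>)" "dact \<gamma> (p k, \<one>\<^bsub>G\<^esub>) = (p k, \<one>\<^bsub>G\<^esub>)"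
            using g False k pk by (auto simp: U_def p_def)
          then show ?thesis
            by (simp add: act_mult[OF tf gc b[OF k]] act_mult[OF gc tf b[OF k]] a k)
        qed
      qed
    qed
    moreover have "map (dact t) (del i (base m l)) = base m (l - 1)"
    proof (rule nth_equalityI)
      have ld: "length (del i (base m l)) = l - 1" using 3 by (simp add: length_del lenb)
      show "length (map (dact t) (del i (base m l))) = length (base m (l - 1))" using 3 by (simp add: ld lenb)
      fix j assume "j < length (map (dact t) (del i (base m l)))"
      then have j: "j < l - 1" by (simp add: ld)
      have "del i (base m l) ! j = (if j < i then base m l ! j else base m l ! Suc j)"
        using 3 j by (intro nth_del) (simp_all add: lenb)
      then show "map (dact t) (del i (base m l)) ! j = base m (l - 1) ! j"
        using 3 j by (auto simp: ld nthb a p_def)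
    qed
    ultimately show ?case using tU by blast
  qed
qed

end

section \<open>The rook algebra\<close>

text \<open>Here \<open>m\<close> is the size of the algebra and \<open>n\<close> that of the
  ambient diagram group in which the group of \<open>m\<close>-diagrams is placed.\<close>

locale rook_alg = rook +
  fixes m n :: nat
  assumes mn: "m \<le> n" and ringR: "ring (rook_algebra G K \<epsilon> m)"
begin

abbreviation R :: "('a diagram \<Rightarrow> 'b) ring" where "R \<equiv> rook_algebra G K \<epsilon> m"

sublocale R: ring R
  by (rule ringR)

definition mon :: "'b \<Rightarrow> 'a diagram \<Rightarrow> 'a diagram \<Rightarrow> 'b" where
  "mon c D = (\<lambda>E. if E = D then c else \<zero>\<^bsub>K\<^esub>)"

lemma carrierD:
  assumes "a \<in> carrier R"
  shows "a D \<in> carrier K" "a D \<noteq> \<zero>\<^bsub>K\<^esub> \<Longrightarrow> D \<in> rd m" "finite {D. a D \<noteq> \<zero>\<^bsub>K\<^esub>}"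
  using assms by (cases "D \<in> rd m"; auto simp: rook_algebra_def formal_combinations_def)+

lemma carrierI:
  assumes "\<And>D. D \<in> rd m \<Longrightarrow> a D \<in> carrier K" "\<And>D. D \<notin> rd m \<Longrightarrow> a D = \<zero>\<^bsub>K\<^esub>" "finite {D. a D \<noteq> \<zero>\<^bsub>K\<^esub>}"
  shows "a \<in> carrier R"
  using assms by (simp add: rook_algebra_def formal_combinations_def)

lemma add_R: "(a \<oplus>\<^bsub>R\<^esub> b) D = a D \<oplus>\<^bsub>K\<^esub> b D"
  and zero_R: "\<zero>\<^bsub>R\<^esub> = (\<lambda>D. \<zero>\<^bsub>K\<^esub>)"
  and one_R: "\<one>\<^bsub>R\<^esub> = mon \<one>\<^bsub>K\<^esub> (idd m)"
  by (simp_all add: rook_algebra_def mon_def)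

lemma minus_R:
  assumes "a \<in> carrier R" "b \<in> carrier R"
  shows "(a \<ominus>\<^bsub>R\<^esub> b) D = a D \<ominus>\<^bsub>K\<^esub> b D"
proof -
  have "(\<ominus>\<^bsub>R\<^esub> b) D \<oplus>\<^bsub>K\<^esub> b D = \<zero>\<^bsub>K\<^esub>"
    using R.l_neg[OF assms(2)] by (metis add_R zero_R)
  then have "(\<ominus>\<^bsub>R\<^esub> b) D = \<ominus>\<^bsub>K\<^esub> b D"
    using carrierD(1)[OF assms(2)] carrierD(1)[OF R.a_inv_closed[OF assms(2)]] K.minus_equality by metis
  then show ?thesis by (simp add: a_minus_def add_R)
qed

lemma finsum_R:
  assumes "finite A" "f \<in> A \<rightarrow> carrier R"
  shows "(\<Oplus>\<^bsub>R\<^esub>i\<in>A. f i) D = (\<Oplus>\<^bsub>K\<^esub>i\<in>A. f i D)"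
  using assms
proof (induction A)
  case empty
  then show ?case by (simp add: zero_R)
next
  case (insert x A)
  then have "(\<lambda>i. f i D) \<in> A \<rightarrow> carrier K" "f x D \<in> carrier K" using carrierD(1) by blast+
  then show ?case using insert by (simp add: add_R)
qed

lemma mon_carrier: "c \<in> carrier K \<Longrightarrow> D \<in> rd m \<Longrightarrow> mon c D \<in> carrier R"
  by (rule carrierI) (auto simp: mon_def)

lemma mon_add: "mon (c \<oplus>\<^bsub>K\<^esub> c') D = mon c D \<oplus>\<^bsub>R\<^esub> mon c' D" if "c \<in> carrier K" "c' \<in> carrier K"
  using that by (auto simp: add_R mon_def)

lemma mon_zero_iff: "mon c D = \<zero>\<^bsub>R\<^esub> \<longleftrightarrow> c = \<zero>\<^bsub>K\<^esub>"
  by (auto simp: zero_R mon_def fun_eq_iff)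

lemma mult_R: "(a \<otimes>\<^bsub>R\<^esub> b) D =
    finsum K (\<lambda>(x, y). a x \<otimes>\<^bsub>K\<^esub> b y \<otimes>\<^bsub>K\<^esub> (\<epsilon> [^]\<^bsub>K\<^esub> isolated_nodes m x y)) {(x, y). a x \<noteq> \<zero>\<^bsub>K\<^esub> \<and> b y \<noteq> \<zero>\<^bsub>K\<^esub> \<and> x \<bullet> y = D}"
  by (simp add: rook_algebra_def)

lemma eps_pow: "\<epsilon> [^]\<^bsub>K\<^esub> (k::nat) \<in> carrier K"
  using \<epsilon> by (intro K.nat_pow_closed K.Units_closed)

lemma mult_zero: "(\<And>x y. a x \<noteq> \<zero>\<^bsub>K\<^esub> \<Longrightarrow> b y \<noteq> \<zero>\<^bsub>K\<^esub> \<Longrightarrow> x \<bullet> y \<noteq> D) \<Longrightarrow> (a \<otimes>\<^bsub>R\<^esub> b) D = \<zero>\<^bsub>K\<^esub>"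
proof -
  assume "\<And>x y. a x \<noteq> \<zero>\<^bsub>K\<^esub> \<Longrightarrow> b y \<noteq> \<zero>\<^bsub>K\<^esub> \<Longrightarrow> x \<bullet> y \<noteq> D"
  then have *: "{(x, y). a x \<noteq> \<zero>\<^bsub>K\<^esub> \<and> b y \<noteq> \<zero>\<^bsub>K\<^esub> \<and> x \<bullet> y = D} = {}" by auto
  show ?thesis unfolding mult_R * by simp
qed

text \<open>In the products computed below a coefficient is reached by at most one pair, because
  both factors are monomials or one of them is an invertible monomial.\<close>

lemma mult_eval:
  assumes "a \<in> carrier R" "b \<in> carrier R" "x0 \<bullet> y0 = D"
    "\<And>x y. a x \<noteq> \<zero>\<^bsub>K\<^esub> \<Longrightarrow> b y \<noteq> \<zero>\<^bsub>K\<^esub> \<Longrightarrow> x \<bullet> y = D \<Longrightarrow> x = x0 \<and> y = y0"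
  shows "(a \<otimes>\<^bsub>R\<^esub> b) D = a x0 \<otimes>\<^bsub>K\<^esub> b y0 \<otimes>\<^bsub>K\<^esub> (\<epsilon> [^]\<^bsub>K\<^esub> isolated_nodes m x0 y0)"
proof (cases "a x0 = \<zero>\<^bsub>K\<^esub> \<or> b y0 = \<zero>\<^bsub>K\<^esub>")
  case True
  have "(a \<otimes>\<^bsub>R\<^esub> b) D = \<zero>\<^bsub>K\<^esub>"
  proof (rule mult_zero)
    fix x y assume "a x \<noteq> \<zero>\<^bsub>K\<^esub>" "b y \<noteq> \<zero>\<^bsub>K\<^esub>"
    then show "x \<bullet> y \<noteq> D" using True assms(4)[of x y] by auto
  qed
  then show ?thesis using True carrierD(1)[OF assms(1)] carrierD(1)[OF assms(2)] eps_pow by auto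
next
  case False
  then have *: "{(x, y). a x \<noteq> \<zero>\<^bsub>K\<^esub> \<and> b y \<noteq> \<zero>\<^bsub>K\<^esub> \<and> x \<bullet> y = D} = {(x0, y0)}"
    using assms(3) by (auto dest: assms(4))
  show ?thesis
    unfolding mult_R * using carrierD(1)[OF assms(1)] carrierD(1)[OF assms(2)] eps_pow by simp
qed

lemma iso_full: "x \<in> fl m \<or> y \<in> fl m \<Longrightarrow> isolated_nodes m x y = 0"
proof -
  assume "x \<in> fl m \<or> y \<in> fl m"
  then have "{k \<in> {..<m}. k \<notin> right_nodes x \<and> k \<notin> left_nodes y} = {}"
    by (auto simp: no_missing_edges_def)
  then show ?thesis by (simp add: isolated_nodes_def)
qed

lemma mon_mult:
  assumes "c \<in> carrier K" "c' \<in> carrier K" "x \<in> rd m" "y \<in> rd m"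
  shows "mon c x \<otimes>\<^bsub>R\<^esub> mon c' y = mon (c \<otimes>\<^bsub>K\<^esub> c' \<otimes>\<^bsub>K\<^esub> (\<epsilon> [^]\<^bsub>K\<^esub> isolated_nodes m x y)) (x \<bullet> y)"
proof
  fix D
  show "(mon c x \<otimes>\<^bsub>R\<^esub> mon c' y) D = mon (c \<otimes>\<^bsub>K\<^esub> c' \<otimes>\<^bsub>K\<^esub> (\<epsilon> [^]\<^bsub>K\<^esub> isolated_nodes m x y)) (x \<bullet> y) D"
  proof (cases "x \<bullet> y = D")
    case True
    have "(mon c x \<otimes>\<^bsub>R\<^esub> mon c' y) D = mon c x x \<otimes>\<^bsub>K\<^esub> mon c' y y \<otimes>\<^bsub>K\<^esub> (\<epsilon> [^]\<^bsub>K\<^esub> isolated_nodes m x y)"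
      by (rule mult_eval[OF mon_carrier mon_carrier True]) (use assms in \<open>auto simp: mon_def split: if_splits\<close>)
    then show ?thesis using True by (simp add: mon_def)
  next
    case False
    then show ?thesis by (subst mult_zero) (auto simp: mon_def split: if_splits)
  qed
qed

lemma mon_mult_full:
  assumes "c \<in> carrier K" "c' \<in> carrier K" "x \<in> rd m" "y \<in> rd m" "x \<in> fl m \<or> y \<in> fl m"
  shows "mon c x \<otimes>\<^bsub>R\<^esub> mon c' y = mon (c \<otimes>\<^bsub>K\<^esub> c') (x \<bullet> y)"
  using mon_mult[OF assms(1-4)] assms(1,2) by (simp add: iso_full[OF assms(5)])

text \<open>An invertible diagram cancels and leaves no isolated middle node, so multiplication by
  it permutes coefficients without any power of \<open>\<epsilon>\<close>.\<close>

lemma mult_full_left: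
  assumes "c \<in> carrier K" "x \<in> fl m" "a \<in> carrier R" "y \<in> rd m"
  shows "(mon c x \<otimes>\<^bsub>R\<^esub> a) (x \<bullet> y) = c \<otimes>\<^bsub>K\<^esub> a y"
proof -
  have x: "x \<in> rd m" and dx: "dinv x \<in> rd m" using assms(2) dinv_full[OF assms(2)] by simp_all
  have cancel: "dinv x \<bullet> (x \<bullet> w) = w" if "w \<in> rd m" for w
    using cmp_assoc[OF dx x that] dinv_cmp[OF assms(2)] idd_cmp[OF that] by simp
  have "(mon c x \<otimes>\<^bsub>R\<^esub> a) (x \<bullet> y) = mon c x x \<otimes>\<^bsub>K\<^esub> a y \<otimes>\<^bsub>K\<^esub> (\<epsilon> [^]\<^bsub>K\<^esub> isolated_nodes m x y)"
  proof (rule mult_eval[OF mon_carrier[OF assms(1) x] assms(3) refl])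
    fix x' y' assume "mon c x x' \<noteq> \<zero>\<^bsub>K\<^esub>" "a y' \<noteq> \<zero>\<^bsub>K\<^esub>" and e: "x' \<bullet> y' = x \<bullet> y"
    then have "x' = x" "y' \<in> rd m" using carrierD(2)[OF assms(3), of y'] by (simp_all add: mon_def split: if_splits)
    then show "x' = x \<and> y' = y" using e cancel[of y'] cancel[OF assms(4)] by metis
  qed
  then show ?thesis
    using carrierD(1)[OF assms(3), of y] assms(1) by (simp add: iso_full[OF disjI1[OF assms(2)]] mon_def)
qed

lemma mult_id_right:
  assumes "c \<in> carrier K" "a \<in> carrier R"
  shows "(a \<otimes>\<^bsub>R\<^esub> mon c (idd m)) D = a D \<otimes>\<^bsub>K\<^esub> c"
proof (cases "D \<in> rd m")
  case True
  have "(a \<otimes>\<^bsub>R\<^esub> mon c (idd m)) D = a D \<otimes>\<^bsub>K\<^esub> mon c (idd m) (idd m) \<otimes>\<^bsub>K\<^esub> (\<epsilon> [^]\<^bsub>K\<^esub> isolated_nodes m D (idd m))"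
  proof (rule mult_eval[OF assms(2) mon_carrier[OF assms(1) idd_rd] cmp_idd[OF True]])
    fix x y assume "a x \<noteq> \<zero>\<^bsub>K\<^esub>" "mon c (idd m) y \<noteq> \<zero>\<^bsub>K\<^esub>" and e: "x \<bullet> y = D"
    then have "y = idd m" "x \<in> rd m" using carrierD(2)[OF assms(2), of x] by (simp_all add: mon_def split: if_splits)
    then show "x = D \<and> y = idd m" using e cmp_idd[of x m] by simp
  qed
  then show ?thesis
    using carrierD(1)[OF assms(2), of D] assms(1) by (simp add: iso_full[OF disjI2[OF idd_full]] mon_def)
next
  case False
  have 1: "a \<otimes>\<^bsub>R\<^esub> mon c (idd m) \<in> carrier R" using assms(2) mon_carrier[OF assms(1) idd_rd] by simp
  have "(a \<otimes>\<^bsub>R\<^esub> mon c (idd m)) D = \<zero>\<^bsub>K\<^esub>" "a D = \<zero>\<^bsub>K\<^esub>"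
    using False carrierD(2)[OF 1, of D] carrierD(2)[OF assms(2), of D] by blast+
  then show ?thesis using assms(1) by simp
qed

lemma mult_id_left:
  assumes "c \<in> carrier K" "a \<in> carrier R"
  shows "(mon c (idd m) \<otimes>\<^bsub>R\<^esub> a) D = c \<otimes>\<^bsub>K\<^esub> a D"
proof (cases "D \<in> rd m")
  case True
  show ?thesis using mult_full_left[OF assms(1) idd_full assms(2) True] idd_cmp[OF True] by simp
next
  case False
  have 1: "mon c (idd m) \<otimes>\<^bsub>R\<^esub> a \<in> carrier R" using assms(2) mon_carrier[OF assms(1) idd_rd] by simp
  have "(mon c (idd m) \<otimes>\<^bsub>R\<^esub> a) D = \<zero>\<^bsub>K\<^esub>" "a D = \<zero>\<^bsub>K\<^esub>"
    using False carrierD(2)[OF 1, of D] carrierD(2)[OF assms(2), of D] by blast+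
  then show ?thesis using assms(1) by simp
qed

lemma decomp:
  assumes "a \<in> carrier R"
  shows "a = (\<Oplus>\<^bsub>R\<^esub>D\<in>{D. a D \<noteq> \<zero>\<^bsub>K\<^esub>}. mon (a D) D)"
proof
  fix E
  let ?S = "{D. a D \<noteq> \<zero>\<^bsub>K\<^esub>}"
  have "(\<Oplus>\<^bsub>R\<^esub>D\<in>?S. mon (a D) D) E = (\<Oplus>\<^bsub>K\<^esub>D\<in>?S. mon (a D) D E)"
    using carrierD[OF assms] mon_carrier by (intro finsum_R) auto
  also have "\<dots> = (\<Oplus>\<^bsub>K\<^esub>D\<in>?S. if E = D then a D else \<zero>\<^bsub>K\<^esub>)" by (simp add: mon_def)
  also have "\<dots> = a E"
  proof (cases "E \<in> ?S")
    case True
    then show ?thesis using carrierD[OF assms] by (intro K.finsum_singleton) auto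
  next
    case False
    then have "(\<Oplus>\<^bsub>K\<^esub>D\<in>?S. if E = D then a D else \<zero>\<^bsub>K\<^esub>) = (\<Oplus>\<^bsub>K\<^esub>D\<in>?S. \<zero>\<^bsub>K\<^esub>)"
      by (intro K.finsum_cong') auto
    then show ?thesis using False by simp
  qed
  finally show "a E = (\<Oplus>\<^bsub>R\<^esub>D\<in>?S. mon (a D) D) E" by simp
qed

section \<open>The ideal of diagrams with missing edges and an element annihilating it\<close>

definition N :: "('a diagram \<Rightarrow> 'b) set" where
  "N = {\<nu> \<in> carrier R. \<forall>D. no_missing_edges m D \<longrightarrow> \<nu> D = \<zero>\<^bsub>K\<^esub>}"

lemma N_mult_right: "\<nu> \<in> N \<Longrightarrow> a \<in> carrier R \<Longrightarrow> \<nu> \<otimes>\<^bsub>R\<^esub> a \<in> N"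
proof -
  assume a: "\<nu> \<in> N" "a \<in> carrier R"
  then have v: "\<nu> \<in> carrier R" by (simp add: N_def)
  have "(\<nu> \<otimes>\<^bsub>R\<^esub> a) D = \<zero>\<^bsub>K\<^esub>" if D: "no_missing_edges m D" for D
  proof (rule mult_zero)
    fix x y assume "\<nu> x \<noteq> \<zero>\<^bsub>K\<^esub>" "a y \<noteq> \<zero>\<^bsub>K\<^esub>"
    then show "x \<bullet> y \<noteq> D" using a(1) carrierD(2)[OF v, of x] cmp_full_left[of x m y] D by (auto simp: N_def)
  qed
  then show ?thesis using a by (simp add: N_def)
qed

lemma N_mult_left: "\<nu> \<in> N \<Longrightarrow> a \<in> carrier R \<Longrightarrow> a \<otimes>\<^bsub>R\<^esub> \<nu> \<in> N"
proof -
  assume a: "\<nu> \<in> N" "a \<in> carrier R"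
  then have v: "\<nu> \<in> carrier R" by (simp add: N_def)
  have "(a \<otimes>\<^bsub>R\<^esub> \<nu>) D = \<zero>\<^bsub>K\<^esub>" if D: "no_missing_edges m D" for D
  proof (rule mult_zero)
    fix x y assume "a x \<noteq> \<zero>\<^bsub>K\<^esub>" "\<nu> y \<noteq> \<zero>\<^bsub>K\<^esub>"
    then show "x \<bullet> y \<noteq> D" using a(1) carrierD(2)[OF v, of y] cmp_full_right[of y m x] D by (auto simp: N_def)
  qed
  then show ?thesis using a by (simp add: N_def)
qed

lemma N_add: "\<nu> \<in> N \<Longrightarrow> \<nu>' \<in> N \<Longrightarrow> \<nu> \<oplus>\<^bsub>R\<^esub> \<nu>' \<in> N"
  by (auto simp: N_def add_R)

definition gap :: "nat \<Rightarrow> 'a diagram" where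
  "gap k = idd m - {(k, \<one>\<^bsub>G\<^esub>, k)}"

lemma gap_iff: "(i, g, j) \<in> gap k \<longleftrightarrow> g = \<one>\<^bsub>G\<^esub> \<and> i = j \<and> j < m \<and> j \<noteq> k"
  by (auto simp: gap_def identity_diagram_def)

lemma gap_rd: "gap k \<in> rd m"
  by (rule rdI) (auto simp: gap_iff)

lemma gap_cmp:
  assumes "D \<in> rd m"
  shows "(i, g, j) \<in> gap k \<bullet> D \<longleftrightarrow> (i, g, j) \<in> D \<and> i \<noteq> k"
proof
  assume "(i, g, j) \<in> gap k \<bullet> D"
  then obtain a l h where e: "g = a \<otimes>\<^bsub>G\<^esub> h" "(i, a, l) \<in> gap k" "(l, h, j) \<in> D" by (rule cmpE)
  then show "(i, g, j) \<in> D \<and> i \<noteq> k" using rdD(2)[OF assms e(3)] by (auto simp: gap_iff)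
next
  assume e: "(i, g, j) \<in> D \<and> i \<noteq> k"
  then have "(i, \<one>\<^bsub>G\<^esub>, i) \<in> gap k" "g \<in> carrier G" using rdD(1,2)[OF assms, of i g j] by (auto simp: gap_iff)
  then show "(i, g, j) \<in> gap k \<bullet> D" using cmpI[of i "\<one>\<^bsub>G\<^esub>" i "gap k" g j D] e by simp
qed

text \<open>In each step \<open>z\<close> is multiplied by one minus \<open>e\<close>, where
  \<open>e\<close> is \<open>gap k\<close> divided by \<open>\<epsilon>\<close>. If \<open>D\<close>
  misses the left node \<open>k\<close>, then \<open>gap k \<bullet> D = D\<close> with exactly one
  isolated middle node, so \<open>e\<close> fixes \<open>D\<close> and the new factor kills it.
  Otherwise \<open>D\<close> and its product with \<open>gap k\<close> both miss a smaller node, and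
  the old \<open>z\<close> kills both.\<close>

lemma exists_projector:
  "k \<le> m \<Longrightarrow> \<exists>z\<in>carrier R. \<one>\<^bsub>R\<^esub> \<ominus>\<^bsub>R\<^esub> z \<in> N \<and>
     (\<forall>c\<in>carrier K. \<forall>D\<in>rd m. (\<exists>i<k. i \<notin> left_nodes D) \<longrightarrow> z \<otimes>\<^bsub>R\<^esub> mon c D = \<zero>\<^bsub>R\<^esub>)"
proof (induction k)
  case 0
  have "\<zero>\<^bsub>R\<^esub> \<in> N" by (simp add: N_def zero_R[symmetric]) (simp add: zero_R)
  then show ?case by (intro bexI[of _ "\<one>\<^bsub>R\<^esub>"]) (simp_all add: a_minus_def R.r_neg)
next
  case (Suc k)
  then have k: "k < m" by simp
  obtain z where z: "z \<in> carrier R" "\<one>\<^bsub>R\<^esub> \<ominus>\<^bsub>R\<^esub> z \<in> N"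
    "\<And>c D i. c \<in> carrier K \<Longrightarrow> D \<in> rd m \<Longrightarrow> i < k \<Longrightarrow> i \<notin> left_nodes D \<Longrightarrow> z \<otimes>\<^bsub>R\<^esub> mon c D = \<zero>\<^bsub>R\<^esub>"
    using Suc.IH[OF less_imp_le[OF k]] by blast
  let ?u = "inv\<^bsub>K\<^esub> \<epsilon>"
  let ?e = "mon ?u (gap k)"
  have u: "?u \<in> carrier K" "\<epsilon> \<in> carrier K" using \<epsilon> by auto
  have e: "?e \<in> carrier R" by (rule mon_carrier[OF u(1) gap_rd])
  have "\<not> no_missing_edges m (gap k)"
  proof
    assume "no_missing_edges m (gap k)"
    from full_D(1)[OF this k] show False by (simp add: gap_iff)
  qed
  then have eN: "?e \<in> N" using e by (auto simp: N_def mon_def)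
  let ?z = "z \<ominus>\<^bsub>R\<^esub> z \<otimes>\<^bsub>R\<^esub> ?e"
  have "\<one>\<^bsub>R\<^esub> \<ominus>\<^bsub>R\<^esub> ?z = (\<one>\<^bsub>R\<^esub> \<ominus>\<^bsub>R\<^esub> z) \<oplus>\<^bsub>R\<^esub> z \<otimes>\<^bsub>R\<^esub> ?e"
    unfolding a_minus_def using z(1) e by (simp add: R.minus_add R.a_assoc)
  then have "\<one>\<^bsub>R\<^esub> \<ominus>\<^bsub>R\<^esub> ?z \<in> N" using N_add[OF z(2) N_mult_left[OF eN z(1)]] by simp
  moreover have zz: "?z \<otimes>\<^bsub>R\<^esub> mon c D = \<zero>\<^bsub>R\<^esub>"
    if D: "c \<in> carrier K" "D \<in> rd m" "i < Suc k" "i \<notin> left_nodes D" for c D i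
  proof -
    have cD: "mon c D \<in> carrier R" by (rule mon_carrier[OF D(1,2)])
    have 1: "?z \<otimes>\<^bsub>R\<^esub> mon c D = z \<otimes>\<^bsub>R\<^esub> mon c D \<ominus>\<^bsub>R\<^esub> z \<otimes>\<^bsub>R\<^esub> (?e \<otimes>\<^bsub>R\<^esub> mon c D)"
      unfolding a_minus_def using z(1) e cD by (simp add: R.l_distr R.l_minus R.m_assoc)
    let ?c = "?u \<otimes>\<^bsub>K\<^esub> c \<otimes>\<^bsub>K\<^esub> (\<epsilon> [^]\<^bsub>K\<^esub> isolated_nodes m (gap k) D)"
    have 2: "?e \<otimes>\<^bsub>R\<^esub> mon c D = mon ?c (gap k \<bullet> D)"
      by (rule mon_mult[OF u(1) D(1) gap_rd D(2)])
    show ?thesis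
    proof (cases "k \<in> left_nodes D")
      case False
      have "(i, g, j) \<in> gap k \<bullet> D \<longleftrightarrow> (i, g, j) \<in> D" for i g j
        using False unfolding gap_cmp[OF D(2)] by (auto simp: left_nodes_def)
      then have 3: "gap k \<bullet> D = D" by auto
      have "{l \<in> {..<m}. l \<notin> right_nodes (gap k) \<and> l \<notin> left_nodes D} = {k}"
        using False k by (auto simp: right_nodes_def gap_iff)
      then have "isolated_nodes m (gap k) D = 1" by (simp add: isolated_nodes_def)
      moreover have "?u \<otimes>\<^bsub>K\<^esub> c \<otimes>\<^bsub>K\<^esub> \<epsilon> = c"
        using K.m_comm[OF u(1) D(1)] K.m_assoc[OF D(1) u(1,2)] K.Units_l_inv[OF \<epsilon>] D(1) by simp
      ultimately have "?c = c" using u(2) by simp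
      then show ?thesis using 1 2 3 z(1) cD by (simp add: a_minus_def R.r_neg)
    next
      case True
      then have i: "i < k" using D(3,4) by (cases "i = k") auto
      have "i \<notin> left_nodes (gap k \<bullet> D)"
        using D(4) unfolding left_nodes_def by (auto simp: gap_cmp[OF D(2)])
      then have "z \<otimes>\<^bsub>R\<^esub> mon ?c (gap k \<bullet> D) = \<zero>\<^bsub>R\<^esub>"
        using u D(1) i by (intro z(3) cmp_rd[OF gap_rd D(2)]) simp_all
      then show ?thesis using 1 2 z(3)[OF D(1,2) i D(4)] by (simp add: a_minus_def)
    qed
  qed
  moreover have "?z \<in> carrier R" using z(1) e by simp
  ultimately show ?case by (intro bexI[of _ ?z] conjI ballI impI) (blast intro: zz)+
qed

text \<open>A diagram with a missing edge misses some left node, the two columns being equinumerous;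
  so the projector for all \<open>m\<close> nodes kills \<open>N\<close> by linearity.\<close>

lemma exists_complement: "\<exists>z\<in>carrier R. \<one>\<^bsub>R\<^esub> \<ominus>\<^bsub>R\<^esub> z \<in> N \<and> (\<forall>\<nu>\<in>N. z \<otimes>\<^bsub>R\<^esub> \<nu> = \<zero>\<^bsub>R\<^esub>)"
proof -
  obtain z where z: "z \<in> carrier R" "\<one>\<^bsub>R\<^esub> \<ominus>\<^bsub>R\<^esub> z \<in> N"
    "\<And>c D i. c \<in> carrier K \<Longrightarrow> D \<in> rd m \<Longrightarrow> i < m \<Longrightarrow> i \<notin> left_nodes D \<Longrightarrow> z \<otimes>\<^bsub>R\<^esub> mon c D = \<zero>\<^bsub>R\<^esub>"
    using exists_projector[OF order_refl] by blast
  have "z \<otimes>\<^bsub>R\<^esub> \<nu> = \<zero>\<^bsub>R\<^esub>" if "\<nu> \<in> N" for \<nu>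
  proof -
    have v: "\<nu> \<in> carrier R" using that by (simp add: N_def)
    let ?S = "{D. \<nu> D \<noteq> \<zero>\<^bsub>K\<^esub>}"
    have "z \<otimes>\<^bsub>R\<^esub> \<nu> = z \<otimes>\<^bsub>R\<^esub> (\<Oplus>\<^bsub>R\<^esub>D\<in>?S. mon (\<nu> D) D)" using decomp[OF v] by simp
    also have "\<dots> = (\<Oplus>\<^bsub>R\<^esub>D\<in>?S. z \<otimes>\<^bsub>R\<^esub> mon (\<nu> D) D)"
      using carrierD[OF v] z(1) mon_carrier by (intro R.finsum_rdistr) auto
    also have "\<dots> = (\<Oplus>\<^bsub>R\<^esub>D\<in>?S. \<zero>\<^bsub>R\<^esub>)"
    proof (rule R.finsum_cong')
      fix D assume "D \<in> ?S"
      then have D: "D \<in> rd m" "\<not> no_missing_edges m D" using carrierD(2)[OF v] that by (auto simp: N_def)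
      then obtain i where "i < m" "i \<notin> left_nodes D" using full_left[of D G m] by blast
      then show "z \<otimes>\<^bsub>R\<^esub> mon (\<nu> D) D = \<zero>\<^bsub>R\<^esub>" using z(3)[OF carrierD(1)[OF v] D(1)] by blast
    qed auto
    finally show ?thesis by simp
  qed
  then show ?thesis using z(1,2) by blast
qed

end

section \<open>The smaller diagram group inside the larger one, and the hypotheses of the
  comparison\<close>

context rook_alg
begin

abbreviation H :: "'a diagram set" where
  "H \<equiv> letters.U (rook_units G n) n dact \<one>\<^bsub>G\<^esub> m"

definition down :: "'a diagram \<Rightarrow> 'a diagram" where
  "down \<gamma> = {(i, g, k) \<in> \<gamma>. k < m}"

definition up :: "'a diagram \<Rightarrow> 'a diagram" where
  "up D = D \<union> {(k, \<one>\<^bsub>G\<^esub>, k) | k. m \<le> k \<and> k < n}"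

lemma H_iff: "\<gamma> \<in> H \<longleftrightarrow> \<gamma> \<in> fl n \<and> (\<forall>k. m \<le> k \<and> k < n \<longrightarrow> (k, \<one>\<^bsub>G\<^esub>, k) \<in> \<gamma>)"
proof -
  interpret letters "rook_units G n" n dact "carrier G" "\<one>\<^bsub>G\<^esub>" "{} :: nat set" "{}"
    by (rule letters_rook) simp
  have "dact \<gamma> (k, \<one>\<^bsub>G\<^esub>) = (k, \<one>\<^bsub>G\<^esub>) \<longleftrightarrow> (k, \<one>\<^bsub>G\<^esub>, k) \<in> \<gamma>" if \<gamma>: "\<gamma> \<in> fl n" and k: "k < n" for k
  proof -
    obtain i g where i: "(i, g, k) \<in> \<gamma>" "g \<in> carrier G" "\<And>h. dact \<gamma> (k, h) = (i, g \<otimes>\<^bsub>G\<^esub> h)"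
      using dact_full[OF \<gamma> k] by metis
    have r: "\<gamma> \<in> rd n" using \<gamma> by simp
    have "i = k \<and> g = \<one>\<^bsub>G\<^esub>" if "(k, \<one>\<^bsub>G\<^esub>, k) \<in> \<gamma>" using rdD(5)[OF r that i(1)] .
    then show ?thesis using i by auto
  qed
  then show ?thesis unfolding U_def by (simp add: rook_units_def) metis
qed

lemma H_fl: "\<gamma> \<in> H \<Longrightarrow> \<gamma> \<in> fl n" and H_rd: "\<gamma> \<in> H \<Longrightarrow> \<gamma> \<in> rd n"
  unfolding H_iff by simp_all

text \<open>The horizontal edges at the nodes from \<open>m\<close> on leave no room for an edge
  between the two ranges of nodes.\<close>

lemma H_small:
  assumes \<gamma>: "\<gamma> \<in> H" and e: "(i, g, k) \<in> \<gamma>"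
  shows "i < m \<longleftrightarrow> k < m" "\<not> k < m \<Longrightarrow> i = k \<and> g = \<one>\<^bsub>G\<^esub>"
proof -
  note r = H_rd[OF \<gamma>]
  have 1: "(j, \<one>\<^bsub>G\<^esub>, j) \<in> \<gamma>" if "\<not> j < m" "j < n" for j using \<gamma> that unfolding H_iff by simp
  show 2: "i = k \<and> g = \<one>\<^bsub>G\<^esub>" if k: "\<not> k < m"
    using rdD(5)[OF r 1[OF k rdD(3)[OF r e]] e] .
  have "k = i" if i: "\<not> i < m"
    using rdD(4)[OF r 1[OF i rdD(1)[OF r e]] e] by simp
  then show "i < m \<longleftrightarrow> k < m" using 2 by auto
qed

lemma down_iff: "(i, g, k) \<in> down \<gamma> \<longleftrightarrow> (i, g, k) \<in> \<gamma> \<and> k < m"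
  by (simp add: down_def)

lemma down_fl: "\<gamma> \<in> H \<Longrightarrow> down \<gamma> \<in> fl m"
proof -
  assume \<gamma>: "\<gamma> \<in> H"
  note r = H_rd[OF \<gamma>]
  have "down \<gamma> \<in> rd m"
  proof (rule rdI)
    show "i < m \<and> g \<in> carrier G \<and> j < m" if "(i, g, j) \<in> down \<gamma>" for i g j
      using that H_small(1)[OF \<gamma>, of i g j] rdD(2)[OF r, of i g j] by (simp add: down_iff)
    show "g = g' \<and> j = j'" if "(i, g, j) \<in> down \<gamma>" "(i, g', j') \<in> down \<gamma>" for i g j g' j'
      using rdD(4)[OF r, of i g j g' j'] that by (simp add: down_iff)
    show "i = i' \<and> g = g'" if "(i, g, j) \<in> down \<gamma>" "(i', g', j) \<in> down \<gamma>" for i g j i' g'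
      using rdD(5)[OF r, of i g j i' g'] that by (simp add: down_iff)
  qed
  moreover have "{..<m} \<subseteq> right_nodes (down \<gamma>)"
  proof
    fix k assume k: "k \<in> {..<m}"
    obtain i g where "(i, g, k) \<in> \<gamma>" using full_D(2)[of n \<gamma> k] H_fl[OF \<gamma>] k mn by auto
    then show "k \<in> right_nodes (down \<gamma>)" using k unfolding right_nodes_def by (auto simp: down_iff)
  qed
  ultimately show ?thesis using full_right[of "down \<gamma>" G m] by simp
qed

lemma up_iff: "(i, g, k) \<in> up D \<longleftrightarrow> (i, g, k) \<in> D \<or> i = k \<and> g = \<one>\<^bsub>G\<^esub> \<and> m \<le> k \<and> k < n"
  by (auto simp: up_def)

lemma up_H: "D \<in> fl m \<Longrightarrow> up D \<in> H"
proof -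
  assume D: "D \<in> fl m"
  then have r: "D \<in> rd m" by simp
  have b: "i < m" "g \<in> carrier G" "k < m" if "(i, g, k) \<in> D" for i g k using rdD(1-3)[OF r that] .
  have "up D \<in> rd n"
  proof (rule rdI)
    show "i < n \<and> g \<in> carrier G \<and> j < n" if "(i, g, j) \<in> up D" for i g j
      using that b[of i g j] mn by (auto simp: up_iff)
    show "g = g' \<and> j = j'" if "(i, g, j) \<in> up D" "(i, g', j') \<in> up D" for i g j g' j'
      using rdD(4)[OF r, of i g j g' j'] that b[of i g j] b[of i g' j'] by (auto simp: up_iff)
    show "i = i' \<and> g = g'" if "(i, g, j) \<in> up D" "(i', g', j) \<in> up D" for i g j i' g'
      using rdD(5)[OF r, of i g j i' g'] that b[of i g j] b[of i' g' j] by (auto simp: up_iff)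
  qed
  moreover have "{..<n} \<subseteq> right_nodes (up D)"
  proof
    fix k assume k: "k \<in> {..<n}"
    show "k \<in> right_nodes (up D)"
    proof (cases "k < m")
      case True
      obtain i g where "(i, g, k) \<in> D" using full_D(2)[of m D k] D True by auto
      then show ?thesis unfolding right_nodes_def by (auto simp: up_iff)
    next
      case False
      then show ?thesis using k unfolding right_nodes_def by (auto simp: up_iff)
    qed
  qed
  ultimately show ?thesis unfolding H_iff using full_right[of "up D" G n] by (simp add: up_iff)
qed

lemma down_up: "D \<in> fl m \<Longrightarrow> down (up D) = D"
proof -
  assume "D \<in> fl m"
  then have r: "D \<in> rd m" by simp
  have "(i, g, k) \<in> down (up D) \<longleftrightarrow> (i, g, k) \<in> D" for i g k
    using rdD(3)[OF r, of i g k] by (auto simp: down_iff up_iff)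
  then show ?thesis by auto
qed

lemma up_down: "\<gamma> \<in> H \<Longrightarrow> up (down \<gamma>) = \<gamma>"
proof -
  assume \<gamma>: "\<gamma> \<in> H"
  have "(k, \<one>\<^bsub>G\<^esub>, k) \<in> \<gamma>" if "m \<le> k" "k < n" for k using \<gamma> that unfolding H_iff by simp
  then have "(i, g, k) \<in> up (down \<gamma>) \<longleftrightarrow> (i, g, k) \<in> \<gamma>" for i g k
    using H_small(2)[OF \<gamma>, of i g k] rdD(3)[OF H_rd[OF \<gamma>], of i g k] by (auto simp: down_iff up_iff)
  then show ?thesis by auto
qed

lemma down_bij: "bij_betw down H (fl m)"
  using down_fl up_H down_up up_down by (intro bij_betw_byWitness[where f' = up]) blast+

lemma down_cmp:
  assumes "\<gamma> \<in> H" "\<delta> \<in> H"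
  shows "down (\<gamma> \<bullet> \<delta>) = down \<gamma> \<bullet> down \<delta>"
proof -
  have "(i, a, k) \<in> down (\<gamma> \<bullet> \<delta>) \<longleftrightarrow> (i, a, k) \<in> down \<gamma> \<bullet> down \<delta>" for i a k
  proof
    assume "(i, a, k) \<in> down (\<gamma> \<bullet> \<delta>)"
    then have "(i, a, k) \<in> \<gamma> \<bullet> \<delta>" and k: "k < m" by (simp_all add: down_iff)
    then obtain g j h where e: "a = g \<otimes>\<^bsub>G\<^esub> h" "(i, g, j) \<in> \<gamma>" "(j, h, k) \<in> \<delta>" by (elim cmpE)
    then have "(i, g, j) \<in> down \<gamma>" "(j, h, k) \<in> down \<delta>" using k H_small(1)[OF assms(2) e(3)] by (simp_all add: down_iff)
    then show "(i, a, k) \<in> down \<gamma> \<bullet> down \<delta>" unfolding e(1) by (rule cmpI)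
  next
    assume "(i, a, k) \<in> down \<gamma> \<bullet> down \<delta>"
    then obtain g j h where e: "a = g \<otimes>\<^bsub>G\<^esub> h" "(i, g, j) \<in> down \<gamma>" "(j, h, k) \<in> down \<delta>" by (rule cmpE)
    then have "(i, g, j) \<in> \<gamma>" "(j, h, k) \<in> \<delta>" "k < m" by (simp_all add: down_iff)
    then show "(i, a, k) \<in> down (\<gamma> \<bullet> \<delta>)" using cmpI[of i g j \<gamma> h k \<delta>] e(1) by (simp add: down_iff)
  qed
  then show ?thesis by auto
qed

lemma down_idd: "down (idd n) = idd m"
  using mn by (auto simp: down_def identity_diagram_def)

definition zz :: "'a diagram \<Rightarrow> 'b" where
  "zz = (SOME z. z \<in> carrier R \<and> \<one>\<^bsub>R\<^esub> \<ominus>\<^bsub>R\<^esub> z \<in> N \<and> (\<forall>\<nu>\<in>N. z \<otimes>\<^bsub>R\<^esub> \<nu> = \<zero>\<^bsub>R\<^esub>))"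

lemma zz: "zz \<in> carrier R \<and> \<one>\<^bsub>R\<^esub> \<ominus>\<^bsub>R\<^esub> zz \<in> N \<and> (\<forall>\<nu>\<in>N. zz \<otimes>\<^bsub>R\<^esub> \<nu> = \<zero>\<^bsub>R\<^esub>)"
  unfolding zz_def using exists_complement unfolding Bex_def by (rule someI_ex)

abbreviation \<beta> :: "'a diagram \<Rightarrow> 'a diagram \<Rightarrow> 'b" where "\<beta> \<gamma> \<equiv> mon \<one>\<^bsub>K\<^esub> (down \<gamma>)"

text \<open>The coefficient of \<open>a\<close> at the diagram of \<open>\<gamma>\<close>, kept as a
  multiple of the identity so that it is again an element of the algebra and can act on
  modules.\<close>

abbreviation \<kappa> :: "'a diagram \<Rightarrow> ('a diagram \<Rightarrow> 'b) \<Rightarrow> 'a diagram \<Rightarrow> 'b" where "\<kappa> \<gamma> a \<equiv> mon (a (down \<gamma>)) (idd m)"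

abbreviation \<iota> :: "'b \<Rightarrow> 'a diagram \<Rightarrow> 'b" where "\<iota> c \<equiv> mon c (idd m)"

lemma supp_H: "a \<in> carrier R \<Longrightarrow> finite {\<gamma> \<in> H. a (down \<gamma>) \<noteq> \<zero>\<^bsub>K\<^esub>}"
proof -
  assume a: "a \<in> carrier R"
  have "inj_on down {\<gamma> \<in> H. a (down \<gamma>) \<noteq> \<zero>\<^bsub>K\<^esub>}"
    using bij_betw_imp_inj_on[OF down_bij] by (rule inj_on_subset) blast
  moreover have "down ` {\<gamma> \<in> H. a (down \<gamma>) \<noteq> \<zero>\<^bsub>K\<^esub>} \<subseteq> {D. a D \<noteq> \<zero>\<^bsub>K\<^esub>}" by blast
  ultimately show ?thesis using carrierD(3)[OF a] by (rule inj_on_finite)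
qed

lemma sum_at_full:
  assumes a: "a \<in> carrier R" and D: "D \<in> fl m"
  shows "(\<Oplus>\<^bsub>R\<^esub>\<gamma>\<in>{\<gamma> \<in> H. \<kappa> \<gamma> a \<noteq> \<zero>\<^bsub>R\<^esub>}. \<beta> \<gamma> \<otimes>\<^bsub>R\<^esub> \<kappa> \<gamma> a) D = a D"
proof -
  let ?S = "{\<gamma> \<in> H. \<kappa> \<gamma> a \<noteq> \<zero>\<^bsub>R\<^esub>}"
  have S: "?S = {\<gamma> \<in> H. a (down \<gamma>) \<noteq> \<zero>\<^bsub>K\<^esub>}" by (simp add: mon_zero_iff)
  have bk: "\<beta> \<gamma> \<otimes>\<^bsub>R\<^esub> \<kappa> \<gamma> a = mon (a (down \<gamma>)) (down \<gamma>)" if "\<gamma> \<in> H" for \<gamma>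
  proof -
    have f: "down \<gamma> \<in> fl m" by (rule down_fl[OF that])
    then have r: "down \<gamma> \<in> rd m" by simp
    show ?thesis
      using mon_mult_full[OF K.one_closed carrierD(1)[OF a] r idd_rd disjI1[OF f], of "down \<gamma>"] carrierD(1)[OF a, of "down \<gamma>"]
      by (simp add: cmp_idd[OF r])
  qed
  have "(\<Oplus>\<^bsub>R\<^esub>\<gamma>\<in>?S. \<beta> \<gamma> \<otimes>\<^bsub>R\<^esub> \<kappa> \<gamma> a) D = (\<Oplus>\<^bsub>K\<^esub>\<gamma>\<in>?S. (\<beta> \<gamma> \<otimes>\<^bsub>R\<^esub> \<kappa> \<gamma> a) D)"
  proof (rule finsum_R)
    show "finite ?S" unfolding S by (rule supp_H[OF a])
    show "(\<lambda>\<gamma>. \<beta> \<gamma> \<otimes>\<^bsub>R\<^esub> \<kappa> \<gamma> a) \<in> ?S \<rightarrow> carrier R"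
      using down_fl mon_carrier carrierD(1)[OF a] by (auto intro!: R.m_closed simp: idd_rd)
  qed
  also have "\<dots> = (\<Oplus>\<^bsub>K\<^esub>\<gamma>\<in>?S. if up D = \<gamma> then a D else \<zero>\<^bsub>K\<^esub>)"
  proof (rule K.finsum_cong')
    fix \<gamma> assume "\<gamma> \<in> ?S"
    then have g: "\<gamma> \<in> H" by simp
    have "D = down \<gamma> \<longleftrightarrow> up D = \<gamma>" using up_down[OF g] down_up[OF D] by auto
    then show "(\<beta> \<gamma> \<otimes>\<^bsub>R\<^esub> \<kappa> \<gamma> a) D = (if up D = \<gamma> then a D else \<zero>\<^bsub>K\<^esub>)" unfolding bk[OF g] by (auto simp: mon_def)
  qed (use carrierD(1)[OF a] in auto)
  also have "\<dots> = a D"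
  proof (cases "a D = \<zero>\<^bsub>K\<^esub>")
    case True
    then have "(\<Oplus>\<^bsub>K\<^esub>\<gamma>\<in>?S. if up D = \<gamma> then a D else \<zero>\<^bsub>K\<^esub>) = (\<Oplus>\<^bsub>K\<^esub>\<gamma>\<in>?S. \<zero>\<^bsub>K\<^esub>)"
      by (intro K.finsum_cong') auto
    then show ?thesis using True by simp
  next
    case False
    then have "up D \<in> ?S" unfolding S using up_H[OF D] down_up[OF D] by simp
    then show ?thesis
      using supp_H[OF a] carrierD(1)[OF a] unfolding S by (intro K.finsum_singleton) auto
  qed
  finally show ?thesis .
qed

lemma tor_side_rook:
  assumes "\<And>i. projective_module R (P i)" "\<And>i. d i \<in> linear_maps R (P (Suc i)) (P i)"
    "\<And>i. {x \<in> carrier (P (Suc i)). d i x = \<zero>\<^bsub>P i\<^esub>} = d (Suc i) ` carrier (P (Suc (Suc i)))"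
  shows "tor_side R (rook_units G n) P d H \<beta> N zz \<kappa>"
proof (intro tor_side.intro tor_side_axioms.intro ringR units_group assms)
  interpret L: letters "rook_units G n" n dact "carrier G" "\<one>\<^bsub>G\<^esub>" "{} :: nat set" "{}"
    by (rule letters_rook) simp
  show "subgroup H (rook_units G n)" by (rule L.U_subgroup)
  have bc: "\<beta> \<gamma> \<in> carrier R" if "\<gamma> \<in> H" for \<gamma> using mon_carrier[OF K.one_closed] down_fl[OF that] by simp
  then show "\<beta> \<gamma> \<in> carrier R" if "\<gamma> \<in> H" for \<gamma> using that .
  show "\<beta> \<one>\<^bsub>rook_units G n\<^esub> = \<one>\<^bsub>R\<^esub>" by (simp add: one_R rook_units_def down_idd)
  show "\<beta> (\<gamma> \<otimes>\<^bsub>rook_units G n\<^esub> \<delta>) = \<beta> \<gamma> \<otimes>\<^bsub>R\<^esub> \<beta> \<delta>" if g: "\<gamma> \<in> H" "\<delta> \<in> H" for \<gamma> \<delta>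
    using down_fl[OF g(1)] down_fl[OF g(2)]
    by (simp add: rook_units_def down_cmp[OF g] mon_mult_full)
  show "N \<subseteq> carrier R" by (auto simp: N_def)
  show "\<beta> \<gamma> \<otimes>\<^bsub>R\<^esub> \<nu> \<in> N" if "\<gamma> \<in> H" "\<nu> \<in> N" for \<gamma> \<nu> using N_mult_left[OF that(2) bc[OF that(1)]] .
  show "zz \<in> carrier R" "\<one>\<^bsub>R\<^esub> \<ominus>\<^bsub>R\<^esub> zz \<in> N" using zz by blast+
  show "zz \<otimes>\<^bsub>R\<^esub> \<nu> = \<zero>\<^bsub>R\<^esub>" if "\<nu> \<in> N" for \<nu> using zz that by blast
  have kc: "\<kappa> \<gamma> a \<in> carrier R" if "a \<in> carrier R" for \<gamma> a using mon_carrier[OF carrierD(1)[OF that] idd_rd] .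
  then show "\<kappa> \<gamma> a \<in> carrier R" if "\<gamma> \<in> H" "a \<in> carrier R" for \<gamma> a using that(2) .
  show "\<kappa> \<gamma> (a \<oplus>\<^bsub>R\<^esub> b) = \<kappa> \<gamma> a \<oplus>\<^bsub>R\<^esub> \<kappa> \<gamma> b" if "\<gamma> \<in> H" "a \<in> carrier R" "b \<in> carrier R" for \<gamma> a b
    using mon_add[OF carrierD(1)[OF that(2)] carrierD(1)[OF that(3)]] by (simp add: add_R)
  show "finite {\<gamma> \<in> H. \<kappa> \<gamma> a \<noteq> \<zero>\<^bsub>R\<^esub>}" if "a \<in> carrier R" for a using supp_H[OF that] by (simp add: mon_zero_iff)
  show "\<kappa> \<gamma> (\<nu> \<otimes>\<^bsub>R\<^esub> a) = \<zero>\<^bsub>R\<^esub>" if "\<gamma> \<in> H" "\<nu> \<in> N" "a \<in> carrier R" for \<gamma> \<nu> a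
    using N_mult_right[OF that(2,3)] down_fl[OF that(1)] by (simp add: mon_zero_iff N_def)
  show "\<kappa> (\<delta> \<otimes>\<^bsub>rook_units G n\<^esub> \<gamma>) (\<beta> \<delta> \<otimes>\<^bsub>R\<^esub> a) = \<kappa> \<gamma> a" if g: "\<gamma> \<in> H" "\<delta> \<in> H" and a: "a \<in> carrier R" for \<gamma> \<delta> a
  proof -
    have "down \<gamma> \<in> rd m" using down_fl[OF g(1)] by simp
    from mult_full_left[OF K.one_closed down_fl[OF g(2)] a this]
    show ?thesis using carrierD(1)[OF a] by (simp add: rook_units_def down_cmp[OF g(2,1)])
  qed
  show "a \<ominus>\<^bsub>R\<^esub> (\<Oplus>\<^bsub>R\<^esub>\<gamma>\<in>{\<gamma> \<in> H. \<kappa> \<gamma> a \<noteq> \<zero>\<^bsub>R\<^esub>}. \<beta> \<gamma> \<otimes>\<^bsub>R\<^esub> \<kappa> \<gamma> a) \<in> N" if a: "a \<in> carrier R" for a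
  proof -
    let ?s = "\<Oplus>\<^bsub>R\<^esub>\<gamma>\<in>{\<gamma> \<in> H. \<kappa> \<gamma> a \<noteq> \<zero>\<^bsub>R\<^esub>}. \<beta> \<gamma> \<otimes>\<^bsub>R\<^esub> \<kappa> \<gamma> a"
    have s: "?s \<in> carrier R" by (rule R.finsum_closed) (use bc kc[OF a] in \<open>auto intro!: R.m_closed\<close>)
    have "(a \<ominus>\<^bsub>R\<^esub> ?s) D = \<zero>\<^bsub>K\<^esub>" if D: "no_missing_edges m D" for D
    proof (cases "D \<in> rd m")
      case True
      then show ?thesis
        using minus_R[OF a s, of D] sum_at_full[OF a, of D] D carrierD(1)[OF a, of D] by (simp add: a_minus_def K.r_neg)
    next
      case False
      then show ?thesis using carrierD(2)[OF R.minus_closed[OF a s], of D] by blast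
    qed
    then show ?thesis using a s by (simp add: N_def)
  qed
qed

abbreviation E :: "('a diagram \<Rightarrow> 'b, 'b) module" where "E \<equiv> trivial_module G K m"

definition aug :: "('a diagram \<Rightarrow> 'b) \<Rightarrow> 'b" where
  "aug a = (\<Oplus>\<^bsub>K\<^esub>D\<in>{D. a D \<noteq> \<zero>\<^bsub>K\<^esub> \<and> no_missing_edges m D}. a D)"

lemma E_smult: "a \<odot>\<^bsub>E\<^esub> c = aug a \<otimes>\<^bsub>K\<^esub> c"
  by (simp add: trivial_module_def aug_def)

lemma aug_closed: "a \<in> carrier R \<Longrightarrow> aug a \<in> carrier K"
  unfolding aug_def using carrierD(1) by (intro K.finsum_closed) auto

lemma aug_mon: "c \<in> carrier K \<Longrightarrow> D \<in> fl m \<Longrightarrow> aug (mon c D) = c"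
proof -
  assume a: "c \<in> carrier K" "D \<in> fl m"
  show ?thesis
  proof (cases "c = \<zero>\<^bsub>K\<^esub>")
    case True
    then have *: "{E. mon c D E \<noteq> \<zero>\<^bsub>K\<^esub> \<and> no_missing_edges m E} = {}" by (auto simp: mon_def)
    show ?thesis unfolding aug_def * using True by simp
  next
    case False
    then have *: "{E. mon c D E \<noteq> \<zero>\<^bsub>K\<^esub> \<and> no_missing_edges m E} = {D}" using a by (auto simp: mon_def)
    show ?thesis unfolding aug_def * using a by (simp add: mon_def)
  qed
qed

lemma aug_N: "\<nu> \<in> N \<Longrightarrow> aug \<nu> = \<zero>\<^bsub>K\<^esub>"
proof -
  assume "\<nu> \<in> N"
  then have *: "{D. \<nu> D \<noteq> \<zero>\<^bsub>K\<^esub> \<and> no_missing_edges m D} = {}" by (auto simp: N_def)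
  show ?thesis unfolding aug_def * by simp
qed

text \<open>Under \<open>down\<close> the group \<open>H\<close> corresponds to the diagrams without
  missing edges, so the coordinates add up to the augmentation, placed at the identity
  diagram.\<close>

lemma sum_\<kappa>:
  assumes a: "a \<in> carrier R"
  shows "(\<Oplus>\<^bsub>R\<^esub>\<gamma>\<in>{\<gamma> \<in> H. \<kappa> \<gamma> a \<noteq> \<zero>\<^bsub>R\<^esub>}. \<kappa> \<gamma> a) = \<iota> (aug a)"
proof
  fix D
  let ?S = "{\<gamma> \<in> H. \<kappa> \<gamma> a \<noteq> \<zero>\<^bsub>R\<^esub>}"
  have S: "?S = {\<gamma> \<in> H. a (down \<gamma>) \<noteq> \<zero>\<^bsub>K\<^esub>}" by (simp add: mon_zero_iff)
  have "(\<Oplus>\<^bsub>R\<^esub>\<gamma>\<in>?S. \<kappa> \<gamma> a) D = (\<Oplus>\<^bsub>K\<^esub>\<gamma>\<in>?S. \<kappa> \<gamma> a D)"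
  proof (rule finsum_R)
    show "finite ?S" unfolding S by (rule supp_H[OF a])
    show "(\<lambda>\<gamma>. \<kappa> \<gamma> a) \<in> ?S \<rightarrow> carrier R" using mon_carrier[OF carrierD(1)[OF a] idd_rd] by simp
  qed
  also have "\<dots> = \<iota> (aug a) D"
  proof (cases "D = idd m")
    case True
    have im: "{D. a D \<noteq> \<zero>\<^bsub>K\<^esub> \<and> no_missing_edges m D} = down ` ?S"
    proof (intro equalityI subsetI)
      fix F assume F: "F \<in> {D. a D \<noteq> \<zero>\<^bsub>K\<^esub> \<and> no_missing_edges m D}"
      then have F': "F \<in> fl m" using carrierD(2)[OF a, of F] by simp
      show "F \<in> down ` ?S"
        unfolding S using F up_H[OF F'] down_up[OF F'] by (intro image_eqI[of _ _ "up F"]) simp_all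
    next
      fix F assume "F \<in> down ` ?S"
      then obtain \<gamma> where "F = down \<gamma>" "\<gamma> \<in> H" "a (down \<gamma>) \<noteq> \<zero>\<^bsub>K\<^esub>" unfolding S by blast
      then show "F \<in> {D. a D \<noteq> \<zero>\<^bsub>K\<^esub> \<and> no_missing_edges m D}" using down_fl[of \<gamma>] by simp
    qed
    have "inj_on down ?S" by (rule inj_on_subset[OF bij_betw_imp_inj_on[OF down_bij]]) blast
    then have "aug a = (\<Oplus>\<^bsub>K\<^esub>\<gamma>\<in>?S. a (down \<gamma>))"
      unfolding aug_def im using carrierD(1)[OF a] by (intro K.finsum_reindex) auto
    then show ?thesis using True by (simp add: mon_def)
  next
    case False
    then show ?thesis by (simp add: mon_def)
  qed
  finally show "(\<Oplus>\<^bsub>R\<^esub>\<gamma>\<in>?S. \<kappa> \<gamma> a) D = \<iota> (aug a) D" .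
qed

lemma tor_triv_rook:
  assumes "projective_resolution R E P d e"
  shows "tor_triv R (rook_units G n) P d H \<beta> N zz \<kappa> K E e \<iota>"
proof (intro tor_triv.intro tor_triv_axioms.intro tor_side_rook)
  have E: "carrier E = carrier K" "add E = add K" "ring.zero E = ring.zero K"
    by (simp_all add: trivial_module_def)
  show "carrier E = carrier K" "add E = add K" "ring.zero E = ring.zero K" by (rule E)+
  show "projective_module R (P i)" for i
    using assms by (simp add: projective_resolution_def)
  show "d i \<in> linear_maps R (P (Suc i)) (P i)" for i
    using assms by (simp add: projective_resolution_def)
  show "{x \<in> carrier (P (Suc i)). d i x = \<zero>\<^bsub>P i\<^esub>} = d (Suc i) ` carrier (P (Suc (Suc i)))" for i
    using assms by (simp add: projective_resolution_def)
  show "abelian_group K" by (rule K.abelian_group_axioms)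
  show "\<one>\<^bsub>K\<^esub> \<in> carrier K" by simp
  show "e \<in> linear_maps R (P 0) E" using assms by (simp add: projective_resolution_def)
  show "e ` carrier (P 0) = carrier E" using assms by (simp add: projective_resolution_def)
  show "{x \<in> carrier (P 0). e x = \<zero>\<^bsub>E\<^esub>} = d 0 ` carrier (P (Suc 0))"
    using assms by (simp add: projective_resolution_def)
  show "a \<odot>\<^bsub>E\<^esub> c \<in> carrier K" if "a \<in> carrier R" "c \<in> carrier K" for a c
    using aug_closed that by (simp add: E_smult)
  show "\<nu> \<odot>\<^bsub>E\<^esub> c = \<zero>\<^bsub>K\<^esub>" if "\<nu> \<in> N" "c \<in> carrier K" for \<nu> c
    using that by (simp add: E_smult aug_N)
  show "\<beta> \<gamma> \<odot>\<^bsub>E\<^esub> c = c" if "\<gamma> \<in> H" "c \<in> carrier K" for \<gamma> c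
    using aug_mon[OF K.one_closed down_fl[OF that(1)]] that(2) by (simp add: E_smult)
  have ic: "\<iota> c \<in> carrier R" if "c \<in> carrier K" for c using mon_carrier[OF that idd_rd] .
  then show "\<iota> c \<in> carrier R" if "c \<in> carrier K" for c using that .
  show "\<iota> (c \<oplus>\<^bsub>K\<^esub> c') = \<iota> c \<oplus>\<^bsub>R\<^esub> \<iota> c'" if "c \<in> carrier K" "c' \<in> carrier K" for c c'
    by (rule mon_add[OF that])
  show "\<iota> \<one>\<^bsub>K\<^esub> = \<one>\<^bsub>R\<^esub>" by (simp add: one_R)
  show "\<iota> c \<odot>\<^bsub>E\<^esub> \<one>\<^bsub>K\<^esub> = c" if "c \<in> carrier K" for c
    using aug_mon[OF that idd_full] that by (simp add: E_smult)
  show "\<iota> c \<otimes>\<^bsub>R\<^esub> a = a \<otimes>\<^bsub>R\<^esub> \<iota> c" if "c \<in> carrier K" "a \<in> carrier R" for c a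
    using mult_id_left[OF that] mult_id_right[OF that] carrierD(1)[OF that(2)] that(1)
    by (simp add: fun_eq_iff K.m_comm)
  show "\<iota> (a \<odot>\<^bsub>E\<^esub> c) = (\<Oplus>\<^bsub>R\<^esub>\<gamma>\<in>{\<gamma> \<in> H. \<kappa> \<gamma> a \<noteq> \<zero>\<^bsub>R\<^esub>}. \<kappa> \<gamma> a) \<otimes>\<^bsub>R\<^esub> \<iota> c"
    if "a \<in> carrier R" "c \<in> carrier K" for a c
    using mon_mult_full[OF aug_closed[OF that(1)] that(2) idd_rd idd_rd disjI1[OF idd_full]]
    by (simp only: sum_\<kappa>[OF that(1)] E_smult cmp_idd[OF idd_rd])
qed

end

section \<open>Comparing two consecutive rook algebras\<close>

locale rook_step = rook +
  fixes m :: nat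
  assumes rings: "ring (rook_algebra G K \<epsilon> m)" "ring (rook_algebra G K \<epsilon> (Suc m))"
begin

text \<open>Both groups are realized inside the diagrams on \<open>m + 1\<close> nodes: for
  \<open>A\<close> as the subgroup with a trivial edge at the last node, for \<open>B\<close> as the
  whole group.\<close>

sublocale A: rook_alg G K \<epsilon> m "Suc m"
  by (intro rook_alg.intro rook_axioms rook_alg_axioms.intro rings) simp

sublocale B: rook_alg G K \<epsilon> "Suc m" "Suc m"
  by (intro rook_alg.intro rook_axioms rook_alg_axioms.intro rings) simp

abbreviation \<phi> :: "('a diagram \<Rightarrow> 'b) \<Rightarrow> 'a diagram \<Rightarrow> 'b" where
  "\<phi> \<equiv> rook_inclusion G K m"

lemma insert_rd:
  assumes "x \<in> rd m"
  shows "insert (m, \<one>\<^bsub>G\<^esub>, m) x \<in> rd (Suc m)"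
proof (rule rdI)
  note b = rdD(1-3)[OF assms]
  show "i < Suc m \<and> g \<in> carrier G \<and> j < Suc m" if "(i, g, j) \<in> insert (m, \<one>\<^bsub>G\<^esub>, m) x" for i g j
    using that b[of i g j] by auto
  show "g = g' \<and> j = j'" if "(i, g, j) \<in> insert (m, \<one>\<^bsub>G\<^esub>, m) x" "(i, g', j') \<in> insert (m, \<one>\<^bsub>G\<^esub>, m) x" for i g j g' j'
    using that b[of i g j] b[of i g' j'] rdD(4)[OF assms, of i g j g' j'] by auto
  show "i = i' \<and> g = g'" if "(i, g, j) \<in> insert (m, \<one>\<^bsub>G\<^esub>, m) x" "(i', g', j) \<in> insert (m, \<one>\<^bsub>G\<^esub>, m) x" for i g j i' g'
    using that b[of i g j] b[of i' g' j] rdD(5)[OF assms, of i g j i' g'] by auto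
qed

lemma \<phi>_mon: "c \<in> carrier K \<Longrightarrow> \<phi> (A.mon c x) = A.mon c (insert (m, \<one>\<^bsub>G\<^esub>, m) x)"
proof
  fix D assume c: "c \<in> carrier K"
  show "\<phi> (A.mon c x) D = A.mon c (insert (m, \<one>\<^bsub>G\<^esub>, m) x) D"
  proof (cases "c = \<zero>\<^bsub>K\<^esub> \<or> insert (m, \<one>\<^bsub>G\<^esub>, m) x \<noteq> D")
    case True
    then have *: "{y. A.mon c x y \<noteq> \<zero>\<^bsub>K\<^esub> \<and> insert (m, \<one>\<^bsub>G\<^esub>, m) y = D} = {}"
      by (auto simp: A.mon_def split: if_splits)
    show ?thesis unfolding rook_inclusion_def * using True by (auto simp: A.mon_def)
  next
    case False
    then have *: "{y. A.mon c x y \<noteq> \<zero>\<^bsub>K\<^esub> \<and> insert (m, \<one>\<^bsub>G\<^esub>, m) y = D} = {x}"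
      by (auto simp: A.mon_def split: if_splits)
    show ?thesis unfolding rook_inclusion_def * using False c by (simp add: A.mon_def)
  qed
qed

lemma \<phi>_carrier:
  assumes "a \<in> carrier A.R"
  shows "\<phi> a \<in> carrier B.R"
proof (rule B.carrierI)
  show "\<phi> a D \<in> carrier K" for D
    unfolding rook_inclusion_def using A.carrierD(1)[OF assms] by (intro K.finsum_closed) auto
  have 0: "\<phi> a D = \<zero>\<^bsub>K\<^esub>" if "D \<notin> insert (m, \<one>\<^bsub>G\<^esub>, m) ` {x. a x \<noteq> \<zero>\<^bsub>K\<^esub>}" for D
  proof -
    have *: "{x. a x \<noteq> \<zero>\<^bsub>K\<^esub> \<and> insert (m, \<one>\<^bsub>G\<^esub>, m) x = D} = {}" using that by auto
    show ?thesis unfolding rook_inclusion_def * by simp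
  qed
  then have "{D. \<phi> a D \<noteq> \<zero>\<^bsub>K\<^esub>} \<subseteq> insert (m, \<one>\<^bsub>G\<^esub>, m) ` {x. a x \<noteq> \<zero>\<^bsub>K\<^esub>}" by blast
  then show "finite {D. \<phi> a D \<noteq> \<zero>\<^bsub>K\<^esub>}" by (rule finite_subset[OF _ finite_imageI[OF A.carrierD(3)[OF assms]]])
  show "\<phi> a D = \<zero>\<^bsub>K\<^esub>" if "D \<notin> rd (Suc m)" for D
  proof (rule 0)
    show "D \<notin> insert (m, \<one>\<^bsub>G\<^esub>, m) ` {x. a x \<noteq> \<zero>\<^bsub>K\<^esub>}"
      using that insert_rd A.carrierD(2)[OF assms] by blast
  qed
qed

text \<open>Adding the last horizontal edge cannot repair a missing edge among the first
  \<open>m\<close> nodes.\<close>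

lemma \<phi>_N: "\<nu> \<in> A.N \<Longrightarrow> \<phi> \<nu> \<in> B.N"
proof -
  assume n: "\<nu> \<in> A.N"
  then have v: "\<nu> \<in> carrier A.R" by (simp add: A.N_def)
  have "\<phi> \<nu> D = \<zero>\<^bsub>K\<^esub>" if D: "no_missing_edges (Suc m) D" for D
  proof -
    have "\<nu> x = \<zero>\<^bsub>K\<^esub>" if x: "insert (m, \<one>\<^bsub>G\<^esub>, m) x = D" for x
    proof (rule ccontr)
      assume nz: "\<nu> x \<noteq> \<zero>\<^bsub>K\<^esub>"
      have "k \<in> left_nodes x" if k: "k < m" for k
      proof -
        obtain g j where "(k, g, j) \<in> D" using full_D(1)[OF D less_SucI[OF k]] by blast
        then have "(k, g, j) \<in> insert (m, \<one>\<^bsub>G\<^esub>, m) x" by (simp only: x)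
        then have "(k, g, j) \<in> x" using k by simp
        then show ?thesis unfolding left_nodes_def by blast
      qed
      then have "{..<m} \<subseteq> left_nodes x" by blast
      then have "no_missing_edges m x" by (rule full_left[OF A.carrierD(2)[OF v nz]])
      then show False using n nz by (simp add: A.N_def)
    qed
    then have *: "{x. \<nu> x \<noteq> \<zero>\<^bsub>K\<^esub> \<and> insert (m, \<one>\<^bsub>G\<^esub>, m) x = D} = {}" by blast
    show ?thesis unfolding rook_inclusion_def * by simp
  qed
  then show ?thesis using \<phi>_carrier[OF v] by (simp add: B.N_def)
qed

lemma up_insert: "A.up D = insert (m, \<one>\<^bsub>G\<^esub>, m) D" "B.up D = D"
  by (auto simp: A.up_def B.up_def)

lemma H_mono: "\<gamma> \<in> A.H \<Longrightarrow> \<gamma> \<in> B.H"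
  unfolding A.H_iff B.H_iff by simp

lemma tor_map_rook:
  assumes "projective_resolution A.R A.E P d e" "projective_resolution B.R B.E P' d' e'"
    and "resolution_map \<phi> A.R (\<lambda>c. c) P d e P' d' e' f"
  shows "tor_map A.R (rook_units G (Suc m)) P d A.H A.\<beta> A.N A.zz A.\<kappa> K A.E e A.\<iota>
    B.R P' d' B.H B.\<beta> B.N B.zz B.\<kappa> B.E e' B.\<iota> \<phi> f"
proof (intro tor_map.intro tor_map_axioms.intro A.tor_triv_rook B.tor_triv_rook assms(1,2))
  show "f j \<in> semilinear_maps \<phi> A.R (P j) (P' j)" for j
    using assms(3) by (simp add: resolution_map_def)
  show "f j (d j x) = d' j (f (Suc j) x)" if "x \<in> carrier (P (Suc j))" for j x
    using assms(3) that by (simp add: resolution_map_def)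
  show "e' (f 0 x) = e x" if "x \<in> carrier (P 0)" for x
    using assms(3) that by (simp add: resolution_map_def)
  show "A.H \<subseteq> B.H" using H_mono by blast
  \<comment> \<open>Adding the last edge is \<open>A.up\<close>, which inverts
    \<open>A.down\<close>; for the larger size \<open>up\<close> changes nothing, so both sides are
    the monomial of \<open>\<gamma>\<close> itself.\<close>
  show "\<phi> (A.\<beta> \<gamma>) = B.\<beta> \<gamma>" if "\<gamma> \<in> A.H" for \<gamma>
    using A.up_down[OF that] B.up_down[OF H_mono[OF that]] by (simp add: \<phi>_mon up_insert)
  show "\<phi> \<nu> \<in> B.N" if "\<nu> \<in> A.N" for \<nu> using \<phi>_N[OF that] .
  have "insert (m, \<one>\<^bsub>G\<^esub>, m) (idd m) = idd (Suc m)" by (auto simp: identity_diagram_def)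
  then show "\<phi> (A.\<iota> c) = B.\<iota> c" if "c \<in> carrier K" for c using \<phi>_mon[OF that] by simp
qed

end

section \<open>Translation to the Tor groups of the statement and conclusion\<close>

lemma sumrel_frags: "abelian_group K \<Longrightarrow> sumrel K \<subseteq> frags (carrier K)"
proof -
  assume "abelian_group K"
  then interpret K: abelian_group K .
  show ?thesis by (auto simp: sumrel_def intro!: subgrp_diff[OF subgrp_frags])
qed

context tor_triv
begin

lemma frag_complex_T: "frag_complex (\<lambda>j. carrier E \<times> carrier (P j)) LT (\<lambda>j. lab (d j))"
  using sub_LT LT_ST additive_lab lab_d_ST lab_d_LT unfolding ST_def by unfold_locales

lemma cyc_T: "frag_complex.cyc (\<lambda>j. carrier E \<times> carrier (P j)) LT (\<lambda>j. lab (d j)) = ZT"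
  and bnd_T: "frag_complex.bnd (\<lambda>j. carrier E \<times> carrier (P j)) LT (\<lambda>j. lab (d j)) = BT"
  unfolding frag_complex.cyc_def[OF frag_complex_T] frag_complex.bnd_def[OF frag_complex_T] ZT_def BT_def ST_def
  by (rule ext, rule refl)+

lemma C_T: "frag_complex.C (\<lambda>j. carrier E \<times> carrier (P j)) LT = Tor_complex R E P"
  by (rule ext, unfold frag_complex.C_def[OF frag_complex_T], unfold Tor_complex_def tensor_product_def LT_def, rule refl)

lemma \<delta>_T: "frag_complex.\<delta> (\<lambda>j. carrier E \<times> carrier (P j)) LT (\<lambda>j. lab (d j)) = Tor_diff R E P d"
  by (rule ext, unfold frag_complex.\<delta>_def[OF frag_complex_T], unfold Tor_diff_def tensor_map_def LT_def lab_def, rule refl)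

end

context tor_map
begin

lemma Tor_map_iso:
  assumes "\<And>w. w \<in> A.WK q \<Longrightarrow> w \<in> B.DK q \<Longrightarrow> w \<in> A.DK q"
    and "\<And>w. w \<in> B.WK q \<Longrightarrow> \<exists>w'\<in>A.WK q. w - w' \<in> B.DK q"
  shows "Tor_map R2 E2 P2 d2 (\<lambda>c. c) f q \<in> iso (Tor R1 E1 P1 d1 q) (Tor R2 E2 P2 d2 q)"
proof -
  note i = homology_iso[OF A.frag_complex_T B.frag_complex_T additive_lab[of "f q"],
      unfolded A.C_T B.C_T A.\<delta>_T B.\<delta>_T A.cyc_T B.cyc_T A.bnd_T B.bnd_T]
  show ?thesis
    unfolding Tor_map_def Tor_def tensor_map_def lab_def[symmetric] B.LT_def[symmetric]
  proof (rule i)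
    show "lab (f q) x \<in> frags (carrier E2 \<times> carrier (P2 q))" if "x \<in> frags (carrier E1 \<times> carrier (P1 q))" for x
      using F_ST[of x q] that unfolding A.ST_def B.ST_def .
    show "lab (f q) x \<in> B.LT q" if "x \<in> A.LT q" for x using F_LT[OF that] .
    show "lab (f q) (lab (d1 q) u) \<in> B.BT q" if u: "u \<in> frags (carrier E1 \<times> carrier (P1 (Suc q)))" for u
    proof -
      have u': "u \<in> A.ST (Suc q)" using u by (simp add: A.ST_def)
      have "lab (f q) (lab (d1 q) u) = lab (d2 q) (lab (f (Suc q)) u)" by (rule F_lab_d[OF u'])
      moreover have "lab (d2 q) (lab (f (Suc q)) u) - lab (d2 q) (lab (f (Suc q)) u) \<in> B.LT q"
        using subgrp_zero[OF B.sub_LT] by simp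
      ultimately show ?thesis
        unfolding B.BT_def using F_ST[OF u'] B.lab_d_ST[OF F_ST[OF u']] by (intro CollectI conjI bexI) simp_all
    qed
    show "lab (f q) x \<in> B.ZT q" if "x \<in> A.ZT q" for x using F_ZT[OF that] .
    show "x \<in> A.BT q" if "x \<in> A.ZT q" "lab (f q) x \<in> B.BT q" for x
      using tor_map_iso(1)[OF assms that] .
    show "\<exists>x\<in>A.ZT q. y - lab (f q) x \<in> B.BT q" if "y \<in> B.ZT q" for y
      using tor_map_iso(2)[OF assms that] .
  qed
qed

end

context rook_step
begin

lemma Tor_map_rook:
  assumes "projective_resolution A.R A.E P d e" "projective_resolution B.R B.E P' d' e'"
    and "resolution_map \<phi> A.R (\<lambda>c. c) P d e P' d' e' f"
    and q: "2 * q + 2 \<le> Suc m"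
  shows "Tor_map B.R B.E P' d' (\<lambda>c. c) f q \<in> iso (Tor A.R A.E P d q) (Tor B.R B.E P' d' q)"
proof -
  interpret M: tor_map A.R "rook_units G (Suc m)" P d A.H A.\<beta> A.N A.zz A.\<kappa> K A.E e A.\<iota>
    B.R P' d' B.H B.\<beta> B.N B.zz B.\<kappa> B.E e' B.\<iota> \<phi> f
    by (rule tor_map_rook[OF assms(1-3)])
  interpret S: stability "rook_units G (Suc m)" "Suc m" dact "carrier G" "\<one>\<^bsub>G\<^esub>" "carrier K" "sumrel K"
    by (rule stability_rook[OF sumrel_frags[OF K.abelian_group_axioms]])
  \<comment> \<open>Unfolded, the chains and relations on the group side of the Tor comparison are
    literally those of the stability theorem, with sizes \<open>m\<close> and
    \<open>m + 1\<close>.\<close>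
  have T: "M.A.T i = S.T i" "M.B.T i = S.T i" for i unfolding M.A.T_def M.B.T_def S.T_def by (rule refl)+
  have gr: "M.A.grK i = S.gr m i" "M.B.grK i = S.gr (Suc m) i" for i
    unfolding M.A.grK_def M.B.grK_def S.gr_def T by (rule refl)+
  have V: "M.A.SK i = S.V i" "M.B.SK i = S.V i" for i
    unfolding M.A.SK_def M.B.SK_def S.V_def T by (rule refl)+
  have L: "M.A.LK i = S.L m i" "M.B.LK i = S.L (Suc m) i" for i
    unfolding M.A.LK_def M.B.LK_def S.L_def T gr by (rule refl)+
  have D: "lift bd w = S.D w" for w by (simp add: S.D_def)
  \<comment> \<open>Degree \<open>q\<close> belongs to tuples of length \<open>q + 1\<close>, so the
    injectivity bound reads \<open>2 * (q + 1) <= m + 1\<close>.\<close>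
  have inj: "S.inj_at (Suc m) (Suc q)" and surj: "S.surj_at (Suc m) (Suc q)"
    using S.stability_aux[of "Suc m"] q by auto
  show ?thesis
  proof (rule M.Tor_map_iso)
    fix w assume w: "w \<in> M.A.WK q" "w \<in> M.B.DK q"
    then obtain u where u: "w \<in> S.V (Suc q)" "u \<in> S.V (Suc (Suc q))" "w - S.D u \<in> S.L (Suc m) (Suc q)"
      unfolding M.B.DK_def V L D by blast
    \<comment> \<open>In degree 0 membership in \<open>WK\<close> gives no condition on the
      boundary. It is recovered from the larger group, since relations on the empty tuple do not
      depend on the size.\<close>
    have "S.D w \<in> S.L m q"
    proof (cases "q = 0")
      case True
      have "S.D (w - S.D u) \<in> S.L (Suc m) 0" using S.D_L[OF u(3)] True by simp
      then have "S.D (w - S.D u) \<in> S.L m 0" unfolding S.L_zero_level[of "Suc m" m] .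
      then show ?thesis using True by (simp add: additive_diff[OF S.additive_D] S.D_D)
    next
      case False
      then show ?thesis using w(1) unfolding M.A.WK_def V L D by blast
    qed
    then show "w \<in> M.A.DK q"
      using inj u unfolding M.A.DK_def V L D S.inj_at_def by (simp only: diff_Suc_1) blast
  next
    fix w assume "w \<in> M.B.WK q"
    then have w: "w \<in> S.V (Suc q)" "q = 0 \<or> S.D w \<in> S.L (Suc m) q" unfolding M.B.WK_def V L D by blast+
    show "\<exists>w'\<in>M.A.WK q. w - w' \<in> M.B.DK q"
    proof (cases "q = 0")
      case True
      have "w \<in> M.A.WK q" unfolding M.A.WK_def V using True w(1) by blast
      moreover have "w - w \<in> M.B.DK q" using subgrp_zero[OF M.B.sub_DK] by simp
      ultimately show ?thesis by blast
    next
      case False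
      then have "S.D w \<in> S.L (Suc m) (Suc q - 1)" using w(2) by simp
      then obtain w' u where 1: "w' \<in> S.V (Suc q)" "u \<in> S.V (Suc (Suc q))"
        "S.D w' \<in> S.L m q" "w - w' - S.D u \<in> S.L (Suc m) (Suc q)"
        using surj w(1) unfolding S.surj_at_def by (simp only: diff_Suc_1) blast
      have "w' \<in> M.A.WK q" unfolding M.A.WK_def V L D using 1 by blast
      moreover have "w - w' \<in> M.B.DK q"
        unfolding M.B.DK_def V L D using 1 subgrp_diff[OF S.V_sub w(1) 1(1)] by blast
      ultimately show ?thesis by blast
    qed
  qed
qed

end

theorem corollary7p10:
  fixes G :: "'g monoid" and K :: "'k ring" and \<alpha> :: "'g \<Rightarrow> 'k \<Rightarrow> 'k" and \<epsilon> :: 'k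
    and n q :: nat
    and P :: "nat \<Rightarrow> ('g diagram \<Rightarrow> 'k, 'p) module" and d :: "nat \<Rightarrow> 'p \<Rightarrow> 'p" and e :: "'p \<Rightarrow> 'k"
    and P' :: "nat \<Rightarrow> ('g diagram \<Rightarrow> 'k, 'p') module" and d' :: "nat \<Rightarrow> 'p' \<Rightarrow> 'p'" and e' :: "'p' \<Rightarrow> 'k"
    and f :: "nat \<Rightarrow> 'p \<Rightarrow> 'p'"
  assumes "group G"
    and "commutative_G_ring G K \<alpha>"
    and "\<epsilon> \<in> Units K"
    and "n \<ge> 2 * q + 2"
    and "projective_resolution (rook_algebra G K \<epsilon> (n - 1)) (trivial_module G K (n - 1)) P d e"
    and "projective_resolution (rook_algebra G K \<epsilon> n) (trivial_module G K n) P' d' e'"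
    and "resolution_map (rook_inclusion G K (n - 1)) (rook_algebra G K \<epsilon> (n - 1)) (\<lambda>c. c)
           P d e P' d' e' f"
  shows "Tor_map (rook_algebra G K \<epsilon> n) (trivial_module G K n) P' d' (\<lambda>c. c) f q
    \<in> iso (Tor (rook_algebra G K \<epsilon> (n - 1)) (trivial_module G K (n - 1)) P d q)
          (Tor (rook_algebra G K \<epsilon> n) (trivial_module G K n) P' d' q)"
proof -
  obtain m where n: "n = Suc m" using assms(4) by (cases n) auto
  note a = assms(4-7)[unfolded n diff_Suc_1]
  \<comment> \<open>A resolution consists of left modules, and \<open>left_module\<close> contains
    the ring axioms for the scalars; associativity of the rook product is taken from there.\<close>
  have ring: "ring R" if "projective_resolution R E P d e" for R :: "('g diagram \<Rightarrow> 'k) ring" and E P d e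
  proof -
    have "projective_module R (P 0)" using that unfolding projective_resolution_def by (elim conjE allE)
    then have "left_module R (P 0)" unfolding projective_module_def by (rule conjunct1)
    then show ?thesis by (rule left_module.axioms(1))
  qed
  interpret rook_step G K \<epsilon> m
  proof (intro rook_step.intro rook.intro rook_axioms.intro rook_step_axioms.intro)
    show "group G" "\<epsilon> \<in> Units K" by (rule assms)+
    show "cring K" using assms(2) by (simp add: commutative_G_ring_def)
    show "ring (rook_algebra G K \<epsilon> m)" by (rule ring[OF a(2)])
    show "ring (rook_algebra G K \<epsilon> (Suc m))" by (rule ring[OF a(3)])
  qed
  show ?thesis unfolding n diff_Suc_1 using a(2,3,4,1) by (rule Tor_map_rook)
qed

end
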